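(* Let $G$ be a compact metric tree and suppose $\lambda_2(G,0)$ is simple. For any $\varepsilon>0$ there exists a tree $G_\varepsilon$ formed by attaching an edge of length $\varepsilon$ to $G$, such that for any $M>0$ the potential $q=0$ does not minimize $\Gamma[q]$ in $C_{G_\varepsilon,M}$.
   Context: A compact metric graph consists of finitely many edges, each identified with a compact interval $[0,|e|]$, $|e|>0$, whose endpoints are partitioned into finitely many classes (vertices) and glued accordingly; it is always assumed connected. Any point in the interior of an edge may be declared to be a vertex of degree two; attaching an edge to $G$ means gluing one endpoint of a new interval to a point of $G$. A tree is a connected metric graph without cycles; a leaf is a vertex of degree one, and the boundary of a tree is the set of its leaves. For a tree $G'$ and a real potential $q$ on $G'$, $H u=-u''+qu$ is the self-adjoint Schrödinger operator on $L^2(G')$ with standard (Kirchhoff) vertex conditions: continuity at each vertex and, at each vertex, the sum of the normal derivatives along all incident edges equals $0$. Its eigenvalues counted with multiplicity are $\lambda_1(G',q)<\lambda_2(G',q)\le\dots$, and $\Gamma[q]=\lambda_2(G',q)-\lambda_1(G',q)$ denotes the fundamental gap on the tree in question. For a tree $G'$ and $M>0$, $C_{G',M}$ is the set of functions $q:G'\to\mathbb{R}$ with $0\le q(x)\le M$ for all $x\in G'$ such that $q$ is convex on every path in $G'$ from one boundary vertex (leaf) to another, each path being regarded as an interval. *)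

theory Defs
  imports "HOL-Analysis.Analysis" "HOL-Library.Disjoint_Sets" "HOL-Library.Function_Algebras"
begin

section \<open>Compact metric graphs and trees\<close>

text \<open>
  The edge \<open>e\<close> is the interval \<open>{0..len G e}\<close>.  Its two endpoints are the pairs \<open>(e, False)\<close>
  (coordinate \<open>0\<close>) and \<open>(e, True)\<close> (coordinate \<open>len G e\<close>); a vertex is a class of endpoints.
\<close>

record 'e metric_graph =
  edges :: "'e set"
  len :: "'e \<Rightarrow> real"
  verts :: "('e \<times> bool) set set"

definition coord :: "'e metric_graph \<Rightarrow> 'e \<times> bool \<Rightarrow> real" where
  "coord G p = (if snd p then len G (fst p) else 0)"

definition opp :: "'e \<times> bool \<Rightarrow> 'e \<times> bool" where
  "opp p = (fst p, \<not> snd p)"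

definition vertex_of :: "'e metric_graph \<Rightarrow> 'e \<times> bool \<Rightarrow> ('e \<times> bool) set" where
  "vertex_of G p = (THE v. v \<in> verts G \<and> p \<in> v)"

text \<open>A walk is a list of oriented edges; the endpoint \<open>p\<close> stands for the edge \<open>fst p\<close> traversed
  from \<open>p\<close> to \<open>opp p\<close>.\<close>

definition walk :: "'e metric_graph \<Rightarrow> ('e \<times> bool) list \<Rightarrow> bool" where
  "walk G ps \<longleftrightarrow> ps \<noteq> [] \<and> set ps \<subseteq> edges G \<times> UNIV \<and>
     successively (\<lambda>p p'. vertex_of G (opp p) = vertex_of G p') ps"

definition walk_start :: "'e metric_graph \<Rightarrow> ('e \<times> bool) list \<Rightarrow> ('e \<times> bool) set" where
  "walk_start G ps = vertex_of G (hd ps)"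

definition walk_end :: "'e metric_graph \<Rightarrow> ('e \<times> bool) list \<Rightarrow> ('e \<times> bool) set" where
  "walk_end G ps = vertex_of G (opp (last ps))"

definition simple_path :: "'e metric_graph \<Rightarrow> ('e \<times> bool) list \<Rightarrow> bool" where
  "simple_path G ps \<longleftrightarrow> walk G ps \<and> distinct (map (vertex_of G) ps @ [walk_end G ps])"

text \<open>Loops and pairs of parallel edges are cycles; running back and forth along one edge is not.\<close>

definition is_cycle :: "'e metric_graph \<Rightarrow> ('e \<times> bool) list \<Rightarrow> bool" where
  "is_cycle G ps \<longleftrightarrow> walk G ps \<and> walk_end G ps = walk_start G ps \<and>
     distinct (map (vertex_of G) ps) \<and> distinct (map fst ps)"

definition compact_metric_graph :: "'e metric_graph \<Rightarrow> bool" where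
  "compact_metric_graph G \<longleftrightarrow>
     finite (edges G) \<and> edges G \<noteq> {} \<and> (\<forall>e\<in>edges G. 0 < len G e) \<and>
     partition_on (edges G \<times> UNIV) (verts G) \<and>
     (\<forall>v\<in>verts G. \<forall>w\<in>verts G. v = w \<or> (\<exists>ps. walk G ps \<and> walk_start G ps = v \<and> walk_end G ps = w))"

definition metric_tree :: "'e metric_graph \<Rightarrow> bool" where
  "metric_tree G \<longleftrightarrow> compact_metric_graph G \<and> \<not> (\<exists>ps. is_cycle G ps)"

text \<open>The degree of a vertex is the number of endpoints in it, so that a loop counts twice.\<close>

definition leaves :: "'e metric_graph \<Rightarrow> ('e \<times> bool) set set" where
  "leaves G = {v \<in> verts G. card v = 1}"

section \<open>Attaching an edge\<close>

text \<open>Declare the point at coordinate \<open>a\<close> of the edge \<open>e\<close> to be a vertex of degree two: \<open>e\<close> keeps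
  the part \<open>{0..a}\<close>, and the new edge \<open>e'\<close> is the remaining part.\<close>

definition subdivide :: "'e metric_graph \<Rightarrow> 'e \<Rightarrow> real \<Rightarrow> 'e \<Rightarrow> 'e metric_graph" where
  "subdivide G e a e' =
     \<lparr>edges = insert e' (edges G),
      len = (len G)(e := a, e' := len G e - a),
      verts = insert {(e, True), (e', False)}
        ((\<lambda>v. if (e, True) \<in> v then insert (e', True) (v - {(e, True)}) else v) ` verts G)\<rparr>"

definition attach_at_vertex ::
  "'e metric_graph \<Rightarrow> ('e \<times> bool) set \<Rightarrow> 'e \<Rightarrow> real \<Rightarrow> 'e metric_graph" where
  "attach_at_vertex G v e l =
     \<lparr>edges = insert e (edges G),
      len = (len G)(e := l),
      verts = insert {(e, True)} (insert (insert (e, False) v) (verts G - {v}))\<rparr>"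

definition attach_edge :: "'e metric_graph \<Rightarrow> real \<Rightarrow> 'e metric_graph \<Rightarrow> bool" where
  "attach_edge G l G' \<longleftrightarrow>
     (\<exists>v e. v \<in> verts G \<and> e \<notin> edges G \<and> G' = attach_at_vertex G v e l) \<or>
     (\<exists>e\<^sub>0 a e\<^sub>1 e. e\<^sub>0 \<in> edges G \<and> 0 < a \<and> a < len G e\<^sub>0 \<and>
        e\<^sub>1 \<notin> edges G \<and> e \<notin> edges G \<and> e \<noteq> e\<^sub>1 \<and>
        G' = attach_at_vertex (subdivide G e\<^sub>0 a e\<^sub>1) {(e\<^sub>0, True), (e\<^sub>1, False)} e l)"

section \<open>Functions on a graph and the Schroedinger operator\<close>

text \<open>Functions are given edgewise, \<open>u e x\<close> being the value at the point with coordinate \<open>x\<close> of the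
  edge \<open>e\<close>.  Such a \<open>u\<close> is a function on the glued space iff endpoints in the same class have the
  same value.  For functions that are continuous along the edges this is continuity at the vertices.\<close>

definition agrees_at_vertices :: "'e metric_graph \<Rightarrow> ('e \<Rightarrow> real \<Rightarrow> real) \<Rightarrow> bool" where
  "agrees_at_vertices G u \<longleftrightarrow>
     (\<forall>v\<in>verts G. \<forall>p\<in>v. \<forall>p'\<in>v. u (fst p) (coord G p) = u (fst p') (coord G p'))"

text \<open>\<open>f\<close> belongs to the Sobolev space \<open>H\<^sup>2(0,l)\<close>, with first derivative \<open>f'\<close> (its continuous
  representative) and second weak derivative \<open>f''\<close>.\<close>

definition sobolev2 :: "real \<Rightarrow> (real \<Rightarrow> real) \<Rightarrow> (real \<Rightarrow> real) \<Rightarrow> (real \<Rightarrow> real) \<Rightarrow> bool" where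
  "sobolev2 l f f' f'' \<longleftrightarrow>
     (\<forall>x\<in>{0..l}. (f has_real_derivative f' x) (at x within {0..l})) \<and>
     f'' \<in> borel_measurable (lebesgue_on {0..l}) \<and>
     integrable (lebesgue_on {0..l}) (\<lambda>x. (f'' x)\<^sup>2) \<and>
     (\<forall>x\<in>{0..l}. f' x = f' 0 + (LINT t|lebesgue_on {0..x}. f'' t))"

text \<open>Derivative at the endpoint \<open>p\<close> in the direction into the edge.\<close>

definition normal_deriv :: "'e metric_graph \<Rightarrow> ('e \<Rightarrow> real \<Rightarrow> real) \<Rightarrow> 'e \<times> bool \<Rightarrow> real" where
  "normal_deriv G u' p = (if snd p then - u' (fst p) (coord G p) else u' (fst p) (coord G p))"

text \<open>The graph of the operator with bounded potential \<open>q\<close>: \<open>u\<close> lies in its domain and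
  \<open>- u'' + q u = f\<close> almost everywhere.\<close>

definition schroedinger ::
  "'e metric_graph \<Rightarrow> ('e \<Rightarrow> real \<Rightarrow> real) \<Rightarrow> ('e \<Rightarrow> real \<Rightarrow> real) \<Rightarrow> ('e \<Rightarrow> real \<Rightarrow> real) \<Rightarrow> bool" where
  "schroedinger G q u f \<longleftrightarrow>
     (\<exists>u' u''.
        (\<forall>e\<in>edges G. sobolev2 (len G e) (u e) (u' e) (u'' e)) \<and>
        agrees_at_vertices G u \<and>
        (\<forall>v\<in>verts G. (\<Sum>p\<in>v. normal_deriv G u' p) = 0) \<and>
        (\<forall>e\<in>edges G. AE x in lebesgue_on {0..len G e}. - u'' e x + q e x * u e x = f e x))"

text \<open>Values off the graph are normalised to \<open>0\<close>, so that distinct elements of an eigenspace are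
  distinct functions on the graph.\<close>

definition eigenspace ::
  "'e metric_graph \<Rightarrow> ('e \<Rightarrow> real \<Rightarrow> real) \<Rightarrow> real \<Rightarrow> ('e \<Rightarrow> real \<Rightarrow> real) set" where
  "eigenspace G q \<mu> =
     {u. (\<forall>e x. \<not> (e \<in> edges G \<and> x \<in> {0..len G e}) \<longrightarrow> u e x = 0) \<and>
         schroedinger G q u (\<lambda>e x. \<mu> * u e x)}"

definition fun_scale :: "real \<Rightarrow> ('e \<Rightarrow> real \<Rightarrow> real) \<Rightarrow> 'e \<Rightarrow> real \<Rightarrow> real" where
  "fun_scale c u = (\<lambda>e x. c * u e x)"

lemma vector_space_fun_scale: "vector_space fun_scale"
  by unfold_locales (auto simp: fun_scale_def fun_eq_iff algebra_simps)

definition is_eigenvalue :: "'e metric_graph \<Rightarrow> ('e \<Rightarrow> real \<Rightarrow> real) \<Rightarrow> real \<Rightarrow> bool" where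
  "is_eigenvalue G q \<mu> \<longleftrightarrow> (\<exists>u\<in>eigenspace G q \<mu>. u \<noteq> (\<lambda>_ _. 0))"

definition multiplicity_of :: "'e metric_graph \<Rightarrow> ('e \<Rightarrow> real \<Rightarrow> real) \<Rightarrow> real \<Rightarrow> nat" where
  "multiplicity_of G q \<mu> = vector_space.dim fun_scale (eigenspace G q \<mu>)"

definition simple_eigenvalue :: "'e metric_graph \<Rightarrow> ('e \<Rightarrow> real \<Rightarrow> real) \<Rightarrow> real \<Rightarrow> bool" where
  "simple_eigenvalue G q \<mu> \<longleftrightarrow> is_eigenvalue G q \<mu> \<and> multiplicity_of G q \<mu> = 1"

text \<open>The \<open>k\<close>-th entry, counting from \<open>k = 1\<close>, of the increasing list of the eigenvalues repeated
  according to multiplicity: the least number up to which there are at least \<open>k\<close> entries.\<close>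

definition eigval :: "'e metric_graph \<Rightarrow> ('e \<Rightarrow> real \<Rightarrow> real) \<Rightarrow> nat \<Rightarrow> real" where
  "eigval G q k =
     (LEAST \<mu>. k \<le> (\<Sum>\<nu>\<in>{\<nu>. is_eigenvalue G q \<nu> \<and> \<nu> \<le> \<mu>}. multiplicity_of G q \<nu>))"

definition fundamental_gap :: "'e metric_graph \<Rightarrow> ('e \<Rightarrow> real \<Rightarrow> real) \<Rightarrow> real" where
  "fundamental_gap G q = eigval G q 2 - eigval G q 1"

section \<open>Potentials that are convex on leaf-to-leaf paths\<close>

definition path_length :: "'e metric_graph \<Rightarrow> ('e \<times> bool) list \<Rightarrow> real" where
  "path_length G ps = (\<Sum>p\<leftarrow>ps. len G (fst p))"

text \<open>The function \<open>q\<close> along a path, as a function of the arc length from the start of the path.\<close>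

fun along :: "'e metric_graph \<Rightarrow> ('e \<Rightarrow> real \<Rightarrow> real) \<Rightarrow> ('e \<times> bool) list \<Rightarrow> real \<Rightarrow> real" where
  "along G q [] t = 0"
| "along G q (p # ps) t =
     (if t \<le> len G (fst p) then q (fst p) (if snd p then len G (fst p) - t else t)
      else along G q ps (t - len G (fst p)))"

definition convex_potentials :: "'e metric_graph \<Rightarrow> real \<Rightarrow> ('e \<Rightarrow> real \<Rightarrow> real) set" where
  "convex_potentials G M =
     {q. agrees_at_vertices G q \<and>
         (\<forall>e\<in>edges G. \<forall>x\<in>{0..len G e}. 0 \<le> q e x \<and> q e x \<le> M) \<and>
         (\<forall>ps. simple_path G ps \<and> walk_start G ps \<in> leaves G \<and> walk_end G ps \<in> leaves G \<longrightarrow>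
            convex_on {0..path_length G ps} (along G q ps))}"

lemma along_zero: "along G (\<lambda>_ _. 0) ps = (\<lambda>_. 0)"
proof
  show "along G (\<lambda>_ _. 0) ps t = 0" for t
    by (induction ps arbitrary: t) auto
qed

lemma zero_in_convex_potentials: "0 \<le> M \<Longrightarrow> (\<lambda>_ _. 0) \<in> convex_potentials G M"
  by (auto simp: convex_potentials_def agrees_at_vertices_def along_zero convex_on_def)

end

theory Submission
  imports Defs "HOL-Complex_Analysis.Great_Picard"
begin

text \<open>
  The edge is attached at a zero \<open>v0\<close> of an eigenfunction \<open>\<phi>\<close> for the second eigenvalue \<open>\<mu>\<close> of \<open>G\<close>
  at which \<open>\<phi>\<close> has nonzero slope. Then \<open>\<mu>\<close> is also a Poincare constant of \<open>G\<close> for functions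
  vanishing at \<open>v0\<close>. Let \<open>\<nu> \<le> \<mu>\<close> be the second eigenvalue of the enlarged tree.

  If \<open>\<nu> = \<mu>\<close>, then \<open>\<phi>\<close>, extended by zero, is an eigenfunction there. A small potential that lives on the
  new edge only does not affect it, while the first eigenvalue becomes positive: the gap decreases.

  If \<open>\<nu> < \<mu>\<close>, an eigenfunction \<open>\<psi>\<close> for \<open>\<nu> = k\<^sup>2\<close> cannot change sign on \<open>G\<close>. Let \<open>s\<close> be the distance from
  the new leaf and \<open>L\<close> the total length. Normalised, \<open>\<psi> = - cos (k s)\<close> on the new edge, which is longer than
  \<open>pi / (2 k)\<close>, and by Kirchhoff's condition \<open>0 \<le> \<psi> \<le> - cos (k s) < 1\<close> further outwards. For the potential
  \<open>t s\<close> the derivative of the gap at \<open>t = 0\<close> is \<open>(\<integral> s \<psi>\<^sup>2) / (\<integral> \<psi>\<^sup>2) - (\<integral> s) / L\<close>. With \<open>X = k s - pi / 2\<close>,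
  testing the equation of \<open>\<psi>\<close> against \<open>\<rho>(X) / cos X\<close> outside the new edge (and a constant on it) for two
  explicit functions \<open>\<rho>\<close> gives \<open>\<integral> X \<psi>\<^sup>2 < 0\<close> and \<open>\<integral> X (1 - \<psi>\<^sup>2) \<ge> 0\<close>; as \<open>\<integral> \<psi>\<^sup>2 < L\<close>, the derivative is
  negative.
\<close>

section \<open>Functions on an interval\<close>

text \<open>All spectral theory is reduced to one statement, \<open>eigenfunction_exists\<close>: a
  test function orthogonal to a given eigenfunction bounds an eigenvalue whose eigenfunction has the
  same orthogonality. With the zero function as the given one this is the Rayleigh bound; applied
  twice it replaces the min-max principle for the second eigenvalue. The slope at the zero must not
  vanish because the mean of \<phi> over a branch at \<open>v0\<close> is, up to a factor, the flux
  into that branch. A branch with nonzero mean can correct the mean of any function vanishing at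
  \<open>v0\<close>, which is where the Poincare constant comes from. The gap is only estimated from
  above, by a two-dimensional trial space for the second eigenvalue and by splitting off the mean
  for the first; no differentiability of eigenvalues enters. The functions \<open>rho\<close> come
  from the unbranched case: if the new edge were merely prolonged, the eigenfunction would be sin X
  and both integral inequalities would be pointwise identities. Branching makes the Wronskian of
  \<psi> and sin X strictly positive, and it enters either integrand with a known sign.\<close>

lemma homogeneous_system:
  fixes a :: "'j \<Rightarrow> 'i \<Rightarrow> real"
  assumes "finite J" "finite I" "card J < card I"
  shows "\<exists>x. (\<exists>i\<in>I. x i \<noteq> 0) \<and> (\<forall>j\<in>J. (\<Sum>i\<in>I. a j i * x i) = 0)"
  using assms
proof (induction J arbitrary: a I rule: finite_induct)
  case empty
  then have "I \<noteq> {}" by auto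
  then show ?case by (intro exI[of _ "\<lambda>_. 1"]) auto
next
  case (insert j J)
  show ?case
  proof (cases "\<forall>i\<in>I. a j i = 0")
    case True
    have "card J < card I" using insert by auto
    with insert.IH[of I a] insert.prems obtain x where
      "\<exists>i\<in>I. x i \<noteq> 0" "\<forall>j\<in>J. (\<Sum>i\<in>I. a j i * x i) = 0" by auto
    with True show ?thesis by (intro exI[of _ x]) auto
  next
    case False
    then obtain i0 where i0: "i0 \<in> I" "a j i0 \<noteq> 0" by auto
    \<comment> \<open>Row elimination with pivot \<open>a j i0\<close>. The result is needed for the
      vertex conditions in \<open>rsol_exists\<close> and for the dimension of eigenspaces in
      \<open>eigenspace_independent_finite\<close>.\<close>
    define b where "b k i = a k i - a k i0 * a j i / a j i0" for k i
    have fin: "finite (I - {i0})" using insert by auto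
    have "card J < card (I - {i0})" using insert i0 by auto
    with insert.IH[OF fin, of b] obtain x where
      x: "\<exists>i\<in>I - {i0}. x i \<noteq> 0" "\<forall>j\<in>J. (\<Sum>i\<in>I - {i0}. b j i * x i) = 0" by auto
    define s where "s = (\<Sum>i\<in>I - {i0}. a j i * x i)"
    define y where "y = x(i0 := - s / a j i0)"
    have eq: "(\<Sum>i\<in>I. a k i * y i) = - a k i0 * s / a j i0 + (\<Sum>i\<in>I - {i0}. a k i * x i)" for k
    proof -
      have "(\<Sum>i\<in>I. a k i * y i) = a k i0 * y i0 + (\<Sum>i\<in>I - {i0}. a k i * y i)"
        using i0 insert by (intro sum.remove) auto
      also have "(\<Sum>i\<in>I - {i0}. a k i * y i) = (\<Sum>i\<in>I - {i0}. a k i * x i)"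
        by (intro sum.cong) (auto simp: y_def)
      finally show ?thesis by (simp add: y_def)
    qed
    have "(\<Sum>i\<in>I. a j i * y i) = 0" using i0 by (simp add: eq s_def[symmetric])
    moreover have "(\<Sum>i\<in>I. a k i * y i) = 0" if "k \<in> J" for k
    proof -
      have "0 = (\<Sum>i\<in>I - {i0}. b k i * x i)" using x that by auto
      also have "\<dots> = (\<Sum>i\<in>I - {i0}. a k i * x i - (a k i0 / a j i0) * (a j i * x i))"
        by (intro sum.cong) (auto simp: b_def algebra_simps)
      also have "\<dots> = (\<Sum>i\<in>I - {i0}. a k i * x i) - a k i0 / a j i0 * s"
        by (simp add: sum_subtractf s_def sum_distrib_left)
      finally show ?thesis by (simp add: eq)
    qed
    moreover have "\<exists>i\<in>I. y i \<noteq> 0" using x by (auto simp: y_def)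
    ultimately show ?thesis by (intro exI[of _ y]) auto
  qed
qed

text \<open>Classical counterpart of \<open>sobolev2\<close>, with one-sided derivatives at the
  ends. For a continuous potential every eigenfunction has this regularity, see
  \<open>sobolev2_imp_C2_on\<close>.\<close>

definition C2_on :: "real \<Rightarrow> (real \<Rightarrow> real) \<Rightarrow> (real \<Rightarrow> real) \<Rightarrow> (real \<Rightarrow> real) \<Rightarrow> bool" where
  "C2_on l u u' u'' \<longleftrightarrow>
     (\<forall>x\<in>{0..l}. (u has_real_derivative u' x) (at x within {0..l}) \<and>
                 (u' has_real_derivative u'' x) (at x within {0..l})) \<and>
     continuous_on {0..l} u''"

lemma C2_onD:
  assumes "C2_on l u u' u''"
  shows "\<And>x. x \<in> {0..l} \<Longrightarrow> (u has_real_derivative u' x) (at x within {0..l})"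
    "\<And>x. x \<in> {0..l} \<Longrightarrow> (u' has_real_derivative u'' x) (at x within {0..l})"
    "continuous_on {0..l} u" "continuous_on {0..l} u'" "continuous_on {0..l} u''"
    "\<And>x. 0 < x \<Longrightarrow> x < l \<Longrightarrow> (u has_real_derivative u' x) (at x)"
    "\<And>x. 0 < x \<Longrightarrow> x < l \<Longrightarrow> (u' has_real_derivative u'' x) (at x)"
proof -
  show 1: "\<And>x. x \<in> {0..l} \<Longrightarrow> (u has_real_derivative u' x) (at x within {0..l})"
    and 2: "\<And>x. x \<in> {0..l} \<Longrightarrow> (u' has_real_derivative u'' x) (at x within {0..l})"
    and "continuous_on {0..l} u''"
    using assms by (auto simp: C2_on_def)
  show "continuous_on {0..l} u" "continuous_on {0..l} u'"
    using 1 2 DERIV_continuous_on by blast+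
  show "\<And>x. 0 < x \<Longrightarrow> x < l \<Longrightarrow> (u has_real_derivative u' x) (at x)"
    using 1 by (metis at_within_Icc_at atLeastAtMost_iff less_eq_real_def)
  show "\<And>x. 0 < x \<Longrightarrow> x < l \<Longrightarrow> (u' has_real_derivative u'' x) (at x)"
    using 2 by (metis at_within_Icc_at atLeastAtMost_iff less_eq_real_def)
qed

section \<open>Linear initial value problems of second order\<close>

lemma integral_power_bound:
  fixes g :: "real \<Rightarrow> real"
  assumes "0 \<le> x" "x \<le> l" "continuous_on {0..l} g" "\<And>t. t \<in> {0..l} \<Longrightarrow> \<bar>g t\<bar> \<le> c * t ^ n / fact n"
  shows "\<bar>integral {0..x} g\<bar> \<le> c * x ^ Suc n / fact (Suc n)"
proof -
  have i: "((\<lambda>t. c * t ^ n / fact n) has_integral (c * x ^ Suc n / fact (Suc n) - c * 0 ^ Suc n / fact (Suc n))) {0..x}"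
    using assms(1)
    apply (intro fundamental_theorem_of_calculus)
     apply simp
    apply (auto intro!: derivative_eq_intros simp: has_real_derivative_iff_has_vector_derivative[symmetric]
        simp del: fact_Suc power_Suc)
    apply (simp add: divide_simps add_nonneg_eq_0_iff)
    done
  have "norm (integral {0..x} g) \<le> integral {0..x} (\<lambda>t. c * t ^ n / fact n)"
    using assms i by (intro integral_norm_bound_integral integrable_continuous_real)
      (auto intro: continuous_on_subset intro!: continuous_intros)
  with integral_unique[OF i] show ?thesis by simp
qed

lemma linear_ivp_exists:
  fixes Q F :: "real \<Rightarrow> real"
  assumes l: "0 \<le> l" and Q: "continuous_on {0..l} Q" and F: "continuous_on {0..l} F"
  shows "\<exists>u u'. u 0 = a \<and> u' 0 = b \<and> C2_on l u u' (\<lambda>x. Q x * u x - F x)"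
proof -
  obtain K0 where K0: "\<And>x. x \<in> {0..l} \<Longrightarrow> \<bar>Q x\<bar> \<le> K0"
    using compact_imp_bounded[OF compact_continuous_image[OF Q]] by (force simp: bounded_iff)
  obtain f where f: "\<And>x. x \<in> {0..l} \<Longrightarrow> \<bar>F x\<bar> \<le> f"
    using compact_imp_bounded[OF compact_continuous_image[OF F]] by (force simp: bounded_iff)
  have f0: "f \<ge> 0" using f[of 0] l by auto
  define K where "K = max 1 K0"
  have K: "K \<ge> 1" "\<And>x. x \<in> {0..l} \<Longrightarrow> \<bar>Q x\<bar> \<le> K" using K0 by (force simp: K_def)+
  define B where "B = \<bar>a\<bar> + \<bar>b\<bar> + f"
  \<comment> \<open>Increments of the Picard iteration for (u, u')' = (u', Q u - F):
    \<open>d n\<close> and \<open>d' n\<close> are what the n-th iteration adds, so the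
    inhomogeneity enters only once, in passing from 0 to 1.\<close>
  define step where "step n p = ((\<lambda>x. integral {0..x} (snd p)),
     (\<lambda>x. integral {0..x} (\<lambda>t. Q t * fst p t - (if n = 0 then F t else 0))))"
    for n :: nat and p :: "(real \<Rightarrow> real) \<times> (real \<Rightarrow> real)"
  define p where "p = rec_nat ((\<lambda>_. a), (\<lambda>_. b)) step"
  define d where "d n = fst (p n)" for n
  define d' where "d' n = snd (p n)" for n
  have d0: "d 0 = (\<lambda>_. a)" "d' 0 = (\<lambda>_. b)" by (auto simp: d_def d'_def p_def)
  have dS: "d (Suc n) = (\<lambda>x. integral {0..x} (d' n))"
      "d' (Suc n) = (\<lambda>x. integral {0..x} (\<lambda>t. Q t * d n t - (if n = 0 then F t else 0)))" for n
    by (auto simp: d_def d'_def p_def step_def)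
  have "continuous_on {0..l} (d n) \<and> continuous_on {0..l} (d' n) \<and>
     (\<forall>x\<in>{0..l}. \<bar>d n x\<bar> \<le> B * K ^ n * x ^ n / fact n \<and> \<bar>d' n x\<bar> \<le> B * K ^ n * x ^ n / fact n)" for n
  proof (induction n)
    case 0
    show ?case using f0 by (auto simp: d0 B_def)
  next
    case (Suc n)
    then have c: "continuous_on {0..l} (d n)" "continuous_on {0..l} (d' n)"
      and bd: "\<And>x. x \<in> {0..l} \<Longrightarrow> \<bar>d n x\<bar> \<le> B * K ^ n * x ^ n / fact n"
        "\<And>x. x \<in> {0..l} \<Longrightarrow> \<bar>d' n x\<bar> \<le> B * K ^ n * x ^ n / fact n" by auto
    have c2: "continuous_on {0..l} (\<lambda>t. Q t * d n t - (if n = 0 then F t else 0))"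
      using c Q F by (cases "n = 0") (auto intro!: continuous_intros)
    have "continuous_on {0..l} (d (Suc n))" "continuous_on {0..l} (d' (Suc n))"
      unfolding dS using c c2 by (auto intro!: indefinite_integral_continuous_1 integrable_continuous_real)
    moreover have "\<bar>d (Suc n) x\<bar> \<le> B * K ^ Suc n * x ^ Suc n / fact (Suc n)" if "x \<in> {0..l}" for x
    proof -
      have "\<bar>d (Suc n) x\<bar> \<le> (B * K ^ Suc n) * x ^ Suc n / fact (Suc n)"
        unfolding dS using that c
      proof (intro integral_power_bound[where l = l])
        fix t assume t: "t \<in> {0..l}"
        have "\<bar>d' n t\<bar> \<le> B * K ^ n * (t ^ n / fact n)" using bd(2)[OF t] by simp
        also have "\<dots> \<le> (B * K ^ Suc n) * (t ^ n / fact n)"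
          using K t f0 by (intro mult_right_mono mult_left_mono power_increasing) (auto simp: B_def)
        finally show "\<bar>d' n t\<bar> \<le> B * K ^ Suc n * t ^ n / fact n" by simp
      qed auto
      then show ?thesis by simp
    qed
    moreover have "\<bar>d' (Suc n) x\<bar> \<le> B * K ^ Suc n * x ^ Suc n / fact (Suc n)" if "x \<in> {0..l}" for x
    proof -
      have "\<bar>d' (Suc n) x\<bar> \<le> (B * K ^ Suc n) * x ^ Suc n / fact (Suc n)"
        unfolding dS using that c2
      proof (intro integral_power_bound[where l = l])
        fix t assume t: "t \<in> {0..l}"
        show "\<bar>Q t * d n t - (if n = 0 then F t else 0)\<bar> \<le> B * K ^ Suc n * t ^ n / fact n"
        proof (cases "n = 0")
          case True
          have "\<bar>Q t * a - F t\<bar> \<le> \<bar>Q t\<bar> * \<bar>a\<bar> + \<bar>F t\<bar>" by (simp add: abs_mult[symmetric])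
          also have "\<dots> \<le> K * \<bar>a\<bar> + K * f"
            using K(1) K(2)[OF t] f[OF t] f0 mult_right_mono[of 1 K f] by (intro add_mono mult_right_mono) auto
          also have "\<dots> \<le> B * K" using K f0 by (auto simp: B_def algebra_simps)
          finally show ?thesis using True by (simp add: d0)
        next
          case False
          have "\<bar>Q t * d n t\<bar> \<le> K * (B * K ^ n * t ^ n / fact n)"
            unfolding abs_mult using K(1) K(2)[OF t] bd(1)[OF t] by (intro mult_mono) auto
          then show ?thesis using False by (simp add: algebra_simps)
        qed
      qed auto
      then show ?thesis by simp
    qed
    ultimately show ?case by blast
  qed
  then have cd: "continuous_on {0..l} (d n)" "continuous_on {0..l} (d' n)"
    and bd: "\<And>x. x \<in> {0..l} \<Longrightarrow> \<bar>d n x\<bar> \<le> B * K ^ n * x ^ n / fact n"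
     "\<And>x. x \<in> {0..l} \<Longrightarrow> \<bar>d' n x\<bar> \<le> B * K ^ n * x ^ n / fact n" for n by blast+
  define M where "M n = B * (inverse (fact n) * (K * l) ^ n)" for n
  have sM: "summable M" unfolding M_def by (intro summable_mult summable_exp)
  have bM: "B * K ^ n * x ^ n / fact n \<le> M n" if "x \<in> {0..l}" for n x
  proof -
    have "B * K ^ n * x ^ n \<le> B * K ^ n * l ^ n"
      using that K f0 by (intro mult_left_mono power_mono) (auto simp: B_def)
    then show ?thesis by (simp add: M_def divide_simps power_mult_distrib mult_ac)
  qed
  define U where "U x = (\<Sum>n. d n x)" for x
  define U' where "U' x = (\<Sum>n. d' n x)" for x
  have ulU: "uniform_limit {0..l} (\<lambda>n x. \<Sum>i<n. d i x) U sequentially"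
    unfolding U_def using sM order.trans[OF bd(1) bM] by (intro Weierstrass_m_test[where M = M]) auto
  have ulU': "uniform_limit {0..l} (\<lambda>n x. \<Sum>i<n. d' i x) U' sequentially"
    unfolding U'_def using sM order.trans[OF bd(2) bM] by (intro Weierstrass_m_test[where M = M]) auto
  have sU: "(\<lambda>n. d n x) sums U x" and sU': "(\<lambda>n. d' n x) sums U' x" if "x \<in> {0..l}" for x
    using tendsto_uniform_limitI[OF ulU that] tendsto_uniform_limitI[OF ulU' that] by (auto simp: sums_def)
  \<comment> \<open>\<open>e n\<close> and \<open>e' n\<close> are the derivatives of
    \<open>d n\<close> and \<open>d' n\<close>. They lag one index behind, and their sums converge
    to \<open>U'\<close> and to Q U - F.\<close>
  define e where "e n = (case n of 0 \<Rightarrow> (\<lambda>_. 0) | Suc m \<Rightarrow> d' m)" for n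
  define e' where "e' n = (case n of 0 \<Rightarrow> (\<lambda>_. 0) | Suc m \<Rightarrow> (\<lambda>t. Q t * d m t - (if m = 0 then F t else 0)))" for n
  have de: "(d n has_real_derivative e n x) (at x within {0..l})" if "x \<in> {0..l}" for n x
    using that cd by (cases n) (auto simp: e_def d0 dS intro!: integral_has_real_derivative derivative_eq_intros)
  have de': "(d' n has_real_derivative e' n x) (at x within {0..l})" if "x \<in> {0..l}" for n x
  proof (cases n)
    case 0 then show ?thesis by (auto simp: e'_def d0)
  next
    case (Suc m)
    have "continuous_on {0..l} (\<lambda>t. Q t * d m t - (if m = 0 then F t else 0))"
      using cd Q F by (cases "m = 0") (auto intro!: continuous_intros)
    then show ?thesis using that unfolding Suc dS by (auto simp: e'_def intro!: integral_has_real_derivative)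
  qed
  have uE: "uniform_limit {0..l} (\<lambda>n x. \<Sum>i<n. e i x) U' sequentially"
  proof -
    have eq: "(\<Sum>i<Suc n. e i x) = (\<Sum>i<n. d' i x)" for n x
      by (subst sum.lessThan_Suc_shift) (simp add: e_def)
    have "uniform_limit {0..l} (\<lambda>n x. \<Sum>i<Suc n. e i x) U' sequentially" unfolding eq by (rule ulU')
    then show ?thesis unfolding uniform_limit_iff
      by (subst (asm) eventually_sequentially_Suc) auto
  qed
  have uE': "uniform_limit {0..l} (\<lambda>n x. \<Sum>i<n. e' i x) (\<lambda>x. Q x * U x - F x) sequentially"
  proof -
    \<comment> \<open>The term 0 is zero and the term 1 carries -F; hence the identity holds only
      from two terms on.\<close>
    have eq: "(\<Sum>i<Suc (Suc n). e' i x) = Q x * (\<Sum>i<Suc n. d i x) - F x" for n x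
    proof (induction n)
      case 0 then show ?case by (simp add: e'_def)
    next
      case (Suc n)
      then show ?case by (subst sum.lessThan_Suc) (simp add: e'_def algebra_simps)
    qed
    have bQ: "bounded (Q ` {0..l})" using compact_imp_bounded[OF compact_continuous_image[OF Q]] by auto
    have cU: "continuous_on {0..l} U"
      by (rule uniform_limit_theorem[OF _ ulU]) (auto intro!: continuous_on_sum cd always_eventually)
    have bU: "bounded (U ` {0..l})" using compact_imp_bounded[OF compact_continuous_image[OF cU]] by auto
    have "uniform_limit {0..l} (\<lambda>n x. Q x * (\<Sum>i<n. d i x)) (\<lambda>x. Q x * U x) sequentially"
      using bQ bU ulU by (intro uniform_lim_mult) (auto intro: uniform_limit_const)
    then have "uniform_limit {0..l} (\<lambda>n x. Q x * (\<Sum>i<n. d i x) - F x) (\<lambda>x. Q x * U x - F x) sequentially"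
      by (rule uniform_limit_minus[OF _ uniform_limit_const])
    then have "uniform_limit {0..l} (\<lambda>n x. Q x * (\<Sum>i<Suc n. d i x) - F x) (\<lambda>x. Q x * U x - F x) sequentially"
      unfolding uniform_limit_iff
      by (subst eventually_sequentially_Suc[of "\<lambda>n. \<forall>x\<in>{0..l}. dist (Q x * (\<Sum>i<n. d i x) - F x) (Q x * U x - F x) < _"]) auto
    then have "uniform_limit {0..l} (\<lambda>n x. \<Sum>i<Suc (Suc n). e' i x) (\<lambda>x. Q x * U x - F x) sequentially"
      unfolding eq .
    then show ?thesis unfolding uniform_limit_iff
      using eventually_sequentially_Suc[of "\<lambda>n. \<forall>x\<in>{0..l}. dist (\<Sum>i<Suc n. e' i x) (Q x * U x - F x) < _"]
       eventually_sequentially_Suc[of "\<lambda>n. \<forall>x\<in>{0..l}. dist (\<Sum>i<n. e' i x) (Q x * U x - F x) < _"]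
      by auto
  qed
  have z: "(0::real) \<in> {0..l}" using l by auto
  obtain g where g: "\<forall>x\<in>{0..l}. (\<lambda>n. d n x) sums g x \<and> (g has_field_derivative U' x) (at x within {0..l})"
    using has_field_derivative_series[OF _ de uE z] sums_summable[OF sU[OF z]] by auto
  obtain g' where g': "\<forall>x\<in>{0..l}. (\<lambda>n. d' n x) sums g' x \<and> (g' has_field_derivative Q x * U x - F x) (at x within {0..l})"
    using has_field_derivative_series[OF _ de' uE' z] sums_summable[OF sU'[OF z]] by auto
  have gU: "g x = U x" "g' x = U' x" if "x \<in> {0..l}" for x
    using g g' sU sU' that sums_unique2 by blast+
  have cg: "continuous_on {0..l} g" using g DERIV_continuous_on by blast
  have dz: "d n 0 = (if n = 0 then a else 0)" "d' n 0 = (if n = 0 then b else 0)" for n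
    by (cases n; simp add: d0 dS)+
  have "g 0 = a" "g' 0 = b"
    using sums_unique2[OF conjunct1[OF bspec[OF g z]]] sums_unique2[OF conjunct1[OF bspec[OF g' z]]]
      sums_If_finite[of "\<lambda>n. n = 0" "\<lambda>_. a"] sums_If_finite[of "\<lambda>n. n = 0" "\<lambda>_. b"]
    by (auto simp: dz)
  moreover have "C2_on l g g' (\<lambda>x. Q x * g x - F x)"
    unfolding C2_on_def using g g' gU cg Q F by (auto intro!: continuous_intros)
  ultimately show ?thesis by blast
qed

text \<open>Gronwall's argument: u^2 + u'^2, damped by exp (- (1 + K) t), cannot increase, because 2
  (1 + Q) u u' is at most (1 + K) (u^2 + u'^2).\<close>

lemma linear_ivp_unique:
  fixes Q :: "real \<Rightarrow> real"
  assumes Q: "continuous_on {0..l} Q" and u: "C2_on l u u' (\<lambda>x. Q x * u x)"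
    and z: "u 0 = 0" "u' 0 = 0" and x: "x \<in> {0..l}"
  shows "u x = 0 \<and> u' x = 0"
proof -
  obtain K where K: "\<And>x. x \<in> {0..l} \<Longrightarrow> \<bar>Q x\<bar> \<le> K"
    using compact_imp_bounded[OF compact_continuous_image[OF Q]] by (force simp: bounded_iff)
  define w where "w t = ((u t)\<^sup>2 + (u' t)\<^sup>2) * exp (- (1 + K) * t)" for t
  note D = C2_onD[OF u]
  have "w x \<le> w 0"
  proof (cases "x = 0")
    case False
    show ?thesis
    proof (rule DERIV_nonpos_imp_decreasing_open[of 0 x w])
      show "0 \<le> x" using x by auto
      fix t assume t: "0 < t" "t < x"
      then have t': "t < l" "t \<in> {0..l}" using x by auto
      have "(w has_real_derivative (2 * u t * u' t + 2 * u' t * (Q t * u t) - (1 + K) * ((u t)\<^sup>2 + (u' t)\<^sup>2)) * exp (- (1 + K) * t)) (at t)"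
        unfolding w_def using D(6,7)[of t] t t'
        by (auto intro!: derivative_eq_intros simp: algebra_simps power2_eq_square)
      moreover have "2 * u t * u' t + 2 * u' t * (Q t * u t) \<le> (1 + K) * ((u t)\<^sup>2 + (u' t)\<^sup>2)"
      proof -
        have "(1 + Q t) * (2 * u t * u' t) \<le> \<bar>1 + Q t\<bar> * \<bar>2 * u t * u' t\<bar>"
          by (metis abs_ge_self abs_mult)
        also have "\<dots> \<le> (1 + K) * ((u t)\<^sup>2 + (u' t)\<^sup>2)"
        proof (intro mult_mono)
          show "\<bar>1 + Q t\<bar> \<le> 1 + K" using K[OF t'(2)] by linarith
          have "0 \<le> (\<bar>u t\<bar> - \<bar>u' t\<bar>)\<^sup>2" by simp
          then show "\<bar>2 * u t * u' t\<bar> \<le> (u t)\<^sup>2 + (u' t)\<^sup>2"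
            unfolding power2_diff by (simp add: abs_mult)
        qed (use K[OF t'(2)] in auto)
        finally show ?thesis by (simp add: algebra_simps)
      qed
      ultimately show "\<exists>y. DERIV w t :> y \<and> y \<le> 0"
        by (meson diff_le_0_iff_le exp_ge_zero mult_nonpos_nonneg)
    next
      show "continuous_on {0..x} w" unfolding w_def
        using x by (auto intro!: continuous_intros intro: continuous_on_subset[OF D(3)] continuous_on_subset[OF D(4)])
    qed
  qed auto
  then have "((u x)\<^sup>2 + (u' x)\<^sup>2) * exp (- (1 + K) * x) \<le> 0" by (simp add: w_def z)
  then have "(u x)\<^sup>2 + (u' x)\<^sup>2 \<le> 0" by (simp add: mult_le_0_iff)
  then show ?thesis by (simp add: sum_power2_le_zero_iff)
qed

lemma oscillator_energy:
  assumes u: "C2_on l u u' (\<lambda>x. - \<mu> * u x)" and x: "x \<in> {0..l}" "y \<in> {0..l}"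
  shows "(u' x)\<^sup>2 + \<mu> * (u x)\<^sup>2 = (u' y)\<^sup>2 + \<mu> * (u y)\<^sup>2"
proof -
  have "\<exists>c. \<forall>x\<in>{0..l}. (u' x)\<^sup>2 + \<mu> * (u x)\<^sup>2 = c"
    using C2_onD(1,2)[OF u]
    by (intro has_field_derivative_zero_constant) (auto intro!: derivative_eq_intros)
  with x show ?thesis by auto
qed

text \<open>Regularity of test functions. Negative parts and functions glued from two edges have
  corners, hence the finite exceptional set; there the values of \<open>g\<close> are
  arbitrary.\<close>

definition pw_diff :: "real \<Rightarrow> (real \<Rightarrow> real) \<Rightarrow> (real \<Rightarrow> real) \<Rightarrow> bool" where
  "pw_diff l f g \<longleftrightarrow> continuous_on {0..l} f \<and>
     (\<exists>S. finite S \<and> (\<forall>x\<in>{0<..<l} - S. (f has_real_derivative g x) (at x))) \<and>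
     (\<lambda>x. (g x)\<^sup>2) integrable_on {0..l}"

text \<open>Integration by parts. It also yields the integrability of \<open>u' * g\<close>, as the
  difference of an exact derivative and a continuous function.\<close>

lemma C2_on_green:
  assumes l: "0 \<le> l" and u: "C2_on l u u' u''" and f: "pw_diff l f g"
  shows "((\<lambda>x. u' x * g x + u'' x * f x) has_integral (u' l * f l - u' 0 * f 0)) {0..l}"
    "(\<lambda>x. u' x * g x) integrable_on {0..l}"
proof -
  note D = C2_onD[OF u]
  obtain S where S: "finite S" "\<And>x. x \<in> {0<..<l} - S \<Longrightarrow> (f has_real_derivative g x) (at x)"
    and cf: "continuous_on {0..l} f"
    using f by (auto simp: pw_diff_def)
  show 1: "((\<lambda>x. u' x * g x + u'' x * f x) has_integral (u' l * f l - u' 0 * f 0)) {0..l}"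
  proof (rule fundamental_theorem_of_calculus_interior_strong[OF S(1) l])
    fix x assume x: "x \<in> {0<..<l} - S"
    show "((\<lambda>x. u' x * f x) has_vector_derivative u' x * g x + u'' x * f x) (at x)"
      unfolding has_real_derivative_iff_has_vector_derivative[symmetric]
      using D(7)[of x] S(2)[OF x] x by (auto intro!: derivative_eq_intros)
  qed (auto intro!: continuous_intros cf D)
  have "(\<lambda>x. u'' x * f x) integrable_on {0..l}"
    using D(5) cf by (intro integrable_continuous_real continuous_intros) auto
  from integrable_diff[OF has_integral_integrable[OF 1] this]
  show "(\<lambda>x. u' x * g x) integrable_on {0..l}" by simp
qed

lemma C2_on_pw_diff: "C2_on l u u' u'' \<Longrightarrow> pw_diff l u u'"
  unfolding pw_diff_def using C2_onD[of l u u' u'']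
  by (auto intro!: exI[of _ "{}"] integrable_continuous_real continuous_intros)

text \<open>Cauchy-Schwarz, in the form that the integral of (u' - c)^2 is nonnegative for the mean
  slope c. It makes sequences of bounded energy equicontinuous.\<close>

lemma C2_on_hoelder:
  assumes u: "C2_on l u u' u''" and xy: "0 \<le> x" "x \<le> y" "y \<le> l"
    and C: "integral {0..l} (\<lambda>t. (u' t)\<^sup>2) \<le> C"
  shows "(u y - u x)\<^sup>2 \<le> C * (y - x)"
proof (cases "x = y")
  case True
  then show ?thesis by simp
next
  case False
  note D = C2_onD[OF u]
  define c where "c = (u y - u x) / (y - x)"
  have sub: "{x..y} \<subseteq> {0..l}" using xy by auto
  have i1: "(u' has_integral (u y - u x)) {x..y}"
  proof (rule fundamental_theorem_of_calculus)
    fix t assume "t \<in> {x..y}"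
    then show "(u has_vector_derivative u' t) (at t within {x..y})"
      using D(1)[of t] sub
      by (auto simp: has_real_derivative_iff_has_vector_derivative[symmetric] intro: DERIV_subset)
  qed (use xy in auto)
  have i2: "(\<lambda>t. (u' t)\<^sup>2) integrable_on {x..y}" "(\<lambda>t. (u' t)\<^sup>2) integrable_on {0..l}"
    using D(4) sub by (auto intro!: integrable_continuous_real continuous_intros intro: continuous_on_subset)
  have "((\<lambda>t. (u' t)\<^sup>2 - 2 * c * u' t + c\<^sup>2) has_integral
        (integral {x..y} (\<lambda>t. (u' t)\<^sup>2) - 2 * c * (u y - u x) + c\<^sup>2 * (y - x))) {x..y}"
    using has_integral_mult_right[OF i1, of "2 * c"] integrable_integral[OF i2(1)] has_integral_const_real[of "c\<^sup>2" x y] xy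
    by (intro has_integral_add has_integral_diff) (auto simp: mult.commute)
  moreover have "0 \<le> (u' t)\<^sup>2 - 2 * c * u' t + c\<^sup>2" for t
    using zero_le_power2[of "u' t - c"] by (simp add: power2_diff algebra_simps)
  ultimately have "0 \<le> integral {x..y} (\<lambda>t. (u' t)\<^sup>2) - 2 * c * (u y - u x) + c\<^sup>2 * (y - x)"
    using has_integral_nonneg by blast
  moreover have "c * (y - x) = u y - u x" using False by (simp add: c_def)
  moreover have "integral {x..y} (\<lambda>t. (u' t)\<^sup>2) \<le> integral {0..l} (\<lambda>t. (u' t)\<^sup>2)"
    using sub i2 by (intro integral_subset_le) auto
  moreover have "c\<^sup>2 * (y - x) = c * (u y - u x)"
    using \<open>c * (y - x) = u y - u x\<close> by (simp add: power2_eq_square mult.assoc)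
  ultimately have "c * (c * (y - x)) \<le> C" using C by (simp add: mult.assoc)
  then have "c * (c * (y - x)) * (y - x) \<le> C * (y - x)" using xy by (intro mult_right_mono) auto
  moreover have "c * (c * (y - x)) * (y - x) = (u y - u x)\<^sup>2"
    unfolding \<open>c * (y - x) = u y - u x\<close>[symmetric] by (simp add: power2_eq_square mult_ac)
  ultimately show ?thesis by simp
qed

text \<open>The equation makes \<open>f''\<close> equal almost everywhere to the continuous function
  \<open>h\<close>. As \<open>f'\<close> is a primitive of \<open>f''\<close>, it is also one of
  \<open>h\<close>, hence continuously differentiable.\<close>

lemma sobolev2_imp_C2_on:
  assumes l: "0 \<le> l" and s: "sobolev2 l f f' f''" and q: "continuous_on {0..l} q"
    and ae: "AE x in lebesgue_on {0..l}. - f'' x + q x * f x = \<mu> * f x"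
  shows "C2_on l f f' (\<lambda>x. (q x - \<mu>) * f x)"
proof -
  have d: "\<And>x. x \<in> {0..l} \<Longrightarrow> (f has_real_derivative f' x) (at x within {0..l})"
    and m: "f'' \<in> borel_measurable (lebesgue_on {0..l})"
    and i: "\<And>x. x \<in> {0..l} \<Longrightarrow> f' x = f' 0 + (LINT t|lebesgue_on {0..x}. f'' t)"
    using s unfolding sobolev2_def by blast+
  have cf: "continuous_on {0..l} f" using d DERIV_continuous_on by blast
  define h where "h x = (q x - \<mu>) * f x" for x
  have ch: "continuous_on {0..l} h" unfolding h_def by (intro continuous_intros q cf)
  have eq: "f' x = f' 0 + integral {0..x} h" if x: "x \<in> {0..l}" for x
  proof -
    have sub: "{0..x} \<subseteq> {0..l}" using x by auto
    have chx: "continuous_on {0..x} h" using ch sub continuous_on_subset by blast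
    have "(LINT t|lebesgue_on {0..x}. f'' t) = (LINT t|lebesgue_on {0..x}. h t)"
    proof (rule integral_cong_AE)
      show "f'' \<in> borel_measurable (lebesgue_on {0..x})"
        using measurable_restrict_mono[OF m sub] .
      show "h \<in> borel_measurable (lebesgue_on {0..x})"
        using chx by (intro continuous_imp_measurable_on_sets_lebesgue) auto
      have "AE t in lebesgue. t \<in> {0..l} \<longrightarrow> f'' t = h t"
        using ae by (subst (asm) AE_restrict_space_iff) (auto elim!: eventually_mono simp: h_def algebra_simps)
      then show "AE t in lebesgue_on {0..x}. f'' t = h t"
        using sub by (subst AE_restrict_space_iff) (auto elim!: eventually_mono)
    qed
    also have "\<dots> = integral {0..x} h"
      using chx by (intro lebesgue_integral_eq_integral continuous_imp_integrable_real) auto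
    finally show ?thesis using i[OF x] by simp
  qed
  have "(f' has_real_derivative h x) (at x within {0..l})" if x: "x \<in> {0..l}" for x
  proof -
    have "((\<lambda>x. f' 0 + integral {0..x} h) has_real_derivative h x) (at x within {0..l})"
      using integral_has_real_derivative[OF ch x] by (auto intro!: derivative_eq_intros)
    then show ?thesis
      by (rule has_field_derivative_transform_within[OF _ zero_less_one x]) (simp add: eq[symmetric])
  qed
  with d ch show ?thesis unfolding C2_on_def h_def by auto
qed

lemma C2_on_imp_sobolev2:
  assumes l: "0 \<le> l" and u: "C2_on l f f' f''"
  shows "sobolev2 l f f' f''"
proof -
  note D = C2_onD[OF u]
  have "f' x = f' 0 + (LINT t|lebesgue_on {0..x}. f'' t)" if x: "x \<in> {0..l}" for x
  proof -
    have sub: "{0..x} \<subseteq> {0..l}" using x by auto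
    have "(f'' has_integral (f' x - f' 0)) {0..x}"
    proof (rule fundamental_theorem_of_calculus)
      fix t assume "t \<in> {0..x}"
      then show "(f' has_vector_derivative f'' t) (at t within {0..x})"
        using D(2)[of t] sub
        by (auto simp: has_real_derivative_iff_has_vector_derivative[symmetric] intro: DERIV_subset)
    qed (use x in auto)
    moreover have "(LINT t|lebesgue_on {0..x}. f'' t) = integral {0..x} f''"
      using continuous_on_subset[OF D(5) sub]
      by (intro lebesgue_integral_eq_integral continuous_imp_integrable_real) auto
    ultimately show ?thesis by (simp add: integral_unique)
  qed
  moreover have "f'' \<in> borel_measurable (lebesgue_on {0..l})"
    using D(5) by (rule continuous_imp_measurable_on_sets_lebesgue) auto
  moreover have "integrable (lebesgue_on {0..l}) (\<lambda>x. (f'' x)\<^sup>2)"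
    using D(5) by (intro continuous_imp_integrable_real continuous_on_power) auto
  ultimately show ?thesis unfolding sobolev2_def using D(1) by blast
qed

section \<open>The weak formulation on a metric graph\<close>

lemma C2_on_lin:
  assumes "C2_on l u u' u''" "C2_on l v v' v''"
  shows "C2_on l (\<lambda>x. a * u x + b * v x) (\<lambda>x. a * u' x + b * v' x) (\<lambda>x. a * u'' x + b * v'' x)"
  using assms unfolding C2_on_def by (auto intro!: derivative_eq_intros continuous_intros)

lemma C2_on_cong:
  assumes "C2_on l u u' u''" "\<And>x. x \<in> {0..l} \<Longrightarrow> u'' x = w x"
  shows "C2_on l u u' w"
  using assms continuous_on_cong[of "{0..l}" "{0..l}" u'' w] by (auto simp: C2_on_def)

definition ip :: "'e metric_graph \<Rightarrow> ('e \<Rightarrow> real \<Rightarrow> real) \<Rightarrow> ('e \<Rightarrow> real \<Rightarrow> real) \<Rightarrow> real" where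
  "ip G f g = (\<Sum>e\<in>edges G. integral {0..len G e} (\<lambda>x. f e x * g e x))"

definition edge_cont :: "'e metric_graph \<Rightarrow> ('e \<Rightarrow> real \<Rightarrow> real) \<Rightarrow> bool" where
  "edge_cont G f \<longleftrightarrow> (\<forall>e\<in>edges G. continuous_on {0..len G e} (f e))"

definition kdom ::
  "'e metric_graph \<Rightarrow> ('e \<Rightarrow> real \<Rightarrow> real) \<Rightarrow> ('e \<Rightarrow> real \<Rightarrow> real) \<Rightarrow> ('e \<Rightarrow> real \<Rightarrow> real) \<Rightarrow> bool" where
  "kdom G u u' u'' \<longleftrightarrow> (\<forall>e\<in>edges G. C2_on (len G e) (u e) (u' e) (u'' e)) \<and>
     agrees_at_vertices G u \<and> (\<forall>v\<in>verts G. (\<Sum>p\<in>v. normal_deriv G u' p) = 0)"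

definition test_fun :: "'e metric_graph \<Rightarrow> ('e \<Rightarrow> real \<Rightarrow> real) \<Rightarrow> ('e \<Rightarrow> real \<Rightarrow> real) \<Rightarrow> bool" where
  "test_fun G f g \<longleftrightarrow> (\<forall>e\<in>edges G. pw_diff (len G e) (f e) (g e)) \<and> agrees_at_vertices G f"

definition lc :: "real \<Rightarrow> ('e \<Rightarrow> real \<Rightarrow> real) \<Rightarrow> real \<Rightarrow> ('e \<Rightarrow> real \<Rightarrow> real) \<Rightarrow> 'e \<Rightarrow> real \<Rightarrow> real" where
  "lc a f b g = (\<lambda>e x. a * f e x + b * g e x)"

text \<open>Solutions of - u'' + (q + 1) u = f. For a nonnegative potential the shift by one makes
  the form coercive, so that the solution operator, the resolvent, exists and is bounded.\<close>

definition rsol ::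
  "'e metric_graph \<Rightarrow> ('e \<Rightarrow> real \<Rightarrow> real) \<Rightarrow> ('e \<Rightarrow> real \<Rightarrow> real) \<Rightarrow> ('e \<Rightarrow> real \<Rightarrow> real) \<Rightarrow> ('e \<Rightarrow> real \<Rightarrow> real) \<Rightarrow> bool" where
  "rsol G q f u u' \<longleftrightarrow> kdom G u u' (\<lambda>e x. (q e x + 1) * u e x - f e x)"

definition esol ::
  "'e metric_graph \<Rightarrow> ('e \<Rightarrow> real \<Rightarrow> real) \<Rightarrow> real \<Rightarrow> ('e \<Rightarrow> real \<Rightarrow> real) \<Rightarrow> ('e \<Rightarrow> real \<Rightarrow> real) \<Rightarrow> bool" where
  "esol G q \<mu> u u' \<longleftrightarrow> kdom G u u' (\<lambda>e x. (q e x - \<mu>) * u e x)"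

lemma normal_deriv_lc: "normal_deriv G (lc a u b v) p = a * normal_deriv G u p + b * normal_deriv G v p"
  by (simp add: normal_deriv_def lc_def)

lemma kdom_lc:
  assumes "kdom G u u' u''" "kdom G v v' v''"
  shows "kdom G (lc a u b v) (lc a u' b v') (lc a u'' b v'')"
proof -
  have "(\<Sum>p\<in>x. a * normal_deriv G u' p + b * normal_deriv G v' p) = 0" if "x \<in> verts G" for x
    using assms that by (simp add: kdom_def sum.distrib sum_distrib_left[symmetric])
  moreover have "C2_on (len G e) (lc a u b v e) (lc a u' b v' e) (lc a u'' b v'' e)" if "e \<in> edges G" for e
    using assms that unfolding lc_def kdom_def by (intro C2_on_lin) auto
  moreover have "agrees_at_vertices G (lc a u b v)"
    using assms unfolding kdom_def agrees_at_vertices_def lc_def by metis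
  ultimately show ?thesis unfolding kdom_def normal_deriv_lc by blast
qed

lemma kdom_cong:
  assumes "kdom G u u' u''" "\<And>e x. e \<in> edges G \<Longrightarrow> x \<in> {0..len G e} \<Longrightarrow> u'' e x = w e x"
  shows "kdom G u u' w"
proof -
  have "C2_on (len G e) (u e) (u' e) (w e)" if "e \<in> edges G" for e
    by (rule C2_on_cong[of _ _ _ "u'' e"]) (use assms that in \<open>auto simp: kdom_def\<close>)
  then show ?thesis using assms by (simp add: kdom_def)
qed

lemma rsol_lc:
  assumes "rsol G q f u u'" "rsol G q g v v'"
  shows "rsol G q (lc a f b g) (lc a u b v) (lc a u' b v')"
proof -
  have "lc a (\<lambda>e x. (q e x + 1) * u e x - f e x) b (\<lambda>e x. (q e x + 1) * v e x - g e x) =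
      (\<lambda>e x. (q e x + 1) * lc a u b v e x - lc a f b g e x)"
    by (auto simp: lc_def algebra_simps)
  then show ?thesis using kdom_lc[OF assms[unfolded rsol_def], of a b] by (simp add: rsol_def)
qed

lemma kdom_edge_cont:
  assumes "kdom G u u' u''"
  shows "edge_cont G u" "edge_cont G u'" "edge_cont G u''"
  using assms unfolding kdom_def edge_cont_def by (auto intro: C2_onD(3-5))

lemma kdom_test_fun: "kdom G u u' u'' \<Longrightarrow> test_fun G u u'"
  unfolding kdom_def test_fun_def by (auto intro: C2_on_pw_diff)

lemma test_fun_edge_cont: "test_fun G f g \<Longrightarrow> edge_cont G f"
  unfolding test_fun_def edge_cont_def pw_diff_def by blast

lemma edge_cont_lc [intro]: "edge_cont G f \<Longrightarrow> edge_cont G g \<Longrightarrow> edge_cont G (lc a f b g)"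
  unfolding edge_cont_def lc_def by (auto intro!: continuous_intros)

lemma edge_cont_mult [intro]: "edge_cont G f \<Longrightarrow> edge_cont G g \<Longrightarrow> edge_cont G (\<lambda>e x. f e x * g e x)"
  unfolding edge_cont_def by (auto intro!: continuous_intros)

lemma ip_commute: "ip G f g = ip G g f"
  by (simp add: ip_def mult.commute)

lemma ip_cong:
  assumes "\<And>e x. e \<in> edges G \<Longrightarrow> x \<in> {0..len G e} \<Longrightarrow> f e x * g e x = f' e x * g' e x"
  shows "ip G f g = ip G f' g'"
  unfolding ip_def using assms by (intro sum.cong integral_cong) auto

lemma edge_cont_integrable:
  "edge_cont G f \<Longrightarrow> edge_cont G g \<Longrightarrow> e \<in> edges G \<Longrightarrow> (\<lambda>x. f e x * g e x) integrable_on {0..len G e}"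
  unfolding edge_cont_def by (intro integrable_continuous_real continuous_on_mult) auto

lemma ip_lc_left:
  assumes "edge_cont G f" "edge_cont G g" "edge_cont G h"
  shows "ip G (lc a f b g) h = a * ip G f h + b * ip G g h"
proof -
  have "integral {0..len G e} (\<lambda>x. lc a f b g e x * h e x) =
     a * integral {0..len G e} (\<lambda>x. f e x * h e x) + b * integral {0..len G e} (\<lambda>x. g e x * h e x)"
    if e: "e \<in> edges G" for e
  proof -
    have "integral {0..len G e} (\<lambda>x. lc a f b g e x * h e x) =
      integral {0..len G e} (\<lambda>x. a * (f e x * h e x) + b * (g e x * h e x))"
      by (simp add: lc_def algebra_simps)
    also have "\<dots> = integral {0..len G e} (\<lambda>x. a * (f e x * h e x)) + integral {0..len G e} (\<lambda>x. b * (g e x * h e x))"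
      using assms e by (intro integral_add integrable_on_mult_right edge_cont_integrable)
    finally show ?thesis by simp
  qed
  then show ?thesis by (simp add: ip_def sum.distrib sum_distrib_left[symmetric])
qed

lemma ip_lc_right:
  assumes "edge_cont G f" "edge_cont G g" "edge_cont G h"
  shows "ip G h (lc a f b g) = a * ip G h f + b * ip G h g"
  using ip_lc_left[OF assms] by (simp add: ip_commute)

lemma ip_lc_square:
  assumes "edge_cont G f" "edge_cont G g"
  shows "ip G (lc a f b g) (lc a f b g) = a\<^sup>2 * ip G f f + 2 * a * b * ip G f g + b\<^sup>2 * ip G g g"
  using assms by (simp add: ip_lc_left ip_lc_right edge_cont_lc ip_commute[of G g f] power2_eq_square algebra_simps)

text \<open>A function that is not integrable has integral 0 by convention, so nonnegativity holds
  without any side condition.\<close>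

lemma integral_nonneg_total:
  fixes f :: "real \<Rightarrow> real"
  assumes "\<And>x. x \<in> S \<Longrightarrow> 0 \<le> f x"
  shows "0 \<le> integral S f"
  using assms by (cases "f integrable_on S") (auto intro: integral_nonneg simp: not_integrable_integral)

lemma ip_nonneg: "(\<And>e x. e \<in> edges G \<Longrightarrow> x \<in> {0..len G e} \<Longrightarrow> 0 \<le> f e x * g e x) \<Longrightarrow> 0 \<le> ip G f g"
  unfolding ip_def
  by (intro sum_nonneg integral_nonneg_total) auto

lemma ip_square_nonneg: "0 \<le> ip G f f"
  by (rule ip_nonneg) simp

lemma ip_mono:
  assumes "edge_cont G f" "edge_cont G g" "edge_cont G f'" "edge_cont G g'"
    and "\<And>e x. e \<in> edges G \<Longrightarrow> x \<in> {0..len G e} \<Longrightarrow> f e x * g e x \<le> f' e x * g' e x"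
  shows "ip G f g \<le> ip G f' g'"
  unfolding ip_def using assms by (intro sum_mono integral_le edge_cont_integrable) auto

lemma ip_young:
  assumes "edge_cont G f" "edge_cont G g"
  shows "2 * ip G f g \<le> ip G f f + ip G g g"
  using ip_square_nonneg[of G "lc 1 f (-1) g"] by (simp add: ip_lc_square assms)

text \<open>The triangle inequality for squared norms, through the intermediate function
  \<open>c * g\<close>.\<close>

lemma ip_sum_square_le:
  assumes "edge_cont G f" "edge_cont G g" "edge_cont G h"
  shows "ip G (lc a f b h) (lc a f b h) \<le>
    2 * ip G (lc a f c g) (lc a f c g) + 2 * ip G (lc (- c) g b h) (lc (- c) g b h)"
proof -
  let ?x = "lc a f c g" and ?y = "lc (- c) g b h"
  have "ip G (lc a f b h) (lc a f b h) = ip G (lc 1 ?x 1 ?y) (lc 1 ?x 1 ?y)"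
    by (rule ip_cong) (simp add: lc_def)
  also have "\<dots> = ip G ?x ?x + 2 * ip G ?x ?y + ip G ?y ?y"
    using assms by (subst ip_lc_square) auto
  finally show ?thesis
    using ip_young[OF edge_cont_lc[OF assms(1,2)] edge_cont_lc[OF assms(2,3)], of a c "- c" b] by linarith
qed

lemma ip_cauchy_schwarz:
  assumes f: "edge_cont G f" and g: "edge_cont G g"
  shows "(ip G f g)\<^sup>2 \<le> ip G f f * ip G g g"
proof (cases "ip G g g = 0")
  case True
  have *: "0 \<le> ip G f f + 2 * c * ip G f g" for c
    using ip_square_nonneg[of G "lc 1 f c g"] True by (simp add: ip_lc_square f g)
  have "ip G f g = 0"
  proof (rule ccontr)
    assume n: "ip G f g \<noteq> 0"
    have "0 \<le> ip G f f + 2 * (- (ip G f f + 1) / (2 * ip G f g)) * ip G f g" by (rule *)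
    also have "\<dots> = - 1" using n by (simp add: field_simps)
    finally show False by simp
  qed
  then show ?thesis using True by simp
next
  case False
  then have pos: "0 < ip G g g" using ip_square_nonneg[of G g] by linarith
  define c where "c = - ip G f g / ip G g g"
  have "0 \<le> ip G f f + 2 * c * ip G f g + c\<^sup>2 * ip G g g"
    using ip_square_nonneg[of G "lc 1 f c g"] by (simp add: ip_lc_square f g)
  also have "\<dots> = ip G f f - (ip G f g)\<^sup>2 / ip G g g"
    using pos by (simp add: c_def power2_eq_square field_simps)
  finally show ?thesis using pos by (simp add: field_simps)
qed

section \<open>Vertices, connectedness and Green's formula\<close>

locale mgraph =
  fixes G :: "'e metric_graph"
  assumes cmg: "compact_metric_graph G"
begin

lemma fin_edges [simp]: "finite (edges G)" and edges_ne: "edges G \<noteq> {}"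
  and len_pos: "e \<in> edges G \<Longrightarrow> 0 < len G e"
  and part: "partition_on (edges G \<times> UNIV) (verts G)"
  using cmg by (auto simp: compact_metric_graph_def)

lemma vert_sub: "v \<in> verts G \<Longrightarrow> v \<subseteq> edges G \<times> UNIV"
  and vert_ne: "v \<in> verts G \<Longrightarrow> v \<noteq> {}"
  and vert_unique: "v \<in> verts G \<Longrightarrow> w \<in> verts G \<Longrightarrow> p \<in> v \<Longrightarrow> p \<in> w \<Longrightarrow> v = w"
  using part unfolding partition_on_def disjoint_def by blast+

lemma fin_vert: "v \<in> verts G \<Longrightarrow> finite v"
  by (rule finite_subset[OF vert_sub]) auto

lemma fin_verts: "finite (verts G)"
  by (rule finite_elements[OF _ part]) simp

lemma vert_ex: "p \<in> edges G \<times> UNIV \<Longrightarrow> \<exists>v\<in>verts G. p \<in> v"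
  using part unfolding partition_on_def by blast

lemma vertex_of_eq: "v \<in> verts G \<Longrightarrow> p \<in> v \<Longrightarrow> vertex_of G p = v"
  unfolding vertex_of_def by (rule the_equality) (use vert_unique in blast)+

lemma vertex_of_in:
  assumes "p \<in> edges G \<times> UNIV"
  shows "vertex_of G p \<in> verts G" "p \<in> vertex_of G p"
proof -
  obtain v where "v \<in> verts G" "p \<in> v" using vert_ex[OF assms] by auto
  with vertex_of_eq[OF this] show "vertex_of G p \<in> verts G" "p \<in> vertex_of G p" by simp_all
qed

lemma sum_endpoints:
  fixes F :: "'e \<times> bool \<Rightarrow> real"
  shows "(\<Sum>e\<in>edges G. F (e, False) + F (e, True)) = (\<Sum>v\<in>verts G. \<Sum>p\<in>v. F p)"
proof -
  have "(\<Sum>v\<in>verts G. \<Sum>p\<in>v. F p) = sum F (\<Union>(verts G))"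
    using part fin_vert by (subst sum.Union_disjoint) (auto simp: partition_on_def disjoint_def)
  also have "\<Union>(verts G) = edges G \<times> UNIV" using part by (simp add: partition_on_def)
  also have "sum F (edges G \<times> UNIV) = (\<Sum>e\<in>edges G. \<Sum>b\<in>UNIV. F (e, b))"
    by (subst sum.cartesian_product) auto
  finally show ?thesis by (simp add: UNIV_bool)
qed

text \<open>The form in which connectedness is used from here on. A walk that starts in an edge set
  containing all or no endpoints of each vertex can never leave it.\<close>

lemma connected_edges:
  assumes Y: "Y \<subseteq> edges G" "Y \<noteq> {}"
    and sat: "\<And>v. v \<in> verts G \<Longrightarrow> v \<subseteq> Y \<times> UNIV \<or> v \<inter> Y \<times> UNIV = {}"
  shows "Y = edges G"
proof -
  obtain e where e: "e \<in> Y" using Y by auto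
  have sat': "p' \<in> Y \<times> UNIV"
    if "p \<in> Y \<times> UNIV" "p' \<in> edges G \<times> UNIV" "vertex_of G p = vertex_of G p'" for p p'
  proof -
    have "p \<in> vertex_of G p" "p' \<in> vertex_of G p" "vertex_of G p \<in> verts G"
      using vertex_of_in[of p] vertex_of_in[of p'] that Y by auto
    then show ?thesis using sat[of "vertex_of G p"] that by blast
  qed
  have walk_in: "set ps \<subseteq> Y \<times> UNIV" if "walk G ps" "hd ps \<in> Y \<times> UNIV" for ps
    using that
  proof (induction ps)
    case (Cons p ps)
    show ?case
    proof (cases ps)
      case (Cons p' ps')
      have w: "walk G ps" using Cons.prems Cons by (auto simp: walk_def)
      have "vertex_of G (opp p) = vertex_of G p'" "p' \<in> edges G \<times> UNIV"
        using Cons.prems Cons by (auto simp: walk_def)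
      moreover have "opp p \<in> Y \<times> UNIV" using Cons.prems by (auto simp: opp_def)
      ultimately have "p' \<in> Y \<times> UNIV" using sat'[of "opp p" p'] by simp
      then show ?thesis using Cons.IH[OF w] Cons Cons.prems by auto
    qed (use Cons in auto)
  qed (auto simp: walk_def)
  have "e' \<in> Y" if e': "e' \<in> edges G" for e'
  proof -
    define v w where "v = vertex_of G (e, False)" and "w = vertex_of G (e', False)"
    have vw: "v \<in> verts G" "w \<in> verts G"
      using vertex_of_in(1)[of "(e, False)"] vertex_of_in(1)[of "(e', False)"] e e' Y
      by (auto simp: v_def w_def)
    show ?thesis
    proof (cases "v = w")
      case True
      then show ?thesis using sat'[of "(e, False)" "(e', False)"] e e' by (auto simp: v_def w_def)
    next
      case False
      then obtain ps where ps: "walk G ps" "walk_start G ps = v" "walk_end G ps = w"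
        using cmg vw unfolding compact_metric_graph_def by metis
      have ne: "ps \<noteq> []" "set ps \<subseteq> edges G \<times> UNIV" using ps by (auto simp: walk_def)
      have "hd ps \<in> Y \<times> UNIV"
        using sat'[of "(e, False)" "hd ps"] ps e subsetD[OF ne(2) hd_in_set[OF ne(1)]]
        by (auto simp: v_def walk_start_def)
      from walk_in[OF ps(1) this] have "last ps \<in> Y \<times> UNIV" using ne last_in_set by blast
      then have "opp (last ps) \<in> Y \<times> UNIV" by (auto simp: opp_def)
      from sat'[OF this, of "(e', False)"] show ?thesis using ps e' by (auto simp: w_def walk_end_def)
    qed
  qed
  then show ?thesis using Y by auto
qed

lemma ip_zeroD:
  assumes f: "edge_cont G f" and z: "ip G f f = 0" and e: "e \<in> edges G" and x: "x \<in> {0..len G e}"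
  shows "f e x = 0"
proof -
  have nn: "0 \<le> integral {0..len G e} (\<lambda>x. f e x * f e x)" for e
    by (rule integral_nonneg_total) simp
  have i0: "integral {0..len G e} (\<lambda>x. f e x * f e x) = 0"
    using z e nn by (simp add: ip_def sum_nonneg_eq_0_iff)
  have "(\<lambda>x. f e x * f e x) x = 0" 
  proof (rule integral_eq_0_iff[of 0 "len G e" "\<lambda>x. f e x * f e x", THEN iffD1, rule_format])
  qed (use f e x i0 len_pos[OF e] in \<open>auto simp: edge_cont_def intro!: continuous_intros\<close>)
  then show ?thesis by simp
qed

text \<open>The boundary terms of the edges are regrouped by vertices. At a vertex \<open>f\<close>
  has a single value, which factors out, and Kirchhoff's condition annihilates the remaining
  sum.\<close>

lemma green:
  assumes u: "kdom G u u' u''" and f: "test_fun G f g"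
  shows "ip G u' g = - ip G u'' f"
proof -
  have i: "integral {0..len G e} (\<lambda>x. u' e x * g e x) + integral {0..len G e} (\<lambda>x. u'' e x * f e x) =
     - (normal_deriv G u' (e, False) * f e 0 + normal_deriv G u' (e, True) * f e (len G e))"
    if e: "e \<in> edges G" for e
  proof -
    have C: "C2_on (len G e) (u e) (u' e) (u'' e)" and P: "pw_diff (len G e) (f e) (g e)"
      using u f e by (auto simp: kdom_def test_fun_def)
    have "0 \<le> len G e" using len_pos[OF e] by simp
    note gr = C2_on_green[OF this C P]
    have "(\<lambda>x. u'' e x * f e x) integrable_on {0..len G e}"
      by (rule edge_cont_integrable[OF kdom_edge_cont(3)[OF u] test_fun_edge_cont[OF f] e])
    then have "integral {0..len G e} (\<lambda>x. u' e x * g e x) + integral {0..len G e} (\<lambda>x. u'' e x * f e x) =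
      integral {0..len G e} (\<lambda>x. u' e x * g e x + u'' e x * f e x)"
      using gr(2) by (intro integral_add[symmetric])
    also have "\<dots> = u' e (len G e) * f e (len G e) - u' e 0 * f e 0"
      using gr(1) by (rule integral_unique)
    finally show ?thesis by (simp add: normal_deriv_def coord_def)
  qed
  define F where "F p = normal_deriv G u' p * f (fst p) (coord G p)" for p
  have "ip G u' g + ip G u'' f = - (\<Sum>e\<in>edges G. F (e, False) + F (e, True))"
    unfolding ip_def sum.distrib[symmetric] sum_negf[symmetric]
    by (rule sum.cong) (auto simp: i F_def coord_def)
  also have "(\<Sum>e\<in>edges G. F (e, False) + F (e, True)) = (\<Sum>v\<in>verts G. \<Sum>p\<in>v. F p)"
    by (rule sum_endpoints)
  also have "\<dots> = 0"
  proof (rule sum.neutral, rule ballI)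
    fix v assume v: "v \<in> verts G"
    obtain p0 where p0: "p0 \<in> v" using vert_ne[OF v] by auto
    have "(\<Sum>p\<in>v. F p) = (\<Sum>p\<in>v. normal_deriv G u' p * f (fst p0) (coord G p0))"
    proof (rule sum.cong)
      fix p assume "p \<in> v"
      then have "f (fst p) (coord G p) = f (fst p0) (coord G p0)"
        using f v p0 unfolding test_fun_def agrees_at_vertices_def by blast
      then show "F p = normal_deriv G u' p * f (fst p0) (coord G p0)" by (simp add: F_def)
    qed auto
    also have "\<dots> = 0" using u v by (simp add: kdom_def sum_distrib_right[symmetric])
    finally show "(\<Sum>p\<in>v. F p) = 0" .
  qed
  finally show ?thesis by simp
qed

lemma edge_integrable_test:
  assumes u: "kdom G u u' u''" and f: "test_fun G f g" and e: "e \<in> edges G"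
  shows "(\<lambda>x. u' e x * g e x) integrable_on {0..len G e}"
  using C2_on_green(2)[of "len G e" "u e" "u' e" "u'' e" "f e" "g e"] len_pos[OF e] u f e
  by (auto simp: kdom_def test_fun_def)

text \<open>The integral of (g - c u')^2, expanded by hand: \<open>g\<close> is only square
  integrable, whereas the bilinearity rules for \<open>ip\<close> ask for continuity along the
  edges.\<close>

lemma energy_square_nonneg:
  assumes u: "kdom G u u' u''" and f: "test_fun G f g"
  shows "0 \<le> ip G g g - 2 * c * ip G u' g + c\<^sup>2 * ip G u' u'"
proof -
  have "0 \<le> integral {0..len G e} (\<lambda>x. g e x * g e x) - 2 * c * integral {0..len G e} (\<lambda>x. u' e x * g e x)
      + c\<^sup>2 * integral {0..len G e} (\<lambda>x. u' e x * u' e x)" if e: "e \<in> edges G" for e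
  proof -
    have 1: "(\<lambda>x. g e x * g e x) integrable_on {0..len G e}"
      using f e by (auto simp: test_fun_def pw_diff_def power2_eq_square)
    note 2 = edge_integrable_test[OF u f e]
    have 3: "(\<lambda>x. u' e x * u' e x) integrable_on {0..len G e}"
      by (rule edge_cont_integrable[OF kdom_edge_cont(2)[OF u] kdom_edge_cont(2)[OF u] e])
    have "((\<lambda>x. g e x * g e x - (2 * c) * (u' e x * g e x) + c\<^sup>2 * (u' e x * u' e x)) has_integral
      (integral {0..len G e} (\<lambda>x. g e x * g e x) - (2 * c) * integral {0..len G e} (\<lambda>x. u' e x * g e x)
      + c\<^sup>2 * integral {0..len G e} (\<lambda>x. u' e x * u' e x))) {0..len G e}"
      by (intro has_integral_add has_integral_diff has_integral_mult_right integrable_integral 1 2 3)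
    moreover have "0 \<le> g e x * g e x - (2 * c) * (u' e x * g e x) + c\<^sup>2 * (u' e x * u' e x)" for x
      using zero_le_power2[of "g e x - c * u' e x"] by (simp add: power2_eq_square algebra_simps)
    ultimately show ?thesis by (rule has_integral_nonneg)
  qed
  then have "0 \<le> (\<Sum>e\<in>edges G. integral {0..len G e} (\<lambda>x. g e x * g e x) - 2 * c * integral {0..len G e} (\<lambda>x. u' e x * g e x)
      + c\<^sup>2 * integral {0..len G e} (\<lambda>x. u' e x * u' e x))" by (intro sum_nonneg)
  also have "\<dots> = ip G g g - 2 * c * ip G u' g + c\<^sup>2 * ip G u' u'"
    by (simp add: ip_def sum.distrib sum_subtractf sum_distrib_left)
  finally show ?thesis .
qed

end

section \<open>Solvability of the shifted equation\<close>

locale pgraph = mgraph G for G :: "'e metric_graph" +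
  fixes q :: "'e \<Rightarrow> real \<Rightarrow> real"
  assumes qc: "edge_cont G q" and qnn: "e \<in> edges G \<Longrightarrow> x \<in> {0..len G e} \<Longrightarrow> 0 \<le> q e x"
begin

abbreviation (input) q1 :: "('e \<Rightarrow> real \<Rightarrow> real) \<Rightarrow> 'e \<Rightarrow> real \<Rightarrow> real" where
  "q1 u \<equiv> (\<lambda>e x. (q e x + 1) * u e x)"

lemma q1c: "edge_cont G u \<Longrightarrow> edge_cont G (q1 u)"
  using qc unfolding edge_cont_def by (auto intro!: continuous_intros)

lemma q1_ge: "edge_cont G u \<Longrightarrow> ip G u u \<le> ip G (q1 u) u"
proof (rule ip_mono)
  fix e x assume "e \<in> edges G" "x \<in> {0..len G e}"
  then have "u e x * u e x * 1 \<le> u e x * u e x * (q e x + 1)"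
    using qnn[of e x] by (intro mult_left_mono) auto
  then show "u e x * u e x \<le> (q e x + 1) * u e x * u e x" by (simp add: mult_ac)
qed (auto intro: q1c)

lemma rsol_weak:
  assumes v: "rsol G q f v v'" and f: "edge_cont G f" and w: "test_fun G w w'"
  shows "ip G f w = ip G v' w' + ip G (q1 v) w"
proof -
  have k: "kdom G v v' (\<lambda>e x. (q e x + 1) * v e x - f e x)" using v by (simp add: rsol_def)
  have vc: "edge_cont G v" using kdom_edge_cont[OF k] by auto
  have eq: "(\<lambda>e x. (q e x + 1) * v e x - f e x) = lc 1 (q1 v) (-1) f" by (simp add: lc_def)
  show ?thesis using green[OF k w] unfolding eq
    using ip_lc_left[OF q1c[OF vc] f test_fun_edge_cont[OF w], of 1 "-1"] by simp
qed

lemma rsol_cont: "rsol G q f v v' \<Longrightarrow> edge_cont G v" "rsol G q f v v' \<Longrightarrow> edge_cont G v'"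
  "rsol G q f v v' \<Longrightarrow> test_fun G v v'"
  unfolding rsol_def by (auto dest: kdom_edge_cont kdom_test_fun)

text \<open>Test the equation with \<open>v\<close> itself: q + 1 >= 1 gives coercivity, and Young's
  inequality absorbs the right-hand side. The last estimate says that the resolvent is a nonnegative
  operator.\<close>

lemma rsol_bound:
  assumes v: "rsol G q f v v'" and f: "edge_cont G f"
  shows "ip G v' v' + ip G v v / 2 \<le> ip G f f / 2" "ip G v v \<le> ip G f f" "ip G v' v' \<le> ip G f f" "0 \<le> ip G v f"
proof -
  have c: "edge_cont G v" using rsol_cont(1)[OF v] .
  have "ip G f v = ip G v' v' + ip G (q1 v) v" by (rule rsol_weak[OF v f rsol_cont(3)[OF v]])
  moreover have "ip G v v \<le> ip G (q1 v) v" by (rule q1_ge[OF c])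
  moreover have "2 * ip G f v \<le> ip G f f + ip G v v" by (rule ip_young[OF f c])
  moreover note ip_square_nonneg[of G v] ip_square_nonneg[of G v'] ip_square_nonneg[of G f]
  ultimately show "ip G v' v' + ip G v v / 2 \<le> ip G f f / 2" "ip G v v \<le> ip G f f" "ip G v' v' \<le> ip G f f"
    "0 \<le> ip G v f"
    unfolding ip_commute[of G v f] by linarith+
qed

lemma rsol_sym:
  assumes v: "rsol G q f v v'" and f: "edge_cont G f" and w: "rsol G q g w w'" and g: "edge_cont G g"
  shows "ip G f w = ip G v g"
proof -
  have "ip G f w = ip G v' w' + ip G (q1 v) w" by (rule rsol_weak[OF v f rsol_cont(3)[OF w]])
  moreover have "ip G g v = ip G w' v' + ip G (q1 w) v" by (rule rsol_weak[OF w g rsol_cont(3)[OF v]])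
  moreover have "ip G (q1 v) w = ip G (q1 w) v" by (rule ip_cong) (simp add: mult_ac)
  ultimately show ?thesis by (simp add: ip_commute)
qed

text \<open>Fredholm alternative by counting. The coefficient \<tau> of the inhomogeneous solutions
  is treated as one more unknown, so the vertex conditions have a nontrivial solution. If \<tau>
  were zero, it would solve the homogeneous problem, which \<open>rsol_bound\<close> excludes; hence
  one may divide by \<tau>.\<close>

lemma rsol_exists:
  assumes f: "edge_cont G f"
  shows "\<exists>v v'. rsol G q f v v'"
proof -
  define Q where "Q e x = q e x + 1" for e x
  have Qc: "continuous_on {0..len G e} (Q e)" if "e \<in> edges G" for e
    unfolding Q_def using qc that by (auto simp: edge_cont_def intro!: continuous_intros)
  have ivp: "\<exists>w. fst w 0 = a \<and> snd w 0 = b \<and> C2_on (len G e) (fst w) (snd w) (\<lambda>x. Q e x * fst w x - F x)"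
    if e: "e \<in> edges G" and F: "continuous_on {0..len G e} F" for e a b F
    using linear_ivp_exists[OF less_imp_le[OF len_pos[OF e]] Qc[OF e] F, of a b] by auto
  have "\<forall>e\<in>edges G. \<exists>w. fst w 0 = 1 \<and> snd w 0 = 0 \<and> C2_on (len G e) (fst w) (snd w) (\<lambda>x. Q e x * fst w x - 0)"
    by (intro ballI) (rule ivp, auto)
  then obtain C where C: "\<And>e. e \<in> edges G \<Longrightarrow> fst (C e) 0 = 1 \<and> snd (C e) 0 = 0 \<and> C2_on (len G e) (fst (C e)) (snd (C e)) (\<lambda>x. Q e x * fst (C e) x - 0)"
    by metis
  have "\<forall>e\<in>edges G. \<exists>w. fst w 0 = 0 \<and> snd w 0 = 1 \<and> C2_on (len G e) (fst w) (snd w) (\<lambda>x. Q e x * fst w x - 0)"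
    by (intro ballI) (rule ivp, auto)
  then obtain S where S: "\<And>e. e \<in> edges G \<Longrightarrow> fst (S e) 0 = 0 \<and> snd (S e) 0 = 1 \<and> C2_on (len G e) (fst (S e)) (snd (S e)) (\<lambda>x. Q e x * fst (S e) x - 0)"
    by metis
  have "\<forall>e\<in>edges G. \<exists>w. fst w 0 = 0 \<and> snd w 0 = 0 \<and> C2_on (len G e) (fst w) (snd w) (\<lambda>x. Q e x * fst w x - f e x)"
    using f by (intro ballI) (rule ivp, auto simp: edge_cont_def)
  then obtain R where R: "\<And>e. e \<in> edges G \<Longrightarrow> fst (R e) 0 = 0 \<and> snd (R e) 0 = 0 \<and> C2_on (len G e) (fst (R e)) (snd (R e)) (\<lambda>x. Q e x * fst (R e) x - f e x)"
    by metis
  define P where "P = edges G \<times> (UNIV :: bool set)"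
  \<comment> \<open>Unknowns: two coefficients for every edge, indexed by its endpoints, and with
    index \<open>None\<close> one factor common to the inhomogeneous solutions of all edges.\<close>
  define I where "I = insert None (Some ` P)"
  have finP: "finite P" by (simp add: P_def)
  have finI: "finite I" using finP by (simp add: I_def)
  have cardI: "card P < card I"
    using finP by (simp add: I_def card_image)
  define U where "U x e t = x (Some (e, False)) * fst (C e) t + x (Some (e, True)) * fst (S e) t + x None * fst (R e) t"
    for x :: "('e \<times> bool) option \<Rightarrow> real" and e t
  define U' where "U' x e t = x (Some (e, False)) * snd (C e) t + x (Some (e, True)) * snd (S e) t + x None * snd (R e) t"
    for x :: "('e \<times> bool) option \<Rightarrow> real" and e t
  \<comment> \<open>Value and normal derivative at the endpoint \<open>p\<close> of the basis
    function with index \<open>i\<close>.\<close>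
  define vc where "vc p i = (case i of None \<Rightarrow> fst (R (fst p)) (coord G p)
     | Some r \<Rightarrow> if fst r = fst p then (if snd r then fst (S (fst p)) (coord G p) else fst (C (fst p)) (coord G p)) else 0)" for p i
  define nc where "nc p i = (if snd p then -1 else 1) * (case i of None \<Rightarrow> snd (R (fst p)) (coord G p)
     | Some r \<Rightarrow> if fst r = fst p then (if snd r then snd (S (fst p)) (coord G p) else snd (C (fst p)) (coord G p)) else 0)" for p i
  have sumI: "(\<Sum>i\<in>I. h i) = h None + (h (Some (e, False)) + h (Some (e, True)))"
    if e: "e \<in> edges G" and z: "\<And>r. r \<in> P \<Longrightarrow> fst r \<noteq> e \<Longrightarrow> h (Some r) = 0" for h :: "_ \<Rightarrow> real" and e
  proof -
    have "(\<Sum>i\<in>I. h i) = h None + (\<Sum>r\<in>P. h (Some r))"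
      using finP by (simp add: I_def sum.reindex)
    also have "(\<Sum>r\<in>P. h (Some r)) = (\<Sum>r\<in>{(e, False), (e, True)}. h (Some r))"
      using e z finP by (intro sum.mono_neutral_right) (auto simp: P_def)
    finally show ?thesis by simp
  qed
  have vsum: "(\<Sum>i\<in>I. vc p i * x i) = U x (fst p) (coord G p)" if "p \<in> P" for p x
    using that by (subst sumI[of "fst p"]) (auto simp: P_def vc_def U_def)
  have nsum: "(\<Sum>i\<in>I. nc p i * x i) = normal_deriv G (U' x) p" if "p \<in> P" for p x
    using that by (subst sumI[of "fst p"]) (auto simp: P_def nc_def U'_def normal_deriv_def)
  have "\<forall>v\<in>verts G. \<exists>p. p \<in> v" using vert_ne by blast
  then obtain r where r: "\<And>v. v \<in> verts G \<Longrightarrow> r v \<in> v" by metis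
  \<comment> \<open>One equation for each endpoint: at the representative \<open>r v\<close> of a
    vertex it is Kirchhoff's condition, at the other endpoints of the vertex it is equality of the
    value with that at \<open>r v\<close>.\<close>
  define a where "a j i = (if j = r (vertex_of G j) then (\<Sum>p\<in>vertex_of G j. nc p i)
     else vc j i - vc (r (vertex_of G j)) i)" for j i
  obtain x where x: "\<exists>i\<in>I. x i \<noteq> 0" "\<And>j. j \<in> P \<Longrightarrow> (\<Sum>i\<in>I. a j i * x i) = 0"
    using homogeneous_system[OF finP finI cardI, of a] by blast
  define \<tau> where "\<tau> = x None"
  have kd: "kdom G (U x) (U' x) (\<lambda>e t. Q e t * U x e t - \<tau> * f e t)"
    unfolding kdom_def
  proof (intro conjI ballI)
    fix e assume e: "e \<in> edges G"
    have "C2_on (len G e) (\<lambda>t. 1 * (x (Some (e, False)) * fst (C e) t + x (Some (e, True)) * fst (S e) t) + \<tau> * fst (R e) t)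
      (\<lambda>t. 1 * (x (Some (e, False)) * snd (C e) t + x (Some (e, True)) * snd (S e) t) + \<tau> * snd (R e) t)
      (\<lambda>t. 1 * (x (Some (e, False)) * (Q e t * fst (C e) t - 0) + x (Some (e, True)) * (Q e t * fst (S e) t - 0)) + \<tau> * (Q e t * fst (R e) t - f e t))"
      using C[OF e] S[OF e] R[OF e] by (intro C2_on_lin) auto
    moreover have "(\<lambda>t. 1 * (x (Some (e, False)) * fst (C e) t + x (Some (e, True)) * fst (S e) t) + \<tau> * fst (R e) t) = U x e"
      "(\<lambda>t. 1 * (x (Some (e, False)) * snd (C e) t + x (Some (e, True)) * snd (S e) t) + \<tau> * snd (R e) t) = U' x e"
      "(\<lambda>t. 1 * (x (Some (e, False)) * (Q e t * fst (C e) t - 0) + x (Some (e, True)) * (Q e t * fst (S e) t - 0)) + \<tau> * (Q e t * fst (R e) t - f e t))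
        = (\<lambda>t. Q e t * U x e t - \<tau> * f e t)"
      by (auto simp: U_def U'_def \<tau>_def algebra_simps)
    ultimately show "C2_on (len G e) (U x e) (U' x e) (\<lambda>t. Q e t * U x e t - \<tau> * f e t)" by simp
  next
    have val: "U x (fst p) (coord G p) = U x (fst (r v)) (coord G (r v))" if v: "v \<in> verts G" and p: "p \<in> v" for v p
    proof (cases "p = r v")
      case False
      have vo: "vertex_of G p = v" using vertex_of_eq[OF v p] .
      have pP: "p \<in> P" "r v \<in> P" using vert_sub[OF v] p r[OF v] by (auto simp: P_def)
      have "0 = (\<Sum>i\<in>I. a p i * x i)" using x(2)[OF pP(1)] by simp
      also have "\<dots> = (\<Sum>i\<in>I. vc p i * x i) - (\<Sum>i\<in>I. vc (r v) i * x i)"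
        using False by (simp add: a_def vo sum_subtractf left_diff_distrib)
      finally show ?thesis by (simp add: vsum pP)
    qed auto
    show "agrees_at_vertices G (U x)" unfolding agrees_at_vertices_def using val by metis
    fix v assume v: "v \<in> verts G"
    have vo: "vertex_of G (r v) = v" using vertex_of_eq[OF v r[OF v]] .
    have vP: "v \<subseteq> P" using vert_sub[OF v] by (simp add: P_def)
    have "0 = (\<Sum>i\<in>I. a (r v) i * x i)" using x(2)[OF subsetD[OF vP r[OF v]]] by simp
    also have "\<dots> = (\<Sum>i\<in>I. \<Sum>p\<in>v. nc p i * x i)" by (simp add: a_def vo sum_distrib_right)
    also have "\<dots> = (\<Sum>p\<in>v. \<Sum>i\<in>I. nc p i * x i)" by (rule sum.swap)
    also have "\<dots> = (\<Sum>p\<in>v. normal_deriv G (U' x) p)" using vP by (intro sum.cong) (auto simp: nsum)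
    finally show "(\<Sum>p\<in>v. normal_deriv G (U' x) p) = 0" by simp
  qed
  have "\<tau> \<noteq> 0"
  proof
    assume "\<tau> = 0"
    with kd have z: "rsol G q (\<lambda>_ _. 0) (U x) (U' x)" by (simp add: rsol_def Q_def)
    have zc: "edge_cont G (\<lambda>_ _. 0)" by (simp add: edge_cont_def)
    have "ip G (\<lambda>_ _. 0) (\<lambda>_ _. 0) = 0" by (simp add: ip_def)
    with rsol_bound[OF z zc] ip_square_nonneg[of G "U x"] ip_square_nonneg[of G "U' x"]
    have "ip G (U x) (U x) = 0" "ip G (U' x) (U' x) = 0" by linarith+
    then have uz: "U x e 0 = 0" "U' x e 0 = 0" if "e \<in> edges G" for e
      using ip_zeroD[OF rsol_cont(1)[OF z] _ that, of 0] ip_zeroD[OF rsol_cont(2)[OF z] _ that, of 0] len_pos[OF that] by auto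
    have "x (Some (e, b)) = 0" if "e \<in> edges G" for e b
      using uz[OF that] C[OF that] S[OF that] R[OF that] by (cases b) (auto simp: U_def U'_def)
    with \<open>\<tau> = 0\<close> x(1) show False by (auto simp: I_def P_def \<tau>_def)
  qed
  have "kdom G (lc (1 / \<tau>) (U x) 0 (U x)) (lc (1 / \<tau>) (U' x) 0 (U' x))
      (lc (1 / \<tau>) (\<lambda>e t. Q e t * U x e t - \<tau> * f e t) 0 (\<lambda>e t. Q e t * U x e t - \<tau> * f e t))"
    by (rule kdom_lc[OF kd kd])
  moreover have "lc (1 / \<tau>) (\<lambda>e t. Q e t * U x e t - \<tau> * f e t) 0 (\<lambda>e t. Q e t * U x e t - \<tau> * f e t) =
     (\<lambda>e t. (q e t + 1) * lc (1 / \<tau>) (U x) 0 (U x) e t - f e t)"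
    using \<open>\<tau> \<noteq> 0\<close> by (auto simp: lc_def Q_def fun_eq_iff field_simps)
  ultimately show ?thesis unfolding rsol_def by metis
qed

end

section \<open>Compactness and existence of eigenfunctions\<close>

lemma (in mgraph) ip_term_le:
  assumes "e \<in> edges G"
  shows "integral {0..len G e} (\<lambda>x. f e x * f e x) \<le> ip G f f"
  unfolding ip_def
  by (rule member_le_sum[OF assms, of "\<lambda>e. integral {0..len G e} (\<lambda>x. f e x * f e x)"])
    (auto intro: integral_nonneg_total)

text \<open>Rellich's theorem. Bounded energy gives equicontinuity by \<open>C2_on_hoelder\<close>,
  mass and energy together give a uniform bound, and uniform convergence on finitely many edges
  implies convergence in mean square.\<close>

lemma (in mgraph) compactness:
  assumes v: "\<And>n. kdom G (v n) (v' n) (v'' n)"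
    and B: "\<And>n. ip G (v' n) (v' n) \<le> C" "\<And>n. ip G (v n) (v n) \<le> C"
  shows "\<exists>g k. edge_cont G g \<and> strict_mono (k :: nat \<Rightarrow> nat) \<and>
    (\<lambda>n. ip G (lc 1 (v (k n)) (-1) g) (lc 1 (v (k n)) (-1) g)) \<longlonglongrightarrow> 0"
proof -
  obtain idx :: "'e \<Rightarrow> nat" where idx: "inj_on idx (edges G)"
    using finite_imp_inj_to_nat_seg[OF fin_edges] by blast
  define ed where "ed a = inv_into (edges G) idx (nat \<lfloor>a\<rfloor>)" for a :: real
  have ed: "ed (real (idx e)) = e" if "e \<in> edges G" for e
    using idx that by (simp add: ed_def)
  \<comment> \<open>The edges become disjoint vertical segments over distinct integers, so that one
    application of the Arzela-Ascoli theorem covers all of them.\<close>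
  define S where "S = (\<Union>e\<in>edges G. {real (idx e)} \<times> {0..len G e})"
  define F where "F n p = v n (ed (fst p)) (snd p)" for n and p :: "real \<times> real"
  have C0: "0 \<le> C" using B(1)[of 0] ip_square_nonneg[of G "v' 0"] by linarith
  have C2: "C2_on (len G e) (v n e) (v' n e) (v'' n e)" if "e \<in> edges G" for n e
    using v[of n] that by (simp add: kdom_def)
  have en: "integral {0..len G e} (\<lambda>t. (v' n e t)\<^sup>2) \<le> C" if "e \<in> edges G" for n e
    using ip_term_le[OF that, of "v' n"] B(1)[of n] by (simp add: power2_eq_square)
  have hoelder: "(v n e x - v n e y)\<^sup>2 \<le> C * \<bar>x - y\<bar>"
    if e: "e \<in> edges G" and xy: "x \<in> {0..len G e}" "y \<in> {0..len G e}" for n e x y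
  proof (cases "x \<le> y")
    case True
    then have "(v n e y - v n e x)\<^sup>2 \<le> C * (y - x)"
      by (intro C2_on_hoelder[OF C2[OF e, of n] _ _ _ en[OF e, of n]]) (use xy in simp_all)
    then show ?thesis using True by (simp add: power2_commute[of "v n e x"])
  next
    case False
    then have "(v n e x - v n e y)\<^sup>2 \<le> C * (x - y)"
      by (intro C2_on_hoelder[OF C2[OF e, of n] _ _ _ en[OF e, of n]]) (use xy in simp_all)
    then show ?thesis using False by simp
  qed
  \<comment> \<open>From (v x)^2 <= 2 (v y)^2 + 2 C l by averaging over y; summing over the edges
    gives a bound common to all of them.\<close>
  define M2 where "M2 = (\<Sum>e\<in>edges G. (2 * C + 2 * C * (len G e)\<^sup>2) / len G e)"
  have bound: "(v n e x)\<^sup>2 \<le> M2" if e: "e \<in> edges G" and x: "x \<in> {0..len G e}" for n e x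
  proof -
    let ?l = "len G e"
    have l: "0 < ?l" using len_pos[OF e] .
    have vc: "continuous_on {0..?l} (v n e)" using C2_onD(3)[OF C2[OF e]] .
    have iv: "(\<lambda>y. v n e y * v n e y) integrable_on {0..?l}"
      by (intro integrable_continuous_real continuous_intros vc)
    have "integral {0..?l} (\<lambda>y. (v n e x)\<^sup>2) \<le> integral {0..?l} (\<lambda>y. 2 * (v n e y * v n e y) + 2 * (C * ?l))"
    proof (rule integral_le)
      fix y assume y: "y \<in> {0..?l}"
      have "(v n e x)\<^sup>2 \<le> 2 * (v n e y)\<^sup>2 + 2 * (v n e x - v n e y)\<^sup>2"
        using zero_le_power2[of "v n e x - 2 * v n e y"] by (simp add: power2_eq_square algebra_simps)
      also have "(v n e x - v n e y)\<^sup>2 \<le> C * \<bar>x - y\<bar>" by (rule hoelder[OF e x y])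
      also have "C * \<bar>x - y\<bar> \<le> C * ?l" using C0 x y by (intro mult_left_mono) auto
      finally show "(v n e x)\<^sup>2 \<le> 2 * (v n e y * v n e y) + 2 * (C * ?l)" by (simp add: power2_eq_square)
    next
      show "(\<lambda>y. 2 * (v n e y * v n e y) + 2 * (C * ?l)) integrable_on {0..?l}"
        by (intro integrable_continuous_real continuous_intros vc)
    qed (intro integrable_continuous_real continuous_intros)
    also have "\<dots> = 2 * integral {0..?l} (\<lambda>y. v n e y * v n e y) + 2 * (C * ?l) * ?l"
      using iv l by (subst integral_add) (auto intro!: integrable_on_mult_right)
    also have "\<dots> \<le> 2 * C + 2 * (C * ?l) * ?l"
      using ip_term_le[OF e, of "v n"] B(2)[of n] by simp
    finally have "?l * (v n e x)\<^sup>2 \<le> 2 * C + 2 * C * ?l\<^sup>2" using l by (simp add: power2_eq_square mult_ac)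
    then have "(v n e x)\<^sup>2 \<le> (2 * C + 2 * C * ?l\<^sup>2) / ?l" using l by (simp add: field_simps)
    also have "\<dots> \<le> M2" unfolding M2_def
      using C0 len_pos by (intro member_le_sum[OF e, of "\<lambda>e. (2 * C + 2 * C * (len G e)\<^sup>2) / len G e"])
        (auto intro!: divide_nonneg_nonneg simp: less_imp_le)
    finally show ?thesis .
  qed
  have cS: "compact S" unfolding S_def by (intro compact_UN compact_Times) auto
  have SD: "ed (fst p) \<in> edges G \<and> fst p = real (idx (ed (fst p))) \<and> snd p \<in> {0..len G (ed (fst p))}" if "p \<in> S" for p
    using that ed by (auto simp: S_def)
  have bd: "norm (F n p) \<le> sqrt M2" if "p \<in> S" for n p
    using bound[of "ed (fst p)" "snd p" n] SD[OF that]
    by (simp add: F_def real_le_rsqrt)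
  have eqc: "\<exists>d>0. \<forall>n y. y \<in> S \<and> norm (p - y) < d \<longrightarrow> norm (F n p - F n y) < \<epsilon>"
    if p: "p \<in> S" and \<epsilon>: "0 < \<epsilon>" for p \<epsilon>
  proof (intro exI conjI allI impI)
    \<comment> \<open>Points of \<open>S\<close> at distance below 1 / 2 have integer abscissas
      closer than 1 and therefore lie on the same edge.\<close>
    let ?d = "min (1/2) (\<epsilon>\<^sup>2 / (C + 1))"
    show "0 < ?d" using C0 \<epsilon> by simp
    fix n y assume y: "y \<in> S \<and> norm (p - y) < ?d"
    have n1: "\<bar>fst p - fst y\<bar> \<le> norm (p - y)" and n2: "\<bar>snd p - snd y\<bar> \<le> norm (p - y)"
      using norm_fst_le[of "fst p - fst y" "snd p - snd y"] norm_snd_le[of "snd p - snd y" "fst p - fst y"]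
      by (simp_all add: minus_prod_def)
    have "\<bar>real (idx (ed (fst p))) - real (idx (ed (fst y)))\<bar> < 1"
      using n1 y SD[OF p] SD[of y] by auto
    then have "idx (ed (fst p)) = idx (ed (fst y))" by linarith
    then have e: "ed (fst p) = ed (fst y)" using idx SD[OF p] SD[of y] y by (auto dest: inj_onD)
    have "(F n p - F n y)\<^sup>2 \<le> C * \<bar>snd p - snd y\<bar>"
      unfolding F_def e using SD[OF p] SD[of y] y e by (intro hoelder) auto
    also have "\<dots> \<le> (C + 1) * \<bar>snd p - snd y\<bar>" by (intro mult_right_mono) auto
    also have "\<dots> < (C + 1) * (\<epsilon>\<^sup>2 / (C + 1))" using n2 y C0 by (intro mult_strict_left_mono) auto
    also have "\<dots> = \<epsilon>\<^sup>2" using C0 by simp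
    finally have "\<bar>F n p - F n y\<bar>\<^sup>2 < \<epsilon>\<^sup>2" by simp
    then show "norm (F n p - F n y) < \<epsilon>" using \<epsilon> power_less_imp_less_base[of "\<bar>F n p - F n y\<bar>" 2 \<epsilon>] by simp
  qed
  obtain g0 k where g0: "continuous_on S g0" and k: "strict_mono (k :: nat \<Rightarrow> nat)"
    and lim: "\<And>\<epsilon>. 0 < \<epsilon> \<Longrightarrow> \<exists>N. \<forall>n x. n \<ge> N \<and> x \<in> S \<longrightarrow> norm (F (k n) x - g0 x) < \<epsilon>"
    using Arzela_Ascoli[of S F "sqrt M2", OF cS bd eqc] by blast
  define g where "g e x = g0 (real (idx e), x)" for e x
  have gc: "edge_cont G g" unfolding edge_cont_def g_def
  proof
    fix e assume e: "e \<in> edges G"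
    show "continuous_on {0..len G e} (\<lambda>x. g0 (real (idx e), x))"
      by (rule continuous_on_compose2[OF g0]) (use e in \<open>auto simp: S_def intro!: continuous_intros\<close>)
  qed
  have "(\<lambda>n. ip G (lc 1 (v (k n)) (-1) g) (lc 1 (v (k n)) (-1) g)) \<longlonglongrightarrow> 0"
  proof (rule LIMSEQ_I)
    fix r :: real assume r: "0 < r"
    define L where "L = (\<Sum>e\<in>edges G. len G e)"
    have L: "0 \<le> L" unfolding L_def using len_pos by (intro sum_nonneg) (simp add: less_imp_le)
    define \<delta> where "\<delta> = sqrt (r / (L + 1))"
    have \<delta>: "0 < \<delta>" "\<delta>\<^sup>2 = r / (L + 1)" using r L by (auto simp: \<delta>_def)
    obtain N where N: "\<And>n x. n \<ge> N \<Longrightarrow> x \<in> S \<Longrightarrow> \<bar>F (k n) x - g0 x\<bar> < \<delta>" using lim[OF \<delta>(1)] by auto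
    have "norm (ip G (lc 1 (v (k n)) (-1) g) (lc 1 (v (k n)) (-1) g) - 0) < r" if n: "n \<ge> N" for n
    proof -
      let ?h = "lc 1 (v (k n)) (-1) g"
      have hc: "edge_cont G ?h" using kdom_edge_cont(1)[OF v] gc by (rule edge_cont_lc)
      have "ip G ?h ?h \<le> (\<Sum>e\<in>edges G. \<delta>\<^sup>2 * len G e)"
        unfolding ip_def
      proof (rule sum_mono)
        fix e assume e: "e \<in> edges G"
        have "integral {0..len G e} (\<lambda>x. ?h e x * ?h e x) \<le> integral {0..len G e} (\<lambda>x. \<delta>\<^sup>2)"
        proof (rule integral_le)
          fix x assume x: "x \<in> {0..len G e}"
          have "(real (idx e), x) \<in> S" using e x by (auto simp: S_def)
          from N[OF n this] have "\<bar>?h e x\<bar> \<le> \<delta>" by (simp add: F_def ed[OF e] g_def lc_def)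
          then have "\<bar>?h e x\<bar>\<^sup>2 \<le> \<delta>\<^sup>2" by (intro power_mono) auto
          then show "?h e x * ?h e x \<le> \<delta>\<^sup>2" by (simp add: power2_eq_square)
        qed (auto intro!: edge_cont_integrable[OF hc hc e])
        then show "integral {0..len G e} (\<lambda>x. ?h e x * ?h e x) \<le> \<delta>\<^sup>2 * len G e"
          using len_pos[OF e] by (simp add: mult.commute)
      qed
      also have "\<dots> = \<delta>\<^sup>2 * L" by (simp only: L_def sum_distrib_left)
      also have "\<dots> = r * (L / (L + 1))" by (simp add: \<delta>)
      also have "\<dots> < r * 1" using r L by (intro mult_strict_left_mono) auto
      finally show ?thesis using ip_square_nonneg[of G ?h] by simp
    qed
    then show "\<exists>N. \<forall>n\<ge>N. norm (ip G (lc 1 (v (k n)) (-1) g) (lc 1 (v (k n)) (-1) g) - 0) < r" by blast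
  qed
  with gc k show ?thesis by blast
qed

lemma lc_simps: "lc a u 0 v = lc a u 0 u" "lc 1 u 0 v = u" "lc 0 u b v = lc b v 0 v"
  by (auto simp: lc_def)

lemma ip_scale: "ip G (lc a f 0 f) g = a * ip G f g"
proof -
  have "ip G (lc a f 0 f) g = (\<Sum>e\<in>edges G. a * integral {0..len G e} (\<lambda>x. f e x * g e x))"
    unfolding ip_def lc_def by (intro sum.cong refl) (simp add: mult.assoc)
  then show ?thesis by (simp add: ip_def sum_distrib_left)
qed

lemma ip_scale_right: "ip G g (lc a f 0 f) = a * ip G g f"
  using ip_scale[of G a f g] by (simp add: ip_commute)

lemma ip_lc_minus_commute: "ip G (lc 1 f (-1) g) (lc 1 f (-1) g) = ip G (lc 1 g (-1) f) (lc 1 g (-1) f)"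
  by (rule ip_cong) (simp add: lc_def algebra_simps)

lemma esol_rsol: "esol G q \<mu> u u' \<Longrightarrow> rsol G q (lc (\<mu> + 1) u 0 u) u u'"
  unfolding esol_def rsol_def
  by (erule kdom_cong) (simp add: lc_def algebra_simps)

lemma rsol_esol:
  assumes "rsol G q f u u'"
    and "\<And>e x. e \<in> edges G \<Longrightarrow> x \<in> {0..len G e} \<Longrightarrow> f e x = (\<mu> + 1) * u e x"
  shows "esol G q \<mu> u u'"
  using assms(1) unfolding esol_def rsol_def
  by (rule kdom_cong) (simp add: assms(2) algebra_simps)

lemma esol_scale:
  assumes "esol G q \<mu> u u'"
  shows "esol G q \<mu> (lc a u 0 u) (lc a u' 0 u')"
  unfolding esol_def
  by (rule kdom_cong[OF kdom_lc[OF assms[unfolded esol_def] assms[unfolded esol_def]]]) (simp add: lc_def)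

lemma esol_zero: "esol G q \<mu> (\<lambda>_ _. 0) (\<lambda>_ _. 0)"
  by (auto simp: esol_def kdom_def C2_on_def agrees_at_vertices_def normal_deriv_def intro!: sum.neutral)

lemma rsol_scale: "rsol G q f u u' \<Longrightarrow> rsol G q (lc a f 0 f) (lc a u 0 u) (lc a u' 0 u')"
  by (rule rsol_lc)

lemma esol_cont: "esol G q \<mu> u u' \<Longrightarrow> edge_cont G u" "esol G q \<mu> u u' \<Longrightarrow> edge_cont G u'"
  "esol G q \<mu> u u' \<Longrightarrow> test_fun G u u'"
  unfolding esol_def by (fact kdom_edge_cont(1) kdom_edge_cont(2) kdom_test_fun)+

section \<open>Variational construction of eigenfunctions\<close>

context pgraph
begin

lemma esol_weak:
  assumes u: "esol G q \<mu> u u'" and w: "test_fun G w w'"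
  shows "\<mu> * ip G u w = ip G u' w' + ip G (\<lambda>e x. q e x * u e x) w"
proof -
  have uc: "edge_cont G u" using esol_cont(1)[OF u] .
  have wc: "edge_cont G w" using test_fun_edge_cont[OF w] .
  have qu: "edge_cont G (\<lambda>e x. q e x * u e x)" using qc uc by (rule edge_cont_mult)
  have "ip G (lc (\<mu> + 1) u 0 u) w = ip G u' w' + ip G (q1 u) w"
    by (rule rsol_weak[OF esol_rsol[OF u] _ w]) (intro edge_cont_lc uc)
  moreover have "ip G (q1 u) w = ip G (lc 1 (\<lambda>e x. q e x * u e x) 1 u) w"
    by (rule ip_cong) (simp add: lc_def algebra_simps)
  ultimately show ?thesis by (simp add: ip_scale ip_lc_left[OF qu uc wc] algebra_simps)
qed

lemma esol_energy:
  assumes u: "esol G q \<mu> u u'"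
  shows "\<mu> * ip G u u = ip G u' u' + ip G (\<lambda>e x. q e x * u e x) u"
  by (rule esol_weak[OF u esol_cont(3)[OF u]])

lemma q_energy_nonneg: "0 \<le> ip G (\<lambda>e x. q e x * u e x) u"
proof (rule ip_nonneg)
  fix e x assume "e \<in> edges G" "x \<in> {0..len G e}"
  then have "0 \<le> q e x" by (rule qnn)
  then have "0 \<le> q e x * (u e x * u e x)" by simp
  then show "0 \<le> q e x * u e x * u e x" by (simp add: mult.assoc)
qed

lemma esol_nonneg:
  assumes u: "esol G q \<mu> u u'" and pos: "0 < ip G u u"
  shows "0 \<le> \<mu>"
proof -
  have "0 \<le> \<mu> * ip G u u"
    unfolding esol_energy[OF u] using q_energy_nonneg[of u] ip_square_nonneg[of G u'] by simp
  then show ?thesis using pos by (simp add: zero_le_mult_iff)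
qed

lemma esol_orthogonal:
  assumes u: "esol G q \<mu> u u'" and w: "esol G q \<nu> w w'" and ne: "\<mu> \<noteq> \<nu>"
  shows "ip G u w = 0"
proof -
  have "\<mu> * ip G u w = ip G u' w' + ip G (\<lambda>e x. q e x * u e x) w"
    by (rule esol_weak[OF u esol_cont(3)[OF w]])
  moreover have "\<nu> * ip G w u = ip G w' u' + ip G (\<lambda>e x. q e x * w e x) u"
    by (rule esol_weak[OF w esol_cont(3)[OF u]])
  moreover have "ip G (\<lambda>e x. q e x * u e x) w = ip G (\<lambda>e x. q e x * w e x) u"
    by (rule ip_cong) (simp add: mult_ac)
  ultimately have "\<mu> * ip G u w = \<nu> * ip G u w" by (simp add: ip_commute)
  then show ?thesis using ne by simp
qed

text \<open>A maximising sequence for the quadratic form of the resolvent, restricted to the orthogonal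
  complement of a known eigenfunction, converges to an eigenfunction.\<close>

lemma eigenfunction_exists:
  assumes f: "test_fun G f g" and pos: "0 < ip G f f"
    and u1: "esol G q \<kappa> u1 u1'" and \<kappa>: "0 \<le> \<kappa>" and orth: "ip G f u1 = 0"
  shows "\<exists>\<mu> u u'. esol G q \<mu> u u' \<and> 0 < ip G u u \<and> ip G u u1 = 0 \<and>
    \<mu> * ip G f f \<le> ip G g g + ip G (\<lambda>e x. q e x * f e x) f"
proof -
  have fc: "edge_cont G f" using test_fun_edge_cont[OF f] .
  have u1c: "edge_cont G u1" using esol_cont(1)[OF u1] .
  \<comment> \<open>The resolvent is symmetric and maps (\<kappa> + 1) u1 to \<open>u1\<close>; as
    \<kappa> + 1 is nonzero, it preserves the orthogonal complement of \<open>u1\<close>.\<close>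
  have orth_res: "ip G v u1 = 0" if v: "rsol G q h v v'" and h: "edge_cont G h" and o: "ip G h u1 = 0" for h v v'
  proof -
    have "ip G h u1 = ip G v (lc (\<kappa> + 1) u1 0 u1)"
      by (rule rsol_sym[OF v h esol_rsol[OF u1]]) (intro edge_cont_lc u1c)
    then show ?thesis using o \<kappa> by (simp add: ip_scale_right)
  qed
  define R where "R = {ip G v h | h v v'. edge_cont G h \<and> ip G h u1 = 0 \<and> ip G h h = 1 \<and> rsol G q h v v'}"
  define M where "M = Sup R"
  have bdR: "bdd_above R"
  proof (rule bdd_aboveI)
    fix r assume "r \<in> R"
    then obtain h v v' where h: "edge_cont G h" "ip G h h = 1" "rsol G q h v v'" "r = ip G v h"
      by (auto simp: R_def)
    have "2 * ip G v h \<le> ip G v v + ip G h h" by (rule ip_young[OF rsol_cont(1)[OF h(3)] h(1)])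
    then show "r \<le> 1" using rsol_bound(2)[OF h(3,1)] h by simp
  qed
  have form_le: "ip G v h \<le> M * ip G h h" if v: "rsol G q h v v'" and h: "edge_cont G h" and o: "ip G h u1 = 0" for h v v'
  proof (cases "ip G h h = 0")
    case True
    have "(ip G v h)\<^sup>2 \<le> ip G v v * ip G h h" by (rule ip_cauchy_schwarz[OF rsol_cont(1)[OF v] h])
    then show ?thesis using True by simp
  next
    case False
    then have p: "0 < ip G h h" using ip_square_nonneg[of G h] by linarith
    define c where "c = 1 / sqrt (ip G h h)"
    have c: "c * c * ip G h h = 1" using p by (simp add: c_def)
    have "ip G (lc c v 0 v) (lc c h 0 h) \<in> R" unfolding R_def
    proof (intro CollectI exI conjI)
      show "rsol G q (lc c h 0 h) (lc c v 0 v) (lc c v' 0 v')" by (rule rsol_scale[OF v])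
      show "ip G (lc c h 0 h) (lc c h 0 h) = 1" using c by (simp add: ip_scale ip_scale_right mult.assoc)
    qed (auto simp: ip_scale o intro!: edge_cont_lc h)
    then have "ip G (lc c v 0 v) (lc c h 0 h) \<le> M" unfolding M_def using bdR by (rule cSup_upper)
    then have "c * c * ip G v h \<le> M" by (simp add: ip_scale ip_scale_right mult.assoc)
    then have "c * c * ip G v h * ip G h h \<le> M * ip G h h" using p by (intro mult_right_mono) auto
    then show ?thesis using c by (metis mult.assoc mult.commute mult.left_neutral)
  qed
  obtain v0 v0' where v0: "rsol G q f v0 v0'" using rsol_exists[OF fc] by blast
  have q1f: "edge_cont G (q1 v0)" by (rule q1c[OF rsol_cont(1)[OF v0]])
  define A where "A = ip G g g + ip G (\<lambda>e x. q e x * f e x) f"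
  \<comment> \<open>The shifted energy of f - c v0 is nonnegative. Since \<open>f\<close> lies only
    in the form domain, this expansion is what links its Rayleigh quotient to the resolvent form; c
    = 1 / M is inserted in \<open>lam_bound\<close>.\<close>
  have form0: "2 * c * ip G f f \<le> A + ip G f f + c\<^sup>2 * ip G v0 f" for c
  proof -
    let ?k = "lc 1 f (- c) v0"
    have k: "kdom G v0 v0' (\<lambda>e x. (q e x + 1) * v0 e x - f e x)" using v0 by (simp add: rsol_def)
    have 1: "0 \<le> ip G g g - 2 * c * ip G v0' g + c\<^sup>2 * ip G v0' v0'"
      by (rule energy_square_nonneg[OF k f])
    have vc: "edge_cont G v0" using rsol_cont(1)[OF v0] .
    have kc: "edge_cont G ?k" by (intro edge_cont_lc fc vc)
    define F1 V1 where "F1 = q1 f" and "V1 = q1 v0"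
    have FV: "edge_cont G F1" "edge_cont G V1" unfolding F1_def V1_def by (rule q1c[OF fc], rule q1c[OF vc])
    have "0 \<le> ip G (q1 ?k) ?k" using q1_ge[OF kc] ip_square_nonneg[of G ?k] by linarith
    also have "ip G (q1 ?k) ?k = ip G (lc 1 F1 (- c) V1) ?k"
      unfolding F1_def V1_def by (rule ip_cong) (simp add: lc_def algebra_simps)
    also have "\<dots> = ip G F1 f - c * ip G V1 f - c * ip G F1 v0 + c\<^sup>2 * ip G V1 v0"
      by (simp add: ip_lc_left[OF FV kc] ip_lc_right[OF fc vc FV(1)] ip_lc_right[OF fc vc FV(2)] power2_eq_square algebra_simps)
    also note F1_def
    also note V1_def
    also have "ip G (q1 f) v0 = ip G (q1 v0) f" by (rule ip_cong) (simp add: mult_ac)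
    also have "ip G (q1 f) f = ip G (lc 1 (\<lambda>e x. q e x * f e x) 1 f) f"
      by (rule ip_cong) (simp add: lc_def algebra_simps)
    also have "\<dots> = ip G (\<lambda>e x. q e x * f e x) f + ip G f f"
      by (subst ip_lc_left) (auto intro!: edge_cont_mult qc fc)
    finally have 2: "0 \<le> ip G (\<lambda>e x. q e x * f e x) f + ip G f f - 2 * c * ip G (q1 v0) f + c\<^sup>2 * ip G (q1 v0) v0"
      by simp
    have 3: "ip G f f = ip G v0' g + ip G (q1 v0) f" by (rule rsol_weak[OF v0 fc f])
    have 4: "ip G f v0 = ip G v0' v0' + ip G (q1 v0) v0" by (rule rsol_weak[OF v0 fc rsol_cont(3)[OF v0]])
    have "2 * c * ip G f f = 2 * c * ip G v0' g + 2 * c * ip G (q1 v0) f"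
      unfolding 3 by (simp add: algebra_simps)
    moreover have "c\<^sup>2 * ip G v0 f = c\<^sup>2 * ip G v0' v0' + c\<^sup>2 * ip G (q1 v0) v0"
      unfolding ip_commute[of G v0 f] 4 by (simp add: algebra_simps)
    ultimately show ?thesis using 1 2 unfolding A_def by linarith
  qed
  have v0_le: "ip G v0 f \<le> M * ip G f f" by (rule form_le[OF v0 fc orth])
  have Mpos: "0 < M"
  proof -
    \<comment> \<open>Otherwise \<open>form0\<close> would bound a linear function of c; the value
      of c inserted makes its left-hand side larger than the bound by one.\<close>
    have "ip G v0 f \<noteq> 0"
    proof
      assume z: "ip G v0 f = 0"
      have "2 * ((A + ip G f f + 1) / (2 * ip G f f)) * ip G f f \<le> A + ip G f f"
        using form0[of "(A + ip G f f + 1) / (2 * ip G f f)"] z by simp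
      then show False using pos by (simp add: field_simps)
    qed
    then have "0 < ip G v0 f" using rsol_bound(4)[OF v0 fc] by linarith
    then have "0 < M * ip G f f" using v0_le by linarith
    then show ?thesis using pos by (simp add: zero_less_mult_iff)
  qed
  have lam_bound: "(1 / M - 1) * ip G f f \<le> A"
  proof -
    have "2 * (1 / M) * ip G f f \<le> A + ip G f f + (1 / M)\<^sup>2 * ip G v0 f" by (rule form0)
    also have "(1 / M)\<^sup>2 * ip G v0 f \<le> (1 / M)\<^sup>2 * (M * ip G f f)" using v0_le by (intro mult_left_mono) auto
    also have "\<dots> = (1 / M) * ip G f f" using Mpos by (simp add: power2_eq_square)
    finally show ?thesis by (simp add: algebra_simps)
  qed
  \<comment> \<open>Nonnegativity of the resolvent applied to h - v / M. It sharpens the bound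
    \<open>M\<close> of the quadratic form to a bound of the squared norm of
    \<open>v\<close>.\<close>
  have norm_le: "ip G v v \<le> M * ip G v h" if v: "rsol G q h v v'" and h: "edge_cont G h" and o: "ip G h u1 = 0" for h v v'
  proof -
    have vc: "edge_cont G v" using rsol_cont(1)[OF v] .
    obtain z z' where z: "rsol G q v z z'" using rsol_exists[OF vc] by blast
    have zc: "edge_cont G z" using rsol_cont(1)[OF z] .
    have zv: "ip G z v \<le> M * ip G v v" by (rule form_le[OF z vc orth_res[OF v h o]])
    have "0 \<le> ip G (lc 1 v (- 1 / M) z) (lc 1 h (- 1 / M) v)"
      by (rule rsol_bound(4)[OF rsol_lc[OF v z]]) (intro edge_cont_lc h vc)
    also have "\<dots> = ip G v h - (ip G v v + ip G z h) / M + ip G z v / (M * M)"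
      by (simp add: ip_lc_left ip_lc_right h vc zc edge_cont_lc add_divide_distrib diff_divide_distrib)
    also have "ip G z h = ip G v v" using rsol_sym[OF v h z vc] by (simp add: ip_commute)
    finally have "0 \<le> ip G v h - 2 * ip G v v / M + ip G z v / (M * M)" by simp
    also have "ip G z v / (M * M) \<le> M * ip G v v / (M * M)" using zv Mpos by (intro divide_right_mono) auto
    finally have "0 \<le> ip G v h - ip G v v / M" using Mpos by simp
    then show ?thesis using Mpos by (simp add: field_simps)
  qed
  have "R \<noteq> {}"
  proof -
    define c where "c = 1 / sqrt (ip G f f)"
    have c: "c * c * ip G f f = 1" using pos by (simp add: c_def)
    have "ip G (lc c v0 0 v0) (lc c f 0 f) \<in> R" unfolding R_def
    proof (intro CollectI exI conjI)
      show "rsol G q (lc c f 0 f) (lc c v0 0 v0) (lc c v0' 0 v0')" by (rule rsol_scale[OF v0])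
      show "ip G (lc c f 0 f) (lc c f 0 f) = 1" using c by (simp add: ip_scale ip_scale_right mult.assoc)
    qed (auto simp: ip_scale orth intro!: edge_cont_lc fc)
    then show ?thesis by blast
  qed
  have "\<exists>h v v'. edge_cont G h \<and> ip G h u1 = 0 \<and> ip G h h = 1 \<and> rsol G q h v v' \<and> M - inverse (Suc n) < ip G v h" for n
  proof -
    have "M - inverse (Suc n) < Sup R" unfolding M_def by simp
    then obtain r where "r \<in> R" "M - inverse (Suc n) < r" using \<open>R \<noteq> {}\<close> less_cSupE by blast
    then show ?thesis unfolding R_def by blast
  qed
  then obtain h v v' where hv: "\<And>n. edge_cont G (h n)" "\<And>n. ip G (h n) u1 = 0" "\<And>n. ip G (h n) (h n) = 1"
     "\<And>n. rsol G q (h n) (v n) (v' n)" "\<And>n. M - inverse (Suc n) < ip G (v n) (h n)"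
    by metis
  have vc: "edge_cont G (v n)" for n using rsol_cont(1)[OF hv(4)] .
  have vk: "kdom G (v n) (v' n) (\<lambda>e x. (q e x + 1) * v n e x - h n e x)" for n using hv(4)[of n] by (simp add: rsol_def)
  have "ip G (v' n) (v' n) \<le> 1" "ip G (v n) (v n) \<le> 1" for n
    using rsol_bound(2,3)[OF hv(4,1)[of n]] hv(3)[of n] by auto
  from compactness[where v = v and v' = v' and C = 1
      and v'' = "\<lambda>n e x. (q e x + 1) * v n e x - h n e x", OF vk this] obtain gg k where gc: "edge_cont G gg" and k: "strict_mono (k :: nat \<Rightarrow> nat)"
    and lim: "(\<lambda>n. ip G (lc 1 (v (k n)) (-1) gg) (lc 1 (v (k n)) (-1) gg)) \<longlonglongrightarrow> 0"
    by (elim exE conjE) (rule that)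
  \<comment> \<open>Members of a maximising sequence are almost eigenvectors of the resolvent for
    \<open>M\<close>: by \<open>norm_le\<close> the squared norm of M h - v is at most M (M - <v,
    h>).\<close>
  have near: "ip G (lc M (h n) (-1) (v n)) (lc M (h n) (-1) (v n)) \<le> M * inverse (Suc n)" for n
  proof -
    have "ip G (lc M (h n) (-1) (v n)) (lc M (h n) (-1) (v n)) = M\<^sup>2 - 2 * M * ip G (v n) (h n) + ip G (v n) (v n)"
      by (simp add: ip_lc_square hv(1) vc hv(3) ip_commute[of G "h n"])
    also have "\<dots> \<le> M\<^sup>2 - 2 * M * ip G (v n) (h n) + M * ip G (v n) (h n)"
      using norm_le[OF hv(4,1,2)[of n]] by simp
    also have "\<dots> = M * (M - ip G (v n) (h n))" by (simp add: power2_eq_square algebra_simps)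
    also have "\<dots> \<le> M * inverse (Suc n)" using Mpos hv(5)[of n] by (intro mult_left_mono) auto
    finally show ?thesis .
  qed
  have lim2: "(\<lambda>n. ip G (lc M (h (k n)) (-1) (v (k n))) (lc M (h (k n)) (-1) (v (k n)))) \<longlonglongrightarrow> 0"
  proof (rule tendsto_sandwich[OF _ _ tendsto_const])
    show "(\<lambda>n. M * inverse (real (Suc n))) \<longlonglongrightarrow> 0"
      using tendsto_mult_left[OF LIMSEQ_inverse_real_of_nat, of M] by simp
    have "M * inverse (real (Suc (k n))) \<le> M * inverse (real (Suc n))" for n
      using seq_suble[OF k, of n] Mpos by (intro mult_left_mono) (auto simp: field_simps)
    then show "\<forall>\<^sub>F n in sequentially. ip G (lc M (h (k n)) (-1) (v (k n))) (lc M (h (k n)) (-1) (v (k n))) \<le> M * inverse (real (Suc n))"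
      using near order_trans by (intro always_eventually allI) blast
  qed (simp add: ip_square_nonneg)
  obtain t t' where t: "rsol G q gg t t'" using rsol_exists[OF gc] by blast
  have tc: "edge_cont G t" using rsol_cont(1)[OF t] .
  \<comment> \<open>M gg - t is split at M v: the first part is controlled by v - gg, the second is
    the resolvent of M h - gg, which has at most the norm of M h - gg, and that is again small
    through \<open>v n\<close>.\<close>
  have le1: "ip G (lc M gg (-1) t) (lc M gg (-1) t) \<le>
     4 * ip G (lc M (h n) (-1) (v n)) (lc M (h n) (-1) (v n)) + (4 + 2 * M\<^sup>2) * ip G (lc 1 (v n) (-1) gg) (lc 1 (v n) (-1) gg)" for n
  proof -
    have "ip G (lc M gg (-1) t) (lc M gg (-1) t) \<le>
      2 * ip G (lc M gg (- M) (v n)) (lc M gg (- M) (v n)) + 2 * ip G (lc (- (- M)) (v n) (-1) t) (lc (- (- M)) (v n) (-1) t)"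
      by (rule ip_sum_square_le[OF gc vc tc])
    also have "ip G (lc M gg (- M) (v n)) (lc M gg (- M) (v n)) = ip G (lc (- M) (lc 1 (v n) (-1) gg) 0 (lc 1 (v n) (-1) gg)) (lc (- M) (lc 1 (v n) (-1) gg) 0 (lc 1 (v n) (-1) gg))"
      by (rule ip_cong) (simp add: lc_def algebra_simps)
    also have "\<dots> = M\<^sup>2 * ip G (lc 1 (v n) (-1) gg) (lc 1 (v n) (-1) gg)"
      by (simp add: ip_scale ip_scale_right power2_eq_square)
    also have "ip G (lc (- (- M)) (v n) (-1) t) (lc (- (- M)) (v n) (-1) t) \<le> ip G (lc (- (- M)) (h n) (-1) gg) (lc (- (- M)) (h n) (-1) gg)"
      by (rule rsol_bound(2)[OF rsol_lc[OF hv(4) t]]) (intro edge_cont_lc hv(1) gc)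
    also have "\<dots> \<le> 2 * ip G (lc M (h n) (-1) (v n)) (lc M (h n) (-1) (v n)) + 2 * ip G (lc 1 (v n) (-1) gg) (lc 1 (v n) (-1) gg)"
      using ip_sum_square_le[OF hv(1)[of n] vc[of n] gc, of M "-1" "-1"] by simp
    finally show ?thesis by (simp add: algebra_simps)
  qed
  have "ip G (lc M gg (-1) t) (lc M gg (-1) t) \<le> 4 * 0 + (4 + 2 * M\<^sup>2) * 0"
  proof (rule LIMSEQ_le_const)
    show "(\<lambda>n. 4 * ip G (lc M (h (k n)) (-1) (v (k n))) (lc M (h (k n)) (-1) (v (k n))) + (4 + 2 * M\<^sup>2) * ip G (lc 1 (v (k n)) (-1) gg) (lc 1 (v (k n)) (-1) gg))
      \<longlonglongrightarrow> 4 * 0 + (4 + 2 * M\<^sup>2) * 0"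
      by (intro tendsto_intros lim lim2)
  qed (use le1 in blast)
  then have "ip G (lc M gg (-1) t) (lc M gg (-1) t) = 0" using ip_square_nonneg[of G "lc M gg (-1) t"] by simp
  then have tM: "t e x = M * gg e x" if "e \<in> edges G" "x \<in> {0..len G e}" for e x
    using ip_zeroD[OF edge_cont_lc[OF gc tc], of M "-1" e x] that by (simp add: lc_def)
  \<comment> \<open>An eigenvalue \<open>M\<close> of the resolvent of H + 1 belongs to the
    eigenvalue 1 / M - 1 of H.\<close>
  have es: "esol G q (1 / M - 1) t t'"
    by (rule rsol_esol[OF t]) (use tM Mpos in auto)
  have ipt: "ip G t t = M\<^sup>2 * ip G gg gg"
  proof -
    have "ip G t t = ip G (lc M gg 0 gg) (lc M gg 0 gg)"
      by (rule ip_cong) (use tM in \<open>auto simp: lc_def\<close>)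
    then show ?thesis by (simp add: ip_scale ip_scale_right power2_eq_square)
  qed
  \<comment> \<open>The limit is not zero, because \<open>gg\<close> is close to M h for unit
    vectors h and \<open>M\<close> is positive.\<close>
  have "ip G gg gg \<noteq> 0"
  proof
    assume z: "ip G gg gg = 0"
    have "M\<^sup>2 \<le> 2 * ip G (lc M (h n) (-1) (v n)) (lc M (h n) (-1) (v n)) + 2 * (2 * ip G (lc 1 (v n) (-1) gg) (lc 1 (v n) (-1) gg))" for n
    proof -
      have "M\<^sup>2 = ip G (lc M (h n) 0 gg) (lc M (h n) 0 gg)"
        unfolding lc_simps(1)[of M "h n" gg] by (simp add: ip_scale ip_scale_right hv(3) power2_eq_square)
      also have "\<dots> \<le> 2 * ip G (lc M (h n) (-1) (v n)) (lc M (h n) (-1) (v n)) + 2 * ip G (lc (- (-1)) (v n) 0 gg) (lc (- (-1)) (v n) 0 gg)"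
        by (rule ip_sum_square_le[OF hv(1) vc gc])
      also have "ip G (lc (- (-1)) (v n) 0 gg) (lc (- (-1)) (v n) 0 gg) \<le> 2 * ip G (lc (- (-1)) (v n) (-1) gg) (lc (- (-1)) (v n) (-1) gg) + 2 * ip G (lc (- (-1)) gg 0 gg) (lc (- (-1)) gg 0 gg)"
        by (rule ip_sum_square_le[OF vc gc gc])
      finally show ?thesis using z by (simp add: ip_scale ip_scale_right)
    qed
    then have "M\<^sup>2 \<le> 2 * 0 + 2 * (2 * 0)"
      by (intro LIMSEQ_le_const[where X = "\<lambda>n. 2 * ip G (lc M (h (k n)) (-1) (v (k n))) (lc M (h (k n)) (-1) (v (k n))) + 2 * (2 * ip G (lc 1 (v (k n)) (-1) gg) (lc 1 (v (k n)) (-1) gg))"]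
          tendsto_intros lim lim2) blast
    then show False using Mpos by simp
  qed
  then have "0 < ip G gg gg" using ip_square_nonneg[of G gg] by linarith
  then have p: "0 < ip G t t" unfolding ipt using Mpos by simp
  have "(ip G gg u1)\<^sup>2 \<le> 0"
  proof (rule LIMSEQ_le_const)
    show "(\<lambda>n. ip G (lc 1 (v (k n)) (-1) gg) (lc 1 (v (k n)) (-1) gg) * ip G u1 u1) \<longlonglongrightarrow> 0"
      using tendsto_mult_right[OF lim, of "ip G u1 u1"] by simp
    have "(ip G gg u1)\<^sup>2 \<le> ip G (lc 1 (v n) (-1) gg) (lc 1 (v n) (-1) gg) * ip G u1 u1" for n
    proof -
      have "ip G (lc 1 (v n) (-1) gg) u1 = - ip G gg u1"
        using orth_res[OF hv(4,1,2)[of n]] by (simp add: ip_lc_left vc gc u1c)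
      then show ?thesis using ip_cauchy_schwarz[OF edge_cont_lc[OF vc gc] u1c, of 1 n "-1"] by simp
    qed
    then show "\<exists>N. \<forall>n\<ge>N. (ip G gg u1)\<^sup>2 \<le> ip G (lc 1 (v (k n)) (-1) gg) (lc 1 (v (k n)) (-1) gg) * ip G u1 u1"
      by blast
  qed
  then have "ip G gg u1 = 0" by simp
  then have "ip G t u1 = 0" by (rule orth_res[OF t gc])
  then show ?thesis using es p lam_bound unfolding A_def by blast
qed

end

section \<open>Counting eigenvalues\<close>

interpretation fs: vector_space "fun_scale :: real \<Rightarrow> ('e \<Rightarrow> real \<Rightarrow> real) \<Rightarrow> 'e \<Rightarrow> real \<Rightarrow> real"
  by (rule vector_space_fun_scale)

definition clip :: "'e metric_graph \<Rightarrow> ('e \<Rightarrow> real \<Rightarrow> real) \<Rightarrow> 'e \<Rightarrow> real \<Rightarrow> real" where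
  "clip G u = (\<lambda>e x. if e \<in> edges G \<and> x \<in> {0..len G e} then u e x else 0)"

lemma C2_on_cong_fun:
  assumes "C2_on l u u' u''" "\<And>x. x \<in> {0..l} \<Longrightarrow> u x = w x"
  shows "C2_on l w u' u''"
proof -
  have "(w has_real_derivative u' x) (at x within {0..l})" if x: "x \<in> {0..l}" for x
    by (rule has_field_derivative_transform_within[where f = u, OF _ zero_less_one x])
      (use assms x in \<open>simp_all add: C2_on_def\<close>)
  then show ?thesis using assms(1) by (auto simp: C2_on_def)
qed

lemma ip_clip: "ip G (clip G u) (clip G w) = ip G u w"
  by (rule ip_cong) (simp add: clip_def)

context pgraph
begin

lemma esol_clip:
  assumes u: "esol G q \<mu> u u'"
  shows "esol G q \<mu> (clip G u) u'"
  unfolding esol_def kdom_def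
proof (intro conjI ballI)
  fix e assume e: "e \<in> edges G"
  have "C2_on (len G e) (u e) (u' e) (\<lambda>x. (q e x - \<mu>) * u e x)"
    using u e by (simp add: esol_def kdom_def)
  then have "C2_on (len G e) (clip G u e) (u' e) (\<lambda>x. (q e x - \<mu>) * u e x)"
    by (rule C2_on_cong_fun) (simp add: clip_def e)
  then show "C2_on (len G e) (clip G u e) (u' e) (\<lambda>x. (q e x - \<mu>) * clip G u e x)"
    by (rule C2_on_cong) (simp add: clip_def e)
next
  have val: "clip G u (fst p) (coord G p) = u (fst p) (coord G p)" if "v \<in> verts G" "p \<in> v" for v p
  proof -
    have "fst p \<in> edges G" using vert_sub[OF that(1)] that(2) by auto
    then show ?thesis using len_pos[of "fst p"] by (simp add: clip_def coord_def)
  qed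
  show "agrees_at_vertices G (clip G u)"
    unfolding agrees_at_vertices_def
  proof (intro ballI)
    fix v p p' assume vp: "v \<in> verts G" "p \<in> v" "p' \<in> v"
    have "u (fst p) (coord G p) = u (fst p') (coord G p')"
      using u vp unfolding esol_def kdom_def agrees_at_vertices_def by blast
    then show "clip G u (fst p) (coord G p) = clip G u (fst p') (coord G p')"
      using val[OF vp(1,2)] val[OF vp(1,3)] by simp
  qed
next
  fix v assume "v \<in> verts G"
  then show "(\<Sum>p\<in>v. normal_deriv G u' p) = 0" using u by (simp add: esol_def kdom_def)
qed

text \<open>The bridge between the Sobolev formulation of the operator and the classical solutions
  used in all proofs.\<close>

lemma eigenspace_iff: "u \<in> eigenspace G q \<mu> \<longleftrightarrow> clip G u = u \<and> (\<exists>u'. esol G q \<mu> u u')"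
proof
  assume u: "u \<in> eigenspace G q \<mu>"
  then have off: "\<And>e x. \<not> (e \<in> edges G \<and> x \<in> {0..len G e}) \<Longrightarrow> u e x = 0"
    and s: "schroedinger G q u (\<lambda>e x. \<mu> * u e x)" unfolding eigenspace_def by blast+
  obtain u' u'' where *: "\<And>e. e \<in> edges G \<Longrightarrow> sobolev2 (len G e) (u e) (u' e) (u'' e)"
      "agrees_at_vertices G u" "\<And>v. v \<in> verts G \<Longrightarrow> (\<Sum>p\<in>v. normal_deriv G u' p) = 0"
      "\<And>e. e \<in> edges G \<Longrightarrow> AE x in lebesgue_on {0..len G e}. - u'' e x + q e x * u e x = \<mu> * u e x"
    using s unfolding schroedinger_def by blast
  have "C2_on (len G e) (u e) (u' e) (\<lambda>x. (q e x - \<mu>) * u e x)" if e: "e \<in> edges G" for e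
    using len_pos[OF e] qc e
    by (intro sobolev2_imp_C2_on[OF _ *(1)[OF e] _ *(4)[OF e]]) (auto simp: edge_cont_def)
  then have "esol G q \<mu> u u'" using * by (simp add: esol_def kdom_def)
  moreover have "clip G u = u" using off by (auto simp: clip_def fun_eq_iff)
  ultimately show "clip G u = u \<and> (\<exists>u'. esol G q \<mu> u u')" by blast
next
  assume "clip G u = u \<and> (\<exists>u'. esol G q \<mu> u u')"
  then obtain u' where c: "clip G u = u" and u: "esol G q \<mu> u u'" by blast
  have "schroedinger G q u (\<lambda>e x. \<mu> * u e x)" unfolding schroedinger_def
  proof (intro exI conjI ballI)
    fix e assume e: "e \<in> edges G"
    have "C2_on (len G e) (u e) (u' e) (\<lambda>x. (q e x - \<mu>) * u e x)"
      using u e by (simp add: esol_def kdom_def)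
    then show "sobolev2 (len G e) (u e) (u' e) (\<lambda>x. (q e x - \<mu>) * u e x)"
      by (rule C2_on_imp_sobolev2[OF less_imp_le[OF len_pos[OF e]]])
    show "AE x in lebesgue_on {0..len G e}. - ((q e x - \<mu>) * u e x) + q e x * u e x = \<mu> * u e x"
      by (simp add: algebra_simps)
  qed (use u in \<open>auto simp: esol_def kdom_def\<close>)
  moreover have "u e x = 0" if "\<not> (e \<in> edges G \<and> x \<in> {0..len G e})" for e x
    using fun_cong[OF fun_cong[OF c], of e x] that by (auto simp: clip_def)
  ultimately show "u \<in> eigenspace G q \<mu>" unfolding eigenspace_def by blast
qed

lemma eigenspace_ip_zero:
  assumes u: "u \<in> eigenspace G q \<mu>" and z: "ip G u u = 0"
  shows "u = (\<lambda>_ _. 0)"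
proof (intro ext)
  fix e x
  obtain u' where c: "clip G u = u" and s: "esol G q \<mu> u u'" using u by (auto simp: eigenspace_iff)
  show "u e x = 0"
    using ip_zeroD[OF esol_cont(1)[OF s] z, of e x] fun_cong[OF fun_cong[OF c], of e x]
    by (auto simp: clip_def split: if_splits)
qed

lemma clip_eigenspace: "esol G q \<mu> u u' \<Longrightarrow> clip G u \<in> eigenspace G q \<mu>"
  unfolding eigenspace_iff using esol_clip by (auto simp: clip_def fun_eq_iff)

lemma is_eigenvalue_iff: "is_eigenvalue G q \<mu> \<longleftrightarrow> (\<exists>u u'. esol G q \<mu> u u' \<and> 0 < ip G u u)"
proof
  assume "is_eigenvalue G q \<mu>"
  then obtain u where u: "u \<in> eigenspace G q \<mu>" "u \<noteq> (\<lambda>_ _. 0)" by (auto simp: is_eigenvalue_def)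
  have "ip G u u \<noteq> 0" using eigenspace_ip_zero[OF u(1)] u(2) by blast
  then have "0 < ip G u u" using ip_square_nonneg[of G u] by linarith
  then show "\<exists>u u'. esol G q \<mu> u u' \<and> 0 < ip G u u" using u(1) by (auto simp: eigenspace_iff)
next
  assume "\<exists>u u'. esol G q \<mu> u u' \<and> 0 < ip G u u"
  then obtain u u' where u: "esol G q \<mu> u u'" "0 < ip G u u" by blast
  have "clip G u \<noteq> (\<lambda>_ _. 0)"
  proof
    assume z: "clip G u = (\<lambda>_ _. 0)"
    have "ip G (clip G u) (clip G u) = 0" unfolding z by (simp add: ip_def)
    then show False using u(2) by (simp add: ip_clip)
  qed
  then show "is_eigenvalue G q \<mu>" using clip_eigenspace[OF u(1)] by (auto simp: is_eigenvalue_def)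
qed

lemma eigenvalue_nonneg: "is_eigenvalue G q \<mu> \<Longrightarrow> 0 \<le> \<mu>"
  unfolding is_eigenvalue_iff using esol_nonneg by blast

text \<open>Infinitely many eigenvalues below \<open>C\<close> would give an orthonormal sequence of
  bounded energy. Any two of its members have squared distance 2, which contradicts
  \<open>compactness\<close>.\<close>

lemma finite_eigenvalues: "finite {\<nu>. is_eigenvalue G q \<nu> \<and> \<nu> \<le> C}"
proof (rule ccontr)
  assume "infinite {\<nu>. is_eigenvalue G q \<nu> \<and> \<nu> \<le> C}"
  then obtain \<nu> :: "nat \<Rightarrow> real" where inj: "inj \<nu>" and ran: "range \<nu> \<subseteq> {\<nu>. is_eigenvalue G q \<nu> \<and> \<nu> \<le> C}"
    using infinite_countable_subset by blast
  have ev: "is_eigenvalue G q (\<nu> n)" "\<nu> n \<le> C" for n using subsetD[OF ran rangeI[of \<nu> n]] by simp_all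
  have "\<exists>u u'. esol G q (\<nu> n) u u' \<and> ip G u u = 1" for n
  proof -
    obtain u u' where u: "esol G q (\<nu> n) u u'" "0 < ip G u u" using ev(1)[of n] by (auto simp: is_eigenvalue_iff)
    define c where "c = 1 / sqrt (ip G u u)"
    have "c * c * ip G u u = 1" using u by (simp add: c_def)
    then have "ip G (lc c u 0 u) (lc c u 0 u) = 1" by (simp add: ip_scale ip_scale_right mult.assoc)
    then show ?thesis using esol_scale[OF u(1), of c] by blast
  qed
  then obtain u u' where u: "\<And>n. esol G q (\<nu> n) (u n) (u' n)" "\<And>n. ip G (u n) (u n) = 1" by metis
  have uc: "edge_cont G (u n)" for n using esol_cont(1)[OF u(1)] .
  define C' where "C' = max C 1"
  have k: "kdom G (u n) (u' n) (\<lambda>e x. (q e x - \<nu> n) * u n e x)" for n using u(1)[of n] by (simp add: esol_def)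
  have b1: "ip G (u' n) (u' n) \<le> C'" for n
    using esol_energy[OF u(1)[of n]] q_energy_nonneg[of "u n"] ev(2)[of n] by (simp add: u(2) C'_def)
  have b2: "ip G (u n) (u n) \<le> C'" for n by (simp add: u(2) C'_def)
  from compactness[where v = u and v' = u' and C = C' and v'' = "\<lambda>n e x. (q e x - \<nu> n) * u n e x", OF k b1 b2]
  obtain g k where gc: "edge_cont G g" and k: "strict_mono (k :: nat \<Rightarrow> nat)"
    and lim: "(\<lambda>n. ip G (lc 1 (u (k n)) (-1) g) (lc 1 (u (k n)) (-1) g)) \<longlonglongrightarrow> 0"
    by (elim exE conjE) (rule that)
  have "2 \<le> 2 * ip G (lc 1 (u (k n)) (-1) g) (lc 1 (u (k n)) (-1) g)
     + 2 * ip G (lc 1 (u (k (Suc n))) (-1) g) (lc 1 (u (k (Suc n))) (-1) g)" for n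
  proof -
    let ?a = "u (k n)" and ?b = "u (k (Suc n))"
    have "k n \<noteq> k (Suc n)" using strict_monoD[OF k, of n "Suc n"] by simp
    then have "\<nu> (k n) \<noteq> \<nu> (k (Suc n))" using inj by (auto dest: injD)
    then have o: "ip G ?a ?b = 0" by (rule esol_orthogonal[OF u(1) u(1)])
    have "2 = ip G (lc 1 ?a (-1) ?b) (lc 1 ?a (-1) ?b)" by (simp add: ip_lc_square[OF uc uc] o u(2))
    also have "\<dots> \<le> 2 * ip G (lc 1 ?a (-1) g) (lc 1 ?a (-1) g) + 2 * ip G (lc (- (-1)) g (-1) ?b) (lc (- (-1)) g (-1) ?b)"
      by (rule ip_sum_square_le[OF uc gc uc])
    finally show ?thesis using ip_lc_minus_commute[of G g ?b] by simp
  qed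
  moreover have "(\<lambda>n. 2 * ip G (lc 1 (u (k n)) (-1) g) (lc 1 (u (k n)) (-1) g)
     + 2 * ip G (lc 1 (u (k (Suc n))) (-1) g) (lc 1 (u (k (Suc n))) (-1) g)) \<longlonglongrightarrow> 2 * 0 + 2 * 0"
    by (intro tendsto_intros lim LIMSEQ_Suc[OF lim])
  ultimately have "2 \<le> 2 * 0 + 2 * (0::real)" by (intro LIMSEQ_le_const) auto
  then show False by simp
qed

lemma C2_on_sum:
  assumes "finite A" "\<And>i. i \<in> A \<Longrightarrow> C2_on l (u i) (u' i) (u'' i)"
  shows "C2_on l (\<lambda>x. \<Sum>i\<in>A. u i x) (\<lambda>x. \<Sum>i\<in>A. u' i x) (\<lambda>x. \<Sum>i\<in>A. u'' i x)"
  using assms unfolding C2_on_def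
  by (auto intro!: DERIV_sum continuous_on_sum)

lemma fun_scale_sum: "(\<Sum>u\<in>A. fun_scale (x u) u) e t = (\<Sum>u\<in>A. x u * u e t)"
  by (induction A rule: infinite_finite_induct) (auto simp: fun_scale_def)

text \<open>On each edge a solution is determined by its value and derivative at coordinate 0. Among
  more functions than twice the number of edges, some nontrivial combination has zero data on every
  edge.\<close>

lemma eigenspace_independent_finite:
  assumes B: "B \<subseteq> eigenspace G q \<mu>" and ind: "fs.independent B"
  shows "finite B"
proof (rule ccontr)
  assume "infinite B"
  define J where "J = edges G \<times> (UNIV :: bool set)"
  have finJ: "finite J" by (simp add: J_def)
  obtain F where F: "F \<subseteq> B" "finite F" "card F = Suc (card J)"
    using infinite_arbitrarily_large[OF \<open>infinite B\<close>] by metis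
  have "\<forall>u\<in>F. \<exists>u'. clip G u = u \<and> esol G q \<mu> u u'" using F(1) B by (auto simp: eigenspace_iff)
  then obtain D where D: "\<And>u. u \<in> F \<Longrightarrow> clip G u = u" "\<And>u. u \<in> F \<Longrightarrow> esol G q \<mu> u (D u)" by metis
  have "card J < card F" using F by simp
  from homogeneous_system[OF finJ F(2) this, of "\<lambda>j u. if snd j then D u (fst j) 0 else u (fst j) 0"]
  obtain x where x: "\<exists>u\<in>F. x u \<noteq> 0"
    "\<And>j. j \<in> J \<Longrightarrow> (\<Sum>u\<in>F. (if snd j then D u (fst j) 0 else u (fst j) 0) * x u) = 0" by blast
  define w where "w e t = (\<Sum>u\<in>F. x u * u e t)" for e t
  define w' where "w' e t = (\<Sum>u\<in>F. x u * D u e t)" for e t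
  have "w e t = 0" for e t
  proof (cases "e \<in> edges G \<and> t \<in> {0..len G e}")
    case True
    have "C2_on (len G e) (w e) (w' e) (\<lambda>t. \<Sum>u\<in>F. x u * ((q e t - \<mu>) * u e t))"
      unfolding w_def w'_def
    proof (rule C2_on_sum[OF F(2)])
      fix u assume "u \<in> F"
      then have "C2_on (len G e) (u e) (D u e) (\<lambda>t. (q e t - \<mu>) * u e t)"
        using D(2) True by (simp add: esol_def kdom_def)
      from C2_on_lin[OF this this, of "x u" 0]
      show "C2_on (len G e) (\<lambda>t. x u * u e t) (\<lambda>t. x u * D u e t) (\<lambda>t. x u * ((q e t - \<mu>) * u e t))" by simp
    qed
    moreover have "(\<lambda>t. \<Sum>u\<in>F. x u * ((q e t - \<mu>) * u e t)) = (\<lambda>t. (q e t - \<mu>) * w e t)"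
      by (simp add: w_def sum_distrib_left mult_ac)
    ultimately have C2: "C2_on (len G e) (w e) (w' e) (\<lambda>t. (q e t - \<mu>) * w e t)" by simp
    have qe: "continuous_on {0..len G e} (\<lambda>t. q e t - \<mu>)"
      using qc True by (auto simp: edge_cont_def intro!: continuous_intros)
    have "w e 0 = 0" "w' e 0 = 0"
      using x(2)[of "(e, False)"] x(2)[of "(e, True)"] True by (simp_all add: w_def w'_def J_def mult.commute)
    with linear_ivp_unique[OF qe C2 this] True show ?thesis by blast
  next
    case False
    have "u e t = 0" if "u \<in> F" for u
      using fun_cong[OF fun_cong[OF D(1)[OF that]], of e t] False by (auto simp: clip_def)
    then show ?thesis unfolding w_def by (intro sum.neutral) simp
  qed
  then have "(\<Sum>u\<in>F. fun_scale (x u) u) = 0" by (simp add: fun_eq_iff fun_scale_sum w_def)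
  then have "x u = 0" if "u \<in> F" for u
    using fs.independentD[OF ind F(2,1) _ that] by blast
  then show False using x(1) by blast
qed

lemma card_le_multiplicity:
  assumes A: "A \<subseteq> eigenspace G q \<mu>" and ind: "fs.independent A"
  shows "card A \<le> multiplicity_of G q \<mu>"
proof -
  obtain B where B: "B \<subseteq> eigenspace G q \<mu>" "fs.independent B" "eigenspace G q \<mu> \<subseteq> fs.span B"
      "card B = fs.dim (eigenspace G q \<mu>)"
    using fs.basis_exists by blast
  have "finite B" by (rule eigenspace_independent_finite[OF B(1,2)])
  from fs.independent_span_bound[OF this ind] A B(3)
  have "card A \<le> card B" by blast
  then show ?thesis by (simp add: multiplicity_of_def B(4))
qed

lemma multiplicity_pos:
  assumes "is_eigenvalue G q \<mu>"
  shows "1 \<le> multiplicity_of G q \<mu>"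
proof -
  obtain u where u: "u \<in> eigenspace G q \<mu>" "u \<noteq> 0"
    using assms by (auto simp: is_eigenvalue_def zero_fun_def)
  have "fs.independent {u}" using u(2) by (simp add: fs.dependent_single)
  from card_le_multiplicity[OF _ this] u(1) show ?thesis by simp
qed

lemma multiplicity_two:
  assumes u: "esol G q \<mu> u u'" "0 < ip G u u" and w: "esol G q \<mu> w w'" "0 < ip G w w" and o: "ip G u w = 0"
  shows "2 \<le> multiplicity_of G q \<mu>"
proof -
  let ?u = "clip G u" and ?w = "clip G w"
  have nz: "?w \<noteq> 0" "?u \<noteq> 0"
    using u(2) w(2) ip_clip[of G u u] ip_clip[of G w w] by (auto simp: ip_def)
  have "?u \<notin> fs.span {?w}"
  proof
    assume "?u \<in> fs.span {?w}"
    then obtain k where k: "?u = fun_scale k ?w" by (auto simp: fs.span_singleton)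
    have "ip G ?u ?u = ip G (lc k ?w 0 ?w) ?u" by (rule ip_cong) (simp add: k fun_scale_def lc_def)
    also have "\<dots> = k * ip G w u" by (simp add: ip_scale ip_clip)
    finally show False using o u(2) by (simp add: ip_clip ip_commute)
  qed
  moreover have "fs.independent {?w}" using nz by (simp add: fs.dependent_single)
  ultimately have "fs.independent {?u, ?w}"
    by (subst fs.independent_insert) (auto intro: fs.span_base)
  moreover have "?u \<noteq> ?w" using \<open>?u \<notin> fs.span {?w}\<close> fs.span_base[of ?w "{?w}"] by auto
  ultimately show ?thesis
    using card_le_multiplicity[of "{?u, ?w}" \<mu>] clip_eigenspace[OF u(1)] clip_eigenspace[OF w(1)] by simp
qed

definition count_upto :: "real \<Rightarrow> nat" where
  "count_upto \<mu> = (\<Sum>\<nu>\<in>{\<nu>. is_eigenvalue G q \<nu> \<and> \<nu> \<le> \<mu>}. multiplicity_of G q \<nu>)"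

text \<open>\<open>LEAST\<close> over the reals is meaningful only if the minimum is attained. The
  count jumps only at the finitely many eigenvalues below \<mu>, so the smallest of these with a
  sufficient count is the minimum.\<close>

lemma eigval_props:
  assumes k: "1 \<le> k" and le: "k \<le> count_upto \<mu>"
  shows "is_eigenvalue G q (eigval G q k)" "k \<le> count_upto (eigval G q k)" "eigval G q k \<le> \<mu>"
proof -
  define S where "S = {\<nu>. is_eigenvalue G q \<nu> \<and> \<nu> \<le> \<mu> \<and> k \<le> count_upto \<nu>}"
  have finS: "finite S"
    by (rule finite_subset[OF _ finite_eigenvalues[of \<mu>]]) (auto simp: S_def)
  have below: "\<exists>\<nu>\<in>S. \<nu> \<le> \<mu>'" if \<mu>': "k \<le> count_upto \<mu>'" "\<mu>' \<le> \<mu>" for \<mu>'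
  proof -
    define L where "L = {\<nu>. is_eigenvalue G q \<nu> \<and> \<nu> \<le> \<mu>'}"
    have finL: "finite L" unfolding L_def by (rule finite_eigenvalues)
    have "L \<noteq> {}" using \<mu>' k by (auto simp: count_upto_def L_def[symmetric])
    then have m: "Max L \<in> L" using finL by simp
    have "{\<nu>. is_eigenvalue G q \<nu> \<and> \<nu> \<le> Max L} = L"
      using m Max_ge[OF finL] by (auto simp: L_def)
    then have "count_upto (Max L) = count_upto \<mu>'" by (simp add: count_upto_def L_def)
    then have "Max L \<in> S" using m \<mu>' by (auto simp: S_def L_def)
    then show ?thesis using m by (auto simp: L_def)
  qed
  have "S \<noteq> {}" using below[OF le] by auto
  then have m: "Min S \<in> S" using finS by simp
  have "eigval G q k = Min S"
    unfolding eigval_def count_upto_def[symmetric]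
  proof (rule Least_equality)
    show "k \<le> count_upto (Min S)" using m by (simp add: S_def)
    fix y assume y: "k \<le> count_upto y"
    show "Min S \<le> y"
    proof (cases "y \<le> \<mu>")
      case True
      then obtain \<nu> where "\<nu> \<in> S" "\<nu> \<le> y" using below[OF y] by auto
      then show ?thesis using Min_le[OF finS] by force
    next
      case False
      then show ?thesis using m by (simp add: S_def)
    qed
  qed
  then show "is_eigenvalue G q (eigval G q k)" "k \<le> count_upto (eigval G q k)" "eigval G q k \<le> \<mu>"
    using m by (auto simp: S_def)
qed

lemma one_le_count:
  assumes "is_eigenvalue G q \<mu>" "\<mu> \<le> C"
  shows "1 \<le> count_upto C"
proof -
  have "multiplicity_of G q \<mu> \<le> count_upto C"
    unfolding count_upto_def using assms finite_eigenvalues by (intro member_le_sum) auto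
  then show ?thesis using multiplicity_pos[OF assms(1)] by linarith
qed

lemma two_le_count:
  assumes u: "esol G q \<mu> u u'" "0 < ip G u u" "\<mu> \<le> C" and w: "esol G q \<nu> w w'" "0 < ip G w w" "\<nu> \<le> C"
    and o: "ip G u w = 0"
  shows "2 \<le> count_upto C"
proof -
  have ev: "is_eigenvalue G q \<mu>" "is_eigenvalue G q \<nu>" using u w by (auto simp: is_eigenvalue_iff)
  show ?thesis
  proof (cases "\<mu> = \<nu>")
    case True
    have "multiplicity_of G q \<mu> \<le> count_upto C"
      unfolding count_upto_def using ev u finite_eigenvalues by (intro member_le_sum) auto
    then show ?thesis using multiplicity_two[OF u(1,2) w(1)[folded True] w(2) o] by linarith
  next
    case False
    have "(\<Sum>x\<in>{\<mu>, \<nu>}. multiplicity_of G q x) \<le> count_upto C"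
      unfolding count_upto_def using ev u w finite_eigenvalues by (intro sum_mono2) auto
    then show ?thesis using False multiplicity_pos[OF ev(1)] multiplicity_pos[OF ev(2)] by simp
  qed
qed

text \<open>The min-max principle for a plane of trial functions. Any nonzero element bounds a first
  eigenvalue; the plane then contains a nonzero element orthogonal to the eigenfunction found, and
  this bounds a second one.\<close>

lemma two_le_count_of_test_space:
  assumes f: "kdom G f f' f''" and g: "kdom G g g' g''"
    and indep: "\<And>a b. ip G (lc a f b g) (lc a f b g) = 0 \<Longrightarrow> a = 0 \<and> b = 0"
    and le: "\<And>a b. ip G (lc a f' b g') (lc a f' b g') + ip G (\<lambda>e x. q e x * lc a f b g e x) (lc a f b g)
        \<le> C * ip G (lc a f b g) (lc a f b g)"
  shows "2 \<le> count_upto C"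
proof -
  have fc: "edge_cont G f" and gc: "edge_cont G g" using kdom_edge_cont(1)[OF f] kdom_edge_cont(1)[OF g] .
  have ex: "\<exists>\<mu> u u'. esol G q \<mu> u u' \<and> 0 < ip G u u \<and> ip G u u1 = 0 \<and> \<mu> \<le> C"
    if ab: "a \<noteq> 0 \<or> b \<noteq> 0" and u1: "esol G q \<kappa> u1 u1'" "0 \<le> \<kappa>" and o: "ip G (lc a f b g) u1 = 0" for a b \<kappa> u1 u1'
  proof -
    have pos: "0 < ip G (lc a f b g) (lc a f b g)"
      using indep[of a b] ab ip_square_nonneg[of G "lc a f b g"] by (cases "ip G (lc a f b g) (lc a f b g) = 0") auto
    obtain \<mu> u u' where u: "esol G q \<mu> u u'" "0 < ip G u u" "ip G u u1 = 0"
      "\<mu> * ip G (lc a f b g) (lc a f b g) \<le> ip G (lc a f' b g') (lc a f' b g') + ip G (\<lambda>e x. q e x * lc a f b g e x) (lc a f b g)"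
      using eigenfunction_exists[OF kdom_test_fun[OF kdom_lc[OF f g]] pos u1 o] by blast
    have "\<mu> * ip G (lc a f b g) (lc a f b g) \<le> C * ip G (lc a f b g) (lc a f b g)"
      using u(4) le[of a b] by linarith
    then have "\<mu> \<le> C" using pos by simp
    with u show ?thesis by blast
  qed
  have "ip G (lc 1 f 0 g) (\<lambda>_ _. 0) = 0" by (simp add: ip_def)
  \<comment> \<open>The zero function solves every eigenvalue equation, so with it as
    \<open>u1\<close> the orthogonality constraint is void.\<close>
  from ex[of 1 0, OF _ esol_zero[of G q 0] _ this] obtain \<mu> u u' where
    u: "esol G q \<mu> u u'" "0 < ip G u u" "\<mu> \<le> C" by auto
  have uc: "edge_cont G u" using esol_cont(1)[OF u(1)] .
  have "\<exists>a b. (a \<noteq> 0 \<or> b \<noteq> 0) \<and> ip G (lc a f b g) u = 0"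
  proof (cases "ip G f u = 0 \<and> ip G g u = 0")
    case True
    then show ?thesis by (intro exI[of _ 1] exI[of _ 0]) (simp add: ip_lc_left[OF fc gc uc])
  next
    case False
    then show ?thesis by (intro exI[of _ "ip G g u"] exI[of _ "- ip G f u"]) (auto simp: ip_lc_left[OF fc gc uc])
  qed
  then obtain a b where ab: "a \<noteq> 0 \<or> b \<noteq> 0" "ip G (lc a f b g) u = 0" by blast
  obtain \<nu> w w' where w: "esol G q \<nu> w w'" "0 < ip G w w" "ip G w u = 0" "\<nu> \<le> C"
    using ex[OF ab(1) u(1) esol_nonneg[OF u(1,2)] ab(2)] by blast
  show ?thesis by (rule two_le_count[OF u w(1,2,4)]) (simp add: ip_commute[of G u w] w(3))
qed

end

section \<open>The spectral gap of the free operator\<close>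

lemma one_kdom: "kdom G (\<lambda>_ _. 1) (\<lambda>_ _. 0) (\<lambda>_ _. 0)"
  by (auto simp: kdom_def C2_on_def agrees_at_vertices_def normal_deriv_def intro!: sum.neutral)

lemma edge_cont_const: "edge_cont G (\<lambda>_ _. c)"
  by (simp add: edge_cont_def)

sublocale mgraph \<subseteq> Z: pgraph G "\<lambda>_ _. 0"
  by unfold_locales (auto simp: edge_cont_const)

context mgraph
begin

lemma one_esol: "esol G (\<lambda>_ _. 0) 0 (\<lambda>_ _. 1) (\<lambda>_ _. 0)"
  using one_kdom[of G] by (simp add: esol_def)

lemma ip_one: "ip G (\<lambda>_ _. 1) (\<lambda>_ _. 1) = (\<Sum>e\<in>edges G. len G e)"
  unfolding ip_def by (intro sum.cong) (auto dest: len_pos)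

lemma length_pos: "0 < ip G (\<lambda>_ _. 1) (\<lambda>_ _. 1)"
  unfolding ip_one using len_pos edges_ne by (intro sum_pos) auto

lemma flat_constant:
  assumes u: "kdom G u u' u''" and z: "ip G u' u' = 0"
  shows "\<exists>c. \<forall>e\<in>edges G. \<forall>x\<in>{0..len G e}. u e x = c"
proof -
  have const: "u e x = u e 0" if e: "e \<in> edges G" and x: "x \<in> {0..len G e}" for e x
  proof -
    have C2: "C2_on (len G e) (u e) (u' e) (u'' e)" using u e by (simp add: kdom_def)
    have "\<exists>c. \<forall>x\<in>{0..len G e}. u e x = c"
    proof (rule has_field_derivative_zero_constant)
      fix x assume x: "x \<in> {0..len G e}"
      show "(u e has_field_derivative 0) (at x within {0..len G e})"
        using C2_onD(1)[OF C2 x] ip_zeroD[OF kdom_edge_cont(2)[OF u] z e x] by simp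
    qed auto
    then show ?thesis using x by auto
  qed
  obtain e0 where e0: "e0 \<in> edges G" using edges_ne by auto
  define Y where "Y = {e\<in>edges G. u e 0 = u e0 0}"
  have end_val: "u (fst p) (coord G p) = u (fst p) 0" if "fst p \<in> edges G" for p
    using const[OF that, of "coord G p"] len_pos[OF that] by (simp add: coord_def)
  have "Y = edges G"
  proof (rule connected_edges)
    fix v assume v: "v \<in> verts G"
    show "v \<subseteq> Y \<times> UNIV \<or> v \<inter> Y \<times> UNIV = {}"
    proof (rule disjCI)
      assume "v \<inter> Y \<times> UNIV \<noteq> {}"
      then obtain p where p: "p \<in> v" "fst p \<in> Y" by auto
      show "v \<subseteq> Y \<times> UNIV"
      proof
        fix p' assume p': "p' \<in> v"
        have E: "fst p \<in> edges G" "fst p' \<in> edges G" using vert_sub[OF v] p p' by auto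
        have "u (fst p) (coord G p) = u (fst p') (coord G p')"
          using u v p p' unfolding kdom_def agrees_at_vertices_def by blast
        then have "fst p' \<in> Y" using p E by (simp add: end_val Y_def)
        then show "p' \<in> Y \<times> UNIV" by (simp add: mem_Times_iff)
      qed
    qed
  qed (use e0 in \<open>auto simp: Y_def\<close>)
  then have "u e x = u e0 0" if "e \<in> edges G" "x \<in> {0..len G e}" for e x
    using const[OF that] that(1) by (auto simp: Y_def)
  then show ?thesis by blast
qed

lemma mean_zero_esol_pos:
  assumes u: "esol G (\<lambda>_ _. 0) \<mu> u u'" and pos: "0 < ip G u u" and o: "ip G u (\<lambda>_ _. 1) = 0"
  shows "0 < \<mu>"
proof (rule ccontr)
  assume "\<not> 0 < \<mu>"
  then have "\<mu> = 0" using Z.esol_nonneg[OF u pos] by simp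
  then have z: "ip G u' u' = 0" using Z.esol_energy[OF u] by (simp add: ip_def)
  obtain c where c: "\<And>e x. e \<in> edges G \<Longrightarrow> x \<in> {0..len G e} \<Longrightarrow> u e x = c"
    using flat_constant[OF u[unfolded esol_def] z] by blast
  have "ip G u (\<lambda>_ _. 1) = ip G (lc c (\<lambda>_ _. 1) 0 (\<lambda>_ _. 1)) (\<lambda>_ _. 1)"
    by (rule ip_cong) (simp add: c lc_def)
  then have "c = 0" using o length_pos by (simp add: ip_scale)
  have "ip G u u = ip G (\<lambda>_ _. 0) (\<lambda>_ _. 0)" by (rule ip_cong) (simp add: c \<open>c = 0\<close>)
  then show False using pos by (simp add: ip_def)
qed

text \<open>Any nonzero trial function of mean zero yields an eigenfunction orthogonal to the
  constants, whose eigenvalue is positive by \<open>mean_zero_esol_pos\<close>.\<close>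

lemma positive_eigenvalue_exists: "\<exists>\<mu>>0. is_eigenvalue G (\<lambda>_ _. 0) \<mu>"
proof -
  obtain e0 where e0: "e0 \<in> edges G" using edges_ne by auto
  let ?l = "len G e0" and ?one = "\<lambda>_ _. 1"
  have l: "0 < ?l" using len_pos[OF e0] .
  \<comment> \<open>A parabola that vanishes at both ends of one edge, hence stays continuous when
    extended by zero.\<close>
  define b where "b e x = (if e = e0 then x * (?l - x) else 0)" for e x
  define b' where "b' e x = (if e = e0 then ?l - 2 * x else 0)" for e x
  define m where "m = ip G b ?one / ip G ?one ?one"
  define f where "f = lc 1 b (- m) ?one"
  have "continuous_on X (b e)" "continuous_on X (b' e)" for X e
    unfolding b_def b'_def by (cases "e = e0"; auto intro!: continuous_intros)+
  note cont = this
  have bc: "edge_cont G b" unfolding edge_cont_def by (intro ballI cont)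
  have fc: "edge_cont G f" unfolding f_def by (intro edge_cont_lc bc edge_cont_const)
  have "pw_diff (len G e) (f e) (b' e)" if e: "e \<in> edges G" for e
    unfolding pw_diff_def
  proof (intro conjI exI[of _ "{}"] ballI)
    show "continuous_on {0..len G e} (f e)" using fc e by (simp add: edge_cont_def)
    fix x
    show "(f e has_real_derivative b' e x) (at x)"
      unfolding f_def lc_def b_def b'_def by (cases "e = e0") (auto intro!: derivative_eq_intros)
    show "(\<lambda>x. (b' e x)\<^sup>2) integrable_on {0..len G e}"
      by (intro integrable_continuous_real continuous_on_power cont)
  qed auto
  moreover have "f (fst p) (coord G p) = - m" for p
    by (simp add: f_def lc_def b_def coord_def)
  ultimately have test: "test_fun G f b'" by (simp add: test_fun_def agrees_at_vertices_def)
  have o: "ip G f ?one = 0"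
    unfolding f_def using length_pos by (simp add: ip_lc_left[OF bc edge_cont_const edge_cont_const] m_def)
  have "ip G f f \<noteq> 0"
  proof
    assume z: "ip G f f = 0"
    have "f e0 0 = 0" "f e0 (?l / 2) = 0" using ip_zeroD[OF fc z e0] l by auto
    then show False using l by (simp add: f_def lc_def b_def)
  qed
  then have pos: "0 < ip G f f" using ip_square_nonneg[of G f] by linarith
  obtain \<mu> u u' where u: "esol G (\<lambda>_ _. 0) \<mu> u u'" "0 < ip G u u" "ip G u ?one = 0"
    using Z.eigenfunction_exists[OF test pos one_esol order_refl o] by blast
  have "0 < \<mu>" by (rule mean_zero_esol_pos[OF u])
  moreover have "is_eigenvalue G (\<lambda>_ _. 0) \<mu>" using u(1,2) unfolding Z.is_eigenvalue_iff by blast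
  ultimately show ?thesis by blast
qed

text \<open>The least positive eigenvalue of the free operator. It is the fundamental gap for q = 0,
  see \<open>fundamental_gap_zero\<close>, but easier to handle than the counting in
  \<open>eigval\<close>.\<close>

definition spectral_gap :: real where
  "spectral_gap = (THE \<mu>. 0 < \<mu> \<and> is_eigenvalue G (\<lambda>_ _. 0) \<mu> \<and>
     (\<forall>\<nu>>0. is_eigenvalue G (\<lambda>_ _. 0) \<nu> \<longrightarrow> \<mu> \<le> \<nu>))"

lemma spectral_gap:
  shows spectral_gap_pos: "0 < spectral_gap"
    and spectral_gap_eigenvalue: "is_eigenvalue G (\<lambda>_ _. 0) spectral_gap"
    and spectral_gap_le: "0 < \<nu> \<Longrightarrow> is_eigenvalue G (\<lambda>_ _. 0) \<nu> \<Longrightarrow> spectral_gap \<le> \<nu>"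
proof -
  obtain \<mu>0 where \<mu>0: "0 < \<mu>0" "is_eigenvalue G (\<lambda>_ _. 0) \<mu>0" using positive_eigenvalue_exists by blast
  define S where "S = {\<nu>. 0 < \<nu> \<and> is_eigenvalue G (\<lambda>_ _. 0) \<nu> \<and> \<nu> \<le> \<mu>0}"
  have finS: "finite S" by (rule finite_subset[OF _ Z.finite_eigenvalues[of \<mu>0]]) (auto simp: S_def)
  have "S \<noteq> {}" using \<mu>0 by (auto simp: S_def)
  then have m: "Min S \<in> S" using finS by simp
  have "0 < Min S \<and> is_eigenvalue G (\<lambda>_ _. 0) (Min S) \<and> (\<forall>\<nu>>0. is_eigenvalue G (\<lambda>_ _. 0) \<nu> \<longrightarrow> Min S \<le> \<nu>)"
  proof (intro conjI allI impI)
    fix \<nu> assume \<nu>: "0 < \<nu>" "is_eigenvalue G (\<lambda>_ _. 0) \<nu>"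
    show "Min S \<le> \<nu>"
    proof (cases "\<nu> \<le> \<mu>0")
      case True
      then show ?thesis using \<nu> finS by (intro Min_le) (auto simp: S_def)
    next
      case False
      then show ?thesis using m by (auto simp: S_def)
    qed
  qed (use m in \<open>auto simp: S_def\<close>)
  from theI[of "\<lambda>\<mu>. 0 < \<mu> \<and> is_eigenvalue G (\<lambda>_ _. 0) \<mu> \<and>
     (\<forall>\<nu>>0. is_eigenvalue G (\<lambda>_ _. 0) \<nu> \<longrightarrow> \<mu> \<le> \<nu>)", OF this]
  have "0 < spectral_gap \<and> is_eigenvalue G (\<lambda>_ _. 0) spectral_gap \<and>
     (\<forall>\<nu>>0. is_eigenvalue G (\<lambda>_ _. 0) \<nu> \<longrightarrow> spectral_gap \<le> \<nu>)"
    unfolding spectral_gap_def[symmetric] using \<open>0 < Min S \<and> _\<close> by (meson order_antisym)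
  then show "0 < spectral_gap" "is_eigenvalue G (\<lambda>_ _. 0) spectral_gap"
    "0 < \<nu> \<Longrightarrow> is_eigenvalue G (\<lambda>_ _. 0) \<nu> \<Longrightarrow> spectral_gap \<le> \<nu>" by blast+
qed

lemma poincare:
  assumes f: "test_fun G f g" and o: "ip G f (\<lambda>_ _. 1) = 0"
  shows "spectral_gap * ip G f f \<le> ip G g g"
proof (cases "ip G f f = 0")
  case True
  then show ?thesis using ip_square_nonneg[of G g] by simp
next
  case False
  then have pos: "0 < ip G f f" using ip_square_nonneg[of G f] by linarith
  obtain \<mu> u u' where u: "esol G (\<lambda>_ _. 0) \<mu> u u'" "0 < ip G u u" "ip G u (\<lambda>_ _. 1) = 0"
     and le: "\<mu> * ip G f f \<le> ip G g g + ip G (\<lambda>e x. 0 * f e x) f"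
    using Z.eigenfunction_exists[OF f pos one_esol order_refl o] by blast
  have "0 < \<mu>" by (rule mean_zero_esol_pos[OF u])
  moreover have "is_eigenvalue G (\<lambda>_ _. 0) \<mu>" using u(1,2) unfolding Z.is_eigenvalue_iff by blast
  ultimately have "spectral_gap \<le> \<mu>" by (rule spectral_gap_le)
  then have "spectral_gap * ip G f f \<le> \<mu> * ip G f f" using pos by (intro mult_right_mono) auto
  also have "\<dots> \<le> ip G g g" using le by (simp add: ip_def)
  finally show ?thesis .
qed

lemma zero_eigenvalue: "is_eigenvalue G (\<lambda>_ _. 0) 0"
  unfolding Z.is_eigenvalue_iff using one_esol length_pos by blast

lemma multiplicity_zero: "multiplicity_of G (\<lambda>_ _. 0) 0 \<le> 1"
proof -
  have "eigenspace G (\<lambda>_ _. 0) 0 \<subseteq> fs.span {clip G (\<lambda>_ _. 1)}"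
  proof
    fix u assume "u \<in> eigenspace G (\<lambda>_ _. 0) 0"
    then obtain u' where cl: "clip G u = u" and u: "esol G (\<lambda>_ _. 0) 0 u u'" by (auto simp: Z.eigenspace_iff)
    have z: "ip G u' u' = 0" using Z.esol_energy[OF u] by (simp add: ip_def)
    obtain c where c: "\<And>e x. e \<in> edges G \<Longrightarrow> x \<in> {0..len G e} \<Longrightarrow> u e x = c"
      using flat_constant[OF u[unfolded esol_def] z] by blast
    have "clip G u = fun_scale c (clip G (\<lambda>_ _. 1))"
      by (auto simp: clip_def fun_scale_def c fun_eq_iff)
    then show "u \<in> fs.span {clip G (\<lambda>_ _. 1)}" unfolding cl by (auto simp: fs.span_singleton)
  qed
  from fs.dim_le_card[OF this] show ?thesis by (simp add: multiplicity_of_def)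
qed

text \<open>Zero is an eigenvalue of multiplicity one, so the second entry of the list is positive
  and at least the least positive eigenvalue.\<close>

lemma fundamental_gap_zero: "fundamental_gap G (\<lambda>_ _. 0) = spectral_gap"
proof -
  obtain u u' where u: "esol G (\<lambda>_ _. 0) spectral_gap u u'" "0 < ip G u u"
    using spectral_gap_eigenvalue by (auto simp: Z.is_eigenvalue_iff)
  have c1: "1 \<le> Z.count_upto 0" by (rule Z.one_le_count[OF zero_eigenvalue order_refl])
  have e1: "eigval G (\<lambda>_ _. 0) 1 = 0"
    using Z.eigval_props[OF order_refl c1] Z.eigenvalue_nonneg by (intro antisym) auto
  have "ip G (\<lambda>_ _. 1) u = 0"
    using Z.esol_orthogonal[OF one_esol u(1)] spectral_gap_pos by simp
  then have c2: "2 \<le> Z.count_upto spectral_gap"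
    by (intro Z.two_le_count[OF one_esol length_pos _ u(1,2)]) (simp_all add: spectral_gap_pos less_imp_le)
  have p: "is_eigenvalue G (\<lambda>_ _. 0) (eigval G (\<lambda>_ _. 0) 2)" "2 \<le> Z.count_upto (eigval G (\<lambda>_ _. 0) 2)"
    "eigval G (\<lambda>_ _. 0) 2 \<le> spectral_gap"
    using Z.eigval_props[OF _ c2] by auto
  have "eigval G (\<lambda>_ _. 0) 2 \<noteq> 0"
  proof
    assume z: "eigval G (\<lambda>_ _. 0) 2 = 0"
    have "{\<nu>. is_eigenvalue G (\<lambda>_ _. 0) \<nu> \<and> \<nu> \<le> 0} = {0}"
      using zero_eigenvalue Z.eigenvalue_nonneg by force
    then have "Z.count_upto 0 = multiplicity_of G (\<lambda>_ _. 0) 0" unfolding Z.count_upto_def by simp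
    then show False using p(2) multiplicity_zero unfolding z by simp
  qed
  then have "0 < eigval G (\<lambda>_ _. 0) 2" using Z.eigenvalue_nonneg[OF p(1)] by simp
  then have "spectral_gap \<le> eigval G (\<lambda>_ _. 0) 2" using p(1) by (rule spectral_gap_le)
  then show ?thesis using p(3) e1 by (simp add: fundamental_gap_def)
qed

end

section \<open>Combinatorics of metric trees\<close>

lemma opp_simps [simp]: "opp (e, b) = (e, \<not> b)" "fst (opp p) = fst p" "opp (opp p) = p" "opp p \<noteq> p"
  by (auto simp: opp_def prod_eq_iff)

lemma vertex_of_partition:
  assumes "partition_on A (verts G)" "v \<in> verts G" "p \<in> v"
  shows "vertex_of G p = v"
  unfolding vertex_of_def
  by (rule the_equality) (use assms in \<open>auto simp: partition_on_def disjoint_def\<close>)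

text \<open>Converse of \<open>connected_edges\<close>: the edges at the vertices reachable from
  \<open>v\<close> form a set to which the criterion applies. For modified graphs this is easier to
  check than the existence of walks.\<close>

lemma compact_metric_graphI:
  assumes fin: "finite (edges G)" and ne: "edges G \<noteq> {}" and lp: "\<And>e. e \<in> edges G \<Longrightarrow> 0 < len G e"
    and part: "partition_on (edges G \<times> UNIV) (verts G)"
    and conn: "\<And>Y. Y \<subseteq> edges G \<Longrightarrow> Y \<noteq> {} \<Longrightarrow>
      (\<And>v. v \<in> verts G \<Longrightarrow> v \<subseteq> Y \<times> UNIV \<or> v \<inter> Y \<times> UNIV = {}) \<Longrightarrow> Y = edges G"
  shows "compact_metric_graph G"
proof -
  have sub: "p \<in> edges G \<times> UNIV" if "w \<in> verts G" "p \<in> w" for w p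
    using partition_onD1[OF part] that by auto
  have vo: "vertex_of G p = w" if "w \<in> verts G" "p \<in> w" for w p
    by (rule vertex_of_partition[OF part that])
  have vin: "vertex_of G p \<in> verts G \<and> p \<in> vertex_of G p" if "p \<in> edges G \<times> UNIV" for p
  proof -
    have "p \<in> \<Union>(verts G)" using that unfolding partition_onD1[OF part] .
    then obtain w where "w \<in> verts G" "p \<in> w" by blast
    then show ?thesis using vo by simp
  qed
  have "\<exists>ps. walk G ps \<and> walk_start G ps = v \<and> walk_end G ps = w" if v: "v \<in> verts G" and w: "w \<in> verts G" for v w
  proof -
    define R where "R = {w \<in> verts G. \<exists>ps. walk G ps \<and> walk_start G ps = v \<and> walk_end G ps = w}"
    have step: "vertex_of G (opp p) \<in> R" if pR: "vertex_of G p \<in> R" and pE: "p \<in> edges G \<times> UNIV" for p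
    proof -
      obtain ps where ps: "walk G ps" "walk_start G ps = v" "walk_end G ps = vertex_of G p"
        using pR unfolding R_def by blast
      have "walk G (ps @ [p])" using ps(1,3) pE
        by (auto simp: walk_def successively_append_iff walk_end_def)
      moreover have "walk_start G (ps @ [p]) = v" using ps by (auto simp: walk_start_def walk_def)
      moreover have "opp p \<in> edges G \<times> UNIV" using pE by (auto simp: opp_def)
      ultimately show ?thesis using vin[of "opp p"] unfolding R_def by (auto simp: walk_end_def)
    qed
    obtain p0 where p0: "p0 \<in> v" using partition_onD3[OF part] v by (metis ex_in_conv)
    have p0E: "p0 \<in> edges G \<times> UNIV" "opp p0 \<in> edges G \<times> UNIV" using sub[OF v p0] by (auto simp: opp_def)
    \<comment> \<open>Walks are nonempty lists, so \<open>v\<close> is reached from itself by going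
      back and forth along one edge.\<close>
    have "walk G [p0, opp p0]" "walk_start G [p0, opp p0] = v" "walk_end G [p0, opp p0] = v"
      using p0E vo[OF v p0] by (auto simp: walk_def walk_start_def walk_end_def)
    then have vR: "v \<in> R" using v unfolding R_def by blast
    define Y where "Y = {e \<in> edges G. vertex_of G (e, False) \<in> R}"
    have iff: "vertex_of G p \<in> R \<longleftrightarrow> fst p \<in> Y" if p: "p \<in> edges G \<times> UNIV" for p
    proof -
      obtain e b where [simp]: "p = (e, b)" by (cases p)
      have e: "e \<in> edges G" using p by simp
      show ?thesis using step[of "(e, False)"] step[of "(e, True)"] e by (cases b) (auto simp: Y_def)
    qed
    have "Y = edges G"
    proof (rule conn)
      show "Y \<noteq> {}" using iff[OF p0E(1)] vo[OF v p0] vR by auto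
      fix w assume w: "w \<in> verts G"
      show "w \<subseteq> Y \<times> UNIV \<or> w \<inter> Y \<times> UNIV = {}"
      proof (cases "w \<in> R")
        case True
        have "p \<in> Y \<times> UNIV" if "p \<in> w" for p
          using iff[OF sub[OF w that]] vo[OF w that] True by (simp add: mem_Times_iff)
        then show ?thesis by blast
      next
        case False
        have "p \<notin> Y \<times> UNIV" if "p \<in> w" for p
          using iff[OF sub[OF w that]] vo[OF w that] False by (simp add: mem_Times_iff)
        then show ?thesis by blast
      qed
    qed (auto simp: Y_def)
    obtain p where p: "p \<in> w" using partition_onD3[OF part] w by (metis ex_in_conv)
    have "w \<in> R" using iff[OF sub[OF w p]] vo[OF w p] sub[OF w p] \<open>Y = edges G\<close> by (simp add: mem_Times_iff)
    then show ?thesis by (auto simp: R_def)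
  qed
  then show ?thesis using fin ne lp part unfolding compact_metric_graph_def by blast
qed

text \<open>A vertex on a cycle contains at least two endpoints of edges of the cycle, so no vertex
  meets the edge set of a cycle exactly once. This converse of \<open>prune\<close> is how attached
  and subdivided graphs are shown to be trees.\<close>

lemma (in mgraph) acyclicI:
  assumes ac: "\<And>Y. Y \<subseteq> edges G \<Longrightarrow> Y \<noteq> {} \<Longrightarrow> \<exists>w\<in>verts G. \<exists>p. w \<inter> Y \<times> UNIV = {p}"
  shows "\<not> is_cycle G ps"
proof
  assume c: "is_cycle G ps"
  define n where "n = length ps"
  have w: "set ps \<subseteq> edges G \<times> UNIV" and ne: "ps \<noteq> []"
    and suc: "\<And>i. Suc i < n \<Longrightarrow> vertex_of G (opp (ps ! i)) = vertex_of G (ps ! Suc i)"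
    and clo: "vertex_of G (opp (ps ! (n - 1))) = vertex_of G (ps ! 0)"
    and dist: "distinct (map fst ps)"
    using c by (auto simp: is_cycle_def walk_def successively_conv_nth walk_end_def walk_start_def n_def hd_conv_nth last_conv_nth)
  have n: "0 < n" using ne by (simp add: n_def)
  have inj: "i = j" if "i < n" "j < n" "fst (ps ! i) = fst (ps ! j)" for i j
    using dist that by (auto simp: distinct_conv_nth n_def)
  have nxt: "\<exists>j<n. vertex_of G (opp (ps ! i)) = vertex_of G (ps ! j)" if "i < n" for i
  proof (cases "Suc i < n")
    case True
    then show ?thesis using suc by blast
  next
    case False
    then have "i = n - 1" using that by simp
    then show ?thesis using clo n by blast
  qed
  have prv: "\<exists>j<n. vertex_of G (opp (ps ! j)) = vertex_of G (ps ! i)" if "i < n" for i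
  proof (cases i)
    case 0
    then show ?thesis using clo n by (metis diff_less zero_less_one)
  next
    case (Suc m)
    then show ?thesis using suc[of m] that by (metis Suc_lessD)
  qed
  define Y where "Y = fst ` set ps"
  have YE: "Y \<subseteq> edges G" "Y \<noteq> {}" using w ne by (auto simp: Y_def)
  then obtain w p where wp: "w \<in> verts G" "w \<inter> Y \<times> UNIV = {p}" using ac by blast
  have psY: "ps ! i \<in> Y \<times> UNIV" "opp (ps ! i) \<in> Y \<times> UNIV" if "i < n" for i
    using that by (auto simp: Y_def mem_Times_iff n_def)
  have only: "p' = p" if "p' \<in> Y \<times> UNIV" "vertex_of G p' = w" for p'
    using vertex_of_in[of p'] that wp(2) YE by auto
  have pw: "p \<in> w" "p \<in> Y \<times> UNIV" using wp by auto
  then have vp: "vertex_of G p = w" using vertex_of_eq[OF wp(1)] by blast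
  obtain i where i: "i < n" "fst p = fst (ps ! i)" using pw(2) by (auto simp: Y_def in_set_conv_nth n_def)
  then consider "p = ps ! i" | "p = opp (ps ! i)" by (cases p; cases "ps ! i") (auto simp: opp_def)
  then show False
  proof cases
    case 1
    obtain j where j: "j < n" "vertex_of G (opp (ps ! j)) = vertex_of G (ps ! i)" using prv[OF i(1)] by blast
    then have "opp (ps ! j) = p" using only[OF psY(2)[OF j(1)]] j(2) vp 1 by simp
    then have *: "opp (ps ! j) = ps ! i" using 1 by simp
    then have "fst (ps ! j) = fst (ps ! i)" using arg_cong[OF *, of fst] unfolding opp_simps by simp
    then have "j = i" by (rule inj[OF j(1) i(1)])
    then show False using * opp_simps(4)[of "ps ! i"] by simp
  next
    case 2
    obtain j where j: "j < n" "vertex_of G (opp (ps ! i)) = vertex_of G (ps ! j)" using nxt[OF i(1)] by blast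
    then have "ps ! j = p" using only[OF psY(1)[OF j(1)]] j(2) vp 2 by simp
    then have *: "ps ! j = opp (ps ! i)" using 2 by simp
    then have "j = i" using inj[OF j(1) i(1)] by simp
    then show False using * opp_simps(4)[of "ps ! i"] by simp
  qed
qed

section \<open>Pruning, branches and orientation of a tree\<close>

locale mtree = mgraph G for G :: "'e metric_graph" +
  assumes acyc: "\<not> is_cycle G ps"
begin

text \<open>A longest path inside \<open>Y\<close> starting at \<open>v0\<close>, or anywhere if \<open>v0\<close> is not incident with \<open>Y\<close>,
  ends in such a vertex.\<close>

lemma prune:
  assumes v0: "v0 \<in> verts G" and Y: "Y \<subseteq> edges G" "Y \<noteq> {}"
  shows "\<exists>w\<in>verts G. w \<noteq> v0 \<and> (\<exists>p. w \<inter> Y \<times> UNIV = {p})"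
proof (rule ccontr)
  assume "\<not> ?thesis"
  then have no: "\<And>w p. w \<in> verts G \<Longrightarrow> w \<noteq> v0 \<Longrightarrow> w \<inter> Y \<times> UNIV \<noteq> {p}" by blast
  have YE: "p \<in> edges G \<times> UNIV" if "p \<in> Y \<times> UNIV" for p using that Y by auto
  have oppY: "opp p \<in> Y \<times> UNIV" if "p \<in> Y \<times> UNIV" for p using that by (auto simp: opp_def)
  \<comment> \<open>If no pruning vertex exists, every path can be prolonged, so paths with distinct
    edges of any length exist in \<open>Y\<close>; the length card Y + 1 is a contradiction.\<close>
  have paths: "\<exists>ps. length ps = Suc n \<and> Defs.simple_path G ps \<and> set ps \<subseteq> Y \<times> UNIV \<and> distinct (map fst ps) \<and>
    (walk_start G ps = v0 \<or> v0 \<inter> Y \<times> UNIV = {})" for n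
  proof (induction n)
    case 0
    have "\<exists>p\<in>Y \<times> UNIV. p \<in> v0 \<or> v0 \<inter> Y \<times> UNIV = {}" using Y by blast
    then obtain p where p: "p \<in> Y \<times> UNIV" "p \<in> v0 \<or> v0 \<inter> Y \<times> UNIV = {}" by blast
    have "vertex_of G p \<noteq> vertex_of G (opp p)"
    proof
      assume "vertex_of G p = vertex_of G (opp p)"
      then have "is_cycle G [p]" using YE[OF p(1)] by (auto simp: is_cycle_def walk_def walk_end_def walk_start_def)
      then show False using acyc by blast
    qed
    then have "Defs.simple_path G [p]" using YE[OF p(1)] by (auto simp: Defs.simple_path_def walk_def walk_end_def)
    moreover have "walk_start G [p] = v0 \<or> v0 \<inter> Y \<times> UNIV = {}"
      using p(2) vertex_of_eq[OF v0, of p] unfolding walk_start_def list.sel(1) by blast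
    ultimately show ?case using p(1) by (intro exI[of _ "[p]"]) auto
  next
    case (Suc n)
    then obtain ps where ps: "length ps = Suc n" "Defs.simple_path G ps" "set ps \<subseteq> Y \<times> UNIV" "distinct (map fst ps)"
      and st: "walk_start G ps = v0 \<or> v0 \<inter> Y \<times> UNIV = {}" by blast
    have ne: "ps \<noteq> []" using ps(1) by auto
    define w where "w = walk_end G ps"
    have wk: "walk G ps" and dv: "distinct (map (vertex_of G) ps @ [w])" using ps(2) by (auto simp: Defs.simple_path_def w_def)
    have wn: "w \<notin> vertex_of G ` set ps" using dv by simp
    have lY: "opp (last ps) \<in> Y \<times> UNIV" using oppY ps(3) last_in_set[OF ne] by blast
    have wv: "w \<in> verts G" "opp (last ps) \<in> w"
      using vertex_of_in[OF YE[OF lY]] by (auto simp: w_def walk_end_def)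
    have "w \<noteq> v0"
    proof
      assume "w = v0"
      then have "walk_start G ps = w" using st wv lY by auto
      then show False using wn hd_in_set[OF ne] by (auto simp: walk_start_def)
    qed
    then obtain p' where p': "p' \<in> w" "p' \<in> Y \<times> UNIV" "p' \<noteq> opp (last ps)"
      using no[OF wv(1), of "opp (last ps)"] wv(2) lY by blast
    have vp': "vertex_of G p' = w" by (rule vertex_of_eq[OF wv(1) p'(1)])
    define qs where "qs = ps @ [p']"
    have wq: "walk G qs" using wk YE[OF p'(2)] vp' ne
      by (auto simp: qs_def walk_def successively_append_iff w_def walk_end_def)
    have "fst p' \<notin> fst ` set ps"
    proof
      assume "fst p' \<in> fst ` set ps"
      then obtain i where i: "i < length ps" "fst p' = fst (ps ! i)" by (auto simp: in_set_conv_nth)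
      then consider "p' = ps ! i" | "p' = opp (ps ! i)" by (cases p'; cases "ps ! i") (auto simp: opp_def)
      then show False
      proof cases
        case 1
        then show False using wn vp' i(1) by auto
      next
        case 2
        show False
        proof (cases "Suc i < length ps")
          case True
          then have "w = vertex_of G (ps ! Suc i)"
            using wk vp' 2 by (auto simp: walk_def successively_conv_nth)
          then show False using wn True by auto
        next
          case False
          then have "ps ! i = last ps" using i(1) ne by (simp add: last_conv_nth not_less) (metis One_nat_def Suc_leI diff_Suc_1 le_antisym)
          then show False using 2 p'(3) by simp
        qed
      qed
    qed
    then have dq: "distinct (map fst qs)" using ps(4) by (auto simp: qs_def)
    define w' where "w' = vertex_of G (opp p')"
    have mv: "map (vertex_of G) qs = map (vertex_of G) ps @ [w]" using vp' by (simp add: qs_def)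
    \<comment> \<open>Returning to the vertex visited at position i would close the cycle
      \<open>drop i qs\<close>.\<close>
    have "w' \<notin> set (map (vertex_of G) qs)"
    proof
      assume "w' \<in> set (map (vertex_of G) qs)"
      then obtain i where i: "i < length qs" "vertex_of G (qs ! i) = w'" by (auto simp: in_set_conv_nth)
      have lst: "last (drop i qs) = p'" using i(1) by (simp add: last_drop) (simp add: qs_def)
      have "is_cycle G (drop i qs)" unfolding is_cycle_def
      proof (intro conjI)
        show "walk G (drop i qs)" using wq i(1) unfolding walk_def successively_conv_nth
          by (auto dest: in_set_dropD)
        show "walk_end G (drop i qs) = walk_start G (drop i qs)"
          using i lst by (simp add: walk_end_def walk_start_def hd_drop_conv_nth w'_def)
        show "distinct (map (vertex_of G) (drop i qs))"
          using distinct_drop[OF dv, of i] by (simp only: drop_map[symmetric] mv)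
        show "distinct (map fst (drop i qs))" using dq by (simp add: drop_map[symmetric])
      qed
      then show False using acyc by blast
    qed
    then have "Defs.simple_path G qs" using wq dv unfolding Defs.simple_path_def mv
      by (auto simp: walk_end_def qs_def w'_def vp')
    moreover have "walk_start G qs = walk_start G ps" using ne by (simp add: qs_def walk_start_def)
    ultimately show ?case using ps p' dq st by (intro exI[of _ qs]) (auto simp: qs_def)
  qed
  obtain ps where ps: "length ps = Suc (card Y) \<and> Defs.simple_path G ps \<and> set ps \<subseteq> Y \<times> UNIV \<and>
      distinct (map fst ps) \<and> (walk_start G ps = v0 \<or> v0 \<inter> Y \<times> UNIV = {})"
    using paths[of "card Y"] by (rule exE)
  have finY: "finite Y" by (rule finite_subset[OF Y(1) fin_edges])
  have "set (map fst ps) \<subseteq> Y" using conjunct1[OF conjunct2[OF conjunct2[OF ps]]] by auto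
  then  have "card (set (map fst ps)) \<le> card Y" using finY by (intro card_mono)
  moreover have "card (set (map fst ps)) = length (map fst ps)" using ps by (intro distinct_card) simp
  ultimately show False using ps by simp
qed

text \<open>For every endpoint \<open>p\<close> at \<open>v0\<close>, the edges \<open>e\<close> with \<open>\<beta> e = p\<close> form the branch through \<open>p\<close>.\<close>

lemma branches:
  assumes v0: "v0 \<in> verts G"
  shows "\<exists>\<beta>. (\<forall>w\<in>verts G. w \<noteq> v0 \<longrightarrow> (\<forall>p\<in>w. \<forall>p'\<in>w. \<beta> (fst p) = \<beta> (fst p'))) \<and> (\<forall>p\<in>v0. \<beta> (fst p) = p)"
proof -
  have "\<exists>\<beta>. (\<forall>w\<in>verts G. w \<noteq> v0 \<longrightarrow> (\<forall>p\<in>w \<inter> Y \<times> UNIV. \<forall>p'\<in>w \<inter> Y \<times> UNIV. \<beta> (fst p) = \<beta> (fst p'))) \<and>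
    (\<forall>p\<in>v0 \<inter> Y \<times> UNIV. \<beta> (fst p) = p)" if "Y \<subseteq> edges G" for Y
    using finite_subset[OF that fin_edges] that
  proof (induction Y rule: finite_psubset_induct)
    case (psubset Y)
    show ?case
    proof (cases "Y = {}")
      case False
      then obtain w p where w: "w \<in> verts G" "w \<noteq> v0" "w \<inter> Y \<times> UNIV = {p}"
        using prune[OF v0 psubset.prems] by blast
      define e where "e = fst p"
      have "p \<in> w \<inter> Y \<times> UNIV" using w(3) by simp
      then have e: "e \<in> Y" and pw: "p \<in> w" by (simp_all add: e_def mem_Times_iff)
      have "Y - {e} \<subset> Y" "Y - {e} \<subseteq> edges G" using e psubset.prems by auto
      from psubset.IH[OF this] obtain \<beta> where B:
        "(\<forall>w\<in>verts G. w \<noteq> v0 \<longrightarrow> (\<forall>p\<in>w \<inter> (Y - {e}) \<times> UNIV. \<forall>p'\<in>w \<inter> (Y - {e}) \<times> UNIV. \<beta> (fst p) = \<beta> (fst p'))) \<and>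
          (\<forall>p\<in>v0 \<inter> (Y - {e}) \<times> UNIV. \<beta> (fst p) = p)"
        by (rule exE)
      have b1: "\<beta> (fst q) = \<beta> (fst q')"
        if "u \<in> verts G" "u \<noteq> v0" "q \<in> u \<inter> (Y - {e}) \<times> UNIV" "q' \<in> u \<inter> (Y - {e}) \<times> UNIV" for u q q'
        by (rule bspec[OF bspec[OF mp[OF bspec[OF conjunct1[OF B] that(1)] that(2)] that(3)] that(4)])
      have b2: "\<beta> (fst q) = q" if "q \<in> v0 \<inter> (Y - {e}) \<times> UNIV" for q
        by (rule bspec[OF conjunct2[OF B] that])
      define u where "u = vertex_of G (opp p)"
      have oY: "opp p \<in> Y \<times> UNIV" using e by (simp add: e_def mem_Times_iff)
      have "opp p \<in> edges G \<times> UNIV" using oY psubset.prems by (auto simp: mem_Times_iff)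
      note u = vertex_of_in[OF this, folded u_def]
      \<comment> \<open>The pruned edge \<open>e\<close> hangs on the rest of \<open>Y\<close> at
        \<open>u\<close> and inherits its label there: its own endpoint if that lies in
        \<open>v0\<close>, otherwise the common label of the other edges at \<open>u\<close>. If
        there are none, the label is arbitrary and harmless.\<close>
      define c where "c = (if opp p \<in> v0 then opp p else \<beta> (fst (SOME q. q \<in> u \<inter> (Y - {e}) \<times> UNIV)))"
      have cq: "\<beta> (fst q) = c" if q: "q \<in> u \<inter> (Y - {e}) \<times> UNIV" and "u \<noteq> v0" for q
      proof -
        have "opp p \<notin> v0" using vert_unique[OF u(1) v0 u(2)] that(2) by blast
        moreover have "(SOME q. q \<in> u \<inter> (Y - {e}) \<times> UNIV) \<in> u \<inter> (Y - {e}) \<times> UNIV" using q by (rule someI)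
        ultimately show ?thesis unfolding c_def using b1[OF u(1) that(2) q] by simp
      qed
      have ends: "q = p \<or> q = opp p" if "fst q = e" for q using that by (cases q; cases p) (auto simp: e_def opp_def)
      have other: "z = u" if "z \<in> verts G" "q \<in> z" "fst q = e" "z \<noteq> w" for z q
      proof -
        have "q \<noteq> p" using vert_unique[OF that(1) w(1) that(2)] pw that(4) by blast
        then have "q = opp p" using ends[OF that(3)] by blast
        then show ?thesis using vert_unique[OF that(1) u(1) that(2)] u(2) by blast
      qed
      show ?thesis
      proof (intro exI[of _ "\<beta>(e := c)"] conjI ballI impI)
        fix z q q' assume z: "z \<in> verts G" "z \<noteq> v0" "q \<in> z \<inter> Y \<times> UNIV" "q' \<in> z \<inter> Y \<times> UNIV"
        show "(\<beta>(e := c)) (fst q) = (\<beta>(e := c)) (fst q')"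
        proof (cases "z = w")
          case True
          then have "q = p" "q' = p" using z w(3) by auto
          then show ?thesis by simp
        next
          case False
          have m: "r \<in> z \<inter> (Y - {e}) \<times> UNIV" if "r \<in> z \<inter> Y \<times> UNIV" "fst r \<noteq> e" for r
            using that by (auto simp: mem_Times_iff)
          show ?thesis
            using b1[OF z(1,2) m m, OF z(3) _ z(4)] cq[of q] cq[of q'] m[OF z(3)] m[OF z(4)]
              other[OF z(1) _ _ False, of q] other[OF z(1) _ _ False, of q'] z(2-4)
            by (cases "fst q = e"; cases "fst q' = e") auto
        qed
      next
        fix q assume q: "q \<in> v0 \<inter> Y \<times> UNIV"
        show "(\<beta>(e := c)) (fst q) = q"
        proof (cases "fst q = e")
          case True
          have "q \<noteq> p" using vert_unique[OF v0 w(1)] q pw w(2) by blast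
          then have "q = opp p" using ends[OF True] by blast
          then show ?thesis using q True by (simp add: c_def)
        next
          case False
          then show ?thesis using b2[of q] q by (simp add: mem_Times_iff)
        qed
      qed
    qed auto
  qed
  from this[OF order_refl] obtain \<beta> where
    B: "(\<forall>w\<in>verts G. w \<noteq> v0 \<longrightarrow> (\<forall>p\<in>w \<inter> edges G \<times> UNIV. \<forall>p'\<in>w \<inter> edges G \<times> UNIV. \<beta> (fst p) = \<beta> (fst p'))) \<and>
    (\<forall>p\<in>v0 \<inter> edges G \<times> UNIV. \<beta> (fst p) = p)" by (rule exE)
  have eq: "w \<inter> edges G \<times> UNIV = w" if "w \<in> verts G" for w using vert_sub[OF that] by (rule Int_absorb2)
  show ?thesis
  proof (intro exI[of _ \<beta>] conjI ballI impI)
    fix w p p' assume w: "w \<in> verts G" "w \<noteq> v0" "p \<in> w" "p' \<in> w"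
    show "\<beta> (fst p) = \<beta> (fst p')"
      using mp[OF bspec[OF conjunct1[OF B] w(1)] w(2)] w(3,4) unfolding eq[OF w(1)] by blast
  qed (use conjunct2[OF B] eq[OF v0] in auto)
qed

text \<open>\<open>bt e\<close> marks the end of \<open>e\<close> that points away from
  \<open>v0\<close>, and \<open>s\<close> is the distance from \<open>v0\<close>. Both are defined
  by undoing the pruning: the edge removed at \<open>w\<close> has its outer end there, and no other
  remaining edge touches \<open>w\<close>.\<close>

lemma orientation:
  assumes v0: "v0 \<in> verts G"
  shows "\<exists>bt s. s v0 = 0 \<and>
    (\<forall>e\<in>edges G. s (vertex_of G (e, bt e)) = s (vertex_of G (e, \<not> bt e)) + len G e \<and> vertex_of G (e, bt e) \<noteq> v0) \<and>
    (\<forall>e\<in>edges G. \<forall>e'\<in>edges G. vertex_of G (e, bt e) = vertex_of G (e', bt e') \<longrightarrow> e = e')"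
proof -
  have "\<exists>bt s. s v0 = 0 \<and>
    (\<forall>e\<in>Y. s (vertex_of G (e, bt e)) = s (vertex_of G (e, \<not> bt e)) + len G e \<and> vertex_of G (e, bt e) \<noteq> v0) \<and>
    (\<forall>e\<in>Y. \<forall>e'\<in>Y. vertex_of G (e, bt e) = vertex_of G (e', bt e') \<longrightarrow> e = e')" if "Y \<subseteq> edges G" for Y
    using finite_subset[OF that fin_edges] that
  proof (induction Y rule: finite_psubset_induct)
    case (psubset Y)
    show ?case
    proof (cases "Y = {}")
      case False
      then obtain w p where w: "w \<in> verts G" "w \<noteq> v0" "w \<inter> Y \<times> UNIV = {p}"
        using prune[OF v0 psubset.prems] by blast
      define e where "e = fst p"
      have "p \<in> w \<inter> Y \<times> UNIV" using w(3) by simp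
      then have e: "e \<in> Y" and pw: "p \<in> w" by (simp_all add: e_def mem_Times_iff)
      have "Y - {e} \<subset> Y" "Y - {e} \<subseteq> edges G" using e psubset.prems by auto
      from psubset.IH[OF this] obtain bt where "\<exists>s. s v0 = 0 \<and>
        (\<forall>e'\<in>Y - {e}. s (vertex_of G (e', bt e')) = s (vertex_of G (e', \<not> bt e')) + len G e' \<and> vertex_of G (e', bt e') \<noteq> v0) \<and>
        (\<forall>e'\<in>Y - {e}. \<forall>e''\<in>Y - {e}. vertex_of G (e', bt e') = vertex_of G (e'', bt e'') \<longrightarrow> e' = e'')"
        by (rule exE)
      then obtain s where B: "s v0 = 0 \<and>
        (\<forall>e'\<in>Y - {e}. s (vertex_of G (e', bt e')) = s (vertex_of G (e', \<not> bt e')) + len G e' \<and> vertex_of G (e', bt e') \<noteq> v0) \<and>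
        (\<forall>e'\<in>Y - {e}. \<forall>e''\<in>Y - {e}. vertex_of G (e', bt e') = vertex_of G (e'', bt e'') \<longrightarrow> e' = e'')"
        by (rule exE)
      note bs = conjunct1[OF B] bspec[OF conjunct1[OF conjunct2[OF B]]]
        bspec[OF bspec[OF conjunct2[OF conjunct2[OF B]]], THEN mp]
      have pe: "p = (e, snd p)" by (simp add: e_def)
      have vp: "vertex_of G (e, snd p) = w" using vertex_of_eq[OF w(1) pw] by (simp add: e_def)
      have nw: "vertex_of G q \<noteq> w" if "q \<in> Y \<times> UNIV" "q \<noteq> p" for q
      proof
        assume "vertex_of G q = w"
        moreover have "q \<in> edges G \<times> UNIV" using that(1) psubset.prems by (auto simp: mem_Times_iff)
        ultimately have "q \<in> w \<inter> Y \<times> UNIV" using vertex_of_in(2)[of q] that(1) by simp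
        then show False unfolding w(3) using that(2) by simp
      qed
      have ne: "vertex_of G (e, \<not> snd p) \<noteq> w"
        by (rule nw) (use e in \<open>auto simp: prod_eq_iff\<close>)
      have nw': "vertex_of G (e', b) \<noteq> w" if "e' \<in> Y - {e}" for e' b
        by (rule nw) (use that in \<open>auto simp: e_def\<close>)
      show ?thesis
      proof (intro exI[of _ "bt(e := snd p)"] exI[of _ "s(w := s (vertex_of G (e, \<not> snd p)) + len G e)"] conjI ballI impI)
        show "(s(w := s (vertex_of G (e, \<not> snd p)) + len G e)) v0 = 0" using bs(1) w(2) by simp
      next
        fix e' assume e': "e' \<in> Y"
        show "(s(w := s (vertex_of G (e, \<not> snd p)) + len G e)) (vertex_of G (e', (bt(e := snd p)) e')) =
          (s(w := s (vertex_of G (e, \<not> snd p)) + len G e)) (vertex_of G (e', \<not> (bt(e := snd p)) e')) + len G e'"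
          using e' vp ne nw'[of e'] bs(2)[of e'] by (cases "e' = e") auto
        show "vertex_of G (e', (bt(e := snd p)) e') \<noteq> v0"
          using e' vp w(2) bs(2)[of e'] by (cases "e' = e") auto
      next
        fix e1 e2 assume e12: "e1 \<in> Y" "e2 \<in> Y"
          "vertex_of G (e1, (bt(e := snd p)) e1) = vertex_of G (e2, (bt(e := snd p)) e2)"
        then show "e1 = e2" using vp nw'[of e1] nw'[of e2] bs(3)[of e1 e2]
          by (cases "e1 = e"; cases "e2 = e") auto
      qed
    qed (auto intro: exI[of _ "\<lambda>_. 0"])
  qed
  from this[OF order_refl] show ?thesis .
qed

end

lemma metric_tree_mtree: "metric_tree G \<Longrightarrow> mtree G"
  by (simp add: metric_tree_def mtree_def mgraph_def mtree_axioms_def)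

lemma metric_treeI:
  assumes fin: "finite (edges G)" and ne: "edges G \<noteq> {}" and lp: "\<And>e. e \<in> edges G \<Longrightarrow> 0 < len G e"
    and part: "partition_on (edges G \<times> UNIV) (verts G)"
    and conn: "\<And>Y. Y \<subseteq> edges G \<Longrightarrow> Y \<noteq> {} \<Longrightarrow>
      (\<And>v. v \<in> verts G \<Longrightarrow> v \<subseteq> Y \<times> UNIV \<or> v \<inter> Y \<times> UNIV = {}) \<Longrightarrow> Y = edges G"
    and ac: "\<And>Y. Y \<subseteq> edges G \<Longrightarrow> Y \<noteq> {} \<Longrightarrow> \<exists>w\<in>verts G. \<exists>p. w \<inter> Y \<times> UNIV = {p}"
  shows "metric_tree G"
proof -
  have c: "compact_metric_graph G" by (rule compact_metric_graphI[OF fin ne lp part conn])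
  then interpret mgraph G by unfold_locales
  show ?thesis unfolding metric_tree_def using c acyclicI[OF ac] by blast
qed

section \<open>Attached edges, rooted trees and convex potentials\<close>

lemma attach_simps [simp]:
  "edges (attach_at_vertex G v e l) = insert e (edges G)"
  "len (attach_at_vertex G v e l) = (len G)(e := l)"
  "verts (attach_at_vertex G v e l) = insert {(e, True)} (insert (insert (e, False) v) (verts G - {v}))"
  by (simp_all add: attach_at_vertex_def)

text \<open>For acyclicity, an edge set with the new edge meets the new leaf exactly once. Any other
  edge set is pruned in \<open>G\<close> at a vertex different from \<open>v\<close>, since the
  class \<open>v\<close> is the only old one that changes.\<close>

lemma attach_tree:
  assumes t: "metric_tree G" and v: "v \<in> verts G" and e: "e \<notin> edges G" and l: "0 < l"
  shows "metric_tree (attach_at_vertex G v e l)"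
proof -
  interpret mtree G by (rule metric_tree_mtree[OF t])
  have ni: "(e, b) \<notin> w" if "w \<in> verts G" for w b using vert_sub[OF that] e by auto
  have Un: "\<Union>(verts G) = edges G \<times> UNIV" using partition_onD1[OF part] by simp
  show ?thesis
  proof (rule metric_treeI; (unfold attach_simps)?)
    show "finite (insert e (edges G))" "insert e (edges G) \<noteq> {}" by simp_all
    show "0 < ((len G)(e := l)) e'" if "e' \<in> insert e (edges G)" for e'
      using that l len_pos[of e'] by auto
    show "partition_on (insert e (edges G) \<times> UNIV) (insert {(e, True)} (insert (insert (e, False) v) (verts G - {v})))"
      unfolding partition_on_def
    proof (intro conjI)
      have "\<Union>(insert {(e, True)} (insert (insert (e, False) v) (verts G - {v}))) = {(e, True), (e, False)} \<union> \<Union>(verts G)"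
        using v by auto
      also have "\<dots> = insert e (edges G) \<times> UNIV" unfolding Un by (auto simp: UNIV_bool)
      finally show "\<Union>(insert {(e, True)} (insert (insert (e, False) v) (verts G - {v}))) = insert e (edges G) \<times> UNIV" .
      have d: "a \<inter> b = {}" if "a \<in> verts G" "b \<in> verts G" "a \<noteq> b" for a b
        using vert_unique[OF that(1,2)] that(3) by blast
      have "v \<inter> b = {}" if "b \<in> verts G - {v}" for b using d[OF v, of b] that by auto
      moreover have "a \<inter> v = {}" if "a \<in> verts G - {v}" for a using d[of a v] v that by auto
      ultimately show "disjoint (insert {(e, True)} (insert (insert (e, False) v) (verts G - {v})))"
        unfolding disjoint_def using d ni ni[OF v] by simp
      show "{} \<notin> insert {(e, True)} (insert (insert (e, False) v) (verts G - {v}))"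
        using vert_ne by auto
    qed
  next
    fix Y assume Y: "Y \<subseteq> insert e (edges G)" "Y \<noteq> {}"
      and sat: "\<And>w. w \<in> insert {(e, True)} (insert (insert (e, False) v) (verts G - {v})) \<Longrightarrow>
         w \<subseteq> Y \<times> UNIV \<or> w \<inter> Y \<times> UNIV = {}"
    have sv: "insert (e, False) v \<subseteq> Y \<times> UNIV \<or> insert (e, False) v \<inter> Y \<times> UNIV = {}"
      by (rule sat) simp
    obtain p where p: "p \<in> v" using vert_ne[OF v] by blast
    have pE: "fst p \<in> edges G" using vert_sub[OF v] p by auto
    have ne: "Y \<inter> edges G \<noteq> {}"
    proof
      assume z: "Y \<inter> edges G = {}"
      then have "Y = {e}" using Y by auto
      then have "p \<in> Y \<times> UNIV" using sv p by auto
      then show False using z pE by (auto simp: mem_Times_iff)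
    qed
    have "Y \<inter> edges G = edges G"
    proof (rule connected_edges)
      fix w assume w: "w \<in> verts G"
      have wE: "w \<subseteq> edges G \<times> UNIV" by (rule vert_sub[OF w])
      have "w \<subseteq> Y \<times> UNIV \<or> w \<inter> Y \<times> UNIV = {}"
      proof (cases "w = v")
        case True
        then show ?thesis using sv by blast
      next
        case False
        then show ?thesis using sat[of w] w by simp
      qed
      then show "w \<subseteq> (Y \<inter> edges G) \<times> UNIV \<or> w \<inter> (Y \<inter> edges G) \<times> UNIV = {}" using wE by blast
    qed (use ne in auto)
    then have EY: "edges G \<subseteq> Y" by auto
    then have "p \<in> Y \<times> UNIV" using pE by (auto simp: mem_Times_iff)
    then have "insert (e, False) v \<subseteq> Y \<times> UNIV" using sv p by blast
    then show "Y = insert e (edges G)" using EY Y by auto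
  next
    fix Y assume Y: "Y \<subseteq> insert e (edges G)" "Y \<noteq> {}"
    show "\<exists>w\<in>insert {(e, True)} (insert (insert (e, False) v) (verts G - {v})). \<exists>p. w \<inter> Y \<times> UNIV = {p}"
    proof (cases "e \<in> Y")
      case True
      then have "{(e, True)} \<inter> Y \<times> UNIV = {(e, True)}" by auto
      then show ?thesis by (intro bexI[of _ "{(e, True)}"] exI[of _ "(e, True)"]) simp_all
    next
      case False
      then have "Y \<subseteq> edges G" using Y by auto
      from prune[OF v this Y(2)] obtain w p where w: "w \<in> verts G" "w \<noteq> v" "w \<inter> Y \<times> UNIV = {p}" by blast
      show ?thesis by (rule bexI[of _ w], rule exI[of _ p], rule w(3)) (use w in simp)
    qed
  qed
qed

lemma subdivide_simps [simp]:
  "edges (subdivide G e a e') = insert e' (edges G)"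
  "len (subdivide G e a e') = (len G)(e := a, e' := len G e - a)"
  by (simp_all add: subdivide_def)

text \<open>An edge set with just one half of \<open>e0\<close> meets the new vertex once. Otherwise
  dropping \<open>e1\<close> gives an edge set of \<open>G\<close>, and the vertex found there by
  pruning is carried over by \<open>h\<close>, which moves the far end of \<open>e0\<close> to
  \<open>e1\<close>.\<close>

lemma subdivide_tree:
  assumes t: "metric_tree G" and e0: "e0 \<in> edges G" and a: "0 < a" "a < len G e0" and e1: "e1 \<notin> edges G"
  shows "metric_tree (subdivide G e0 a e1)"
proof -
  interpret mtree G by (rule metric_tree_mtree[OF t])
  define h where "h w = (if (e0, True) \<in> w then insert (e1, True) (w - {(e0, True)}) else w)" for w
  define m where "m = {(e0, True), (e1, False)}"
  have V: "verts (subdivide G e0 a e1) = insert m (h ` verts G)" by (simp add: subdivide_def h_def m_def)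
  have ne01: "e0 \<noteq> e1" using e0 e1 by auto
  have ni: "(e1, b) \<notin> w" if "w \<in> verts G" for w b using vert_sub[OF that] e1 by auto
  have Un: "\<Union>(verts G) = edges G \<times> UNIV" using partition_onD1[OF part] by simp
  have hi: "p \<in> h w \<longleftrightarrow> p = (e1, True) \<and> (e0, True) \<in> w \<or> p \<in> w \<and> p \<noteq> (e0, True)" for p w
    by (auto simp: h_def)
  show ?thesis
  proof (rule metric_treeI; (unfold subdivide_simps V)?)
    show "finite (insert e1 (edges G))" "insert e1 (edges G) \<noteq> {}" by simp_all
    show "0 < ((len G)(e0 := a, e1 := len G e0 - a)) e'" if "e' \<in> insert e1 (edges G)" for e'
      using that a len_pos[of e'] by auto
    show "partition_on (insert e1 (edges G) \<times> UNIV) (insert m (h ` verts G))"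
      unfolding partition_on_def
    proof (intro conjI)
      show "\<Union>(insert m (h ` verts G)) = insert e1 (edges G) \<times> UNIV"
      proof (intro set_eqI)
        fix p
        have "p \<in> \<Union>(insert m (h ` verts G)) \<longleftrightarrow> p \<in> m \<or> (\<exists>w\<in>verts G. p \<in> h w)" by auto
        also have "(\<exists>w\<in>verts G. p \<in> h w) \<longleftrightarrow> p = (e1, True) \<and> (e0, True) \<in> \<Union>(verts G) \<or> p \<in> \<Union>(verts G) \<and> p \<noteq> (e0, True)"
          unfolding hi by blast
        finally show "p \<in> \<Union>(insert m (h ` verts G)) \<longleftrightarrow> p \<in> insert e1 (edges G) \<times> UNIV"
          unfolding Un using e0 by (cases p) (auto simp: m_def)
      qed
      have d: "h w \<inter> h w' = {}" if "w \<in> verts G" "w' \<in> verts G" "h w \<noteq> h w'" for w w'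
      proof -
        have "w \<noteq> w'" using that(3) by auto
        then have no: "\<not> (p \<in> w \<and> p \<in> w')" for p using vert_unique[OF that(1,2)] by blast
        show ?thesis using no ni[OF that(1), of True] ni[OF that(2), of True] by (auto simp: hi)
      qed
      have dm: "m \<inter> h w = {}" if "w \<in> verts G" for w
        using ni[OF that, of False] ne01 by (auto simp: m_def hi)
      then have dm': "h w \<inter> m = {}" if "w \<in> verts G" for w using that by blast
      show "disjoint (insert m (h ` verts G))" unfolding disjoint_def
        using d dm dm' by (simp add: ball_simps)
      have "h w \<noteq> {}" if "w \<in> verts G" for w using vert_ne[OF that] by (auto simp: h_def)
      then show "{} \<notin> insert m (h ` verts G)" by (auto simp: m_def)
    qed
  next
    fix Y assume Y: "Y \<subseteq> insert e1 (edges G)" "Y \<noteq> {}"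
      and sat: "\<And>w. w \<in> insert m (h ` verts G) \<Longrightarrow> w \<subseteq> Y \<times> UNIV \<or> w \<inter> Y \<times> UNIV = {}"
    have "m \<subseteq> Y \<times> UNIV \<or> m \<inter> Y \<times> UNIV = {}" by (rule sat) simp
    then have iff: "e0 \<in> Y \<longleftrightarrow> e1 \<in> Y" by (auto simp: m_def)
    have ne: "Y \<inter> edges G \<noteq> {}" using Y iff e0 by auto
    have "Y \<inter> edges G = edges G"
    proof (rule connected_edges)
      fix w assume w: "w \<in> verts G"
      have wE: "w \<subseteq> edges G \<times> UNIV" by (rule vert_sub[OF w])
      have "h w \<subseteq> Y \<times> UNIV \<or> h w \<inter> Y \<times> UNIV = {}" by (rule sat) (use w in simp)
      then show "w \<subseteq> (Y \<inter> edges G) \<times> UNIV \<or> w \<inter> (Y \<inter> edges G) \<times> UNIV = {}"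
      proof
        assume s: "h w \<subseteq> Y \<times> UNIV"
        have "p \<in> (Y \<inter> edges G) \<times> UNIV" if "p \<in> w" for p
        proof (cases "p = (e0, True)")
          case True
          then have "(e1, True) \<in> h w" using that by (simp add: hi)
          then show ?thesis using s iff e0 True by auto
        next
          case False
          then have "p \<in> h w" using that by (simp add: hi)
          then show ?thesis using s wE that by auto
        qed
        then show ?thesis by blast
      next
        assume s: "h w \<inter> Y \<times> UNIV = {}"
        have "p \<notin> (Y \<inter> edges G) \<times> UNIV" if "p \<in> w" for p
        proof (cases "p = (e0, True)")
          case True
          then have "(e1, True) \<in> h w" using that by (simp add: hi)
          then show ?thesis using s iff True by auto
        next
          case False
          then have "p \<in> h w" using that by (simp add: hi)
          then show ?thesis using s by auto
        qed
        then show ?thesis by blast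
      qed
    qed (use ne in auto)
    then show "Y = insert e1 (edges G)" using Y iff e0 by auto
  next
    fix Y assume Y: "Y \<subseteq> insert e1 (edges G)" "Y \<noteq> {}"
    show "\<exists>w\<in>insert m (h ` verts G). \<exists>p. w \<inter> Y \<times> UNIV = {p}"
    proof (cases "e0 \<in> Y \<longleftrightarrow> e1 \<in> Y")
      case False
      then have "m \<inter> Y \<times> UNIV = {(e0, True)} \<or> m \<inter> Y \<times> UNIV = {(e1, False)}" by (auto simp: m_def)
      then show ?thesis by blast
    next
      case True
      have Y': "Y - {e1} \<subseteq> edges G" "Y - {e1} \<noteq> {}" using Y True ne01 by auto
      obtain v0 where v0: "v0 \<in> verts G" using vertex_of_in(1)[of "(e0, True)"] e0 by auto
      obtain w p where w: "w \<in> verts G" "w \<inter> (Y - {e1}) \<times> UNIV = {p}"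
        using prune[OF v0 Y'] by blast
      have mem: "x \<in> w \<and> fst x \<in> Y - {e1} \<longleftrightarrow> x = p" for x
        using w(2) by (metis IntE IntI UNIV_I insertI1 mem_Times_iff singletonD)
      have "\<exists>p'. h w \<inter> Y \<times> UNIV = {p'}"
      proof (cases "p = (e0, True)")
        case True
        have "x \<in> h w \<inter> Y \<times> UNIV \<longleftrightarrow> x = (e1, True)" for x
          using mem[of x] mem[of p] True \<open>e0 \<in> Y \<longleftrightarrow> e1 \<in> Y\<close> ni[OF w(1)] by (cases x) (auto simp: hi)
        then show ?thesis by blast
      next
        case False
        have "x \<in> h w \<inter> Y \<times> UNIV \<longleftrightarrow> x = p" for x
          using mem[of x] mem[of p] mem[of "(e0, True)"] False \<open>e0 \<in> Y \<longleftrightarrow> e1 \<in> Y\<close> ni[OF w(1)] ne01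
          by (cases x; cases p) (auto simp: hi)
        then show ?thesis by blast
      qed
      then show ?thesis using w(1) by blast
    qed
  qed
qed

section \<open>Simple paths and convex functions on an interval\<close>

context mgraph
begin

definition visited :: "('e \<times> bool) list \<Rightarrow> ('e \<times> bool) set list" where
  "visited ps = map (vertex_of G) ps @ [walk_end G ps]"

lemma visited_opp: "walk G ps \<Longrightarrow> p \<in> set ps \<Longrightarrow> vertex_of G (opp p) \<in> set (visited ps)"
proof (induction ps)
  case (Cons q ps)
  show ?case
  proof (cases ps)
    case Nil
    then show ?thesis using Cons.prems by (simp add: visited_def walk_end_def)
  next
    case (Cons q' ps')
    have w: "walk G ps" "vertex_of G (opp q) = vertex_of G q'" using Cons.prems(1) Cons by (auto simp: walk_def)
    have v: "visited (q # ps) = vertex_of G q # visited ps" using Cons by (simp add: visited_def walk_end_def)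
    show ?thesis
    proof (cases "p = q")
      case True
      then show ?thesis using w(2) Cons by (simp add: visited_def)
    next
      case False
      then show ?thesis using Cons.IH[OF w(1)] Cons.prems(2) v by simp
    qed
  qed
qed simp

lemma simple_path_iff: "Defs.simple_path G ps \<longleftrightarrow> walk G ps \<and> distinct (visited ps)"
  by (simp add: Defs.simple_path_def visited_def)

lemma simple_path_Cons:
  assumes "Defs.simple_path G (p # q # ps)"
  shows "Defs.simple_path G (q # ps)" "vertex_of G (opp p) = vertex_of G q" "p \<in> edges G \<times> UNIV"
    "q \<in> edges G \<times> UNIV" "q \<noteq> opp p" "vertex_of G p \<notin> set (visited (q # ps))"
proof -
  have w: "walk G (p # q # ps)" and d: "distinct (visited (p # q # ps))" using assms by (auto simp: simple_path_iff)
  have v: "visited (p # q # ps) = vertex_of G p # visited (q # ps)" by (simp add: visited_def walk_end_def)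
  have wq: "walk G (q # ps)" using w by (auto simp: walk_def)
  show "Defs.simple_path G (q # ps)" using wq d unfolding simple_path_iff v by simp
  show "vertex_of G (opp p) = vertex_of G q" "p \<in> edges G \<times> UNIV" "q \<in> edges G \<times> UNIV"
    using w by (auto simp: walk_def)
  show n: "vertex_of G p \<notin> set (visited (q # ps))" using d unfolding v by simp
  show "q \<noteq> opp p"
  proof
    assume "q = opp p"
    then show False using visited_opp[OF wq, of q] n by simp
  qed
qed

end

lemma convex_on_eq:
  fixes S :: "real set"
  assumes "convex_on S f" "\<And>x. x \<in> S \<Longrightarrow> f x = g x"
  shows "convex_on S g"
proof -
  have c: "convex S" using assms(1) by (rule convex_on_imp_convex)
  show ?thesis unfolding convex_on_def
  proof (intro conjI ballI allI impI c)
    fix x y u v :: real assume h: "x \<in> S" "y \<in> S" "0 \<le> u" "0 \<le> v" "u + v = 1"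
    have "u *\<^sub>R x + v *\<^sub>R y \<in> S" using c h by (rule convexD)
    then have eq: "f (u *\<^sub>R x + v *\<^sub>R y) = g (u *\<^sub>R x + v *\<^sub>R y)" by (rule assms(2))
    have "f (u *\<^sub>R x + v *\<^sub>R y) \<le> u * f x + v * f y"
      using assms(1) h unfolding convex_on_def by blast
    then show "g (u *\<^sub>R x + v *\<^sub>R y) \<le> u * g x + v * g y" unfolding eq assms(2)[OF h(1)] assms(2)[OF h(2)] .
  qed
qed

lemma convex_on_abs_diff: "convex_on {a..b :: real} (\<lambda>t. \<bar>t - c\<bar>)"
  using convex_on_dist[of "{a..b}" c] by (simp add: dist_real_def abs_minus_commute)

lemma convex_on_affine: "convex_on {a..b :: real} (\<lambda>t. m * t + c)"
  unfolding convex_on_def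
proof (intro conjI ballI allI impI)
  fix x y u v :: real assume "u + v = 1"
  then have v: "v = 1 - u" by simp
  show "m * (u *\<^sub>R x + v *\<^sub>R y) + c \<le> u * (m * x + c) + v * (m * y + c)" unfolding v by (simp add: algebra_simps)
qed simp

lemma convex_on_pos_part: "convex_on {a..b :: real} (\<lambda>t. max 0 (m * t + c))"
proof (cases "m = 0")
  case True
  then show ?thesis using convex_on_affine[of a b 0 "max 0 c"] by simp
next
  case False
  have "convex_on {a..b} (\<lambda>t. (m / 2 * t + c / 2) + \<bar>m\<bar> / 2 * \<bar>t - (- c / m)\<bar>)"
    by (intro convex_on_add convex_on_affine convex_on_cmul convex_on_abs_diff) simp
  then show ?thesis
  proof (rule convex_on_eq)
    fix t
    have "\<bar>m\<bar> * \<bar>t - (- c / m)\<bar> = \<bar>m * t + c\<bar>" using False by (simp add: abs_mult[symmetric] algebra_simps)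
    then show "(m / 2 * t + c / 2) + \<bar>m\<bar> / 2 * \<bar>t - (- c / m)\<bar> = max 0 (m * t + c)"
      by (cases "0 \<le> m * t + c") (simp_all add: max_def field_simps)
  qed
qed

lemma along_scale: "along G (\<lambda>e x. c * q e x) ps t = c * along G q ps t"
  by (induction ps arbitrary: t) auto

section \<open>A convex potential supported on a leaf edge\<close>

locale leaf_edge = mtree G for G :: "'e metric_graph" +
  fixes er :: 'e
  assumes er: "er \<in> edges G" and root: "{(er, True)} \<in> verts G"
begin

text \<open>The perturbation for the case that attaching the edge leaves the second eigenvalue
  unchanged: it grows linearly towards the leaf and vanishes on the rest of the tree.\<close>

definition ramp :: "'e \<Rightarrow> real \<Rightarrow> real" where
  "ramp e x = (if e = er then x else 0)"

lemma vertex_root: "vertex_of G (er, True) = {(er, True)}"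
  by (rule vertex_of_eq[OF root]) simp

lemma vertex_rootD: "p \<in> edges G \<times> UNIV \<Longrightarrow> vertex_of G p = {(er, True)} \<Longrightarrow> p = (er, True)"
  using vertex_of_in(2)[of p] by simp

lemma along_ramp_zero: "er \<notin> fst ` set ps \<Longrightarrow> along G ramp ps t = 0"
  by (induction ps arbitrary: t) (auto simp: ramp_def)

lemma path_not_root:
  assumes "Defs.simple_path G (p # q # ps)"
  shows "p \<noteq> (er, False)" "q \<noteq> (er, True)"
proof -
  note S = simple_path_Cons[OF assms]
  show "q \<noteq> (er, True)"
  proof
    assume q: "q = (er, True)"
    have "opp p \<in> edges G \<times> UNIV" using S(3) by (auto simp: mem_Times_iff)
    moreover have "vertex_of G (opp p) = {(er, True)}" using S(2) vertex_root unfolding q by (rule trans)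
    ultimately have "opp p = (er, True)" by (rule vertex_rootD)
    then show False using S(5) q by simp
  qed
  show "p \<noteq> (er, False)"
  proof
    assume p: "p = (er, False)"
    have "vertex_of G q = {(er, True)}" using S(2) vertex_root p by simp
    then have "q = (er, True)" using S(4) by (intro vertex_rootD)
    then show False using S(5) p by simp
  qed
qed

text \<open>The edge ends in a leaf, so a simple path that does not start at this leaf can use
  \<open>er\<close> only as its last edge. Along the path the ramp is therefore zero first and
  linear afterwards.\<close>

lemma along_ramp:
  assumes "Defs.simple_path G ps" "hd ps \<noteq> (er, True)"
  shows "\<exists>t0\<ge>0. \<forall>t\<in>{0..path_length G ps}. along G ramp ps t = max 0 (t - t0)"
  using assms
proof (induction ps)
  case (Cons p ps)
  have pE: "p \<in> edges G \<times> UNIV" using Cons.prems(1) by (auto simp: simple_path_iff walk_def)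
  then have l: "0 < len G (fst p)" using len_pos by (auto simp: mem_Times_iff)
  show ?case
  proof (cases ps)
    case Nil
    show ?thesis
    proof (cases "fst p = er")
      case True
      then have "p = (er, False)" using Cons.prems(2) by (cases p) auto
      then show ?thesis using Nil by (intro exI[of _ 0]) (auto simp: ramp_def path_length_def)
    next
      case False
      then show ?thesis using Nil l by (intro exI[of _ "len G (fst p)"]) (auto simp: ramp_def path_length_def)
    qed
  next
    case (Cons q qs)
    note sp = Cons.prems(1)[unfolded Cons]
    note S = simple_path_Cons[OF sp] and N = path_not_root[OF sp]
    have "fst p \<noteq> er" using N(1) Cons.prems(2) by (cases p) auto
    have "hd ps \<noteq> (er, True)" using N(2) Cons by simp
    from Cons.IH[OF S(1)[folded Cons] this] obtain t0 where
      t0: "0 \<le> t0" "\<And>t. t \<in> {0..path_length G ps} \<Longrightarrow> along G ramp ps t = max 0 (t - t0)" by blast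
    have "along G ramp (p # ps) t = max 0 (t - (t0 + len G (fst p)))" if "t \<in> {0..path_length G (p # ps)}" for t
      using that t0 \<open>fst p \<noteq> er\<close> by (auto simp: ramp_def path_length_def diff_diff_add add.commute)
    then show ?thesis using t0(1) l by (intro exI[of _ "t0 + len G (fst p)"]) auto
  qed
qed (simp add: simple_path_iff walk_def)

lemma ramp_convex:
  assumes sp: "Defs.simple_path G ps"
  shows "convex_on {0..path_length G ps} (along G ramp ps)"
proof (cases "hd ps = (er, True)")
  case False
  from along_ramp[OF sp False] obtain t0 where
    t0: "\<And>t. t \<in> {0..path_length G ps} \<Longrightarrow> along G ramp ps t = max 0 (t - t0)" by blast
  have "convex_on {0..path_length G ps} (\<lambda>t. max 0 (1 * t + (- t0)))" by (rule convex_on_pos_part)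
  then show ?thesis by (rule convex_on_eq) (simp add: t0)
next
  case True
  have "ps \<noteq> []" using sp by (auto simp: simple_path_iff walk_def)
  then obtain qs where ps: "ps = (er, True) # qs" using True by (cases ps) auto
  have "along G ramp qs t = 0" for t
  proof (cases qs)
    case (Cons q rs)
    note S = simple_path_Cons[OF sp[unfolded ps Cons]]
    have wq: "walk G qs" using S(1) Cons by (simp add: simple_path_iff)
    have "er \<noteq> fst r" if r: "r \<in> set qs" for r
    proof
      assume e: "er = fst r"
      have vq: "{(er, True)} \<notin> set (visited qs)" using S(6) Cons vertex_root by simp
      show False
      proof (cases "snd r")
        case True
        then have "r = (er, True)" using e by (cases r) auto
        then have "{(er, True)} \<in> set (visited qs)"
          using r vertex_root unfolding visited_def by (metis Un_iff image_eqI set_append set_map)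
        then show False using vq by simp
      next
        case False
        then have "r = (er, False)" using e by (cases r) auto
        then show False using visited_opp[OF wq r] vq vertex_root by simp
      qed
    qed
    then show ?thesis by (intro along_ramp_zero) auto
  qed simp
  then have "along G ramp ps = (\<lambda>t. max 0 (- 1 * t + len G er))"
    unfolding ps by (intro ext) (auto simp: ramp_def)
  then show ?thesis by (simp only: convex_on_pos_part)
qed

end

text \<open>A tree rooted in a leaf, with the data of \<open>orientation\<close>:
  \<open>bt e\<close> marks the outer end of \<open>e\<close>, \<open>s\<close> is the distance from
  the root, and \<open>bot_inj\<close> says that no vertex is entered by two edges.\<close>

locale rtree = leaf_edge G er for G :: "'e metric_graph" and er +
  fixes bt :: "'e \<Rightarrow> bool" and s :: "('e \<times> bool) set \<Rightarrow> real"
  assumes s_root: "s {(er, True)} = 0"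
    and s_bot: "e \<in> edges G \<Longrightarrow> s (vertex_of G (e, bt e)) = s (vertex_of G (e, \<not> bt e)) + len G e"
    and bot_not_root: "e \<in> edges G \<Longrightarrow> vertex_of G (e, bt e) \<noteq> {(er, True)}"
    and bot_inj: "e \<in> edges G \<Longrightarrow> e' \<in> edges G \<Longrightarrow> vertex_of G (e, bt e) = vertex_of G (e', bt e') \<Longrightarrow> e = e'"

lemma (in leaf_edge) rtree_exists: "\<exists>bt s. rtree G er bt s"
proof -
  from orientation[OF root] obtain bt where "\<exists>s. s {(er, True)} = 0 \<and>
    (\<forall>e\<in>edges G. s (vertex_of G (e, bt e)) = s (vertex_of G (e, \<not> bt e)) + len G e \<and> vertex_of G (e, bt e) \<noteq> {(er, True)}) \<and>
    (\<forall>e\<in>edges G. \<forall>e'\<in>edges G. vertex_of G (e, bt e) = vertex_of G (e', bt e') \<longrightarrow> e = e')" by (rule exE)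
  then obtain s where B: "s {(er, True)} = 0 \<and>
    (\<forall>e\<in>edges G. s (vertex_of G (e, bt e)) = s (vertex_of G (e, \<not> bt e)) + len G e \<and> vertex_of G (e, bt e) \<noteq> {(er, True)}) \<and>
    (\<forall>e\<in>edges G. \<forall>e'\<in>edges G. vertex_of G (e, bt e) = vertex_of G (e', bt e') \<longrightarrow> e = e')" by (rule exE)
  have "rtree G er bt s"
    by (rule rtree.intro[OF leaf_edge_axioms], unfold rtree_axioms_def) (use B in blast)
  then show ?thesis by blast
qed

section \<open>Induction from the root and the distance from it\<close>

context rtree
begin

abbreviation topv :: "'e \<Rightarrow> ('e \<times> bool) set" where "topv e \<equiv> vertex_of G (e, \<not> bt e)"
abbreviation botv :: "'e \<Rightarrow> ('e \<times> bool) set" where "botv e \<equiv> vertex_of G (e, bt e)"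

lemma bt_er: "\<not> bt er"
proof
  assume "bt er"
  then have "vertex_of G (er, bt er) = {(er, True)}" using vertex_root by simp
  then show False using bot_not_root[OF er] by contradiction
qed

lemma top_er: "topv er = {(er, True)}"
  using bt_er vertex_root by simp

inductive reach :: "'e \<Rightarrow> bool" where
  reach_root: "reach er"
| reach_step: "reach e \<Longrightarrow> e \<in> edges G \<Longrightarrow> e' \<in> edges G \<Longrightarrow> topv e' = botv e \<Longrightarrow> reach e'"

lemma endpoint_cases: "p = (fst p, bt (fst p)) \<or> p = (fst p, \<not> bt (fst p))"
  by (cases p) auto

lemma reach_edges: "reach e \<Longrightarrow> e \<in> edges G"
  by (induction rule: reach.induct) (use er in auto)

text \<open>Beyond the root, a vertex met by the reached edges is the outer end of a reached edge,
  the only edge entering it by \<open>bot_inj\<close>; the edges leaving it are then reached too.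
  Connectedness does the rest, and \<open>reach\<close> becomes an induction principle.\<close>

lemma all_reach:
  assumes "e \<in> edges G"
  shows "reach e"
proof -
  have "{e \<in> edges G. reach e} = edges G"
  proof (rule connected_edges)
    show "{e \<in> edges G. reach e} \<noteq> {}" using er reach_root by blast
    fix w assume w: "w \<in> verts G"
    let ?Y = "{e \<in> edges G. reach e}"
    show "w \<subseteq> ?Y \<times> UNIV \<or> w \<inter> ?Y \<times> UNIV = {}"
    proof (rule disjCI)
      assume "w \<inter> ?Y \<times> UNIV \<noteq> {}"
      then obtain p where p: "p \<in> w" "reach (fst p)" "fst p \<in> edges G" by auto
      have vp: "vertex_of G p = w" by (rule vertex_of_eq[OF w p(1)])
      have "w = {(er, True)} \<or> (\<exists>e1. reach e1 \<and> botv e1 = w)"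
      proof (cases "p = (fst p, bt (fst p))")
        case True
        then show ?thesis using vp p(2) by metis
      next
        case False
        then have tp: "topv (fst p) = w" using endpoint_cases[of p] vp by metis
        show ?thesis using p(2)
        proof (cases rule: reach.cases)
          case reach_root
          then show ?thesis using tp top_er by simp
        next
          case (reach_step e)
          then show ?thesis using tp by auto
        qed
      qed
      then have "reach (fst p')" if "p' \<in> w" for p'
      proof (elim disjE exE conjE)
        assume "w = {(er, True)}"
        then show ?thesis using that reach_root by simp
      next
        fix e1 assume e1: "reach e1" "botv e1 = w"
        have vp': "vertex_of G p' = w" by (rule vertex_of_eq[OF w that])
        have p'E: "fst p' \<in> edges G" using vert_sub[OF w] that by auto
        show ?thesis
        proof (cases "p' = (fst p', bt (fst p'))")
          case True
          then have "botv (fst p') = botv e1" using vp' e1(2) by metis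
          then show ?thesis using bot_inj[OF p'E reach_edges[OF e1(1)]] e1(1) by simp
        next
          case False
          then have "topv (fst p') = botv e1" using endpoint_cases[of p'] vp' e1(2) by metis
          then show ?thesis using reach_step[OF e1(1) reach_edges[OF e1(1)] p'E] by simp
        qed
      qed
      then show "w \<subseteq> ?Y \<times> UNIV" using vert_sub[OF w] by (auto simp: mem_Times_iff)
    qed
  qed auto
  then show ?thesis using assms by blast
qed

definition kids :: "('e \<times> bool) set \<Rightarrow> 'e set" where
  "kids w = {e \<in> edges G. topv e = w}"

text \<open>A vertex other than the root consists of the outer end of the one edge entering it and
  of the inner ends of the edges leaving it.\<close>

lemma sum_vertex:
  fixes F :: "'e \<times> bool \<Rightarrow> real"
  assumes e: "e \<in> edges G"
  shows "(\<Sum>p\<in>botv e. F p) = F (e, bt e) + (\<Sum>e'\<in>kids (botv e). F (e', \<not> bt e'))"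
proof -
  have "(e, bt e) \<in> edges G \<times> UNIV" using e by simp
  note bv = vertex_of_in[OF this]
  have "botv e = insert (e, bt e) ((\<lambda>e'. (e', \<not> bt e')) ` kids (botv e))"
  proof (intro set_eqI iffI)
    fix p assume p: "p \<in> botv e"
    have vp: "vertex_of G p = botv e" by (rule vertex_of_eq[OF bv(1) p])
    have pE: "fst p \<in> edges G" using vert_sub[OF bv(1)] p by auto
    show "p \<in> insert (e, bt e) ((\<lambda>e'. (e', \<not> bt e')) ` kids (botv e))"
    proof (cases "p = (fst p, bt (fst p))")
      case True
      then have "botv (fst p) = botv e" using vp by metis
      then have "fst p = e" by (rule bot_inj[OF pE e])
      then show ?thesis using True by simp
    next
      case False
      then have *: "p = (fst p, \<not> bt (fst p))" using endpoint_cases[of p] by blast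
      then have "topv (fst p) = botv e" using vp by metis
      then have "fst p \<in> kids (botv e)" using pE by (simp add: kids_def)
      then show ?thesis
        by (rule insertI2[OF image_eqI[where x = "fst p" and f = "\<lambda>e'. (e', \<not> bt e')", OF *]])
    qed
  next
    fix p assume "p \<in> insert (e, bt e) ((\<lambda>e'. (e', \<not> bt e')) ` kids (botv e))"
    then show "p \<in> botv e"
    proof (elim insertE imageE)
      fix e' assume e': "p = (e', \<not> bt e')" "e' \<in> kids (botv e)"
      have "e' \<in> edges G" "topv e' = botv e" using e'(2) by (auto simp: kids_def)
      then show ?thesis using vertex_of_in(2)[of "(e', \<not> bt e')"] e'(1) by simp
    qed (use bv in simp)
  qed
  then have "(\<Sum>p\<in>botv e. F p) = (\<Sum>p\<in>insert (e, bt e) ((\<lambda>e'. (e', \<not> bt e')) ` kids (botv e)). F p)" by simp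
  also have "\<dots> = F (e, bt e) + (\<Sum>p\<in>(\<lambda>e'. (e', \<not> bt e')) ` kids (botv e). F p)"
    by (rule sum.insert) (auto simp: kids_def)
  also have "(\<Sum>p\<in>(\<lambda>e'. (e', \<not> bt e')) ` kids (botv e). F p) = (\<Sum>e'\<in>kids (botv e). F (e', \<not> bt e'))"
    by (subst sum.reindex) (auto simp: inj_on_def)
  finally show ?thesis .
qed

definition rdist :: "'e \<Rightarrow> real \<Rightarrow> real" where
  "rdist e x = s (topv e) + (if bt e then x else len G e - x)"

lemma rdist_endpoint:
  assumes "p \<in> edges G \<times> UNIV"
  shows "rdist (fst p) (coord G p) = s (vertex_of G p)"
proof -
  obtain e b where p: "p = (e, b)" by (cases p)
  have e: "e \<in> edges G" using assms by (simp add: p)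
  show ?thesis
  proof (cases "b = bt e")
    case True
    show ?thesis unfolding p True s_bot[OF e] by (simp add: rdist_def coord_def)
  next
    case False
    then have b: "b = (\<not> bt e)" by simp
    show ?thesis unfolding p b by (simp add: rdist_def coord_def)
  qed
qed

lemma rdist_agrees: "agrees_at_vertices G rdist"
  unfolding agrees_at_vertices_def
proof (intro ballI)
  fix v p p' assume v: "v \<in> verts G" "p \<in> v" "p' \<in> v"
  have "p \<in> edges G \<times> UNIV" "p' \<in> edges G \<times> UNIV" using vert_sub[OF v(1)] v(2,3) by auto
  then show "rdist (fst p) (coord G p) = rdist (fst p') (coord G p')"
    using vertex_of_eq[OF v(1,2)] vertex_of_eq[OF v(1,3)] by (simp add: rdist_endpoint)
qed

lemma top_nonneg: "e \<in> edges G \<Longrightarrow> 0 \<le> s (topv e)"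
proof -
  assume "e \<in> edges G"
  then have "reach e" by (rule all_reach)
  then show ?thesis
  proof (induction rule: reach.induct)
    case reach_root
    then show ?case unfolding top_er s_root by simp
  next
    case (reach_step e e')
    then show ?case using s_bot[of e] len_pos[of e] by simp
  qed
qed

lemma rdist_nonneg: "e \<in> edges G \<Longrightarrow> x \<in> {0..len G e} \<Longrightarrow> 0 \<le> rdist e x"
  using top_nonneg[of e] by (auto simp: rdist_def)

lemma rdist_bounded: "\<exists>B. \<forall>e\<in>edges G. \<forall>x\<in>{0..len G e}. rdist e x \<le> B"
proof (intro exI ballI)
  fix e x assume e: "e \<in> edges G" and x: "x \<in> {0..len G e}"
  have "rdist e x \<le> s (botv e)" using s_bot[OF e] x by (auto simp: rdist_def)
  also have "\<dots> \<le> Max ((\<lambda>e. s (botv e)) ` edges G)" using e by (intro Max_ge) auto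
  finally show "rdist e x \<le> Max ((\<lambda>e. s (botv e)) ` edges G)" .
qed

text \<open>A simple path never turns back towards the root: after an edge traversed outwards,
  \<open>bot_inj\<close> allows an inward continuation only along the same edge. The distance thus
  falls until \<open>t0\<close> and rises afterwards. The clause on the first edge carries this
  through the induction.\<close>

lemma along_rdist:
  assumes "Defs.simple_path G ps"
  shows "\<exists>a t0. 0 \<le> t0 \<and> (snd (hd ps) \<noteq> bt (fst (hd ps)) \<longrightarrow> t0 = 0) \<and> a + t0 = s (vertex_of G (hd ps)) \<and>
    (\<forall>t\<in>{0..path_length G ps}. along G rdist ps t = a + \<bar>t - t0\<bar>)"
  using assms
proof (induction ps)
  case (Cons p ps)
  define e where "e = fst p"
  have pE: "p \<in> edges G \<times> UNIV" using Cons.prems by (auto simp: simple_path_iff walk_def)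
  then have e: "e \<in> edges G" by (auto simp: e_def mem_Times_iff)
  have l: "0 < len G e" by (rule len_pos[OF e])
  have down: "rdist e (if snd p then len G e - t else t) = s (topv e) + t" if "snd p \<noteq> bt e" for t
    using that by (auto simp: rdist_def)
  have up: "rdist e (if snd p then len G e - t else t) = s (topv e) + len G e - t" if "snd p = bt e" for t
    using that by (auto simp: rdist_def)
  have vp: "vertex_of G p = (if snd p = bt e then botv e else topv e)" "vertex_of G (opp p) = (if snd p = bt e then topv e else botv e)"
    by (cases p; auto simp: e_def)+
  show ?case
  proof (cases ps)
    case Nil
    have pl: "path_length G (p # ps) = len G e" using Nil by (simp add: path_length_def e_def)
    show ?thesis
    proof (cases "snd p = bt e")
      case True
      show ?thesis
        by (rule exI[of _ "s (topv e)"], rule exI[of _ "len G e"])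
          (use True l s_bot[OF e] vp(1) up pl in \<open>auto simp: e_def[symmetric]\<close>)
    next
      case False
      show ?thesis
        by (rule exI[of _ "s (topv e)"], rule exI[of _ 0])
          (use False l vp(1) down pl in \<open>auto simp: e_def[symmetric]\<close>)
    qed
  next
    case (Cons q qs)
    note sp = Cons.prems[unfolded Cons]
    note S = simple_path_Cons[OF sp]
    have "\<exists>a t0. 0 \<le> t0 \<and> (snd q \<noteq> bt (fst q) \<longrightarrow> t0 = 0) \<and> a + t0 = s (vertex_of G q) \<and>
      (\<forall>t\<in>{0..path_length G ps}. along G rdist ps t = a + \<bar>t - t0\<bar>)"
      using Cons.IH[OF S(1)[folded Cons]] by (simp only: Cons list.sel)
    then obtain a t0 where B: "0 \<le> t0 \<and> (snd q \<noteq> bt (fst q) \<longrightarrow> t0 = 0) \<and> a + t0 = s (vertex_of G q) \<and>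
      (\<forall>t\<in>{0..path_length G ps}. along G rdist ps t = a + \<bar>t - t0\<bar>)"
      by (elim exE) (rule that)
    note A = conjunct1[OF B] mp[OF conjunct1[OF conjunct2[OF B]]] conjunct1[OF conjunct2[OF conjunct2[OF B]]]
      bspec[OF conjunct2[OF conjunct2[OF conjunct2[OF B]]]]
    have pl: "path_length G (p # ps) = len G e + path_length G ps" by (simp add: path_length_def e_def)
    show ?thesis
    proof (cases "snd p = bt e")
      case True
      have "a + t0 = s (topv e)" using A(3) S(2) vp(2) True by simp
      then show ?thesis
        by (intro exI[of _ a] exI[of _ "t0 + len G e"])
          (use True l s_bot[OF e] vp(1) up[OF True] pl A(1,4) in \<open>auto simp: e_def[symmetric]\<close>)
    next
      case False
      have "snd q \<noteq> bt (fst q)"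
      proof
        assume q: "snd q = bt (fst q)"
        have "botv (fst q) = vertex_of G q" unfolding q[symmetric] by simp
        also have "\<dots> = botv e" using S(2) vp(2) False by simp
        finally have "fst q = e" using S(4) by (intro bot_inj[OF _ e]) (auto simp: mem_Times_iff)
        then have "q = opp p" using q False by (cases p; cases q) (auto simp: e_def)
        then show False using S(5) by simp
      qed
      then have "t0 = 0" by (rule A(2))
      moreover have "a + t0 = s (topv e) + len G e" using A(3) S(2) vp(2) False s_bot[OF e] by simp
      ultimately show ?thesis
        by (intro exI[of _ "s (topv e)"] exI[of _ 0])
          (use False l vp(1) down[OF False] pl A(4) in \<open>auto simp: e_def[symmetric]\<close>)
    qed
  qed
qed (simp add: simple_path_iff walk_def)

lemma rdist_convex:
  assumes sp: "Defs.simple_path G ps"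
  shows "convex_on {0..path_length G ps} (along G rdist ps)"
proof -
  from along_rdist[OF sp] obtain a t0 where
    a: "\<And>t. t \<in> {0..path_length G ps} \<Longrightarrow> along G rdist ps t = a + \<bar>t - t0\<bar>" by blast
  have "convex_on {0..path_length G ps} (\<lambda>t. (0 * t + a) + \<bar>t - t0\<bar>)"
    by (intro convex_on_add convex_on_affine convex_on_abs_diff)
  then show ?thesis by (rule convex_on_eq) (simp add: a)
qed

end

section \<open>Calibration functions\<close>

text \<open>\<open>rho True\<close> and \<open>rho False\<close> are the primitives of \<open>- x (sin x)\<^sup>2\<close> and \<open>- x (cos x)\<^sup>2\<close> that vanish
  at \<open>\<plusminus> pi / 2\<close>.\<close>

definition rho :: "bool \<Rightarrow> real \<Rightarrow> real" where
  "rho b x = (pi\<^sup>2 / 4 - x\<^sup>2) / 4 + (if b then 1 else -1) * (x * sin x * cos x / 2 + (cos x)\<^sup>2 / 4)"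

definition drho :: "bool \<Rightarrow> real \<Rightarrow> real" where
  "drho b x = x * (if b then (sin x)\<^sup>2 else (cos x)\<^sup>2)"

lemma DERIV_rho: "(rho b has_real_derivative - drho b x) (at x within S)"
proof -
  have c: "(cos x)\<^sup>2 = 1 - (sin x)\<^sup>2" by (simp add: cos_squared_eq)
  have "(rho b has_real_derivative - 2 * x / 4 + (if b then 1 else -1) * ((sin x * cos x + x * (cos x * cos x - sin x * sin x)) / 2 - 2 * cos x * sin x / 4)) (at x within S)"
    unfolding rho_def by (cases b) (auto intro!: derivative_eq_intros simp: field_simps power2_eq_square)
  moreover have "- 2 * x / 4 + (if b then 1 else -1) * ((sin x * cos x + x * (cos x * cos x - sin x * sin x)) / 2 - 2 * cos x * sin x / 4) = - drho b x"
    unfolding c[unfolded power2_eq_square] drho_def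
    by (cases b) (simp_all add: c[unfolded power2_eq_square] power2_eq_square field_simps)
  ultimately show ?thesis by simp
qed

lemma rho_half_pi [simp]: "rho b (pi / 2) = 0" "rho b (- (pi / 2)) = 0"
  by (simp_all add: rho_def power2_eq_square)

text \<open>The difference vanishes at pi / 2 and has the derivative - t cos^2 t - sin t cos t. It
  is the coefficient of the Wronskian in \<open>calibration_upper\<close>.\<close>

lemma rho_True_gt:
  assumes x: "0 \<le> x" "x < pi / 2"
  shows "x * sin x * cos x < rho True x"
proof -
  let ?d = "\<lambda>x. (pi\<^sup>2 / 4 - x\<^sup>2) / 4 - x * sin x * cos x / 2 + (cos x)\<^sup>2 / 4"
  have "?d (pi / 2) < ?d x"
  proof (rule DERIV_neg_imp_decreasing_open[OF x(2)])
    fix t assume t: "x < t" "t < pi / 2"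
    have s: "0 < sin t" "0 < cos t" using t x by (auto intro: sin_gt_zero cos_gt_zero)
    have "(?d has_real_derivative - 2 * t / 4 - (sin t * cos t + t * (cos t * cos t - sin t * sin t)) / 2 - 2 * cos t * sin t / 4) (at t)"
      by (auto intro!: derivative_eq_intros simp: field_simps power2_eq_square)
    also have "- 2 * t / 4 - (sin t * cos t + t * (cos t * cos t - sin t * sin t)) / 2 - 2 * cos t * sin t / 4
       = - t * (cos t)\<^sup>2 - sin t * cos t"
    proof -
      have ss: "sin t * sin t = 1 - cos t * cos t" using sin_cos_squared_add[of t] by (simp add: power2_eq_square)
      show ?thesis unfolding power2_eq_square ss by (simp add: field_simps)
    qed
    finally have D: "(?d has_real_derivative - t * (cos t)\<^sup>2 - sin t * cos t) (at t)" .
    have "- t * (cos t)\<^sup>2 - sin t * cos t < 0"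
    proof -
      have "0 \<le> t * (cos t)\<^sup>2" "0 < sin t * cos t" using t x s by auto
      then show ?thesis by simp
    qed
    with D show "\<exists>y. DERIV ?d t :> y \<and> y < 0" by (intro exI conjI)
  qed (auto intro!: continuous_intros)
  then show ?thesis by (simp add: rho_def power2_eq_square)
qed

text \<open>After division by sin x, the difference x cos^3 x / sin x - \<open>rho False x\<close>
  vanishes at pi / 2. In its derivative the term - sin t Z cancels against
  \<open>drho False\<close>, which leaves Z' cos t <= 0.\<close>

lemma rho_False_le:
  assumes x: "0 < x" "x < pi / 2"
  shows "rho False x * sin x \<le> x * cos x ^ 3"
proof -
  let ?Z = "\<lambda>x. x * (cos x)\<^sup>2 / sin x"
  let ?d = "\<lambda>x. cos x * ?Z x - rho False x"
  have sp: "0 < sin t" if "x \<le> t" "t \<le> pi / 2" for t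
    using that x pi_half_less_two by (intro sin_gt_zero) linarith+
  have "?d (pi / 2) \<le> ?d x"
  proof (rule DERIV_nonpos_imp_decreasing_open[of x "pi / 2" ?d])
    show "x \<le> pi / 2" using x by simp
    fix t assume t: "x < t" "t < pi / 2"
    have s: "0 < sin t" "0 < cos t" using sp[of t] t x by (auto intro: cos_gt_zero)
    let ?Z' = "cos t / (sin t)\<^sup>2 * (cos t * sin t - t - t * (sin t)\<^sup>2)"
    have "(?Z has_real_derivative (((cos t)\<^sup>2 + t * (2 * cos t * - sin t)) * sin t - t * (cos t)\<^sup>2 * cos t) / (sin t * sin t)) (at t)"
      using s by (auto intro!: derivative_eq_intros simp: power2_eq_square)
    moreover have "(((cos t)\<^sup>2 + t * (2 * cos t * - sin t)) * sin t - t * (cos t)\<^sup>2 * cos t) / (sin t * sin t) = ?Z'"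
    proof -
      have c: "cos t * cos t = 1 - sin t * sin t" using sin_cos_squared_add[of t] by (simp add: power2_eq_square)
      have "((cos t)\<^sup>2 + t * (2 * cos t * - sin t)) * sin t - t * (cos t)\<^sup>2 * cos t
        = cos t * (cos t * sin t - 2 * t * (sin t * sin t) - t * (cos t * cos t))"
        by (simp add: power2_eq_square algebra_simps)
      also have "\<dots> = cos t * (cos t * sin t - t - t * (sin t)\<^sup>2)" unfolding c by (simp add: power2_eq_square algebra_simps)
      finally show ?thesis by (simp add: power2_eq_square)
    qed
    ultimately have dZ: "(?Z has_real_derivative ?Z') (at t)" by simp
    have "(?d has_real_derivative - sin t * ?Z t + ?Z' * cos t - (- drho False t)) (at t)"
      by (rule DERIV_diff[OF _ DERIV_rho], rule DERIV_mult[OF _ dZ, THEN DERIV_cong]) (auto intro!: derivative_eq_intros)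
    moreover have "- sin t * ?Z t + ?Z' * cos t - (- drho False t) = ?Z' * cos t"
      using s by (simp add: drho_def)
    moreover have "?Z' * cos t \<le> 0"
    proof -
      have "cos t * sin t \<le> 1 * sin t" using s by (intro mult_right_mono) auto
      also have "\<dots> \<le> t" using sin_x_le_x[of t] t x by simp
      finally have "cos t * sin t \<le> t" .
      moreover have "0 \<le> t * (sin t)\<^sup>2" using t x by simp
      ultimately have "cos t * sin t - t - t * (sin t)\<^sup>2 \<le> 0" by linarith
      moreover have "0 \<le> cos t / (sin t)\<^sup>2" using s by simp
      ultimately have "?Z' \<le> 0" by (intro mult_nonneg_nonpos)
      then show ?thesis by (rule mult_nonpos_nonneg[OF _ less_imp_le[OF s(2)]])
    qed
    ultimately show "\<exists>y. DERIV ?d t :> y \<and> y \<le> 0" by (intro exI conjI) simp_all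
  next
    have "continuous_on {x..pi / 2} (rho False)"
      using DERIV_rho by (intro DERIV_continuous_on) blast
    moreover have "sin t \<noteq> 0" if "t \<in> {x..pi / 2}" for t using sp[of t] that by auto
    ultimately show "continuous_on {x..pi / 2} ?d" by (intro continuous_intros) auto
  qed
  then have "rho False x \<le> cos x * ?Z x" by simp
  then have "rho False x * sin x \<le> cos x * ?Z x * sin x" using sp[of x] x by (intro mult_right_mono) auto
  also have "\<dots> = x * cos x ^ 3" using sp[of x] x by (simp add: power2_eq_square power3_eq_cube)
  finally show ?thesis .
qed

text \<open>In the next two lemmas \<open>f\<close> and \<open>p\<close> stand for the eigenfunction and its outward derivative divided
  by \<open>k\<close>; on an interval they are \<open>sin x\<close> and \<open>cos x\<close>, and then both inequalities are equalities.\<close>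

lemma calibration_upper:
  assumes x: "0 \<le> x" "x < pi / 2" and f: "0 \<le> f" "f \<le> sin x" and w: "0 < f * cos x - p * sin x"
  shows "x * f\<^sup>2 < rho True x * (f * cos x - p * sin x) / (cos x)\<^sup>2 + drho True x * p / cos x"
proof -
  let ?S = "sin x" and ?C = "cos x" and ?w = "f * cos x - p * sin x"
  have C: "0 < ?C" using x by (intro cos_gt_zero_pi) auto
  \<comment> \<open>Collected by the Wronskian: its coefficient is positive by
    \<open>rho_True_gt\<close>, and the remaining term x sin x f dominates x f^2.\<close>
  have eq: "rho True x * ?w / ?C\<^sup>2 + drho True x * p / ?C = x * ?S * f + (rho True x - x * ?S * ?C) / ?C\<^sup>2 * ?w"
    using C by (simp add: drho_def power2_eq_square field_simps)
  have "0 < (rho True x - x * ?S * ?C) / ?C\<^sup>2 * ?w"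
    using rho_True_gt[OF x] C w by (intro mult_pos_pos divide_pos_pos) auto
  moreover have "x * f\<^sup>2 \<le> x * ?S * f"
    using mult_left_mono[OF mult_right_mono[OF f(2,1)] x(1)] by (simp add: power2_eq_square mult.assoc)
  ultimately show ?thesis unfolding eq by linarith
qed

lemma calibration_lower:
  assumes x: "0 < x" "x < pi / 2" and f: "0 \<le> f" "f \<le> sin x" and w: "0 < f * cos x - p * sin x"
  shows "rho False x * (f * cos x - p * sin x) / (cos x)\<^sup>2 + drho False x * p / cos x \<le> x * (1 - f\<^sup>2)"
proof -
  let ?S = "sin x" and ?C = "cos x" and ?w = "f * cos x - p * sin x"
  have C: "0 < ?C" using x by (intro cos_gt_zero_pi) auto
  have S: "0 < ?S" using x pi_gt_zero by (intro sin_gt_zero) linarith+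
  \<comment> \<open>Now \<open>rho_False_le\<close> makes the Wronskian term nonpositive. What
    remains, x cos^2 x f / sin x, is compared with x (1 - f^2) through (sin x - f) (1 + f sin x) >=
    0.\<close>
  have eq: "rho False x * ?w / ?C\<^sup>2 + drho False x * p / ?C = x * ?C\<^sup>2 * f / ?S - (x * ?C ^ 3 - rho False x * ?S) / (?S * ?C\<^sup>2) * ?w"
    using C S by (simp add: drho_def power2_eq_square power3_eq_cube field_simps)
  have "0 \<le> (x * ?C ^ 3 - rho False x * ?S) / (?S * ?C\<^sup>2) * ?w"
    using rho_False_le[OF x] C S w by (intro mult_nonneg_nonneg divide_nonneg_nonneg) auto
  moreover have "x * ?C\<^sup>2 * f / ?S \<le> x * (1 - f\<^sup>2)"
  proof -
    have "0 \<le> (?S - f) * (1 + ?S * f)" using S f by (intro mult_nonneg_nonneg) auto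
    then have "?C\<^sup>2 * f \<le> (1 - f\<^sup>2) * ?S" unfolding cos_squared_eq by (simp add: power2_eq_square algebra_simps)
    then have "?C\<^sup>2 * f / ?S \<le> 1 - f\<^sup>2" using S by (simp add: pos_divide_le_eq)
    then have "x * (?C\<^sup>2 * f / ?S) \<le> x * (1 - f\<^sup>2)" using x by (intro mult_left_mono) auto
    then show ?thesis by (simp add: mult.assoc)
  qed
  ultimately show ?thesis unfolding eq by linarith
qed

section \<open>Comparison with a cosine along one edge\<close>

lemma C2_on_reflect:
  assumes u: "C2_on l u u' u''"
  shows "C2_on l (\<lambda>x. u (l - x)) (\<lambda>x. - u' (l - x)) (\<lambda>x. u'' (l - x))"
proof -
  have r: "((\<lambda>x. f (l - x)) has_real_derivative - f' (l - x)) (at x within {0..l})"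
    if "\<And>x. x \<in> {0..l} \<Longrightarrow> (f has_real_derivative f' x) (at x within {0..l})" "x \<in> {0..l}" for f f' :: "real \<Rightarrow> real" and x
  proof -
    have im: "(\<lambda>x. l - x) ` {0..l} = {0..l}" by simp
    have "l - x \<in> {0..l}" using that(2) by auto
    then have "(f has_real_derivative f' (l - x)) (at (l - x) within (\<lambda>x. l - x) ` {0..l})" unfolding im by (rule that(1))
    moreover have "((\<lambda>x. l - x) has_real_derivative - 1) (at x within {0..l})" by (auto intro!: derivative_eq_intros)
    ultimately show ?thesis using DERIV_image_chain[of f "f' (l - x)" "\<lambda>x. l - x" x "{0..l}" "- 1"] by (simp add: o_def)
  qed
  have "((\<lambda>x. - u' (l - x)) has_real_derivative u'' (l - x)) (at x within {0..l})" if "x \<in> {0..l}" for x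
    using DERIV_minus[OF r[OF C2_onD(2)[OF u] that]] by simp
  moreover have "continuous_on {0..l} (\<lambda>x. u'' (l - x))"
    by (rule continuous_on_compose2[OF C2_onD(5)[OF u]]) (auto intro!: continuous_intros)
  ultimately show ?thesis unfolding C2_on_def using r[OF C2_onD(1)[OF u]] by blast
qed

text \<open>Comparison of a solution on an edge with \<open>- cos (k \<cdot>)\<close>, the solution on the edge that leads to
  the root; \<open>a\<close> is the distance of the start of the edge from the root.\<close>

lemma edge_comparison:
  assumes k: "0 < k" and f: "C2_on l f p (\<lambda>x. - k\<^sup>2 * f x)"
    and pos: "\<And>x. x \<in> {0..l} \<Longrightarrow> 0 \<le> f x" "\<And>x. x \<in> {0..l} \<Longrightarrow> 0 \<le> p x"
    and a: "pi / 2 \<le> k * a" "k * a < pi"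
    and w: "0 < f 0 * sin (k * a) + p 0 / k * cos (k * a)"
    and e: "(f 0)\<^sup>2 + (p 0 / k)\<^sup>2 \<le> 1" and le: "f 0 \<le> - cos (k * a)"
    and x: "x \<in> {0..l}"
  shows "k * (a + x) < pi" "0 < f x * sin (k * (a + x)) + p x / k * cos (k * (a + x))"
    "(f x)\<^sup>2 + (p x / k)\<^sup>2 \<le> 1" "f x \<le> - cos (k * (a + x))"
proof -
  note D = C2_onD[OF f]
  \<comment> \<open>The Wronskian of \<open>f\<close> and - cos (k (a + x)), divided by
    \<open>k\<close>; it is constant because both solve the same equation.\<close>
  define W where "W x = f x * sin (k * (a + x)) + p x / k * cos (k * (a + x))" for x
  have "\<exists>c. \<forall>x\<in>{0..l}. W x = c"
  proof (rule has_field_derivative_zero_constant)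
    fix x assume x: "x \<in> {0..l}"
    have "(W has_real_derivative p x * sin (k * (a + x)) + f x * (k * cos (k * (a + x))) +
       ((- k\<^sup>2 * f x) / k * cos (k * (a + x)) + p x / k * (- (k * sin (k * (a + x)))))) (at x within {0..l})"
      unfolding W_def using D(1,2)[OF x] k by (auto intro!: derivative_eq_intros simp: field_simps)
    then show "(W has_field_derivative 0) (at x within {0..l})" using k by (simp add: power2_eq_square)
  qed auto
  then have Wc: "W x = W 0" if "x \<in> {0..l}" for x using that by force
  have W0: "0 < W 0" using w by (simp add: W_def)
  have Wp: "0 < W x" if "x \<in> {0..l}" for x using Wc[OF that] W0 by simp
  \<comment> \<open>Where the phase reaches pi, the Wronskian is - p / k, which is not
    positive.\<close>
  have lt: "k * (a + x) < pi" if x: "x \<in> {0..l}" for x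
  proof (rule ccontr)
    assume "\<not> k * (a + x) < pi"
    define y where "y = pi / k - a"
    have "pi \<le> k * (a + x)" using \<open>\<not> k * (a + x) < pi\<close> by simp
    also have "\<dots> \<le> k * (a + l)" using k x by (intro mult_left_mono) auto
    finally have y: "y \<in> {0..l}" using a(2) k by (auto simp: y_def field_simps)
    have "k * (a + y) = pi" using k by (simp add: y_def)
    then have "W y = - (p y / k)" by (simp add: W_def)
    moreover have "0 \<le> p y / k" using pos(2)[OF y] k by simp
    ultimately show False using Wp[OF y] by linarith
  qed
  have E: "(f x)\<^sup>2 + (p x / k)\<^sup>2 \<le> 1" if x: "x \<in> {0..l}" for x
  proof -
    have "(p x)\<^sup>2 + k\<^sup>2 * (f x)\<^sup>2 = (p 0)\<^sup>2 + k\<^sup>2 * (f 0)\<^sup>2"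
      using x by (intro oscillator_energy[OF f]) auto
    moreover have "(f y)\<^sup>2 + (p y / k)\<^sup>2 = ((p y)\<^sup>2 + k\<^sup>2 * (f y)\<^sup>2) / k\<^sup>2" for y
      using k by (simp add: power_divide field_simps)
    ultimately show ?thesis using e by simp
  qed
  have rng: "pi / 2 \<le> k * (a + x)" if x: "x \<in> {0..l}" for x
  proof -
    have "0 \<le> k * x" using k x by simp
    then show ?thesis using a(1) by (simp add: distrib_left)
  qed
  have sc: "0 < sin (k * (a + x))" "cos (k * (a + x)) \<le> 0" if x: "x \<in> {0..l}" for x
  proof -
    show "0 < sin (k * (a + x))" using rng[OF x] lt[OF x] pi_gt_zero by (intro sin_gt_zero) linarith+
    have "0 \<le> sin (k * (a + x) - pi / 2)" using rng[OF x] lt[OF x] by (intro sin_ge_zero) linarith+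
    then show "cos (k * (a + x)) \<le> 0" by (simp add: sin_diff)
  qed
  \<comment> \<open>With q = p / k, S and C, positivity of the Wronskian reads q S <= f C. Squaring
    it and using f^2 <= 1 - q^2 from the energy gives q^2 (S^2 + C^2) <= C^2. So \<open>f\<close>
    grows no faster than the cosine it is compared with.\<close>
  have pc: "p x \<le> k * sin (k * (a + x))" if x: "x \<in> {0..l}" for x
  proof -
    let ?C = "sin (k * (a + x))" and ?S = "- cos (k * (a + x))" and ?q = "p x / k"
    have q: "0 \<le> ?q" using pos(2)[OF x] k by simp
    have "?q * ?S \<le> f x * ?C" using Wp[OF x] by (simp add: W_def)
    then have "(?q * ?S)\<^sup>2 \<le> (f x * ?C)\<^sup>2" using q sc[OF x] by (intro power_mono mult_nonneg_nonneg) auto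
    then have "?q\<^sup>2 * ?S\<^sup>2 \<le> (f x)\<^sup>2 * ?C\<^sup>2" unfolding power_mult_distrib .
    also have "\<dots> \<le> (1 - ?q\<^sup>2) * ?C\<^sup>2" using E[OF x] by (intro mult_right_mono) auto
    also have "(1 - ?q\<^sup>2) * ?C\<^sup>2 = ?C\<^sup>2 - ?q\<^sup>2 * ?C\<^sup>2" by (simp only: left_diff_distrib mult_1)
    finally have le: "?q\<^sup>2 * ?S\<^sup>2 \<le> ?C\<^sup>2 - ?q\<^sup>2 * ?C\<^sup>2" .
    have "?q\<^sup>2 = ?q\<^sup>2 * (?S\<^sup>2 + ?C\<^sup>2)" by simp
    also have "\<dots> = ?q\<^sup>2 * ?S\<^sup>2 + ?q\<^sup>2 * ?C\<^sup>2" by (rule distrib_left)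
    finally have "?q\<^sup>2 \<le> ?C\<^sup>2" using le by linarith
    then have "?q \<le> ?C" by (rule power2_le_imp_le[OF _ less_imp_le[OF sc(1)[OF x]]])
    then show ?thesis using k by (simp add: pos_divide_le_eq mult.commute)
  qed
  have le': "f x \<le> - cos (k * (a + x))" if x: "x \<in> {0..l}" for x
  proof -
    let ?g = "\<lambda>x. - cos (k * (a + x)) - f x"
    have "?g 0 \<le> ?g x"
    proof (rule DERIV_nonneg_imp_increasing_open[of 0 x ?g])
      fix t assume t: "0 < t" "t < x"
      then have t': "t \<in> {0..l}" "t < l" using x by auto
      have "(?g has_real_derivative k * sin (k * (a + t)) - p t) (at t)"
        using D(6)[OF t(1) t'(2)] by (auto intro!: derivative_eq_intros)
      moreover have "0 \<le> k * sin (k * (a + t)) - p t" using pc[OF t'(1)] by simp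
      ultimately show "\<exists>y. DERIV ?g t :> y \<and> 0 \<le> y" by (intro exI conjI)
    next
      show "0 \<le> x" using x by simp
      show "continuous_on {0..x} ?g"
        by (intro continuous_intros continuous_on_subset[OF D(3)]) (use x in simp)
    qed
    then show ?thesis using le by simp
  qed
  show "k * (a + x) < pi" "(f x)\<^sup>2 + (p x / k)\<^sup>2 \<le> 1" "f x \<le> - cos (k * (a + x))"
    by (rule lt[OF x], rule E[OF x], rule le'[OF x])
  show "0 < f x * sin (k * (a + x)) + p x / k * cos (k * (a + x))" using Wp[OF x] by (simp add: W_def)
qed

lemma integral_less:
  fixes f g :: "real \<Rightarrow> real"
  assumes l: "0 < l" and f: "continuous_on {0..l} f" and g: "continuous_on {0..l} g"
    and less: "\<And>x. x \<in> {0..l} \<Longrightarrow> f x < g x"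
  shows "integral {0..l} f < integral {0..l} g"
proof -
  have d: "continuous_on {0..l} (\<lambda>x. g x - f x)" by (intro continuous_intros f g)
  obtain m where m: "m \<in> {0..l}" "\<And>x. x \<in> {0..l} \<Longrightarrow> g m - f m \<le> g x - f x"
    using continuous_attains_inf[OF _ _ d] l by auto
  have "integral {0..l} (\<lambda>x. g m - f m) \<le> integral {0..l} (\<lambda>x. g x - f x)"
    using m(2) d by (intro integral_le integrable_continuous_real) auto
  also have "\<dots> = integral {0..l} g - integral {0..l} f"
    using f g by (intro integral_diff integrable_continuous_real)
  finally have "l * (g m - f m) \<le> integral {0..l} g - integral {0..l} f" using l by simp
  moreover have "0 < l * (g m - f m)" using l less[OF m(1)] by simp
  ultimately show ?thesis by linarith
qed

section \<open>The eigenfunction along outward paths\<close>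

locale eigen_rtree = rtree G er bt s for G :: "'e metric_graph" and er bt s +
  fixes k :: real and \<phi> \<phi>' :: "'e \<Rightarrow> real \<Rightarrow> real"
  assumes k: "0 < k" and es: "esol G (\<lambda>_ _. 0) (k\<^sup>2) \<phi> \<phi>'"
    and nn: "e \<in> edges G \<Longrightarrow> e \<noteq> er \<Longrightarrow> x \<in> {0..len G e} \<Longrightarrow> 0 \<le> \<phi> e x"
begin

text \<open>An involution that exchanges the coordinate of an edge with the arc length from its
  inner end; \<open>f\<close> and \<open>p\<close> are the eigenfunction and its outward derivative
  in that parameter.\<close>

definition fw :: "'e \<Rightarrow> real \<Rightarrow> real" where
  "fw e x = (if bt e then x else len G e - x)"

definition f :: "'e \<Rightarrow> real \<Rightarrow> real" where "f e t = \<phi> e (fw e t)"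
definition p :: "'e \<Rightarrow> real \<Rightarrow> real" where "p e t = (if bt e then 1 else -1) * \<phi>' e (fw e t)"

lemma fw_fw [simp]: "fw e (fw e x) = x" by (simp add: fw_def)

lemma fw_in: "x \<in> {0..len G e} \<Longrightarrow> fw e x \<in> {0..len G e}" by (auto simp: fw_def)

lemma phi_kdom: "kdom G \<phi> \<phi>' (\<lambda>e x. - k\<^sup>2 * \<phi> e x)"
  using es by (simp add: esol_def)

lemma phi_C2: "e \<in> edges G \<Longrightarrow> C2_on (len G e) (\<phi> e) (\<phi>' e) (\<lambda>x. - k\<^sup>2 * \<phi> e x)"
  using phi_kdom by (simp add: kdom_def)

lemma outward_C2:
  assumes "e \<in> edges G"
  shows "C2_on (len G e) (f e) (p e) (\<lambda>t. - k\<^sup>2 * f e t)"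
proof (cases "bt e")
  case True
  then have "f e = \<phi> e" "p e = \<phi>' e" by (auto simp: f_def p_def fw_def)
  then show ?thesis using phi_C2[OF assms] by simp
next
  case False
  then have "f e = (\<lambda>t. \<phi> e (len G e - t))" "p e = (\<lambda>t. - \<phi>' e (len G e - t))" by (auto simp: f_def p_def fw_def)
  then show ?thesis using C2_on_reflect[OF phi_C2[OF assms]] by simp
qed

lemma outward_ends:
  "p e 0 = normal_deriv G \<phi>' (e, \<not> bt e)" "p e (len G e) = - normal_deriv G \<phi>' (e, bt e)"
  "f e 0 = \<phi> e (coord G (e, \<not> bt e))" "f e (len G e) = \<phi> e (coord G (e, bt e))"
  by (simp_all add: p_def f_def fw_def normal_deriv_def coord_def)

lemma kids_top: "e' \<in> kids (botv e) \<Longrightarrow> e' \<in> edges G" "e' \<in> kids (botv e) \<Longrightarrow> topv e' = botv e"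
  by (simp_all add: kids_def)

lemma kids_ne_er: "e \<in> edges G \<Longrightarrow> e' \<in> kids (botv e) \<Longrightarrow> e' \<noteq> er"
  using kids_top(2)[of e' e] top_er bot_not_root[of e] by auto

lemma fin_kids: "finite (kids v)" by (simp add: kids_def)

lemma kid_value:
  assumes e: "e \<in> edges G" and e': "e' \<in> kids (botv e)"
  shows "f e' 0 = f e (len G e)"
proof -
  have E: "(e, bt e) \<in> edges G \<times> UNIV" "(e', \<not> bt e') \<in> edges G \<times> UNIV" using e kids_top(1)[OF e'] by simp_all
  have v: "botv e \<in> verts G" "(e, bt e) \<in> botv e" "(e', \<not> bt e') \<in> botv e"
    using vertex_of_in[OF E(1)] vertex_of_in(2)[OF E(2)] unfolding kids_top(2)[OF e'] by simp_all
  have "\<phi> (fst (e', \<not> bt e')) (coord G (e', \<not> bt e')) = \<phi> (fst (e, bt e)) (coord G (e, bt e))"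
    using phi_kdom v unfolding kdom_def agrees_at_vertices_def by blast
  then show ?thesis by (simp add: outward_ends)
qed

lemma kirchhoff:
  assumes e: "e \<in> edges G"
  shows "(\<Sum>e'\<in>kids (botv e). p e' 0) = p e (len G e)"
proof -
  have "(e, bt e) \<in> edges G \<times> UNIV" using e by simp
  then have "botv e \<in> verts G" by (rule vertex_of_in(1))
  then have "(\<Sum>q\<in>botv e. normal_deriv G \<phi>' q) = 0" using phi_kdom by (simp add: kdom_def)
  then show ?thesis unfolding sum_vertex[OF e] by (simp add: outward_ends)
qed

lemma p_antimono:
  assumes e: "e \<in> edges G" "e \<noteq> er" and xy: "0 \<le> x" "x \<le> y" "y \<le> len G e"
  shows "p e y \<le> p e x"
proof (rule DERIV_nonpos_imp_decreasing_open[of x y "p e"])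
  note D = C2_onD[OF outward_C2[OF e(1)]]
  show "x \<le> y" by (rule xy)
  show "continuous_on {x..y} (p e)" by (rule continuous_on_subset[OF D(4)]) (use xy in auto)
  fix t assume t: "x < t" "t < y"
  then have t': "0 < t" "t < len G e" using xy by auto
  have "0 \<le> f e t" unfolding f_def by (rule nn[OF e fw_in]) (use t' in auto)
  then have "- k\<^sup>2 * f e t \<le> 0" by simp
  with D(7)[OF t'] show "\<exists>z. (p e has_real_derivative z) (at t) \<and> z \<le> 0" by (intro exI conjI)
qed

text \<open>If some outward slope at an outer end were negative, take such an edge farthest from the
  root. Kirchhoff's condition gives a child with negative initial slope, and concavity keeps it
  negative up to the outer end of the child, which is farther away.\<close>

lemma p_bottom_nonneg:
  assumes "e \<in> edges G"
  shows "0 \<le> p e (len G e)"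
proof (rule ccontr)
  assume neg: "\<not> 0 \<le> p e (len G e)"
  define N where "N = {e \<in> edges G. p e (len G e) < 0}"
  have N: "finite N" "N \<noteq> {}" using assms neg by (auto simp: N_def)
  have "Max ((\<lambda>e. s (botv e)) ` N) \<in> (\<lambda>e. s (botv e)) ` N" using N by (intro Max_in) auto
  then obtain e0 where e0: "e0 \<in> N" "s (botv e0) = Max ((\<lambda>e. s (botv e)) ` N)" by auto
  have e0E: "e0 \<in> edges G" "p e0 (len G e0) < 0" using e0(1) by (auto simp: N_def)
  have "\<exists>e'\<in>kids (botv e0). p e' 0 < 0"
  proof (rule ccontr)
    assume "\<not> ?thesis"
    then have "0 \<le> (\<Sum>e'\<in>kids (botv e0). p e' 0)" by (intro sum_nonneg) force
    then show False using kirchhoff[OF e0E(1)] e0E(2) by simp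
  qed
  then obtain e' where e': "e' \<in> kids (botv e0)" "p e' 0 < 0" by blast
  have E: "e' \<in> edges G" "e' \<noteq> er" using kids_top(1)[OF e'(1)] kids_ne_er[OF e0E(1) e'(1)] by auto
  have "p e' (len G e') \<le> p e' 0" using len_pos[OF E(1)] by (intro p_antimono E) auto
  then have "e' \<in> N" using E(1) e'(2) by (simp add: N_def)
  then have "s (botv e') \<le> s (botv e0)" unfolding e0(2) using N(1) by (intro Max_ge) auto
  then show False using s_bot[OF E(1)] kids_top(2)[OF e'(1)] len_pos[OF E(1)] by simp
qed

lemma p_nonneg:
  assumes e: "e \<in> edges G" "e \<noteq> er" and x: "x \<in> {0..len G e}"
  shows "0 \<le> p e x"
  using p_antimono[OF e, of x "len G e"] p_bottom_nonneg[OF e(1)] x by auto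

text \<open>\<open>f\<close> does not decrease along the edge and stays positive, so the slope falls
  strictly and still ends nonnegative.\<close>

lemma p_top_pos:
  assumes e: "e \<in> edges G" "e \<noteq> er" and pos: "0 < f e 0"
  shows "0 < p e 0"
proof -
  have l: "0 < len G e" by (rule len_pos[OF e(1)])
  note D = C2_onD[OF outward_C2[OF e(1)]]
  have p0: "0 \<le> p e 0" using l by (intro p_nonneg e) auto
  have mono: "f e 0 \<le> f e x" if "x \<in> {0..len G e}" for x
  proof (rule DERIV_nonneg_imp_increasing_open[of 0 x "f e"])
    show "0 \<le> x" "continuous_on {0..x} (f e)" using that by (auto intro: continuous_on_subset[OF D(3)])
    fix t assume t: "0 < t" "t < x"
    then have t': "t < len G e" using that by auto
    have "0 \<le> p e t" using t t' by (intro p_nonneg e) auto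
    with D(6)[OF t(1) t'] show "\<exists>z. (f e has_real_derivative z) (at t) \<and> 0 \<le> z" by (intro exI conjI)
  qed
  have "p e differentiable (at x)" if "0 < x" "x < len G e" for x
    using D(7)[OF that] by (auto simp: real_differentiable_def)
  from MVT[OF l D(4) this] obtain z d where
    z: "0 < z" "z < len G e" and d: "(p e has_real_derivative d) (at z)" "p e (len G e) - p e 0 = (len G e - 0) * d"
    by blast
  have "d = - k\<^sup>2 * f e z" by (rule DERIV_unique[OF d(1) D(7)[OF z]])
  with d(2) have z3: "p e (len G e) - p e 0 = len G e * (- k\<^sup>2 * f e z)" by simp
  have "0 < f e z" using mono[of z] pos z by simp
  then have "len G e * (- k\<^sup>2 * f e z) < 0" using l k by (simp add: mult_pos_neg)
  then show ?thesis using z3 p_bottom_nonneg[OF e(1)] by linarith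
qed

lemma kid_slope:
  assumes e: "e \<in> edges G" and e': "e' \<in> kids (botv e)"
  shows "0 \<le> p e' 0" "p e' 0 \<le> p e (len G e)"
    "e'' \<in> kids (botv e) \<Longrightarrow> e'' \<noteq> e' \<Longrightarrow> 0 < f e'' 0 \<Longrightarrow> p e' 0 < p e (len G e)"
proof -
  have P: "0 \<le> p x 0" if "x \<in> kids (botv e)" for x
    using len_pos[OF kids_top(1)[OF that]] by (intro p_nonneg kids_top(1)[OF that] kids_ne_er[OF e that]) auto
  show "0 \<le> p e' 0" by (rule P[OF e'])
  have eq: "p e (len G e) = p e' 0 + (\<Sum>x\<in>kids (botv e) - {e'}. p x 0)"
    unfolding kirchhoff[OF e, symmetric] by (rule sum.remove[OF fin_kids e'])
  have "0 \<le> (\<Sum>x\<in>kids (botv e) - {e'}. p x 0)" by (intro sum_nonneg) (simp add: P)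
  then show "p e' 0 \<le> p e (len G e)" unfolding eq by simp
  assume e'': "e'' \<in> kids (botv e)" "e'' \<noteq> e'" "0 < f e'' 0"
  have "0 < p e'' 0" by (rule p_top_pos[OF kids_top(1)[OF e''(1)] kids_ne_er[OF e e''(1)] e''(3)])
  also have "\<dots> \<le> (\<Sum>x\<in>kids (botv e) - {e'}. p x 0)"
    by (rule member_le_sum) (use e'' fin_kids P in auto)
  finally show "p e' 0 < p e (len G e)" unfolding eq by simp
qed

end

text \<open>The eigenfunction normalised on the leaf edge, where its Wronskian with the comparison
  cosine is zero. The second branch provided by \<open>two\<close> takes away some of the slope,
  which makes the Wronskian strictly positive beyond the attaching vertex.\<close>

locale outer_nodal = eigen_rtree G er bt s k \<phi> \<phi>'
  for G :: "'e metric_graph" and er bt s k \<phi> \<phi>' +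
  assumes kl: "pi / 2 < k * len G er" "k * len G er < pi"
    and er_val: "x \<in> {0..len G er} \<Longrightarrow> \<phi> er x = - cos (k * (len G er - x))"
    and er_deriv: "x \<in> {0..len G er} \<Longrightarrow> \<phi>' er x = - k * sin (k * (len G er - x))"
    and two: "\<exists>e1\<in>kids (botv er). \<exists>e2\<in>kids (botv er). e1 \<noteq> e2"
begin

text \<open>Induction outwards with \<open>edge_comparison\<close> on each edge. At a vertex the
  value persists while the slope can only drop, see \<open>kid_slope\<close>; as the cosine is
  nonpositive there, a smaller slope raises the Wronskian and lowers the energy, so the hypotheses
  survive.\<close>

lemma outward_profile:
  assumes "e \<in> edges G" "e \<noteq> er" "x \<in> {0..len G e}"
  shows "len G er \<le> s (topv e)" "k * (s (topv e) + x) < pi"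
    "0 < f e x * sin (k * (s (topv e) + x)) + p e x / k * cos (k * (s (topv e) + x))"
    "(f e x)\<^sup>2 + (p e x / k)\<^sup>2 \<le> 1" "f e x \<le> - cos (k * (s (topv e) + x))"
proof -
  let ?P = "\<lambda>e. len G er \<le> s (topv e) \<and> (\<forall>x\<in>{0..len G e}. k * (s (topv e) + x) < pi \<and>
    0 < f e x * sin (k * (s (topv e) + x)) + p e x / k * cos (k * (s (topv e) + x)) \<and>
    (f e x)\<^sup>2 + (p e x / k)\<^sup>2 \<le> 1 \<and> f e x \<le> - cos (k * (s (topv e) + x)))"
  have "reach e" by (rule all_reach[OF assms(1)])
  then have "e \<noteq> er \<longrightarrow> ?P e"
  proof (induction rule: reach.induct)
    case (reach_step e e')
    note e = reach_step.hyps(2) and e' = reach_step.hyps(3)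
    have kid: "e' \<in> kids (botv e)" using reach_step.hyps by (simp add: kids_def)
    have ne: "e' \<noteq> er" by (rule kids_ne_er[OF e kid])
    have st: "s (topv e') = s (topv e) + len G e" using s_bot[OF e] reach_step.hyps(4) by simp
    let ?a = "s (topv e')"
    have f0: "f e' 0 = f e (len G e)" by (rule kid_value[OF e kid])
    note sl = kid_slope[OF e kid]
    have l: "0 < len G e" "0 < len G e'" using len_pos e e' by auto
    have init: "len G er \<le> ?a \<and> k * ?a < pi \<and> 0 < f e' 0 * sin (k * ?a) + p e' 0 / k * cos (k * ?a) \<and>
       (f e' 0)\<^sup>2 + (p e' 0 / k)\<^sup>2 \<le> 1 \<and> f e' 0 \<le> - cos (k * ?a)"
    proof (cases "e = er")
      case True
      have a: "?a = len G er" using st True top_er s_root by simp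
      have fr: "f er (len G er) = - cos (k * len G er)" "p er (len G er) = k * sin (k * len G er)"
        using l True bt_er by (simp_all add: f_def p_def fw_def er_val er_deriv)
      have c: "cos (k * len G er) < 0" using kl cos_monotone_0_pi[of "pi / 2" "k * len G er"] by simp
      have "\<exists>e2\<in>kids (botv er). e2 \<noteq> e'" using two by metis
      then obtain e2 where e2: "e2 \<in> kids (botv er)" "e2 \<noteq> e'" by blast
      have "0 < f e2 0" using kid_value[OF er e2(1)] c fr by simp
      then have less: "p e' 0 < k * sin (k * len G er)" using sl(3) e2 True fr by simp
      then have less': "p e' 0 / k < sin (k * len G er)" using k by (simp add: pos_divide_less_eq mult.commute)
      have "0 < (sin (k * len G er) - p e' 0 / k) * - cos (k * len G er)" using less' c by (intro mult_pos_pos) auto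
      moreover have "(cos (k * len G er))\<^sup>2 + (p e' 0 / k)\<^sup>2 \<le> 1"
      proof -
        have "(p e' 0 / k)\<^sup>2 \<le> (sin (k * len G er))\<^sup>2" using less' sl(1) k by (intro power_mono) auto
        with sin_cos_squared_add[of "k * len G er"] show ?thesis by linarith
      qed
      ultimately show ?thesis using True f0 fr kl(2) unfolding a by (auto simp: algebra_simps)
    next
      case False
      have IH: "?P e" using reach_step.IH False by blast
      have "len G er \<le> ?a" using conjunct1[OF IH] st l by simp
      then have half: "pi / 2 \<le> k * ?a" using kl(1) mult_left_mono[of "len G er" ?a k] k by linarith
      have E: "k * ?a < pi" "0 < f e (len G e) * sin (k * ?a) + p e (len G e) / k * cos (k * ?a)"
        "(f e (len G e))\<^sup>2 + (p e (len G e) / k)\<^sup>2 \<le> 1" "f e (len G e) \<le> - cos (k * ?a)"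
        using IH l unfolding st by auto
      have c: "cos (k * ?a) \<le> 0" using half E(1) cos_monotone_0_pi_le[of "pi / 2" "k * ?a"] by simp
      have le: "p e' 0 / k \<le> p e (len G e) / k" using sl(2) k by (simp add: divide_right_mono)
      have "p e (len G e) / k * cos (k * ?a) \<le> p e' 0 / k * cos (k * ?a)" by (rule mult_right_mono_neg[OF le c])
      moreover have "(p e' 0 / k)\<^sup>2 \<le> (p e (len G e) / k)\<^sup>2" using le sl(1) k by (intro power_mono) auto
      ultimately show ?thesis unfolding f0 using E \<open>len G er \<le> ?a\<close> by (intro conjI; linarith)
    qed
    have half: "pi / 2 \<le> k * ?a"
      using kl(1) mult_left_mono[OF conjunct1[OF init], of k] k by linarith
    note I = conjunct1[OF init] conjunct2[OF init]
    have pos: "0 \<le> f e' x" "0 \<le> p e' x" if "x \<in> {0..len G e'}" for x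
      using that unfolding f_def by (intro nn e' ne fw_in p_nonneg; simp)+
    note C = edge_comparison[OF k outward_C2[OF e'] pos half]
    have "\<forall>x\<in>{0..len G e'}. k * (?a + x) < pi \<and>
      0 < f e' x * sin (k * (?a + x)) + p e' x / k * cos (k * (?a + x)) \<and>
      (f e' x)\<^sup>2 + (p e' x / k)\<^sup>2 \<le> 1 \<and> f e' x \<le> - cos (k * (?a + x))"
      using C I by (intro ballI conjI) auto
    with I(1) show ?case by (intro impI conjI)
  qed simp
  with assms show "len G er \<le> s (topv e)" "k * (s (topv e) + x) < pi"
    "0 < f e x * sin (k * (s (topv e) + x)) + p e x / k * cos (k * (s (topv e) + x))"
    "(f e x)\<^sup>2 + (p e x / k)\<^sup>2 \<le> 1" "f e x \<le> - cos (k * (s (topv e) + x))" by simp_all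
qed

end

section \<open>Correlation with the distance from the leaf\<close>

context outer_nodal
begin

definition X :: "'e \<Rightarrow> real \<Rightarrow> real" where "X e x = k * rdist e x - pi / 2"

lemma X_bounds:
  assumes "e \<in> edges G" "e \<noteq> er" "x \<in> {0..len G e}"
  shows "0 < X e x" "X e x < pi / 2"
proof -
  have r: "rdist e x = s (topv e) + fw e x" by (simp add: rdist_def fw_def)
  note B = outward_profile[OF assms(1,2) fw_in[OF assms(3)]]
  show "X e x < pi / 2" using B(2) by (simp add: X_def r)
  have "len G er \<le> rdist e x" using B(1) fw_in[OF assms(3)] by (simp add: r)
  then have "k * len G er \<le> k * rdist e x" using k by simp
  then show "0 < X e x" using kl(1) by (simp add: X_def)
qed

lemma profile:
  assumes "e \<in> edges G" "e \<noteq> er" "x \<in> {0..len G e}"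
  shows "0 \<le> \<phi> e x" "\<phi> e x \<le> sin (X e x)"
    "0 < \<phi> e x * cos (X e x) - (if bt e then 1 else -1) * \<phi>' e x / k * sin (X e x)"
proof -
  have r: "rdist e x = s (topv e) + fw e x" by (simp add: rdist_def fw_def)
  note B = outward_profile[OF assms(1,2) fw_in[OF assms(3)]]
  have t: "cos (k * rdist e x) = - sin (X e x)" "sin (k * rdist e x) = cos (X e x)"
    by (simp_all add: X_def cos_diff sin_diff)
  show "0 \<le> \<phi> e x" by (rule nn[OF assms])
  show "\<phi> e x \<le> sin (X e x)" using B(5) unfolding r[symmetric] t by (simp add: f_def)
  show "0 < \<phi> e x * cos (X e x) - (if bt e then 1 else -1) * \<phi>' e x / k * sin (X e x)"
    using B(3) unfolding r[symmetric] t by (simp add: f_def p_def)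
qed

abbreviation x0 :: real where "x0 \<equiv> k * len G er - pi / 2"

definition gp :: "bool \<Rightarrow> real \<Rightarrow> real" where "gp b x = rho b x / cos x"

text \<open>On \<open>er\<close> the quotient is frozen at its value at the attaching vertex. This
  keeps \<open>W\<close> continuous, removes \<open>er\<close> from the derivative term, and leaves
  only the explicit integral of \<phi> over \<open>er\<close>.\<close>

definition W :: "bool \<Rightarrow> 'e \<Rightarrow> real \<Rightarrow> real" where
  "W b e x = (if e = er then gp b x0 else gp b (X e x))"

definition W' :: "bool \<Rightarrow> 'e \<Rightarrow> real \<Rightarrow> real" where
  "W' b e x = (if e = er then 0 else (rho b (X e x) * sin (X e x) / (cos (X e x))\<^sup>2 - drho b (X e x) / cos (X e x)) *
     (k * (if bt e then 1 else -1)))"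

lemma cos_X_pos: "e \<in> edges G \<Longrightarrow> e \<noteq> er \<Longrightarrow> x \<in> {0..len G e} \<Longrightarrow> 0 < cos (X e x)"
  using X_bounds[of e x] by (intro cos_gt_zero_pi) auto

lemma X_er: "x \<in> {0..len G er} \<Longrightarrow> X er x = k * (len G er - x) - pi / 2"
  using top_er s_root bt_er by (simp add: X_def rdist_def)

lemma X_cont: "continuous_on S (X e)"
  unfolding X_def rdist_def by (cases "bt e") (auto intro!: continuous_intros)

lemma rho_cont: "continuous_on S (rho b)" and drho_cont: "continuous_on S (drho b)"
  by (cases b; auto simp: rho_def drho_def intro!: continuous_intros)+

lemma W_test: "test_fun G (W b) (W' b)"
  unfolding test_fun_def
proof (intro conjI ballI)
  fix e assume e: "e \<in> edges G"
  show "pw_diff (len G e) (W b e) (W' b e)"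
  proof (cases "e = er")
    case True
    then have "W b e = (\<lambda>_. gp b x0)" "W' b e = (\<lambda>_. 0)" by (auto simp: W_def W'_def)
    then show ?thesis by (auto simp: pw_diff_def intro!: exI[of _ "{}"])
  next
    case False
    have c: "cos (X e x) \<noteq> 0" if "x \<in> {0..len G e}" for x using cos_X_pos[OF e False that] by simp
    have D: "(W b e has_real_derivative W' b e x) (at x within S)" if "x \<in> {0..len G e}" for x S
    proof -
      have dX: "(X e has_real_derivative k * (if bt e then 1 else -1)) (at x within S)"
        unfolding X_def rdist_def by (cases "bt e") (auto intro!: derivative_eq_intros)
      have "(gp b has_real_derivative rho b (X e x) * sin (X e x) / (cos (X e x))\<^sup>2 - drho b (X e x) / cos (X e x)) (at (X e x))"
        unfolding gp_def using c[OF that]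
        by (auto intro!: derivative_eq_intros DERIV_rho simp: field_simps power2_eq_square)
      from DERIV_chain2[OF this dX] have "((\<lambda>x. gp b (X e x)) has_real_derivative W' b e x) (at x within S)"
        unfolding W'_def if_not_P[OF False] .
      moreover have "W b e = (\<lambda>x. gp b (X e x))" using False by (simp add: W_def fun_eq_iff)
      ultimately show ?thesis by simp
    qed
    have "continuous_on {0..len G e} (W b e)" using D by (intro DERIV_continuous_on) blast
    moreover have "continuous_on {0..len G e} (W' b e)"
    proof -
      have cc: "continuous_on {0..len G e} (\<lambda>x. h (X e x))" if "continuous_on UNIV h" for h :: "real \<Rightarrow> real"
        by (rule continuous_on_compose2[OF that X_cont]) simp
      have "continuous_on {0..len G e} (\<lambda>x. (rho b (X e x) * sin (X e x) / (cos (X e x))\<^sup>2 - drho b (X e x) / cos (X e x)) *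
        (k * (if bt e then 1 else -1)))"
        by (intro continuous_intros cc rho_cont drho_cont continuous_on_id) (use c in auto)
      then show ?thesis using False by (simp add: W'_def[abs_def])
    qed
    ultimately show ?thesis using D
      by (auto simp: pw_diff_def intro!: exI[of _ "{}"] integrable_continuous_real continuous_on_power)
  qed
next
  have ep: "W b (fst p) (coord G p) = gp b (k * s v - pi / 2)" if v: "v \<in> verts G" "p \<in> v" "v \<noteq> {(er, True)}" for v p
  proof -
    have pE: "p \<in> edges G \<times> UNIV" using vert_sub[OF v(1)] v(2) by auto
    have r: "rdist (fst p) (coord G p) = s v" using rdist_endpoint[OF pE] vertex_of_eq[OF v(1,2)] by simp
    show ?thesis
    proof (cases "fst p = er")
      case True
      have "snd p \<noteq> True"
      proof
        assume "snd p = True"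
        then have "p = (er, True)" using True by (cases p) simp
        then have "v = {(er, True)}" using vertex_of_eq[OF v(1,2)] vertex_root by simp
        then show False using v(3) by simp
      qed
      then have "p = (er, False)" using True by (cases p) auto
      then have "s v = len G er" using r top_er s_root bt_er by (simp add: rdist_def coord_def)
      then show ?thesis using True by (simp add: W_def)
    next
      case False
      then show ?thesis by (simp add: W_def X_def r)
    qed
  qed
  show "agrees_at_vertices G (W b)"
    unfolding agrees_at_vertices_def
  proof (intro ballI)
    fix v p p' assume v: "v \<in> verts G" "p \<in> v" "p' \<in> v"
    show "W b (fst p) (coord G p) = W b (fst p') (coord G p')"
    proof (cases "v = {(er, True)}")
      case True
      then show ?thesis using v by simp
    next
      case False
      then show ?thesis using ep[OF v(1,2)] ep[OF v(1,3)] by simp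
    qed
  qed
qed

text \<open>Off \<open>er\<close> the integrand k^2 \<phi> W - \<phi>' W' of the weak equation
  equals k^2 \<open>kappa\<close>. The terms are grouped by Wronskian and slope to match
  \<open>calibration_upper\<close> and \<open>calibration_lower\<close>.\<close>

definition kappa :: "bool \<Rightarrow> 'e \<Rightarrow> real \<Rightarrow> real" where
  "kappa b e x = rho b (X e x) * (\<phi> e x * cos (X e x) - (if bt e then 1 else -1) * \<phi>' e x / k * sin (X e x)) / (cos (X e x))\<^sup>2
     + drho b (X e x) * ((if bt e then 1 else -1) * \<phi>' e x / k) / cos (X e x)"

lemma phi_cont: "e \<in> edges G \<Longrightarrow> continuous_on {0..len G e} (\<phi> e)" "e \<in> edges G \<Longrightarrow> continuous_on {0..len G e} (\<phi>' e)"
  using C2_onD(3,4)[OF phi_C2] by auto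

lemma kappa_cont:
  assumes e: "e \<in> edges G" "e \<noteq> er"
  shows "continuous_on {0..len G e} (kappa b e)"
proof -
  have cc: "continuous_on {0..len G e} (\<lambda>x. h (X e x))" if "continuous_on UNIV h" for h :: "real \<Rightarrow> real"
    by (rule continuous_on_compose2[OF that X_cont]) simp
  show ?thesis unfolding kappa_def using k
    by (intro continuous_intros cc rho_cont drho_cont continuous_on_id phi_cont e) (use cos_X_pos[OF e] in fastforce)+
qed

lemma gp_x0: "gp b x0 * sin (k * len G er) = rho b x0"
proof -
  have "cos x0 = sin (k * len G er)" by (simp add: cos_diff)
  moreover have "0 < sin (k * len G er)" using kl pi_gt_zero by (intro sin_gt_zero) linarith+
  ultimately show ?thesis by (simp add: gp_def)
qed

lemma er_integral: "integral {0..len G er} (\<phi> er) = - sin (k * len G er) / k"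
proof -
  have l: "0 < len G er" by (rule len_pos[OF er])
  have "((\<lambda>x. - cos (k * (len G er - x))) has_integral sin (k * (len G er - len G er)) / k - sin (k * (len G er - 0)) / k) {0..len G er}"
    by (rule fundamental_theorem_of_calculus)
      (use l k in \<open>auto intro!: derivative_eq_intros simp: has_real_derivative_iff_has_vector_derivative[symmetric]\<close>)
  then have "(\<phi> er has_integral sin (k * (len G er - len G er)) / k - sin (k * (len G er - 0)) / k) {0..len G er}"
    by (rule has_integral_eq[rotated]) (simp add: er_val)
  then show ?thesis by (simp add: integral_unique)
qed

lemma sum_er: "sum h (edges G) = h er + sum h (edges G - {er})" for h :: "'e \<Rightarrow> real"
  by (rule sum.remove[OF fin_edges er])

text \<open>The weak equation tested with \<open>W\<close>. On \<open>er\<close> only the constant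
  value of \<open>W\<close> times the integral of \<phi> contributes, and the cosine in the
  denominator of \<open>gp\<close> cancels the sine in that integral.\<close>

lemma kappa_total: "(\<Sum>e\<in>edges G - {er}. integral {0..len G e} (kappa b e)) = rho b x0 / k"
proof -
  note wk = Z.esol_weak[OF es W_test[of b]]
  have pt: "k\<^sup>2 * (\<phi> e x * W b e x) - \<phi>' e x * W' b e x = k\<^sup>2 * kappa b e x"
    if "e \<in> edges G" "e \<noteq> er" "x \<in> {0..len G e}" for e x
  proof -
    have "cos (X e x) \<noteq> 0" using cos_X_pos[OF that] by simp
    then show ?thesis using that(2) k
      by (simp add: W_def W'_def kappa_def gp_def) (simp add: field_simps power2_eq_square)
  qed
  have Wc: "edge_cont G (W b)" by (rule test_fun_edge_cont[OF W_test])
  have i1: "(\<lambda>x. \<phi> e x * W b e x) integrable_on {0..len G e}" if "e \<in> edges G" for e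
    using that phi_cont(1)[OF that] Wc unfolding edge_cont_def by (intro integrable_continuous_real continuous_on_mult) auto
  have i2: "(\<lambda>x. k\<^sup>2 * kappa b e x) integrable_on {0..len G e}" if "e \<in> edges G - {er}" for e
    using that by (intro integrable_continuous_real continuous_on_mult continuous_on_const kappa_cont) auto
  have i: "integral {0..len G e} (\<lambda>x. \<phi>' e x * W' b e x) = k\<^sup>2 * integral {0..len G e} (\<lambda>x. \<phi> e x * W b e x) - k\<^sup>2 * integral {0..len G e} (kappa b e)"
    if "e \<in> edges G - {er}" for e
  proof -
    have "integral {0..len G e} (\<lambda>x. \<phi>' e x * W' b e x) = integral {0..len G e} (\<lambda>x. k\<^sup>2 * (\<phi> e x * W b e x) - k\<^sup>2 * kappa b e x)"
      using that pt by (intro integral_cong) (auto simp: algebra_simps)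
    also have "\<dots> = integral {0..len G e} (\<lambda>x. k\<^sup>2 * (\<phi> e x * W b e x)) - integral {0..len G e} (\<lambda>x. k\<^sup>2 * kappa b e x)"
      using that i2[OF that] integrable_on_cmult_left[OF i1[of e], of "k\<^sup>2"] by (intro integral_diff) auto
    finally show ?thesis by simp
  qed
  have "k\<^sup>2 * ip G \<phi> (W b) = ip G \<phi>' (W' b)" using wk by (simp add: ip_def)
  then have "k\<^sup>2 * integral {0..len G er} (\<lambda>x. \<phi> er x * W b er x) + k\<^sup>2 * (\<Sum>e\<in>edges G - {er}. integral {0..len G e} (\<lambda>x. \<phi> e x * W b e x))
    = integral {0..len G er} (\<lambda>x. \<phi>' er x * W' b er x) + (\<Sum>e\<in>edges G - {er}. integral {0..len G e} (\<lambda>x. \<phi>' e x * W' b e x))"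
    unfolding ip_def sum_er by (simp add: distrib_left)
  also have "integral {0..len G er} (\<lambda>x. \<phi>' er x * W' b er x) = 0" by (simp add: W'_def)
  also have "(\<Sum>e\<in>edges G - {er}. integral {0..len G e} (\<lambda>x. \<phi>' e x * W' b e x)) =
     k\<^sup>2 * (\<Sum>e\<in>edges G - {er}. integral {0..len G e} (\<lambda>x. \<phi> e x * W b e x)) - k\<^sup>2 * (\<Sum>e\<in>edges G - {er}. integral {0..len G e} (kappa b e))"
    by (simp add: i sum_subtractf sum_distrib_left)
  also have "integral {0..len G er} (\<lambda>x. \<phi> er x * W b er x) = gp b x0 * (- sin (k * len G er) / k)"
    unfolding er_integral[symmetric] by (simp add: W_def mult.commute)
  finally have "k\<^sup>2 * (\<Sum>e\<in>edges G - {er}. integral {0..len G e} (kappa b e)) = k\<^sup>2 * (gp b x0 * sin (k * len G er) / k)" by simp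
  then have "k\<^sup>2 * (\<Sum>e\<in>edges G - {er}. integral {0..len G e} (kappa b e)) = k\<^sup>2 * (rho b x0 / k)" unfolding gp_x0 .
  moreover have "k\<^sup>2 \<noteq> 0" using k by simp
  ultimately show ?thesis by (simp only: mult_cancel_left simp_thms)
qed

text \<open>\<open>rho\<close> vanishes at - pi / 2, the phase at the leaf, so only the attaching
  vertex contributes. The value is opposite to that of \<open>kappa_total\<close>; this cancellation
  is why \<open>rho\<close> is normalised to vanish there.\<close>

lemma er_drho: "integral {0..len G er} (\<lambda>x. drho b (X er x)) = - rho b x0 / k"
proof -
  have l: "0 < len G er" by (rule len_pos[OF er])
  let ?Y = "\<lambda>x. k * (len G er - x) - pi / 2"
  have D: "((\<lambda>x. rho b (?Y x) / k) has_real_derivative drho b (?Y x)) (at x within S)" for x S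
  proof -
    have "(?Y has_real_derivative - k) (at x within S)" by (auto intro!: derivative_eq_intros)
    from DERIV_cdivide[OF DERIV_chain2[OF DERIV_rho this], where c = k] show ?thesis using k by simp
  qed
  have "((\<lambda>x. drho b (?Y x)) has_integral rho b (?Y (len G er)) / k - rho b (?Y 0) / k) {0..len G er}"
    by (rule fundamental_theorem_of_calculus)
      (use l D in \<open>auto simp: has_real_derivative_iff_has_vector_derivative[symmetric]\<close>)
  then have "((\<lambda>x. drho b (X er x)) has_integral rho b (?Y (len G er)) / k - rho b (?Y 0) / k) {0..len G er}"
    by (rule has_integral_eq[rotated]) (simp add: X_er)
  then show ?thesis by (simp add: integral_unique)
qed

lemma er_phi: "x \<in> {0..len G er} \<Longrightarrow> \<phi> er x = sin (X er x)"
  by (simp add: er_val X_er sin_diff)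

lemma another_edge: "\<exists>e\<in>edges G - {er}. True"
  using two kids_top(1) kids_ne_er[OF er] by blast

text \<open>Off \<open>er\<close> the integrand lies strictly below \<open>kappa True\<close>, on
  \<open>er\<close> it equals \<open>drho True\<close>, and the two totals cancel.\<close>

lemma weighted_neg: "ip G (\<lambda>e x. X e x * \<phi> e x) \<phi> < 0"
proof -
  have "(\<Sum>e\<in>edges G - {er}. integral {0..len G e} (\<lambda>x. X e x * \<phi> e x * \<phi> e x)) < (\<Sum>e\<in>edges G - {er}. integral {0..len G e} (kappa True e))"
  proof (rule sum_strict_mono)
    show "finite (edges G - {er})" "edges G - {er} \<noteq> {}" using another_edge by auto
    fix e assume e: "e \<in> edges G - {er}"
    show "integral {0..len G e} (\<lambda>x. X e x * \<phi> e x * \<phi> e x) < integral {0..len G e} (kappa True e)"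
    proof (rule integral_less)
      show "0 < len G e" "continuous_on {0..len G e} (\<lambda>x. X e x * \<phi> e x * \<phi> e x)" "continuous_on {0..len G e} (kappa True e)"
        using e len_pos by (auto intro!: continuous_on_mult X_cont phi_cont kappa_cont)
      fix x assume x: "x \<in> {0..len G e}"
      have E: "e \<in> edges G" "e \<noteq> er" using e by auto
      note B = X_bounds[OF E x] and P = profile[OF E x]
      have "X e x * (\<phi> e x)\<^sup>2 < kappa True e x"
        unfolding kappa_def by (rule calibration_upper[OF less_imp_le[OF B(1)] B(2) P])
      then show "X e x * \<phi> e x * \<phi> e x < kappa True e x" by (simp add: power2_eq_square mult.assoc)
    qed
  qed
  also have "\<dots> = rho True x0 / k" by (rule kappa_total)
  finally have *: "(\<Sum>e\<in>edges G - {er}. integral {0..len G e} (\<lambda>x. X e x * \<phi> e x * \<phi> e x)) < rho True x0 / k" .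
  have "integral {0..len G er} (\<lambda>x. X er x * \<phi> er x * \<phi> er x) = - rho True x0 / k"
    unfolding er_drho[symmetric] by (intro integral_cong) (simp add: er_phi drho_def power2_eq_square)
  with * show ?thesis unfolding ip_def sum_er by simp
qed

text \<open>The same cancellation with \<open>False\<close>: on \<open>er\<close>, where \<phi> =
  sin X, the weight X (1 - \<phi>^2) is X cos^2 X.\<close>

lemma weighted_complement: "ip G (\<lambda>e x. X e x * \<phi> e x) \<phi> \<le> ip G X (\<lambda>_ _. 1)"
proof -
  have i: "(\<lambda>x. X e x * (1 - (\<phi> e x)\<^sup>2)) integrable_on {0..len G e}" if "e \<in> edges G" for e
    using that by (intro integrable_continuous_real continuous_intros X_cont phi_cont)
  have "rho False x0 / k = (\<Sum>e\<in>edges G - {er}. integral {0..len G e} (kappa False e))" by (rule kappa_total[symmetric])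
  also have "\<dots> \<le> (\<Sum>e\<in>edges G - {er}. integral {0..len G e} (\<lambda>x. X e x * (1 - (\<phi> e x)\<^sup>2)))"
  proof (intro sum_mono integral_le)
    fix e assume e: "e \<in> edges G - {er}"
    have E: "e \<in> edges G" "e \<noteq> er" using e by auto
    show "kappa False e integrable_on {0..len G e}" by (intro integrable_continuous_real kappa_cont E)
    show "(\<lambda>x. X e x * (1 - (\<phi> e x)\<^sup>2)) integrable_on {0..len G e}" by (rule i[OF E(1)])
    fix x assume x: "x \<in> {0..len G e}"
    show "kappa False e x \<le> X e x * (1 - (\<phi> e x)\<^sup>2)"
      unfolding kappa_def by (rule calibration_lower[OF X_bounds[OF E x] profile[OF E x]])
  qed
  finally have *: "rho False x0 / k \<le> (\<Sum>e\<in>edges G - {er}. integral {0..len G e} (\<lambda>x. X e x * (1 - (\<phi> e x)\<^sup>2)))" .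
  have "integral {0..len G er} (\<lambda>x. X er x * (1 - (\<phi> er x)\<^sup>2)) = - rho False x0 / k"
    unfolding er_drho[symmetric] by (intro integral_cong) (simp add: er_phi drho_def cos_squared_eq)
  with * have "0 \<le> (\<Sum>e\<in>edges G. integral {0..len G e} (\<lambda>x. X e x * (1 - (\<phi> e x)\<^sup>2)))" unfolding sum_er by simp
  also have "\<dots> = (\<Sum>e\<in>edges G. integral {0..len G e} (\<lambda>x. X e x * 1 - X e x * \<phi> e x * \<phi> e x))"
    by (intro sum.cong integral_cong) (simp_all add: power2_eq_square algebra_simps)
  also have "\<dots> = (\<Sum>e\<in>edges G. integral {0..len G e} (\<lambda>x. X e x * 1) - integral {0..len G e} (\<lambda>x. X e x * \<phi> e x * \<phi> e x))"
    by (intro sum.cong integral_diff integrable_continuous_real continuous_intros X_cont phi_cont refl)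
  finally show ?thesis unfolding ip_def by (simp add: sum_subtractf)
qed

lemma mass_less: "ip G \<phi> \<phi> < ip G (\<lambda>_ _. 1) (\<lambda>_ _. 1)"
  unfolding ip_def
proof (rule sum_strict_mono_ex1[OF fin_edges])
  have le: "\<phi> e x * \<phi> e x < 1" if E: "e \<in> edges G" "e \<noteq> er" "x \<in> {0..len G e}" for e x
  proof -
    have "sin (X e x) < sin (pi / 2)" using X_bounds[OF E] by (intro sin_monotone_2pi) auto
    then have "\<phi> e x < 1" "0 \<le> \<phi> e x" using profile[OF E] by auto
    then show ?thesis using mult_strict_mono[of "\<phi> e x" 1 "\<phi> e x" 1] by simp
  qed
  show "\<forall>e\<in>edges G. integral {0..len G e} (\<lambda>x. \<phi> e x * \<phi> e x) \<le> integral {0..len G e} (\<lambda>x. 1 * 1)"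
  proof (intro ballI integral_le integrable_continuous_real continuous_intros phi_cont)
    fix e x assume e: "e \<in> edges G" "x \<in> {0..len G e}"
    show "\<phi> e x * \<phi> e x \<le> 1 * 1"
    proof (cases "e = er")
      case True
      then show ?thesis using e er_phi[of x] abs_square_le_1[of "sin (X er x)"] by (simp add: power2_eq_square[symmetric])
    qed (use le[OF e(1) _ e(2)] in simp)
  qed
  from another_edge obtain e where e: "e \<in> edges G" "e \<noteq> er" by blast
  have "integral {0..len G e} (\<lambda>x. \<phi> e x * \<phi> e x) < integral {0..len G e} (\<lambda>x. 1 * 1)"
    using e le len_pos by (intro integral_less continuous_intros phi_cont) auto
  then show "\<exists>e\<in>edges G. integral {0..len G e} (\<lambda>x. \<phi> e x * \<phi> e x) < integral {0..len G e} (\<lambda>x. 1 * 1)" using e by blast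
qed

lemma rdist_cont: "edge_cont G rdist"
  unfolding edge_cont_def rdist_def by (intro ballI, rename_tac e, case_tac "bt e") (auto intro!: continuous_intros)

text \<open>Adding a constant to the weight changes both sides equally, so \<open>X\<close> may take
  the place of \<open>rdist\<close>. Then L, the larger total, meets a negative integral and may be
  replaced by the mass of \<phi>, after which \<open>weighted_complement\<close> applies.\<close>

theorem distance_correlation:
  "ip G (\<lambda>_ _. 1) (\<lambda>_ _. 1) * ip G (\<lambda>e x. rdist e x * \<phi> e x) \<phi> < ip G \<phi> \<phi> * ip G rdist (\<lambda>_ _. 1)"
proof -
  have Xlc: "X = lc k rdist (- (pi / 2)) (\<lambda>_ _. 1)" by (simp add: X_def lc_def fun_eq_iff)
  have Xplc: "(\<lambda>e x. X e x * \<phi> e x) = lc k (\<lambda>e x. rdist e x * \<phi> e x) (- (pi / 2)) \<phi>"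
    by (simp add: X_def lc_def fun_eq_iff algebra_simps)
  have pc: "edge_cont G \<phi>" by (simp add: edge_cont_def phi_cont)
  have A: "ip G (\<lambda>e x. X e x * \<phi> e x) \<phi> = k * ip G (\<lambda>e x. rdist e x * \<phi> e x) \<phi> - pi / 2 * ip G \<phi> \<phi>"
    unfolding Xplc by (subst ip_lc_left) (auto intro: edge_cont_mult rdist_cont pc)
  have B: "ip G X (\<lambda>_ _. 1) = k * ip G rdist (\<lambda>_ _. 1) - pi / 2 * ip G (\<lambda>_ _. 1) (\<lambda>_ _. 1)"
    unfolding Xlc by (subst ip_lc_left) (auto intro: rdist_cont edge_cont_const)
  let ?L = "ip G (\<lambda>_ _. 1) (\<lambda>_ _. 1)" and ?E = "ip G \<phi> \<phi>"
  have "?L * ip G (\<lambda>e x. X e x * \<phi> e x) \<phi> < ?E * ip G (\<lambda>e x. X e x * \<phi> e x) \<phi>"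
    using mass_less weighted_neg by (simp add: mult_less_cancel_right)
  also have "\<dots> \<le> ?E * ip G X (\<lambda>_ _. 1)" using weighted_complement ip_square_nonneg[of G \<phi>] by (intro mult_left_mono)
  finally have "k * (?L * ip G (\<lambda>e x. rdist e x * \<phi> e x) \<phi>) < k * (?E * ip G rdist (\<lambda>_ _. 1))"
    unfolding A B by (simp add: algebra_simps)
  then show ?thesis using k by simp
qed

end

section \<open>Perturbation of the gap\<close>

lemma young_product:
  fixes a b c A B :: real
  assumes "0 < A" "0 \<le> B" "c\<^sup>2 \<le> A * B"
  shows "2 * a * b * c \<le> A * a\<^sup>2 + B * b\<^sup>2"
proof -
  have "0 \<le> (A * a - b * c)\<^sup>2" by simp
  then have "A * (2 * a * b * c) \<le> A * (A * a\<^sup>2) + b\<^sup>2 * c\<^sup>2" by (simp add: power2_eq_square algebra_simps)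
  also have "\<dots> \<le> A * (A * a\<^sup>2) + b\<^sup>2 * (A * B)" using assms(3) by (intro add_left_mono mult_left_mono) auto
  finally have "A * (2 * a * b * c) \<le> A * (A * a\<^sup>2 + B * b\<^sup>2)" by (simp add: algebra_simps)
  then show ?thesis using assms(1) by simp
qed

context mgraph
begin

lemma spectral_gap_esol_orth:
  assumes "esol G (\<lambda>_ _. 0) spectral_gap \<phi> \<phi>'"
  shows "ip G \<phi> (\<lambda>_ _. 1) = 0"
  by (rule Z.esol_orthogonal[OF assms one_esol]) (use spectral_gap_pos in simp)

text \<open>On the span of 1 and \<phi> the only coupling is the cross term in the potential energy.
  Constants stay well below the claimed bound, and this surplus absorbs the cross term at a cost of
  order t^2 in the coefficient of b^2.\<close>

lemma eigval2_upper:
  assumes \<phi>: "esol G (\<lambda>_ _. 0) spectral_gap \<phi> \<phi>'" and pos: "0 < ip G \<phi> \<phi>"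
    and q: "edge_cont G q" and t: "0 \<le> t"
    and qnn: "\<And>e x. e \<in> edges G \<Longrightarrow> x \<in> {0..len G e} \<Longrightarrow> 0 \<le> q e x"
    and small: "2 * t * ip G q (\<lambda>_ _. 1) \<le> spectral_gap * ip G (\<lambda>_ _. 1) (\<lambda>_ _. 1)"
  shows "eigval G (\<lambda>e x. t * q e x) 2 \<le> spectral_gap + t * ip G (\<lambda>e x. q e x * \<phi> e x) \<phi> / ip G \<phi> \<phi> +
    2 * (ip G q \<phi>)\<^sup>2 / (spectral_gap * ip G (\<lambda>_ _. 1) (\<lambda>_ _. 1) * ip G \<phi> \<phi>) * t\<^sup>2"
proof -
  interpret T: pgraph G "\<lambda>e x. t * q e x"
    by unfold_locales (use q t qnn in \<open>auto simp: edge_cont_def intro: continuous_on_mult_left\<close>)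
  let ?one = "\<lambda>(_::'a) (_::real). 1 :: real"
  let ?L = "ip G ?one ?one" and ?E = "ip G \<phi> \<phi>"
  define K where "K = 2 * (ip G q \<phi>)\<^sup>2 / (spectral_gap * ?L * ?E)"
  define C where "C = spectral_gap + t * ip G (\<lambda>e x. q e x * \<phi> e x) \<phi> / ?E + K * t\<^sup>2"
  note L = length_pos and g = spectral_gap_pos
  have pc: "edge_cont G \<phi>" "edge_cont G \<phi>'" using esol_cont[OF \<phi>] by auto
  have oc: "edge_cont G ?one" by (rule edge_cont_const)
  have orth: "ip G \<phi> ?one = 0" by (rule spectral_gap_esol_orth[OF \<phi>])
  have kd: "kdom G \<phi> \<phi>' (\<lambda>e x. (0 - spectral_gap) * \<phi> e x)" using \<phi> by (simp only: esol_def)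
  have mass: "ip G (lc a ?one b \<phi>) (lc a ?one b \<phi>) = a\<^sup>2 * ?L + b\<^sup>2 * ?E" for a b
    using orth ip_lc_square[OF oc pc(1)] by (simp add: ip_commute[of G ?one \<phi>])
  have "2 \<le> T.count_upto C"
  proof (rule T.two_le_count_of_test_space[OF one_kdom kd])
    show "a = 0 \<and> b = 0" if "ip G (lc a ?one b \<phi>) (lc a ?one b \<phi>) = 0" for a b
    proof -
      have "0 \<le> a\<^sup>2 * ?L" "0 \<le> b\<^sup>2 * ?E" using L pos by simp_all
      then have "a\<^sup>2 * ?L = 0" "b\<^sup>2 * ?E = 0" using that[unfolded mass] by linarith+
      then show ?thesis using L pos by simp
    qed
    fix a b
    have qoc: "edge_cont G (\<lambda>e x. q e x * \<phi> e x)" by (intro edge_cont_mult q pc)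
    have 1: "ip G (lc a (\<lambda>_ _. 0) b \<phi>') (lc a (\<lambda>_ _. 0) b \<phi>') = b\<^sup>2 * (spectral_gap * ?E)"
    proof -
      have "lc a (\<lambda>_ _. 0) b \<phi>' = lc b \<phi>' 0 \<phi>'" by (simp add: lc_def)
      then show ?thesis using Z.esol_energy[OF \<phi>] by (simp add: ip_scale ip_scale_right power2_eq_square) (simp add: ip_def)
    qed
    have 2: "ip G (\<lambda>e x. t * q e x * lc a ?one b \<phi> e x) (lc a ?one b \<phi>) =
      t * (a\<^sup>2 * ip G q ?one + 2 * a * b * ip G q \<phi> + b\<^sup>2 * ip G (\<lambda>e x. q e x * \<phi> e x) \<phi>)"
    proof -
      have eq: "(\<lambda>e x. t * q e x * lc a ?one b \<phi> e x) = lc (t * a) q (t * b) (\<lambda>e x. q e x * \<phi> e x)"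
        by (simp add: lc_def fun_eq_iff algebra_simps)
      have sw: "ip G (\<lambda>e x. q e x * \<phi> e x) ?one = ip G q \<phi>" by (rule ip_cong) simp
      show ?thesis
        unfolding eq ip_lc_left[OF q qoc edge_cont_lc[OF oc pc(1)]] ip_lc_right[OF oc pc(1) q] ip_lc_right[OF oc pc(1) qoc] sw
        by (simp add: algebra_simps power2_eq_square)
    qed
    have K0: "0 \<le> K" unfolding K_def using g L pos by (intro divide_nonneg_nonneg mult_nonneg_nonneg) auto
    have CE: "C * ?E = spectral_gap * ?E + t * ip G (\<lambda>e x. q e x * \<phi> e x) \<phi> + K * t\<^sup>2 * ?E"
      unfolding C_def using pos by (simp add: field_simps)
    have q2: "0 \<le> ip G (\<lambda>e x. q e x * \<phi> e x) \<phi>" by (rule ip_nonneg) (simp add: qnn mult.assoc)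
    have "spectral_gap \<le> C" unfolding C_def using K0 q2 pos t by simp
    then have "spectral_gap * ?L \<le> C * ?L" using L by simp
    \<comment> \<open>By \<open>small\<close>, constants use at most half of what the bound
      \<open>C\<close> grants them; the other half is the coefficient of a^2 in
      \<open>young_product\<close>.\<close>
    then have CL: "spectral_gap * ?L / 2 + t * ip G q ?one \<le> C * ?L" using small by simp
    have "2 * a * b * (t * ip G q \<phi>) \<le> spectral_gap * ?L / 2 * a\<^sup>2 + (K * t\<^sup>2 * ?E) * b\<^sup>2"
    proof (rule young_product)
      show "0 < spectral_gap * ?L / 2" "0 \<le> K * t\<^sup>2 * ?E" using g L K0 pos by simp_all
      have "spectral_gap * ?L * ?E * K = 2 * (ip G q \<phi>)\<^sup>2" unfolding K_def using g L pos by simp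
      then have "spectral_gap * ?L / 2 * (K * t\<^sup>2 * ?E) = (ip G q \<phi>)\<^sup>2 * t\<^sup>2" by (simp add: mult_ac)
      then show "(t * ip G q \<phi>)\<^sup>2 \<le> spectral_gap * ?L / 2 * (K * t\<^sup>2 * ?E)" by (simp only: power_mult_distrib mult.commute order_refl)
    qed
    moreover have "(spectral_gap * ?L / 2 + t * ip G q ?one) * a\<^sup>2 \<le> C * ?L * a\<^sup>2"
      by (rule mult_right_mono[OF CL]) simp
    moreover have "C * ?E * b\<^sup>2 = (spectral_gap * ?E + t * ip G (\<lambda>e x. q e x * \<phi> e x) \<phi> + K * t\<^sup>2 * ?E) * b\<^sup>2" unfolding CE ..
    ultimately show "ip G (lc a (\<lambda>_ _. 0) b \<phi>') (lc a (\<lambda>_ _. 0) b \<phi>') + ip G (\<lambda>e x. t * q e x * lc a ?one b \<phi> e x) (lc a ?one b \<phi>)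
        \<le> C * ip G (lc a ?one b \<phi>) (lc a ?one b \<phi>)"
      unfolding 1 2 mass by (simp add: algebra_simps)
  qed
  from T.eigval_props(3)[OF _ this] show ?thesis unfolding C_def K_def by simp
qed

text \<open>Split u into its mean \<open>m\<close> and a rest \<open>v\<close>. The Poincare
  inequality gives \<open>v\<close> energy; half of it absorbs the cross term up to an error of
  order t^2 in m^2, the other half dominates the claimed bound times the mass of
  \<open>v\<close>.\<close>

lemma eigenvalue_lower:
  assumes q: "edge_cont G q" and t: "0 \<le> t"
    and qnn: "\<And>e x. e \<in> edges G \<Longrightarrow> x \<in> {0..len G e} \<Longrightarrow> 0 \<le> q e x"
    and small: "2 * t * ip G q (\<lambda>_ _. 1) \<le> spectral_gap * ip G (\<lambda>_ _. 1) (\<lambda>_ _. 1)"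
    and u: "esol G (\<lambda>e x. t * q e x) \<mu> u u'" and pos: "0 < ip G u u"
  shows "t * ip G q (\<lambda>_ _. 1) / ip G (\<lambda>_ _. 1) (\<lambda>_ _. 1)
     - 2 * (ip G q q + 1) / (spectral_gap * ip G (\<lambda>_ _. 1) (\<lambda>_ _. 1)) * t\<^sup>2 \<le> \<mu>"
proof -
  interpret T: pgraph G "\<lambda>e x. t * q e x"
    by unfold_locales (use q t qnn in \<open>auto simp: edge_cont_def intro: continuous_on_mult_left\<close>)
  let ?one = "\<lambda>(_::'a) (_::real). 1 :: real"
  let ?L = "ip G ?one ?one" and ?Q = "ip G q ?one"
  \<comment> \<open>The summand 1 keeps \<open>K\<close> positive, as \<open>young_product\<close>
    requires, even if \<open>q\<close> vanishes.\<close>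
  define K where "K = 2 * (ip G q q + 1) / (spectral_gap * ?L)"
  define m where "m = ip G u ?one / ?L"
  define v where "v = lc 1 u (- m) ?one"
  note L = length_pos and g = spectral_gap_pos
  have oc: "edge_cont G ?one" by (rule edge_cont_const)
  have uc: "edge_cont G u" by (rule esol_cont(1)[OF u])
  have vc: "edge_cont G v" unfolding v_def by (intro edge_cont_lc uc oc)
  have v0: "ip G v ?one = 0" unfolding v_def ip_lc_left[OF uc oc oc] m_def using L by simp
  have kd: "kdom G u u' (\<lambda>e x. (t * q e x - \<mu>) * u e x)" using u by (simp add: esol_def)
  have "lc 1 u' (- m) (\<lambda>_ _. 0) = u'" by (simp add: lc_def)
  then have "test_fun G v u'" using kdom_test_fun[OF kdom_lc[OF kd one_kdom, of 1 "- m"]] by (simp add: v_def)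
  from poincare[OF this v0] have P: "spectral_gap * ip G v v \<le> ip G u' u'" .
  have u_eq: "u = lc m ?one 1 v" by (simp add: v_def lc_def)
  have mass: "ip G u u = m\<^sup>2 * ?L + ip G v v"
    using ip_lc_square[OF oc vc, of m 1] by (simp add: u_eq[symmetric] v0 ip_commute[of G ?one v])
  have qvc: "edge_cont G (\<lambda>e x. q e x * v e x)" by (intro edge_cont_mult q vc)
  have pot: "ip G (\<lambda>e x. t * q e x * u e x) u = t * (m\<^sup>2 * ?Q + 2 * m * ip G q v + ip G (\<lambda>e x. q e x * v e x) v)"
  proof -
    have eq: "(\<lambda>e x. t * q e x * lc m ?one 1 v e x) = lc (t * m) q t (\<lambda>e x. q e x * v e x)"
      by (simp add: lc_def fun_eq_iff algebra_simps)
    have sw: "ip G (\<lambda>e x. q e x * v e x) ?one = ip G q v" by (rule ip_cong) simp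
    have "ip G (\<lambda>e x. t * q e x * u e x) u = ip G (\<lambda>e x. t * q e x * lc m ?one 1 v e x) (lc m ?one 1 v)"
      using u_eq by simp
    also have "\<dots> = t * (m\<^sup>2 * ?Q + 2 * m * ip G q v + ip G (\<lambda>e x. q e x * v e x) v)"
      unfolding eq ip_lc_left[OF q qvc edge_cont_lc[OF oc vc]] ip_lc_right[OF oc vc q] ip_lc_right[OF oc vc qvc] sw
      by (simp add: algebra_simps power2_eq_square)
    finally show ?thesis .
  qed
  have "0 \<le> ip G (\<lambda>e x. q e x * v e x) v" by (rule ip_nonneg) (simp add: qnn mult.assoc)
  then have nn: "0 \<le> t * ip G (\<lambda>e x. q e x * v e x) v" using t by simp
  have vv: "0 \<le> ip G v v" by (rule ip_square_nonneg)
  have K0: "0 \<le> K" unfolding K_def using g L ip_square_nonneg[of G q] by (intro divide_nonneg_nonneg mult_nonneg_nonneg) auto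
  have Q1: "0 < ip G q q + 1" using ip_square_nonneg[of G q] by simp
  have KL: "K * ?L * spectral_gap = 2 * (ip G q q + 1)" unfolding K_def using g L by simp
  have Y: "2 * t * (- m) * ip G q v \<le> K * ?L * t\<^sup>2 * m\<^sup>2 + spectral_gap / 2 * ip G v v"
  proof -
    have "2 * (t * m) * 1 * (- ip G q v) \<le> K * ?L * (t * m)\<^sup>2 + (spectral_gap / 2 * ip G v v) * 1\<^sup>2"
    proof (rule young_product)
      show "0 < K * ?L" using Q1 KL g by (metis mult_pos_pos zero_less_mult_pos2 zero_less_numeral)
      show "0 \<le> spectral_gap / 2 * ip G v v" using vv g by simp
      have "(ip G q v)\<^sup>2 \<le> ip G q q * ip G v v" by (rule ip_cauchy_schwarz[OF q vc])
      also have "\<dots> \<le> (ip G q q + 1) * ip G v v" using vv by (intro mult_right_mono) auto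
      also have "\<dots> = K * ?L * (spectral_gap / 2 * ip G v v)"
      proof -
        have "2 * (K * ?L * (spectral_gap / 2 * ip G v v)) = (K * ?L * spectral_gap) * ip G v v" by simp
        also have "\<dots> = 2 * ((ip G q q + 1) * ip G v v)" unfolding KL by simp
        finally show ?thesis by linarith
      qed
      finally show "(- ip G q v)\<^sup>2 \<le> K * ?L * (spectral_gap / 2 * ip G v v)" by simp
    qed
    then show ?thesis by (simp add: power_mult_distrib mult_ac)
  qed
  define b where "b = t * ?Q / ?L - K * t\<^sup>2"
  have "b * ip G u u \<le> \<mu> * ip G u u"
  proof -
    have "t * ?Q / ?L \<le> spectral_gap / 2" using small L by (simp add: field_simps)
    then have "b \<le> spectral_gap / 2" unfolding b_def using K0 by (smt (verit) mult_nonneg_nonneg zero_le_power2)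
    then have 1: "b * ip G v v \<le> spectral_gap / 2 * ip G v v" using vv by (rule mult_right_mono)
    have 2: "b * (m\<^sup>2 * ?L) = t * m\<^sup>2 * ?Q - K * ?L * t\<^sup>2 * m\<^sup>2" unfolding b_def using L by (simp add: field_simps)
    have "b * ip G u u = b * (m\<^sup>2 * ?L) + b * ip G v v" unfolding mass by (rule distrib_left)
    also have "\<dots> \<le> spectral_gap * ip G v v + t * m\<^sup>2 * ?Q + 2 * t * m * ip G q v" using 1 2 Y by simp
    also have "\<dots> \<le> ip G u' u' + ip G (\<lambda>e x. t * q e x * u e x) u"
      unfolding pot using P nn by (simp add: algebra_simps)
    also have "\<dots> = \<mu> * ip G u u" using T.esol_energy[OF u] by simp
    finally show ?thesis .
  qed
  then show ?thesis using pos unfolding b_def K_def by simp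
qed

lemma perturbed_eigenvalues:
  assumes q: "edge_cont G q" and t: "0 \<le> t"
    and qnn: "\<And>e x. e \<in> edges G \<Longrightarrow> x \<in> {0..len G e} \<Longrightarrow> 0 \<le> q e x"
  shows "is_eigenvalue G (\<lambda>e x. t * q e x) (eigval G (\<lambda>e x. t * q e x) 1)"
proof -
  interpret T: pgraph G "\<lambda>e x. t * q e x"
    by unfold_locales (use q t qnn in \<open>auto simp: edge_cont_def intro: continuous_on_mult_left\<close>)
  let ?one = "\<lambda>(_::'a) (_::real). 1 :: real"
  have z: "esol G (\<lambda>e x. t * q e x) 0 (\<lambda>_ _. 0) (\<lambda>_ _. 0)" by (rule esol_zero)
  have "ip G ?one (\<lambda>_ _. 0) = 0" by (simp add: ip_def)
  from T.eigenfunction_exists[OF kdom_test_fun[OF one_kdom] length_pos z order_refl this]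
  obtain \<mu> u u' where "esol G (\<lambda>e x. t * q e x) \<mu> u u'" "0 < ip G u u" by blast
  then have "is_eigenvalue G (\<lambda>e x. t * q e x) \<mu>" unfolding T.is_eigenvalue_iff by blast
  from T.eigval_props(1)[OF _ T.one_le_count[OF this order_refl]] show ?thesis by simp
qed

text \<open>To first order in t the second eigenvalue rises at most by the average of
  \<open>q\<close> with respect to \<phi>^2 and the first at least by its plain average;
  \<open>corr\<close> compares these rates.\<close>

theorem gap_decreases_of_correlation:
  assumes \<phi>: "esol G (\<lambda>_ _. 0) spectral_gap \<phi> \<phi>'" and pos: "0 < ip G \<phi> \<phi>"
    and q: "edge_cont G q" and qnn: "\<And>e x. e \<in> edges G \<Longrightarrow> x \<in> {0..len G e} \<Longrightarrow> 0 \<le> q e x"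
    and corr: "ip G (\<lambda>_ _. 1) (\<lambda>_ _. 1) * ip G (\<lambda>e x. q e x * \<phi> e x) \<phi> < ip G \<phi> \<phi> * ip G q (\<lambda>_ _. 1)"
  shows "\<exists>t0>0. \<forall>t. 0 < t \<longrightarrow> t \<le> t0 \<longrightarrow> fundamental_gap G (\<lambda>e x. t * q e x) < fundamental_gap G (\<lambda>_ _. 0)"
proof -
  let ?one = "\<lambda>(_::'a) (_::real). 1 :: real"
  let ?L = "ip G ?one ?one" and ?E = "ip G \<phi> \<phi>" and ?Q = "ip G q ?one" and ?R = "ip G (\<lambda>e x. q e x * \<phi> e x) \<phi>"
  define K where "K = 2 * (ip G q \<phi>)\<^sup>2 / (spectral_gap * ?L * ?E) + 2 * (ip G q q + 1) / (spectral_gap * ?L)"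
  define \<delta> where "\<delta> = ?Q / ?L - ?R / ?E"
  note L = length_pos and g = spectral_gap_pos
  have \<delta>: "0 < \<delta>" unfolding \<delta>_def using corr L pos by (simp add: field_simps)
  have K: "0 < K" unfolding K_def using g L pos ip_square_nonneg[of G q]
    by (intro add_nonneg_pos divide_nonneg_nonneg divide_pos_pos mult_pos_pos mult_nonneg_nonneg) auto
  have Q: "0 \<le> ?Q" by (rule ip_nonneg) (simp add: qnn)
  \<comment> \<open>The first entry guarantees the condition \<open>small\<close> of both eigenvalue
    bounds, the second that the error K t^2 stays below the gain t \<delta>.\<close>
  define t0 where "t0 = min (spectral_gap * ?L / (2 * (?Q + 1))) (\<delta> / (2 * K))"
  have "0 < t0" unfolding t0_def using g L Q \<delta> K by simp
  moreover have "fundamental_gap G (\<lambda>e x. t * q e x) < fundamental_gap G (\<lambda>_ _. 0)" if t: "0 < t" "t \<le> t0" for t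
  proof -
    have "t * (2 * (?Q + 1)) \<le> spectral_gap * ?L" using t(2) Q unfolding t0_def by (simp add: pos_le_divide_eq)
    then have small: "2 * t * ?Q \<le> spectral_gap * ?L" using t(1) by (simp add: algebra_simps)
    have "t * (2 * K) \<le> \<delta>" using t(2) K unfolding t0_def by (simp add: pos_le_divide_eq)
    then have "2 * (K * t) \<le> \<delta>" by (simp add: mult_ac)
    then have "K * t < \<delta>" using \<delta> by linarith
    then have "t * (K * t) < t * \<delta>" using t(1) by simp
    then have Kt: "K * t\<^sup>2 < t * \<delta>" by (simp add: power2_eq_square mult_ac)
    interpret T: pgraph G "\<lambda>e x. t * q e x"
      by unfold_locales (use q t qnn in \<open>auto simp: edge_cont_def intro: continuous_on_mult_left\<close>)
    from perturbed_eigenvalues[OF q less_imp_le[OF t(1)] qnn, unfolded T.is_eigenvalue_iff]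
    obtain u u' where u: "esol G (\<lambda>e x. t * q e x) (eigval G (\<lambda>e x. t * q e x) 1) u u'" "0 < ip G u u" by blast
    note lo = eigenvalue_lower[OF q less_imp_le[OF t(1)] qnn small u]
    note up = eigval2_upper[OF \<phi> pos q less_imp_le[OF t(1)] qnn small]
    have "fundamental_gap G (\<lambda>e x. t * q e x) \<le> spectral_gap + K * t\<^sup>2 - t * \<delta>"
      unfolding fundamental_gap_def K_def \<delta>_def using lo up by (simp add: algebra_simps)
    then show ?thesis unfolding fundamental_gap_zero using Kt by simp
  qed
  ultimately show ?thesis by blast
qed

text \<open>\<phi> remains an eigenfunction. The constant is orthogonal to it and has little energy,
  so there is a further eigenvalue below \<open>spectral_gap\<close> and the second one does not
  increase. The first is not zero, since its eigenfunction would be a constant on which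
  \<open>q\<close> has no energy.\<close>

theorem gap_decreases_of_disjoint_support:
  assumes \<phi>: "esol G (\<lambda>_ _. 0) spectral_gap \<phi> \<phi>'" and pos: "0 < ip G \<phi> \<phi>"
    and q: "edge_cont G q" and qnn: "\<And>e x. e \<in> edges G \<Longrightarrow> x \<in> {0..len G e} \<Longrightarrow> 0 \<le> q e x"
    and q1: "0 < ip G q (\<lambda>_ _. 1)"
    and disj: "\<And>e x. e \<in> edges G \<Longrightarrow> x \<in> {0..len G e} \<Longrightarrow> q e x * \<phi> e x = 0"
  shows "\<exists>t0>0. \<forall>t. 0 < t \<longrightarrow> t \<le> t0 \<longrightarrow> fundamental_gap G (\<lambda>e x. t * q e x) < fundamental_gap G (\<lambda>_ _. 0)"
proof -
  let ?one = "\<lambda>(_::'a) (_::real). 1 :: real"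
  let ?L = "ip G ?one ?one" and ?Q = "ip G q ?one"
  define t0 where "t0 = spectral_gap * ?L / (2 * ?Q)"
  note L = length_pos and g = spectral_gap_pos
  have "0 < t0" unfolding t0_def using g L q1 by simp
  moreover have "fundamental_gap G (\<lambda>e x. t * q e x) < fundamental_gap G (\<lambda>_ _. 0)" if t: "0 < t" "t \<le> t0" for t
  proof -
    interpret T: pgraph G "\<lambda>e x. t * q e x"
      by unfold_locales (use q t qnn in \<open>auto simp: edge_cont_def intro: continuous_on_mult_left\<close>)
    have es: "esol G (\<lambda>e x. t * q e x) spectral_gap \<phi> \<phi>'"
      unfolding esol_def by (rule kdom_cong[OF \<phi>[unfolded esol_def]]) (simp add: left_diff_distrib mult.assoc disj)
    have orth: "ip G ?one \<phi> = 0" using spectral_gap_esol_orth[OF \<phi>] by (simp add: ip_commute)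
    from T.eigenfunction_exists[OF kdom_test_fun[OF one_kdom] L es less_imp_le[OF g] orth]
    obtain \<mu> w w' where w: "esol G (\<lambda>e x. t * q e x) \<mu> w w'" "0 < ip G w w" "ip G w \<phi> = 0"
      "\<mu> * ?L \<le> ip G (\<lambda>_ _. 0) (\<lambda>_ _. 0) + ip G (\<lambda>e x. t * q e x * 1) ?one" by blast
    have "ip G (\<lambda>_ _. 0) (\<lambda>_ _. 0) + ip G (\<lambda>e x. t * q e x * 1) ?one = t * ?Q"
      by (simp add: ip_def sum_distrib_left)
    also have "\<dots> \<le> t0 * ?Q" using t q1 by simp
    also have "\<dots> = spectral_gap * ?L / 2" unfolding t0_def using q1 by simp
    also have "\<dots> \<le> spectral_gap * ?L" using g L by simp
    finally have "\<mu> * ?L \<le> spectral_gap * ?L" using w(4) by linarith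
    then have "\<mu> \<le> spectral_gap" using L by (rule mult_right_le_imp_le)
    from T.two_le_count[OF w(1,2) this es pos order_refl w(3)]
    have e2: "eigval G (\<lambda>e x. t * q e x) 2 \<le> spectral_gap" by (intro T.eigval_props(3)) auto
    from perturbed_eigenvalues[OF q less_imp_le[OF t(1)] qnn, unfolded T.is_eigenvalue_iff]
    obtain u u' where u: "esol G (\<lambda>e x. t * q e x) (eigval G (\<lambda>e x. t * q e x) 1) u u'" "0 < ip G u u" by blast
    have "eigval G (\<lambda>e x. t * q e x) 1 \<noteq> 0"
    proof
      assume z: "eigval G (\<lambda>e x. t * q e x) 1 = 0"
      have "0 = ip G u' u' + ip G (\<lambda>e x. t * q e x * u e x) u" using T.esol_energy[OF u(1)] z by simp
      then have z1: "ip G u' u' = 0" and z2: "ip G (\<lambda>e x. t * q e x * u e x) u = 0"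
        using T.q_energy_nonneg[of u] ip_square_nonneg[of G u'] by linarith+
      from flat_constant[OF u(1)[unfolded esol_def] z1] obtain c where c: "\<forall>e\<in>edges G. \<forall>x\<in>{0..len G e}. u e x = c" by blast
      have "ip G (\<lambda>e x. t * q e x * u e x) u = ip G (lc (t * c\<^sup>2) q 0 q) ?one"
        by (rule ip_cong) (simp add: c lc_def power2_eq_square mult_ac)
      then have "t * c\<^sup>2 * ?Q = 0" using z2 by (simp add: ip_scale)
      then have "c = 0" using t(1) q1 by simp
      then have "ip G u u = ip G (\<lambda>_ _. 0) (\<lambda>_ _. 0)" using c by (intro ip_cong) simp
      then show False using u(2) by (simp add: ip_def)
    qed
    moreover have "0 \<le> eigval G (\<lambda>e x. t * q e x) 1" by (rule T.esol_nonneg[OF u])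
    ultimately show ?thesis unfolding fundamental_gap_zero unfolding fundamental_gap_def using e2 by simp
  qed
  ultimately show ?thesis by blast
qed

end

section \<open>Zeros of eigenfunctions\<close>

lemma pw_diff_minus:
  assumes l: "0 \<le> l" and f: "pw_diff l f g" and u: "C2_on l u u' u''"
  shows "pw_diff l (\<lambda>x. f x - a * u x) (\<lambda>x. g x - a * u' x)"
    "integral {0..l} (\<lambda>x. (g x - a * u' x) * (g x - a * u' x)) =
      integral {0..l} (\<lambda>x. g x * g x) - 2 * a * integral {0..l} (\<lambda>x. u' x * g x) + a\<^sup>2 * integral {0..l} (\<lambda>x. u' x * u' x)"
proof -
  note D = C2_onD[OF u]
  obtain S where S: "finite S" "\<forall>x\<in>{0<..<l} - S. (f has_real_derivative g x) (at x)"
    using f by (auto simp: pw_diff_def)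
  have i1: "(\<lambda>x. g x * g x) integrable_on {0..l}" using f by (simp add: pw_diff_def power2_eq_square)
  have i2: "(\<lambda>x. u' x * g x) integrable_on {0..l}" by (rule C2_on_green(2)[OF l u f])
  have i3: "(\<lambda>x. u' x * u' x) integrable_on {0..l}" by (intro integrable_continuous_real continuous_on_mult D)
  have "((\<lambda>x. g x * g x - 2 * a * (u' x * g x) + a\<^sup>2 * (u' x * u' x)) has_integral
      integral {0..l} (\<lambda>x. g x * g x) - 2 * a * integral {0..l} (\<lambda>x. u' x * g x) + a\<^sup>2 * integral {0..l} (\<lambda>x. u' x * u' x)) {0..l}"
    by (intro has_integral_add has_integral_diff has_integral_mult_right integrable_integral i1 i2 i3)
  then have H: "((\<lambda>x. (g x - a * u' x) * (g x - a * u' x)) has_integral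
      integral {0..l} (\<lambda>x. g x * g x) - 2 * a * integral {0..l} (\<lambda>x. u' x * g x) + a\<^sup>2 * integral {0..l} (\<lambda>x. u' x * u' x)) {0..l}"
    by (rule has_integral_eq[rotated]) (simp add: power2_eq_square algebra_simps)
  show "integral {0..l} (\<lambda>x. (g x - a * u' x) * (g x - a * u' x)) =
      integral {0..l} (\<lambda>x. g x * g x) - 2 * a * integral {0..l} (\<lambda>x. u' x * g x) + a\<^sup>2 * integral {0..l} (\<lambda>x. u' x * u' x)"
    by (rule integral_unique[OF H])
  show "pw_diff l (\<lambda>x. f x - a * u x) (\<lambda>x. g x - a * u' x)"
    unfolding pw_diff_def
  proof (intro conjI exI[of _ S] ballI S(1))
    show "continuous_on {0..l} (\<lambda>x. f x - a * u x)" using f D(3) by (auto simp: pw_diff_def intro!: continuous_intros)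
    show "(\<lambda>x. (g x - a * u' x)\<^sup>2) integrable_on {0..l}" using H by (auto simp: power2_eq_square integrable_on_def)
    fix x assume x: "x \<in> {0<..<l} - S"
    then have "(f has_real_derivative g x) (at x)" "(u has_real_derivative u' x) (at x)" using S(2) D(6)[of x] by auto
    then show "((\<lambda>x. f x - a * u x) has_real_derivative g x - a * u' x) (at x)"
      by (intro DERIV_diff DERIV_cmult)
  qed
qed

definition cutoff :: "'e set \<Rightarrow> ('e \<Rightarrow> real \<Rightarrow> real) \<Rightarrow> 'e \<Rightarrow> real \<Rightarrow> real" where
  "cutoff S f e x = (if e \<in> S then f e x else 0)"

lemma C2_on_zero: "C2_on l (\<lambda>_. 0) (\<lambda>_. 0) (\<lambda>_. 0)"
  by (simp add: C2_on_def)

lemma C2_on_cut: "C2_on l (u e) (u' e) (u'' e) \<Longrightarrow> C2_on l (cutoff S u e) (cutoff S u' e) (cutoff S u'' e)"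
  by (cases "e \<in> S") (simp_all add: cutoff_def[abs_def] C2_on_zero)

lemma ip_cut_left: "ip G (cutoff S f) g = ip G f (cutoff S g)"
  by (rule ip_cong) (simp add: cutoff_def)

lemma ip_cut_cut: "ip G (cutoff S f) (cutoff S g) = ip G f (cutoff S g)"
  by (rule ip_cong) (simp add: cutoff_def)

context mgraph
begin

text \<open>Formulated edgewise rather than with \<open>kdom\<close>, because \<open>u\<close> will
  be an eigenfunction cut off to one branch, which may violate Kirchhoff's condition at the
  cut.\<close>

lemma test_fun_minus:
  assumes f: "test_fun G f g" and u: "\<And>e. e \<in> edges G \<Longrightarrow> C2_on (len G e) (u e) (u' e) (u'' e)" and ag: "agrees_at_vertices G u"
  shows "test_fun G (lc 1 f (- a) u) (lc 1 g (- a) u')"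
    "ip G (lc 1 g (- a) u') (lc 1 g (- a) u') = ip G g g - 2 * a * ip G u' g + a\<^sup>2 * ip G u' u'"
proof -
  have P: "pw_diff (len G e) (f e) (g e)" if "e \<in> edges G" for e using f that by (simp add: test_fun_def)
  have L: "0 \<le> len G e" if "e \<in> edges G" for e using len_pos[OF that] by simp
  have af: "agrees_at_vertices G f" using f by (simp add: test_fun_def)
  show "test_fun G (lc 1 f (- a) u) (lc 1 g (- a) u')"
    unfolding test_fun_def
  proof (intro conjI ballI)
    show "pw_diff (len G e) (lc 1 f (- a) u e) (lc 1 g (- a) u' e)" if "e \<in> edges G" for e
      using pw_diff_minus(1)[OF L[OF that] P[OF that] u[OF that], of a] by (simp add: lc_def)
    show "agrees_at_vertices G (lc 1 f (- a) u)"
      unfolding agrees_at_vertices_def lc_def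
    proof (intro ballI)
      fix v p p' assume v: "v \<in> verts G" "p \<in> v" "p' \<in> v"
      have "f (fst p) (coord G p) = f (fst p') (coord G p')" "u (fst p) (coord G p) = u (fst p') (coord G p')"
        using af ag v unfolding agrees_at_vertices_def by blast+
      then show "1 * f (fst p) (coord G p) + - a * u (fst p) (coord G p) = 1 * f (fst p') (coord G p') + - a * u (fst p') (coord G p')"
        by simp
    qed
  qed
  show "ip G (lc 1 g (- a) u') (lc 1 g (- a) u') = ip G g g - 2 * a * ip G u' g + a\<^sup>2 * ip G u' u'"
    unfolding ip_def lc_def
    using pw_diff_minus(2)[OF L P u, where a = a] by (simp add: sum_subtractf sum.distrib sum_distrib_left)
qed

text \<open>If \<phi>' vanished at every zero of \<phi>, conservation of energy would make \<phi>
  zero on any edge with a zero. Across vertices the sign would then be the same on the whole graph,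
  against positive mass or zero mean.\<close>

lemma nodal_zero_exists:
  assumes \<phi>: "esol G (\<lambda>_ _. 0) spectral_gap \<phi> \<phi>'" and pos: "0 < ip G \<phi> \<phi>"
  shows "\<exists>e\<in>edges G. \<exists>x\<in>{0..len G e}. \<phi> e x = 0 \<and> \<phi>' e x \<noteq> 0"
proof (rule ccontr)
  assume "\<not> ?thesis"
  then have N: "\<And>e x. e \<in> edges G \<Longrightarrow> x \<in> {0..len G e} \<Longrightarrow> \<phi> e x = 0 \<Longrightarrow> \<phi>' e x = 0" by blast
  note g = spectral_gap_pos
  have kd: "kdom G \<phi> \<phi>' (\<lambda>e x. - spectral_gap * \<phi> e x)" using \<phi> by (simp add: esol_def)
  have C2: "C2_on (len G e) (\<phi> e) (\<phi>' e) (\<lambda>x. - spectral_gap * \<phi> e x)" if "e \<in> edges G" for e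
    using kd that by (simp add: kdom_def)
  have ag: "agrees_at_vertices G \<phi>" using kd by (simp add: kdom_def)
  have co: "coord G p \<in> {0..len G (fst p)}" if "fst p \<in> edges G" for p using len_pos[OF that] by (simp add: coord_def)
  have Z: "\<phi> e y = 0" if e: "e \<in> edges G" and x: "x \<in> {0..len G e}" "\<phi> e x = 0" and y: "y \<in> {0..len G e}" for e x y
  proof -
    have "(\<phi>' e y)\<^sup>2 + spectral_gap * (\<phi> e y)\<^sup>2 = 0"
      using oscillator_energy[OF C2[OF e] y x(1)] x(2) N[OF e x] by simp
    then have "spectral_gap * (\<phi> e y)\<^sup>2 \<le> 0" by (smt (verit) zero_le_power2)
    then show ?thesis using g by (simp add: mult_le_0_iff)
  qed
  have all: "Y = edges G" if Y: "Y \<subseteq> edges G" "Y \<noteq> {}" and P: "\<And>e. e \<in> edges G \<Longrightarrow> e \<in> Y \<longleftrightarrow> (\<exists>x\<in>{0..len G e}. P (\<phi> e x))"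
      "\<And>e. e \<in> edges G \<Longrightarrow> e \<in> Y \<longleftrightarrow> (\<forall>x\<in>{0..len G e}. P (\<phi> e x))" for Y P
  proof (rule connected_edges[OF Y])
    fix v assume v: "v \<in> verts G"
    show "v \<subseteq> Y \<times> UNIV \<or> v \<inter> Y \<times> UNIV = {}"
    proof (rule disjCI)
      assume "v \<inter> Y \<times> UNIV \<noteq> {}"
      then obtain p where p: "p \<in> v" "fst p \<in> Y" by auto
      have pE: "fst p \<in> edges G" using p(2) Y by auto
      have Pp: "P (\<phi> (fst p) (coord G p))" using P(2)[OF pE] p(2) co[OF pE] by blast
      have "fst p' \<in> Y" if "p' \<in> v" for p'
      proof -
        have E: "fst p' \<in> edges G" using vert_sub[OF v] that by auto
        have "\<phi> (fst p') (coord G p') = \<phi> (fst p) (coord G p)" using ag v that p(1) unfolding agrees_at_vertices_def by blast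
        then have "P (\<phi> (fst p') (coord G p'))" using Pp by simp
        then show ?thesis using P(1)[OF E] co[OF E] by blast
      qed
      then show "v \<subseteq> Y \<times> UNIV" by (auto simp: mem_Times_iff)
    qed
  qed
  have const: "(\<exists>x\<in>{0..len G e}. P (\<phi> e x)) \<longleftrightarrow> (\<forall>x\<in>{0..len G e}. P (\<phi> e x))"
    if e: "e \<in> edges G" and P: "P = (\<lambda>y. y = 0) \<or> P = (\<lambda>y. 0 < y)" for e P
  proof -
    have l: "0 < len G e" by (rule len_pos[OF e])
    note cont = C2_onD(3)[OF C2[OF e]]
    have "0 < \<phi> e y" if x: "x \<in> {0..len G e}" "0 < \<phi> e x" and y: "y \<in> {0..len G e}" for x y
    proof (rule ccontr)
      assume "\<not> 0 < \<phi> e y"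
      have "connected (\<phi> e ` {0..len G e})" by (rule connected_continuous_image[OF cont]) simp
      moreover have "\<phi> e y \<in> \<phi> e ` {0..len G e}" "\<phi> e x \<in> \<phi> e ` {0..len G e}" using x y by auto
      ultimately have "0 \<in> \<phi> e ` {0..len G e}"
        using x(2) \<open>\<not> 0 < \<phi> e y\<close> by (auto simp: connected_iff_interval)
      then obtain z where "z \<in> {0..len G e}" "\<phi> e z = 0" by auto
      then have "\<phi> e x = 0" by (rule Z[OF e _ _ x(1)])
      then show False using x(2) by simp
    qed
    moreover have "\<phi> e y = 0" if "x \<in> {0..len G e}" "\<phi> e x = 0" "y \<in> {0..len G e}" for x y by (rule Z[OF e that])
    moreover have "0 \<in> {0..len G e}" using l by simp
    ultimately show ?thesis using P by blast
  qed
  have orth: "ip G \<phi> (\<lambda>_ _. 1) = 0" by (rule spectral_gap_esol_orth[OF \<phi>])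
  define Y where "Y P = {e \<in> edges G. \<forall>x\<in>{0..len G e}. P (\<phi> e x)}" for P
  have dich: "Y P = {} \<or> Y P = edges G" if P: "P = (\<lambda>y. y = 0) \<or> P = (\<lambda>y. 0 < y)" for P
  proof (rule disjCI)
    assume "Y P \<noteq> edges G"
    show "Y P = {}"
    proof (rule ccontr)
      assume ne: "Y P \<noteq> {}"
      have "Y P = edges G" by (rule all[OF _ ne]) (use const[OF _ P] in \<open>auto simp: Y_def\<close>)
      with \<open>Y P \<noteq> edges G\<close> show False by simp
    qed
  qed
  have "Y (\<lambda>y. y = 0) \<noteq> edges G"
  proof
    assume "Y (\<lambda>y. y = 0) = edges G"
    then have "\<forall>e\<in>edges G. \<forall>x\<in>{0..len G e}. \<phi> e x = 0" unfolding Y_def by blast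
    then have "ip G \<phi> \<phi> = ip G (\<lambda>_ _. 0) (\<lambda>_ _. 0)" by (intro ip_cong) simp
    then show False using pos by (simp add: ip_def)
  qed
  then have nz: "\<phi> e x \<noteq> 0" if "e \<in> edges G" "x \<in> {0..len G e}" for e x
    using dich[of "\<lambda>y. y = 0"] const[OF that(1), of "\<lambda>y. y = 0"] that by (auto simp: Y_def)
  have pc: "continuous_on {0..len G e} (\<phi> e)" if "e \<in> edges G" for e by (rule C2_onD(3)[OF C2[OF that]])
  have False if s: "s = 1 \<or> s = -1" and sp: "\<And>e x. e \<in> edges G \<Longrightarrow> x \<in> {0..len G e} \<Longrightarrow> 0 < s * \<phi> e x" for s :: real
  proof -
    have "0 < (\<Sum>e\<in>edges G. integral {0..len G e} (\<lambda>x. s * \<phi> e x))"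
    proof (rule sum_pos)
      fix e assume e: "e \<in> edges G"
      have "integral {0..len G e} (\<lambda>x. 0) < integral {0..len G e} (\<lambda>x. s * \<phi> e x)"
        using e by (intro integral_less len_pos continuous_intros pc sp) auto
      then show "0 < integral {0..len G e} (\<lambda>x. s * \<phi> e x)" by simp
    qed (use edges_ne in auto)
    also have "\<dots> = s * ip G \<phi> (\<lambda>_ _. 1)" by (simp add: ip_def sum_distrib_left)
    finally show False using orth by simp
  qed
  then have neg: "\<not> (\<forall>e\<in>edges G. \<forall>x\<in>{0..len G e}. 0 < \<phi> e x)" "\<not> (\<forall>e\<in>edges G. \<forall>x\<in>{0..len G e}. \<phi> e x < 0)"
    by (metis mult_1, metis mult_minus1 neg_0_less_iff_less)
  from neg(1) have "Y (\<lambda>y. 0 < y) = {}" using dich[of "\<lambda>y. 0 < y"] by (auto simp: Y_def)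
  then have "\<not> 0 < \<phi> e x" if "e \<in> edges G" "x \<in> {0..len G e}" for e x
    using const[OF that(1), of "\<lambda>y. 0 < y"] that unfolding Y_def by blast
  then have "\<phi> e x < 0" if "e \<in> edges G" "x \<in> {0..len G e}" for e x
    using nz[OF that] that by (meson linorder_neqE_linordered_idom)
  with neg(2) show False by blast
qed

end

section \<open>The Poincare inequality for functions vanishing at a zero of \<phi>\<close>

locale nodal_point = mtree G for G :: "'e metric_graph" +
  fixes v0 :: "('e \<times> bool) set" and \<phi> \<phi>' :: "'e \<Rightarrow> real \<Rightarrow> real"
  assumes v0: "v0 \<in> verts G" and \<phi>: "esol G (\<lambda>_ _. 0) spectral_gap \<phi> \<phi>'" and pos: "0 < ip G \<phi> \<phi>"
    and zero: "p \<in> v0 \<Longrightarrow> \<phi> (fst p) (coord G p) = 0" and slope: "\<exists>p\<in>v0. normal_deriv G \<phi>' p \<noteq> 0"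
begin

lemma phi_kdom: "kdom G \<phi> \<phi>' (\<lambda>e x. - spectral_gap * \<phi> e x)" using \<phi> by (simp add: esol_def)

lemma phi_kirchhoff: "v \<in> verts G \<Longrightarrow> (\<Sum>p\<in>v. normal_deriv G \<phi>' p) = 0" using phi_kdom by (simp add: kdom_def)

lemma two_endpoints: "\<exists>p\<in>v0. \<exists>p'\<in>v0. p \<noteq> p'"
proof (rule ccontr)
  assume N: "\<not> ?thesis"
  obtain p where p: "p \<in> v0" "normal_deriv G \<phi>' p \<noteq> 0" using slope by blast
  then have "v0 = {p}" using N by blast
  then show False using phi_kirchhoff[OF v0] p(2) by simp
qed

text \<open>One of the branches at \<open>v0\<close> carries nonzero mass of \<open>\<phi>\<close>. Subtracting a multiple of \<open>\<phi>\<close> on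
  that branch makes a test function mean zero without changing its energy excess.\<close>

lemma dirichlet_poincare:
  assumes f: "test_fun G f g" and f0: "\<And>p. p \<in> v0 \<Longrightarrow> f (fst p) (coord G p) = 0"
  shows "spectral_gap * ip G f f \<le> ip G g g"
proof -
  let ?one = "\<lambda>(_::'e) (_::real). 1 :: real" and ?g = spectral_gap
  obtain p0 where p0: "p0 \<in> v0" "normal_deriv G \<phi>' p0 \<noteq> 0" using slope by blast
  from branches[OF v0] obtain \<beta> where B: "(\<forall>w\<in>verts G. w \<noteq> v0 \<longrightarrow> (\<forall>p\<in>w. \<forall>p'\<in>w. \<beta> (fst p) = \<beta> (fst p'))) \<and> (\<forall>p\<in>v0. \<beta> (fst p) = p)"
    by (rule exE)
  define S where "S = {e. \<beta> e = p0}"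
  have Sv0: "fst p \<in> S \<longleftrightarrow> p = p0" if "p \<in> v0" for p using B that by (simp add: S_def)
  have Sw: "fst p \<in> S \<longleftrightarrow> fst p' \<in> S" if "w \<in> verts G" "w \<noteq> v0" "p \<in> w" "p' \<in> w" for w p p'
  proof -
    have "\<beta> (fst p) = \<beta> (fst p')" using conjunct1[OF B] that by blast
    then show ?thesis by (simp only: S_def mem_Collect_eq)
  qed
  have ag_cut: "agrees_at_vertices G (cutoff S h)" if h: "agrees_at_vertices G h" "\<And>p. p \<in> v0 \<Longrightarrow> h (fst p) (coord G p) = 0" for h
    unfolding agrees_at_vertices_def
  proof (intro ballI)
    fix w p p' assume w: "w \<in> verts G" "p \<in> w" "p' \<in> w"
    have hh: "h (fst p) (coord G p) = h (fst p') (coord G p')" using h(1) w unfolding agrees_at_vertices_def by blast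
    show "cutoff S h (fst p) (coord G p) = cutoff S h (fst p') (coord G p')"
    proof (cases "w = v0")
      case True
      then show ?thesis using h(2) w(2,3) unfolding cutoff_def by simp
    next
      case False
      show ?thesis unfolding cutoff_def Sw[OF w(1) False w(2,3)] hh ..
    qed
  qed
  have C2: "C2_on (len G e) (\<phi> e) (\<phi>' e) (\<lambda>x. - ?g * \<phi> e x)" if "e \<in> edges G" for e
    using phi_kdom that by (simp add: kdom_def)
  have pc: "edge_cont G \<phi>" by (rule esol_cont(1)[OF \<phi>])
  have fc: "edge_cont G f" by (rule test_fun_edge_cont[OF f])
  have oc: "edge_cont G ?one" by (rule edge_cont_const)
  have cc: "edge_cont G (cutoff S h)" if "edge_cont G h" for h
    unfolding edge_cont_def
  proof
    show "continuous_on {0..len G e} (cutoff S h e)" if "e \<in> edges G" for e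
      using that \<open>edge_cont G h\<close> by (cases "e \<in> S") (simp_all add: cutoff_def[abs_def] edge_cont_def)
  qed
  \<comment> \<open>Integrate the equation of \<phi> over the branch: Kirchhoff's condition cancels
    all vertex terms except the flux through \<open>p0\<close>, so \<phi> has nonzero mean
    there.\<close>
  have mass: "?g * ip G (cutoff S \<phi>) ?one = normal_deriv G \<phi>' p0"
  proof -
    define F where "F p = (if fst p \<in> S then normal_deriv G \<phi>' p else 0)" for p
    have edge: "?g * integral {0..len G e} (\<lambda>x. cutoff S \<phi> e x * 1) = F (e, False) + F (e, True)" if e: "e \<in> edges G" for e
    proof (cases "e \<in> S")
      case True
      have l: "0 \<le> len G e" using len_pos[OF e] by simp
      have H: "((\<lambda>x. - ?g * \<phi> e x) has_integral \<phi>' e (len G e) - \<phi>' e 0) {0..len G e}"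
        by (rule fundamental_theorem_of_calculus[OF l])
          (use C2_onD(2)[OF C2[OF e]] in \<open>simp add: has_real_derivative_iff_has_vector_derivative\<close>)
      then have "- ?g * integral {0..len G e} (\<phi> e) = \<phi>' e (len G e) - \<phi>' e 0"
        using integral_unique[OF H] by simp
      then show ?thesis using True by (simp add: cutoff_def F_def normal_deriv_def coord_def)
    next
      case False
      then show ?thesis by (simp add: cutoff_def F_def)
    qed
    have vert: "(\<Sum>p\<in>v. F p) = (if v = v0 then normal_deriv G \<phi>' p0 else 0)" if v: "v \<in> verts G" for v
    proof (cases "v = v0")
      case True
      have "(\<Sum>p\<in>v0. F p) = (\<Sum>p\<in>v0. if p = p0 then normal_deriv G \<phi>' p0 else 0)"
        by (intro sum.cong refl) (simp add: F_def Sv0)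
      then show ?thesis using True p0(1) fin_vert[OF v0] by simp
    next
      case False
      show ?thesis
      proof (cases "\<exists>p\<in>v. fst p \<in> S")
        case True
        then obtain p where p: "p \<in> v" "fst p \<in> S" by blast
        have "fst p' \<in> S" if "p' \<in> v" for p' using Sw[OF v False p(1) that] p(2) by simp
        then have "(\<Sum>p\<in>v. F p) = (\<Sum>p\<in>v. normal_deriv G \<phi>' p)" by (intro sum.cong refl) (simp add: F_def)
        then show ?thesis using phi_kirchhoff[OF v] False by simp
      next
        case F: False
        then have "(\<Sum>p\<in>v. F p) = (\<Sum>p\<in>v. 0)" by (intro sum.cong refl) (auto simp: F_def)
        then show ?thesis using False by simp
      qed
    qed
    have "?g * ip G (cutoff S \<phi>) ?one = (\<Sum>e\<in>edges G. F (e, False) + F (e, True))"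
      unfolding ip_def sum_distrib_left by (rule sum.cong[OF refl edge])
    also have "\<dots> = (\<Sum>v\<in>verts G. \<Sum>p\<in>v. F p)" by (rule sum_endpoints)
    also have "\<dots> = (\<Sum>v\<in>verts G. if v = v0 then normal_deriv G \<phi>' p0 else 0)" by (rule sum.cong[OF refl vert])
    also have "\<dots> = normal_deriv G \<phi>' p0" using v0 fin_verts by simp
    finally show ?thesis .
  qed
  define I where "I = ip G (cutoff S \<phi>) ?one"
  have I: "I \<noteq> 0" using mass p0(2) unfolding I_def by auto
  define a where "a = ip G f ?one / I"
  have agphi: "agrees_at_vertices G \<phi>" using phi_kdom by (simp add: kdom_def)
  note agS = ag_cut[OF agphi zero]
  have C2c: "C2_on (len G e) (cutoff S \<phi> e) (cutoff S \<phi>' e) (cutoff S (\<lambda>e x. - ?g * \<phi> e x) e)" if "e \<in> edges G" for e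
    by (rule C2_on_cut) (rule C2[OF that])
  note T = test_fun_minus[OF f C2c agS, of a]
  have T1: "test_fun G (lc 1 f (- a) (cutoff S \<phi>)) (lc 1 g (- a) (cutoff S \<phi>'))" by (rule T(1))
  have T2: "ip G (lc 1 g (- a) (cutoff S \<phi>')) (lc 1 g (- a) (cutoff S \<phi>')) =
    ip G g g - 2 * a * ip G (cutoff S \<phi>') g + a\<^sup>2 * ip G (cutoff S \<phi>') (cutoff S \<phi>')" by (rule T(2))
  have mz: "ip G (lc 1 f (- a) (cutoff S \<phi>)) ?one = 0"
    unfolding ip_lc_left[OF fc cc[OF pc] oc] using I by (simp add: I_def[symmetric] a_def)
  have cutf: "test_fun G (cutoff S f) (cutoff S g)"
  proof -
    have "pw_diff (len G e) (cutoff S f e) (cutoff S g e)" if "e \<in> edges G" for e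
    proof (cases "e \<in> S")
      case True
      then have "cutoff S f e = f e" "cutoff S g e = g e" by (simp_all add: cutoff_def fun_eq_iff)
      then show ?thesis using f that by (simp add: test_fun_def)
    next
      case False
      then have "cutoff S f e = (\<lambda>_. 0)" "cutoff S g e = (\<lambda>_. 0)" by (simp_all add: cutoff_def fun_eq_iff)
      then show ?thesis using C2_on_pw_diff[OF C2_on_zero] by simp
    qed
    moreover have "agrees_at_vertices G f" using f by (simp add: test_fun_def)
    ultimately show ?thesis using ag_cut f0 by (simp add: test_fun_def)
  qed
  have cutphi: "test_fun G (cutoff S \<phi>) (cutoff S \<phi>')"
    unfolding test_fun_def using C2_on_pw_diff[OF C2c] agS by blast
  \<comment> \<open>Both identities come from the weak equation on the whole tree, tested with
    functions cut off to the branch; these are admissible because they vanish at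
    \<open>v0\<close>.\<close>
  have W1: "ip G (cutoff S \<phi>') g = ?g * ip G (cutoff S \<phi>) f"
    using Z.esol_weak[OF \<phi> cutf] by (simp add: ip_cut_left) (simp add: ip_def)
  have W2: "ip G (cutoff S \<phi>') (cutoff S \<phi>') = ?g * ip G (cutoff S \<phi>) (cutoff S \<phi>)"
    using Z.esol_weak[OF \<phi> cutphi] by (simp add: ip_cut_cut) (simp add: ip_def)
  have "?g * ip G (lc 1 f (- a) (cutoff S \<phi>)) (lc 1 f (- a) (cutoff S \<phi>)) \<le> ip G g g - 2 * a * ip G (cutoff S \<phi>') g + a\<^sup>2 * ip G (cutoff S \<phi>') (cutoff S \<phi>')"
    using poincare[OF T1 mz] unfolding T2 .
  then have E: "?g * (1\<^sup>2 * ip G f f + 2 * 1 * (- a) * ip G (cutoff S \<phi>) f + (- a)\<^sup>2 * ip G (cutoff S \<phi>) (cutoff S \<phi>)) \<le>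
      ip G g g - 2 * a * (?g * ip G (cutoff S \<phi>) f) + a\<^sup>2 * (?g * ip G (cutoff S \<phi>) (cutoff S \<phi>))"
    unfolding ip_lc_square[OF fc cc[OF pc]] W1 W2 ip_commute[of G f "cutoff S \<phi>"] .
  \<comment> \<open>The terms linear and quadratic in \<open>a\<close> agree on both sides, so the
    correction of the mean leaves no trace.\<close>
  have alg: "\<nu> * x \<le> w" if "\<nu> * (1\<^sup>2 * x + 2 * 1 * (- a) * y + (- a)\<^sup>2 * z) \<le> w - 2 * a * (\<nu> * y) + a\<^sup>2 * (\<nu> * z)" for \<nu> x y z w :: real
    using that by (simp add: algebra_simps)
  show ?thesis by (rule alg[OF E])
qed

end

section \<open>Subdividing an edge\<close>

lemma has_integral_glue:
  fixes f g :: "real \<Rightarrow> real"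
  assumes a: "0 \<le> a" "a \<le> l" and f: "(f has_integral i) {0..a}" and g: "(g has_integral j) {0..l - a}"
  shows "((\<lambda>x. if x \<le> a then f x else g (x - a)) has_integral (i + j)) {0..l}"
proof (rule has_integral_combine[OF a])
  show "((\<lambda>x. if x \<le> a then f x else g (x - a)) has_integral i) {0..a}"
    using f by (rule has_integral_eq[rotated]) simp
  have "(g has_integral j) (cbox 0 (l - a))" using g by simp
  from has_integral_affinity[OF this, of 1 "- a"]
  have "((\<lambda>x. g (x - a)) has_integral j) ((\<lambda>x. x + a) ` {0..l - a})" by simp
  moreover have "(\<lambda>x. x + a) ` {0..l - a} = {a..l}" by simp
  ultimately have "((\<lambda>x. g (x - a)) has_integral j) {a..l}" by simp
  then show "((\<lambda>x. if x \<le> a then f x else g (x - a)) has_integral j) {a..l}"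
    by (rule has_integral_spike_finite[of "{a}", rotated 2]) auto
qed

definition glue_edge :: "'e \<Rightarrow> real \<Rightarrow> 'e \<Rightarrow> ('e \<Rightarrow> real \<Rightarrow> real) \<Rightarrow> 'e \<Rightarrow> real \<Rightarrow> real" where
  "glue_edge e0 a e1 f e x = (if e = e0 then (if x \<le> a then f e0 x else f e1 (x - a)) else f e x)"

definition split_edge :: "'e \<Rightarrow> real \<Rightarrow> 'e \<Rightarrow> ('e \<Rightarrow> real \<Rightarrow> real) \<Rightarrow> 'e \<Rightarrow> real \<Rightarrow> real" where
  "split_edge e0 a e1 f e x = (if e = e1 then f e0 (a + x) else f e x)"

locale subdivision = mtree G for G :: "'e metric_graph" +
  fixes e0 :: 'e and a :: real and e1 :: 'e
  assumes e0: "e0 \<in> edges G" and a: "0 < a" "a < len G e0" and e1: "e1 \<notin> edges G"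
begin

abbreviation H :: "'e metric_graph" where "H \<equiv> subdivide G e0 a e1"

definition mid :: "('e \<times> bool) set" where "mid = {(e0, True), (e1, False)}"

definition move :: "('e \<times> bool) set \<Rightarrow> ('e \<times> bool) set" where
  "move w = (if (e0, True) \<in> w then insert (e1, True) (w - {(e0, True)}) else w)"

lemma H_tree: "mtree H"
proof -
  have "metric_tree G" using cmg acyc by (simp add: metric_tree_def)
  then show ?thesis by (intro metric_tree_mtree subdivide_tree e0 a e1)
qed

sublocale H: mtree H by (rule H_tree)

lemma verts_H: "verts H = insert mid (move ` verts G)"
  by (simp add: subdivide_def move_def[abs_def] mid_def)

lemma ne: "e0 \<noteq> e1" using e0 e1 by auto

lemma ni: "w \<in> verts G \<Longrightarrow> (e1, b) \<notin> w" using vert_sub[of w] e1 by auto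

abbreviation "gl \<equiv> glue_edge e0 a e1"
abbreviation "sp \<equiv> split_edge e0 a e1"

lemma gl_sp: "gl (sp f) = (\<lambda>e x. if e = e1 then sp f e1 x else f e x)"
  using ne by (auto simp: glue_edge_def split_edge_def fun_eq_iff)

lemma sp_endpoint:
  assumes w: "w \<in> verts G" and p: "p \<in> move w"
  shows "\<exists>p'\<in>w. sp f (fst p) (coord H p) = f (fst p') (coord G p')"
proof (cases "p = (e1, True)")
  case True
  then have "(e0, True) \<in> w" using p ni[OF w] by (auto simp: move_def split: if_splits)
  then show ?thesis using True ne by (intro bexI[of _ "(e0, True)"]) (auto simp: split_edge_def coord_def)
next
  case False
  then have pw: "p \<in> w" "p \<noteq> (e0, True)" using p by (auto simp: move_def split: if_splits)
  have "fst p \<noteq> e1" using ni[OF w, of "snd p"] pw(1) by (cases p) auto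
  moreover have "coord H p = coord G p" using pw(2) \<open>fst p \<noteq> e1\<close> by (cases p) (auto simp: coord_def)
  ultimately show ?thesis using pw(1) by (intro bexI[of _ p]) (auto simp: split_edge_def)
qed

lemma gl_endpoint:
  assumes w: "w \<in> verts G" and p: "p \<in> w"
  shows "\<exists>p'\<in>move w. gl f (fst p) (coord G p) = f (fst p') (coord H p')"
proof (cases "p = (e0, True)")
  case True
  then show ?thesis using p a ne by (intro bexI[of _ "(e1, True)"]) (auto simp: glue_edge_def coord_def move_def)
next
  case False
  have "fst p \<noteq> e1" using ni[OF w, of "snd p"] p by (cases p) auto
  then have "gl f (fst p) (coord G p) = f (fst p) (coord H p)" using False a by (cases p) (auto simp: glue_edge_def coord_def)
  moreover have "p \<in> move w" using p False by (simp add: move_def)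
  ultimately show ?thesis by blast
qed

lemma sum_edges_H: "sum h (edges H) = h e0 + h e1 + sum h (edges G - {e0})" for h :: "'e \<Rightarrow> real"
proof -
  have "sum h (edges H) = h e1 + sum h (edges G)" using e1 by simp
  also have "sum h (edges G) = h e0 + sum h (edges G - {e0})" by (rule sum.remove[OF fin_edges e0])
  finally show ?thesis by simp
qed

lemma ip_glue:
  assumes i: "\<And>e. e \<in> edges H \<Longrightarrow> (\<lambda>x. f e x * g e x) integrable_on {0..len H e}"
  shows "ip G (gl f) (gl g) = ip H f g"
proof -
  have "(\<lambda>x. f e0 x * g e0 x) integrable_on {0..a}" using i[of e0] e0 ne by simp
  moreover have "(\<lambda>x. f e1 x * g e1 x) integrable_on {0..len G e0 - a}" using i[of e1] by simp
  ultimately have "((\<lambda>x. if x \<le> a then f e0 x * g e0 x else f e1 (x - a) * g e1 (x - a)) has_integral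
     integral {0..a} (\<lambda>x. f e0 x * g e0 x) + integral {0..len G e0 - a} (\<lambda>x. f e1 x * g e1 x)) {0..len G e0}"
    using a by (intro has_integral_glue[where g = "\<lambda>x. f e1 x * g e1 x"] integrable_integral) auto
  then have "((\<lambda>x. gl f e0 x * gl g e0 x) has_integral
     integral {0..a} (\<lambda>x. f e0 x * g e0 x) + integral {0..len G e0 - a} (\<lambda>x. f e1 x * g e1 x)) {0..len G e0}"
    by (rule has_integral_eq[rotated]) (simp add: glue_edge_def)
  then have 1: "integral {0..len G e0} (\<lambda>x. gl f e0 x * gl g e0 x) = integral {0..a} (\<lambda>x. f e0 x * g e0 x) + integral {0..len G e0 - a} (\<lambda>x. f e1 x * g e1 x)"
    by (rule integral_unique)
  have 2: "(\<Sum>e\<in>edges G - {e0}. integral {0..len G e} (\<lambda>x. gl f e x * gl g e x)) = (\<Sum>e\<in>edges G - {e0}. integral {0..len H e} (\<lambda>x. f e x * g e x))"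
    by (rule sum.cong) (use e1 in \<open>auto simp: glue_edge_def\<close>)
  have "ip G (gl f) (gl g) = integral {0..len G e0} (\<lambda>x. gl f e0 x * gl g e0 x) + (\<Sum>e\<in>edges G - {e0}. integral {0..len G e} (\<lambda>x. gl f e x * gl g e x))"
    unfolding ip_def by (rule sum.remove[OF fin_edges e0])
  also have "\<dots> = ip H f g" unfolding 1 2 ip_def sum_edges_H using ne by simp
  finally show ?thesis .
qed

lemma test_fun_glue:
  assumes f: "test_fun H f g"
  shows "test_fun G (gl f) (gl g)"
  unfolding test_fun_def
proof (intro conjI ballI)
  have P: "pw_diff (len H e) (f e) (g e)" if "e \<in> edges H" for e using f that unfolding test_fun_def by blast
  have agf: "agrees_at_vertices H f" using f by (simp add: test_fun_def)
  show "agrees_at_vertices G (gl f)"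
    unfolding agrees_at_vertices_def
  proof (intro ballI)
    fix w p p' assume w: "w \<in> verts G" "p \<in> w" "p' \<in> w"
    obtain r where r: "r \<in> move w" "gl f (fst p) (coord G p) = f (fst r) (coord H r)" using gl_endpoint[OF w(1,2)] by blast
    obtain r' where r': "r' \<in> move w" "gl f (fst p') (coord G p') = f (fst r') (coord H r')" using gl_endpoint[OF w(1,3)] by blast
    have "move w \<in> verts H" using w(1) by (simp add: verts_H)
    then have "f (fst r) (coord H r) = f (fst r') (coord H r')" using agf r(1) r'(1) unfolding agrees_at_vertices_def by blast
    then show "gl f (fst p) (coord G p) = gl f (fst p') (coord G p')" using r(2) r'(2) by simp
  qed
  fix e assume e: "e \<in> edges G"
  show "pw_diff (len G e) (gl f e) (gl g e)"
  proof (cases "e = e0")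
    case False
    then have "gl f e = f e" "gl g e = g e" by (simp_all add: glue_edge_def fun_eq_iff)
    moreover have "e \<noteq> e1" using e e1 by auto
    ultimately show ?thesis using P[of e] e False by auto
  next
    case True
    have P0: "pw_diff a (f e0) (g e0)" and P1: "pw_diff (len G e0 - a) (f e1) (g e1)" using P[of e0] P[of e1] e0 ne by auto
    have "mid \<in> verts H" "(e0, True) \<in> mid" "(e1, False) \<in> mid" by (simp_all add: verts_H mid_def)
    then have "f (fst (e0, True)) (coord H (e0, True)) = f (fst (e1, False)) (coord H (e1, False))" using agf unfolding agrees_at_vertices_def by blast
    then have m: "f e0 a = f e1 0" using ne by (simp add: coord_def)
    obtain S0 where S0: "finite S0" "\<forall>x\<in>{0<..<a} - S0. (f e0 has_real_derivative g e0 x) (at x)" using P0 by (auto simp: pw_diff_def)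
    obtain S1 where S1: "finite S1" "\<forall>x\<in>{0<..<len G e0 - a} - S1. (f e1 has_real_derivative g e1 x) (at x)" using P1 by (auto simp: pw_diff_def)
    have F: "gl f e0 = (\<lambda>x. if x \<le> a then f e0 x else f e1 (x - a))" "gl g e0 = (\<lambda>x. if x \<le> a then g e0 x else g e1 (x - a))"
      by (simp_all add: glue_edge_def fun_eq_iff)
    have "pw_diff (len G e0) (gl f e0) (gl g e0)"
      unfolding pw_diff_def
    \<comment> \<open>The derivative may jump at the joint \<open>a\<close>, which therefore joins
      the exceptional points.\<close>
    proof (intro conjI exI[of _ "S0 \<union> (\<lambda>x. x + a) ` S1 \<union> {a}"] ballI)
      show "finite (S0 \<union> (\<lambda>x. x + a) ` S1 \<union> {a})" using S0 S1 by simp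
      show "continuous_on {0..len G e0} (gl f e0)"
        unfolding F
      proof (rule continuous_on_cases_le)
        have "{t \<in> {0..len G e0}. t \<le> a} = {0..a}" using a by auto
        then show "continuous_on {t \<in> {0..len G e0}. t \<le> a} (f e0)" using P0 by (simp add: pw_diff_def)
        have "continuous_on {0..len G e0 - a} (f e1)" using P1 by (simp add: pw_diff_def)
        then show "continuous_on {t \<in> {0..len G e0}. a \<le> t} (\<lambda>x. f e1 (x - a))"
          by (rule continuous_on_compose2) (auto intro!: continuous_intros)
      qed (use m in \<open>auto intro: continuous_intros\<close>)
      have "((\<lambda>x. if x \<le> a then (g e0 x)\<^sup>2 else (g e1 (x - a))\<^sup>2) has_integral integral {0..a} (\<lambda>x. (g e0 x)\<^sup>2) + integral {0..len G e0 - a} (\<lambda>x. (g e1 x)\<^sup>2)) {0..len G e0}"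
        using a P0 P1 by (intro has_integral_glue[where g = "\<lambda>x. (g e1 x)\<^sup>2"] integrable_integral) (auto simp: pw_diff_def)
      then have "((\<lambda>x. (gl g e0 x)\<^sup>2) has_integral integral {0..a} (\<lambda>x. (g e0 x)\<^sup>2) + integral {0..len G e0 - a} (\<lambda>x. (g e1 x)\<^sup>2)) {0..len G e0}"
        by (rule has_integral_eq[rotated]) (simp add: F)
      then show "(\<lambda>x. (gl g e0 x)\<^sup>2) integrable_on {0..len G e0}" by (auto simp: integrable_on_def)
      fix x assume x: "x \<in> {0<..<len G e0} - (S0 \<union> (\<lambda>x. x + a) ` S1 \<union> {a})"
      show "(gl f e0 has_real_derivative gl g e0 x) (at x)"
      proof (cases "x < a")
        case True
        have "(f e0 has_real_derivative g e0 x) (at x)" using S0(2) x True by simp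
        then have "(gl f e0 has_real_derivative g e0 x) (at x)"
          by (rule has_field_derivative_transform_within_open[of _ _ _ "{..<a}"]) (use True in \<open>auto simp: F\<close>)
        then show ?thesis using True by (simp add: F)
      next
        case False
        then have xa: "a < x" using x by auto
        have "x - a \<notin> S1"
        proof
          assume "x - a \<in> S1"
          then have "x - a + a \<in> (\<lambda>x. x + a) ` S1" by (rule imageI)
          then show False using x by simp
        qed
        then have "(f e1 has_real_derivative g e1 (x - a)) (at (x - a))" using S1(2) x xa by simp
        moreover have "((\<lambda>x. x - a) has_real_derivative 1) (at x)" by (auto intro!: derivative_eq_intros)
        ultimately have "((\<lambda>x. f e1 (x - a)) has_real_derivative g e1 (x - a) * 1) (at x)" by (rule DERIV_chain2)
        then have "(gl f e0 has_real_derivative g e1 (x - a) * 1) (at x)"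
          by (rule has_field_derivative_transform_within_open[of _ _ _ "{a<..}"]) (use xa in \<open>auto simp: F\<close>)
        then show ?thesis using xa by (simp add: F)
      qed
    qed
    then show ?thesis using True by simp
  qed
qed

text \<open>Gluing the two halves of \<open>e0\<close> turns test functions on \<open>H\<close> into
  test functions on \<open>G\<close> with the same integrals.\<close>

lemma poincare_H:
  assumes f: "test_fun H f g" and o: "ip H f (\<lambda>_ _. 1) = 0"
  shows "spectral_gap * ip H f f \<le> ip H g g"
proof -
  have fc: "edge_cont H f" by (rule test_fun_edge_cont[OF f])
  have g1: "gl (\<lambda>_ _. 1) = (\<lambda>_ _. 1)" by (simp add: glue_edge_def fun_eq_iff)
  have "ip G (gl f) (gl (\<lambda>_ _. 1)) = ip H f (\<lambda>_ _. 1)"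
    by (rule ip_glue) (rule edge_cont_integrable[OF fc edge_cont_const])
  then have "ip G (gl f) (\<lambda>_ _. 1) = 0" using o unfolding g1 by simp
  have gi: "(\<lambda>x. g e x * g e x) integrable_on {0..len H e}" if "e \<in> edges H" for e
    using f that unfolding test_fun_def pw_diff_def power2_eq_square by blast
  have "ip G (gl f) (gl f) = ip H f f" "ip G (gl g) (gl g) = ip H g g"
    by (rule ip_glue, rule edge_cont_integrable[OF fc fc], assumption) (rule ip_glue, rule gi)
  with poincare[OF test_fun_glue[OF f] \<open>ip G (gl f) (\<lambda>_ _. 1) = 0\<close>] show ?thesis by simp
qed

lemma kdom_split:
  assumes u: "kdom G u u' u''"
  shows "kdom H (sp u) (sp u') (sp u'')"
  unfolding kdom_def
proof (intro conjI ballI)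
  have C2: "C2_on (len G e) (u e) (u' e) (u'' e)" if "e \<in> edges G" for e using u that by (simp add: kdom_def)
  have ag: "agrees_at_vertices G u" using u by (simp add: kdom_def)
  note D = C2_onD[OF C2[OF e0]]
  fix e assume e: "e \<in> edges H"
  have sh: "((\<lambda>x. h (a + x)) has_real_derivative h' (a + x)) (at x within {0..len G e0 - a})"
    if h: "\<And>y. y \<in> {0..len G e0} \<Longrightarrow> (h has_real_derivative h' y) (at y within {0..len G e0})" and x: "x \<in> {0..len G e0 - a}" for h h' :: "real \<Rightarrow> real" and x
  proof -
    have "(h has_real_derivative h' (a + x)) (at (a + x) within {0..len G e0})" using x a by (intro h) auto
    then have "(h has_real_derivative h' (a + x)) (at (a + x) within (\<lambda>x. a + x) ` {0..len G e0 - a})"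
      by (rule DERIV_subset) (use a in auto)
    moreover have "((\<lambda>x. a + x) has_real_derivative 1) (at x within {0..len G e0 - a})" by (auto intro!: derivative_eq_intros)
    ultimately have "((h \<circ> (\<lambda>x. a + x)) has_real_derivative h' (a + x) * 1) (at x within {0..len G e0 - a})" by (rule DERIV_image_chain)
    then show ?thesis by (simp add: o_def)
  qed
  show "C2_on (len H e) (sp u e) (sp u' e) (sp u'' e)"
  proof (cases "e = e1")
    case True
    have F: "sp h e1 = (\<lambda>x. h e0 (a + x))" for h by (simp add: split_edge_def fun_eq_iff)
    have "continuous_on {0..len G e0 - a} (\<lambda>x. u'' e0 (a + x))"
      by (rule continuous_on_compose2[OF D(5)]) (use a in \<open>auto intro!: continuous_intros\<close>)
    then have "C2_on (len G e0 - a) (sp u e1) (sp u' e1) (sp u'' e1)"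
      unfolding C2_on_def F using sh[OF D(1)] sh[OF D(2)] by auto
    then show ?thesis using True by simp
  next
    case False
    then have eG: "e \<in> edges G" using e by simp
    have F: "sp h e = h e" for h using False by (simp add: split_edge_def fun_eq_iff)
    show ?thesis
    proof (cases "e = e0")
      case True
      have sub: "{0..a} \<subseteq> {0..len G e0}" using a by auto
      have "C2_on a (u e0) (u' e0) (u'' e0)"
        unfolding C2_on_def using sub
        by (auto intro: DERIV_subset[OF D(1)] DERIV_subset[OF D(2)] continuous_on_subset[OF D(5)])
      then show ?thesis unfolding F using ne by (simp add: True)
    next
      case 2: False
      then show ?thesis using C2[OF eG] False by (simp add: F)
    qed
  qed
next
  have ag: "agrees_at_vertices G u" using u by (simp add: kdom_def)
  show "agrees_at_vertices H (sp u)"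
    unfolding agrees_at_vertices_def verts_H
  proof (intro ballI)
    fix v p p' assume v: "v \<in> insert mid (move ` verts G)" "p \<in> v" "p' \<in> v"
    show "sp u (fst p) (coord H p) = sp u (fst p') (coord H p')"
    proof (cases "v = mid")
      case True
      have "sp u (fst r) (coord H r) = u e0 a" if "r \<in> mid" for r
        using that ne by (auto simp: mid_def split_edge_def coord_def)
      then show ?thesis using v True by simp
    next
      case False
      then obtain w where w: "w \<in> verts G" "v = move w" using v by blast
      obtain r where r: "r \<in> w" "sp u (fst p) (coord H p) = u (fst r) (coord G r)" using sp_endpoint[OF w(1)] v(2) w(2) by blast
      obtain r' where r': "r' \<in> w" "sp u (fst p') (coord H p') = u (fst r') (coord G r')" using sp_endpoint[OF w(1)] v(3) w(2) by blast
      have "u (fst r) (coord G r) = u (fst r') (coord G r')" using ag w(1) r(1) r'(1) unfolding agrees_at_vertices_def by blast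
      then show ?thesis using r(2) r'(2) by simp
    qed
  qed
next
  fix v assume v: "v \<in> verts H"
  show "(\<Sum>p\<in>v. normal_deriv H (sp u') p) = 0"
  proof (cases "v = mid")
    case True
    then show ?thesis using ne by (simp add: mid_def normal_deriv_def split_edge_def coord_def)
  next
    case False
    then obtain w where w: "w \<in> verts G" "v = move w" using v by (auto simp: verts_H)
    have k: "(\<Sum>p\<in>w. normal_deriv G u' p) = 0" using u w(1) by (simp add: kdom_def)
    have same: "normal_deriv H (sp u') p = normal_deriv G u' p" if p: "p \<in> w" "p \<noteq> (e0, True)" for p
    proof -
      have "fst p \<noteq> e1" using ni[OF w(1), of "snd p"] p(1) by (cases p) auto
      then show ?thesis using p(2) by (cases p) (auto simp: normal_deriv_def split_edge_def coord_def)
    qed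
    show ?thesis
    proof (cases "(e0, True) \<in> w")
      case True
      have fw: "finite w" by (rule fin_vert[OF w(1)])
      have "(\<Sum>p\<in>v. normal_deriv H (sp u') p) = normal_deriv H (sp u') (e1, True) + (\<Sum>p\<in>w - {(e0, True)}. normal_deriv H (sp u') p)"
        unfolding w(2) move_def using True fw ni[OF w(1)] by (simp add: sum.insert)
      also have "(\<Sum>p\<in>w - {(e0, True)}. normal_deriv H (sp u') p) = (\<Sum>p\<in>w - {(e0, True)}. normal_deriv G u' p)"
        by (rule sum.cong) (use same in auto)
      also have "normal_deriv H (sp u') (e1, True) = normal_deriv G u' (e0, True)" by (simp add: normal_deriv_def split_edge_def coord_def)
      also have "normal_deriv G u' (e0, True) + (\<Sum>p\<in>w - {(e0, True)}. normal_deriv G u' p) = (\<Sum>p\<in>w. normal_deriv G u' p)"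
        by (rule sum.remove[OF fw True, symmetric])
      finally show ?thesis using k by simp
    next
      case False
      then have "(\<Sum>p\<in>v. normal_deriv H (sp u') p) = (\<Sum>p\<in>w. normal_deriv G u' p)"
        unfolding w(2) move_def using False by (auto intro!: sum.cong same)
      then show ?thesis using k by simp
    qed
  qed
qed

text \<open>Subdivision keeps the gap: splitting \<phi> shows that it does not grow, and
  \<open>poincare_H\<close> that it does not shrink. So the split \<phi> again belongs to the least
  positive eigenvalue.\<close>

theorem nodal_point_subdivide:
  assumes \<phi>: "esol G (\<lambda>_ _. 0) spectral_gap \<phi> \<phi>'" and pos: "0 < ip G \<phi> \<phi>" and z: "\<phi> e0 a = 0" "\<phi>' e0 a \<noteq> 0"
  shows "nodal_point H {(e0, True), (e1, False)} (sp \<phi>) (sp \<phi>')"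
proof
  have "kdom H (sp \<phi>) (sp \<phi>') (sp (\<lambda>e x. (0 - spectral_gap) * \<phi> e x))" by (rule kdom_split) (use \<phi> in \<open>simp only: esol_def\<close>)
  moreover have "sp (\<lambda>e x. (0 - spectral_gap) * \<phi> e x) = (\<lambda>e x. (0 - spectral_gap) * sp \<phi> e x)" by (simp add: split_edge_def fun_eq_iff)
  ultimately have es: "esol H (\<lambda>_ _. 0) spectral_gap (sp \<phi>) (sp \<phi>')" by (simp only: esol_def)
  have pc: "edge_cont H (sp \<phi>)" by (rule esol_cont(1)[OF es])
  have "ip G (gl (sp \<phi>)) (gl (sp \<phi>)) = ip G \<phi> \<phi>"
    by (rule ip_cong) (use e1 in \<open>auto simp: gl_sp\<close>)
  then have pos': "0 < ip H (sp \<phi>) (sp \<phi>)" using pos ip_glue[OF edge_cont_integrable[OF pc pc]] by simp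
  have "H.spectral_gap = spectral_gap"
  proof (rule antisym)
    show "H.spectral_gap \<le> spectral_gap"
      by (rule H.spectral_gap_le[OF spectral_gap_pos]) (use es pos' H.Z.is_eigenvalue_iff in blast)
    obtain u u' where u: "esol H (\<lambda>_ _. 0) H.spectral_gap u u'" "0 < ip H u u"
      using H.spectral_gap_eigenvalue unfolding H.Z.is_eigenvalue_iff by blast
    have "spectral_gap * ip H u u \<le> ip H u' u'" by (rule poincare_H[OF esol_cont(3)[OF u(1)] H.spectral_gap_esol_orth[OF u(1)]])
    also have "\<dots> = H.spectral_gap * ip H u u" using H.Z.esol_energy[OF u(1)] by (simp add: ip_def)
    finally show "spectral_gap \<le> H.spectral_gap" using u(2) by simp
  qed
  then show "esol H (\<lambda>_ _. 0) H.spectral_gap (sp \<phi>) (sp \<phi>')" using es by simp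
  show "0 < ip H (sp \<phi>) (sp \<phi>)" by (rule pos')
  show "{(e0, True), (e1, False)} \<in> verts H" unfolding verts_H mid_def by simp
  show "sp \<phi> (fst p) (coord H p) = 0" if "p \<in> {(e0, True), (e1, False)}" for p
    using that z ne by (auto simp: split_edge_def coord_def)
  show "\<exists>p\<in>{(e0, True), (e1, False)}. normal_deriv H (sp \<phi>') p \<noteq> 0"
    using z by (intro bexI[of _ "(e1, False)"]) (auto simp: normal_deriv_def split_edge_def coord_def)
qed

end

section \<open>Attaching an edge at a zero\<close>

text \<open>At a limit point of zeros both \<open>u\<close> and \<open>u'\<close> vanish, and
  conservation of energy forces \<open>u\<close> to vanish identically.\<close>

lemma C2_on_oscillator_zeros:
  assumes u: "C2_on l u u' (\<lambda>x. - \<nu> * u x)" and \<nu>: "0 < \<nu>"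
  shows "finite {x \<in> {0..l}. u x = 0} \<or> (\<forall>x\<in>{0..l}. u x = 0)"
proof (rule disjCI)
  note D = C2_onD[OF u]
  let ?Z = "{x \<in> {0..l}. u x = 0}"
  assume "\<not> (\<forall>x\<in>{0..l}. u x = 0)"
  then obtain y where y: "y \<in> {0..l}" "u y \<noteq> 0" by blast
  show "finite ?Z"
  proof (rule ccontr)
    assume inf: "infinite ?Z"
    have "\<exists>z\<in>{0..l}. z islimpt ?Z"
      using compact_eq_Bolzano_Weierstrass[of "{0..l}"] inf by (metis (no_types, lifting) compact_Icc mem_Collect_eq subsetI)
    then obtain z where z: "z \<in> {0..l}" "z islimpt ?Z" by blast
    have nt: "at z within ?Z \<noteq> bot" using z(2) by (simp add: trivial_limit_within)
    have sub: "?Z \<subseteq> {0..l}" by auto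
    have zero: "\<forall>\<^sub>F x in at z within ?Z. u x = 0" by (simp add: eventually_at_filter)
    have "(u \<longlongrightarrow> u z) (at z within {0..l})" using D(3) z(1) by (simp add: continuous_on_def)
    then have "(u \<longlongrightarrow> u z) (at z within ?Z)" by (rule tendsto_within_subset[OF _ sub])
    then have "((\<lambda>_. 0) \<longlongrightarrow> u z) (at z within ?Z)" using zero by (rule Lim_transform_eventually)
    then have uz: "u z = 0" using tendsto_unique[OF nt _ tendsto_const] by blast
    have "((\<lambda>x. (u x - u z) / (x - z)) \<longlongrightarrow> u' z) (at z within {0..l})"
      using D(1)[OF z(1)] by (simp add: has_field_derivative_iff)
    then have "((\<lambda>x. (u x - u z) / (x - z)) \<longlongrightarrow> u' z) (at z within ?Z)" by (rule tendsto_within_subset[OF _ sub])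
    moreover have "\<forall>\<^sub>F x in at z within ?Z. (u x - u z) / (x - z) = 0" using zero by eventually_elim (simp add: uz)
    ultimately have "((\<lambda>_. 0) \<longlongrightarrow> u' z) (at z within ?Z)" by (rule Lim_transform_eventually)
    then have u'z: "u' z = 0" using tendsto_unique[OF nt _ tendsto_const] by blast
    have "(u' y)\<^sup>2 + \<nu> * (u y)\<^sup>2 = 0" using oscillator_energy[OF u y(1) z(1)] uz u'z by simp
    moreover have "0 < \<nu> * (u y)\<^sup>2" using \<nu> y(2) by simp
    moreover have "0 \<le> (u' y)\<^sup>2" by simp
    ultimately show False by linarith
  qed
qed

text \<open>By \<open>C2_on_oscillator_zeros\<close> the negative part is differentiable off
  finitely many points or identically zero.\<close>

lemma pw_diff_neg_part:
  assumes l: "0 < l" and u: "C2_on l u u' (\<lambda>x. - \<nu> * u x)" and \<nu>: "0 < \<nu>"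
  shows "pw_diff l (\<lambda>x. min (u x) 0) (\<lambda>x. if u x < 0 then u' x else 0)"
proof -
  note D = C2_onD[OF u]
  define m where "m x = min (u x) 0" for x
  define m' where "m' x = (if u x < 0 then u' x else 0)" for x
  have mc: "continuous_on {0..l} m" unfolding m_def by (intro continuous_intros D(3))
  have "\<exists>S. finite S \<and> (\<forall>x\<in>{0<..<l} - S. (m has_real_derivative m' x) (at x))"
    using C2_on_oscillator_zeros[OF u \<nu>]
  proof
    assume Z: "\<forall>x\<in>{0..l}. u x = 0"
    have "(m has_real_derivative m' x) (at x)" if x: "x \<in> {0<..<l}" for x
    proof -
      have "m' x = 0" using Z x by (simp add: m'_def)
      moreover have "((\<lambda>_. 0) has_real_derivative 0) (at x)" by simp
      then have "(m has_real_derivative 0) (at x)"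
        by (rule has_field_derivative_transform_within_open[of _ _ _ "{0<..<l}"]) (use x Z in \<open>auto simp: m_def\<close>)
      ultimately show ?thesis by simp
    qed
    then show ?thesis by (intro exI[of _ "{}"]) simp
  next
    assume fin: "finite {x \<in> {0..l}. u x = 0}"
    have "(m has_real_derivative m' x) (at x)" if x: "x \<in> {0<..<l} - {x \<in> {0..l}. u x = 0}" for x
    proof -
      have x': "0 < x" "x < l" "u x \<noteq> 0" using x by auto
      have cont: "continuous_on {0<..<l} u" by (rule continuous_on_subset[OF D(3)]) auto
      show ?thesis
      proof (cases "u x < 0")
        case True
        have o: "open ({0<..<l} \<inter> u -` {..<0})" using cont by (intro continuous_open_preimage) auto
        have "(m has_real_derivative u' x) (at x)"
          by (rule has_field_derivative_transform_within_open[OF D(6)[OF x'(1,2)] o]) (use x' True in \<open>auto simp: m_def\<close>)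
        then show ?thesis using True by (simp add: m'_def)
      next
        case False
        have o: "open ({0<..<l} \<inter> u -` {0<..})" using cont by (intro continuous_open_preimage) auto
        have "((\<lambda>_. 0) has_real_derivative 0) (at x)" by simp
        then have "(m has_real_derivative 0) (at x)"
          by (rule has_field_derivative_transform_within_open[OF _ o]) (use x' False in \<open>auto simp: m_def\<close>)
        then show ?thesis using False by (simp add: m'_def)
      qed
    qed
    then show ?thesis using fin by blast
  qed
  then obtain S where S: "finite S" "\<And>x. x \<in> {0<..<l} - S \<Longrightarrow> (m has_real_derivative m' x) (at x)" by blast
  \<comment> \<open>The square of \<open>m'\<close> is \<open>m' u' = (m u')' - m u''\<close>, which is integrable by the fundamental theorem.\<close>
  have "((\<lambda>x. m' x * u' x + (- \<nu> * u x) * m x) has_integral m l * u' l - m 0 * u' 0) {0..l}"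
  proof (rule fundamental_theorem_of_calculus_interior_strong[OF S(1)])
    show "0 \<le> l" using l by simp
    show "continuous_on {0..l} (\<lambda>x. m x * u' x)" by (intro continuous_on_mult mc D(4))
    fix x assume x: "x \<in> {0<..<l} - S"
    have "((\<lambda>x. m x * u' x) has_real_derivative m' x * u' x + (- \<nu> * u x) * m x) (at x)"
      by (rule DERIV_mult[OF S(2)[OF x]]) (use x D(7) in auto)
    then show "((\<lambda>x. m x * u' x) has_vector_derivative m' x * u' x + (- \<nu> * u x) * m x) (at x)"
      by (simp only: has_real_derivative_iff_has_vector_derivative)
  qed
  moreover have "(\<lambda>x. (- \<nu> * u x) * m x) integrable_on {0..l}"
    by (intro integrable_continuous_real continuous_on_mult mc D(5))
  ultimately have "(\<lambda>x. (m' x * u' x + (- \<nu> * u x) * m x) - (- \<nu> * u x) * m x) integrable_on {0..l}"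
    by (intro integrable_diff) (auto simp: integrable_on_def)
  moreover have "(\<lambda>x. (m' x * u' x + (- \<nu> * u x) * m x) - (- \<nu> * u x) * m x) = (\<lambda>x. (m' x)\<^sup>2)"
    by (auto simp: m'_def power2_eq_square)
  ultimately have "(\<lambda>x. (m' x)\<^sup>2) integrable_on {0..l}" by simp
  then show ?thesis using mc S unfolding pw_diff_def m_def m'_def by blast
qed

lemma (in mgraph) not_minimizer:
  assumes q: "agrees_at_vertices G q" and b: "\<And>e x. e \<in> edges G \<Longrightarrow> x \<in> {0..len G e} \<Longrightarrow> 0 \<le> q e x \<and> q e x \<le> B"
    and c: "\<And>ps. Defs.simple_path G ps \<Longrightarrow> convex_on {0..path_length G ps} (along G q ps)"
    and d: "\<exists>t0>0. \<forall>t. 0 < t \<longrightarrow> t \<le> t0 \<longrightarrow> fundamental_gap G (\<lambda>e x. t * q e x) < fundamental_gap G (\<lambda>_ _. 0)"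
    and M: "0 < M"
  shows "\<not> is_arg_min (fundamental_gap G) (\<lambda>q. q \<in> convex_potentials G M) (\<lambda>_ _. 0)"
proof -
  obtain t0 where t0: "0 < t0" "\<And>t. 0 < t \<Longrightarrow> t \<le> t0 \<Longrightarrow> fundamental_gap G (\<lambda>e x. t * q e x) < fundamental_gap G (\<lambda>_ _. 0)"
    using d by blast
  \<comment> \<open>The second entry keeps t q below \<open>M\<close>; the absolute value and the
    summand 1 make the denominator positive.\<close>
  define t where "t = min t0 (M / (\<bar>B\<bar> + 1))"
  have t: "0 < t" "t \<le> t0" unfolding t_def using t0(1) M by simp_all
  have "t \<le> M / (\<bar>B\<bar> + 1)" by (simp add: t_def)
  then have tB: "t * (\<bar>B\<bar> + 1) \<le> M" by (simp add: pos_le_divide_eq)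
  have "(\<lambda>e x. t * q e x) \<in> convex_potentials G M"
    unfolding convex_potentials_def
  proof (intro CollectI conjI allI impI ballI)
    show "agrees_at_vertices G (\<lambda>e x. t * q e x)"
      unfolding agrees_at_vertices_def
    proof (intro ballI)
      fix v p p' assume "v \<in> verts G" "p \<in> v" "p' \<in> v"
      then have "q (fst p) (coord G p) = q (fst p') (coord G p')" using q unfolding agrees_at_vertices_def by blast
      then show "t * q (fst p) (coord G p) = t * q (fst p') (coord G p')" by simp
    qed
    fix e x assume ex: "e \<in> edges G" "x \<in> {0..len G e}"
    show "0 \<le> t * q e x" using t b[OF ex] by simp
    have "q e x \<le> \<bar>B\<bar> + 1" using b[OF ex] by linarith
    then have "t * q e x \<le> t * (\<bar>B\<bar> + 1)" using t by simp
    then show "t * q e x \<le> M" using tB by linarith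
  next
    fix ps assume "Defs.simple_path G ps \<and> walk_start G ps \<in> leaves G \<and> walk_end G ps \<in> leaves G"
    then have "convex_on {0..path_length G ps} (along G q ps)" using c by blast
    then have "convex_on {0..path_length G ps} (\<lambda>x. t * along G q ps x)" using t by (intro convex_on_cmul) auto
    moreover have "along G (\<lambda>e x. t * q e x) ps = (\<lambda>x. t * along G q ps x)" by (rule ext) (rule along_scale)
    ultimately show "convex_on {0..path_length G ps} (along G (\<lambda>e x. t * q e x) ps)" by simp
  qed
  then show ?thesis using t0(2)[OF t] unfolding is_arg_min_def by blast
qed

section \<open>The tree with the attached edge\<close>

locale attached = nodal_point G v0 \<phi> \<phi>' for G :: "'e metric_graph" and v0 \<phi> \<phi>' +
  fixes er :: 'e and \<epsilon> :: real
  assumes er: "er \<notin> edges G" and \<epsilon>: "0 < \<epsilon>"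
begin

abbreviation H :: "'e metric_graph" where "H \<equiv> attach_at_vertex G v0 er \<epsilon>"

lemma H_tree: "metric_tree H"
proof -
  have "metric_tree G" using cmg acyc by (simp add: metric_tree_def)
  then show ?thesis by (rule attach_tree[OF _ v0 er \<epsilon>])
qed

sublocale H: leaf_edge H er
proof (rule leaf_edge.intro[OF metric_tree_mtree[OF H_tree]], unfold_locales)
qed simp_all

lemma ni: "w \<in> verts G \<Longrightarrow> (er, b) \<notin> w" using vert_sub[of w] er by auto

lemma fst_ne: "w \<in> verts G \<Longrightarrow> p \<in> w \<Longrightarrow> fst p \<noteq> er" using ni[of w "snd p"] by (cases p) auto

lemma coord_H: "fst p \<noteq> er \<Longrightarrow> coord H p = coord G p" by (simp add: coord_def)

lemma ip_H: "ip H f g = integral {0..\<epsilon>} (\<lambda>x. f er x * g er x) + ip G f g"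
proof -
  have "(\<Sum>e\<in>edges G. integral {0..len H e} (\<lambda>x. f e x * g e x)) = ip G f g"
    unfolding ip_def by (rule sum.cong) (use er in auto)
  then show ?thesis unfolding ip_def using er by simp
qed

lemma agrees_H_iff:
  "agrees_at_vertices H f \<longleftrightarrow> agrees_at_vertices G f \<and> (\<forall>p\<in>v0. f (fst p) (coord G p) = f er 0)"
proof
  assume H: "agrees_at_vertices H f"
  have h: "f (fst p) (coord H p) = f (fst p') (coord H p')" if "v \<in> verts H" "p \<in> v" "p' \<in> v" for v p p'
    using H that unfolding agrees_at_vertices_def by blast
  have W: "insert (er, False) v0 \<in> verts H" by simp
  have 1: "f (fst p) (coord G p) = f er 0" if "p \<in> v0" for p
  proof -
    have "f (fst p) (coord H p) = f (fst (er, False)) (coord H (er, False))" by (rule h[OF W]) (use that in auto)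
    then show ?thesis using coord_H[OF fst_ne[OF v0 that]] by (simp add: coord_def)
  qed
  have "agrees_at_vertices G f"
    unfolding agrees_at_vertices_def
  proof (intro ballI)
    fix v p p' assume v: "v \<in> verts G" "p \<in> v" "p' \<in> v"
    show "f (fst p) (coord G p) = f (fst p') (coord G p')"
    proof (cases "v = v0")
      case True
      then show ?thesis using 1 v by simp
    next
      case False
      then have "v \<in> verts H" using v(1) by simp
      from h[OF this v(2,3)] show ?thesis using coord_H[OF fst_ne[OF v(1,2)]] coord_H[OF fst_ne[OF v(1,3)]] by simp
    qed
  qed
  then show "agrees_at_vertices G f \<and> (\<forall>p\<in>v0. f (fst p) (coord G p) = f er 0)" using 1 by blast
next
  assume A: "agrees_at_vertices G f \<and> (\<forall>p\<in>v0. f (fst p) (coord G p) = f er 0)"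
  show "agrees_at_vertices H f"
    unfolding agrees_at_vertices_def
  proof (intro ballI)
    fix v p p' assume v: "v \<in> verts H" "p \<in> v" "p' \<in> v"
    then consider "v = {(er, True)}" | "v = insert (er, False) v0" | "v \<in> verts G" by auto
    then show "f (fst p) (coord H p) = f (fst p') (coord H p')"
    proof cases
      case 1
      then show ?thesis using v by simp
    next
      case 2
      have "f (fst r) (coord H r) = f er 0" if "r \<in> v" for r
      proof (cases "r = (er, False)")
        case True
        then show ?thesis by (simp add: coord_def)
      next
        case False
        then have "r \<in> v0" using that 2 by simp
        then show ?thesis using A coord_H[OF fst_ne[OF v0 \<open>r \<in> v0\<close>]] by simp
      qed
      then show ?thesis using v by simp
    next
      case 3
      then have "f (fst p) (coord G p) = f (fst p') (coord G p')" using A v unfolding agrees_at_vertices_def by blast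
      then show ?thesis using coord_H[OF fst_ne[OF 3 v(2)]] coord_H[OF fst_ne[OF 3 v(3)]] by simp
    qed
  qed
qed

lemma test_fun_H_iff:
  "test_fun H f g \<longleftrightarrow> test_fun G f g \<and> pw_diff \<epsilon> (f er) (g er) \<and> (\<forall>p\<in>v0. f (fst p) (coord G p) = f er 0)"
proof -
  have "(\<forall>e\<in>edges G. pw_diff (len H e) (f e) (g e)) \<longleftrightarrow> (\<forall>e\<in>edges G. pw_diff (len G e) (f e) (g e))"
    by (rule ball_cong) (use er in auto)
  then show ?thesis unfolding test_fun_def agrees_H_iff by auto
qed

lemma edge_cont_H_iff: "edge_cont H f \<longleftrightarrow> edge_cont G f \<and> continuous_on {0..\<epsilon>} (f er)"
proof -
  have "(\<forall>e\<in>edges G. continuous_on {0..len H e} (f e)) \<longleftrightarrow> (\<forall>e\<in>edges G. continuous_on {0..len G e} (f e))"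
    by (rule ball_cong) (use er in auto)
  then show ?thesis unfolding edge_cont_def by auto
qed

lemma normal_deriv_H: "fst p \<noteq> er \<Longrightarrow> normal_deriv H u p = normal_deriv G u p"
  by (simp add: normal_deriv_def coord_H)

text \<open>With zero slope at both ends the new edge adds no flux, so Kirchhoff's condition at
  \<open>v0\<close> is inherited from \<open>G\<close> and the one at the leaf holds.\<close>

lemma kdom_H:
  assumes u: "kdom G u u' u''" and c: "C2_on \<epsilon> (u er) (u' er) (u'' er)"
    and v: "\<And>p. p \<in> v0 \<Longrightarrow> u (fst p) (coord G p) = u er 0" and z: "u' er 0 = 0" "u' er \<epsilon> = 0"
  shows "kdom H u u' u''"
  unfolding kdom_def
proof (intro conjI ballI)
  show "C2_on (len H e) (u e) (u' e) (u'' e)" if "e \<in> edges H" for e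
  proof (cases "e = er")
    case True
    then show ?thesis using c by simp
  next
    case False
    then show ?thesis using u that by (simp add: kdom_def)
  qed
  show "agrees_at_vertices H u" using u v by (simp add: agrees_H_iff kdom_def)
  fix w assume "w \<in> verts H"
  then consider "w = {(er, True)}" | "w = insert (er, False) v0" | "w \<in> verts G" by auto
  then show "(\<Sum>p\<in>w. normal_deriv H u' p) = 0"
  proof cases
    case 1
    then show ?thesis using z by (simp add: normal_deriv_def coord_def)
  next
    case 2
    have "(\<Sum>p\<in>w. normal_deriv H u' p) = normal_deriv H u' (er, False) + (\<Sum>p\<in>v0. normal_deriv H u' p)"
      unfolding 2 using fin_vert[OF v0] ni[OF v0] by simp
    also have "(\<Sum>p\<in>v0. normal_deriv H u' p) = (\<Sum>p\<in>v0. normal_deriv G u' p)"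
      by (rule sum.cong[OF refl normal_deriv_H[OF fst_ne[OF v0]]])
    also have "\<dots> = 0" using u v0 by (simp add: kdom_def)
    finally show ?thesis using z by (simp add: normal_deriv_def coord_def)
  next
    case 3
    have "(\<Sum>p\<in>w. normal_deriv H u' p) = (\<Sum>p\<in>w. normal_deriv G u' p)"
      by (rule sum.cong[OF refl normal_deriv_H[OF fst_ne[OF 3]]])
    then show ?thesis using u 3 by (simp add: kdom_def)
  qed
qed

lemma dirichlet_H:
  assumes f: "test_fun H f g" and z: "f er 0 = 0"
  shows "spectral_gap * ip G f f \<le> ip G g g"
  using f z unfolding test_fun_H_iff by (intro dirichlet_poincare) auto

abbreviation ext0 :: "('e \<Rightarrow> real \<Rightarrow> real) \<Rightarrow> 'e \<Rightarrow> real \<Rightarrow> real" where "ext0 \<equiv> cutoff (edges G)"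

lemma ext0_simps [simp]: "e \<in> edges G \<Longrightarrow> ext0 f e = f e" "ext0 f er = (\<lambda>_. 0)"
  using er by (simp_all add: cutoff_def fun_eq_iff)

lemma ext0_v0: "p \<in> v0 \<Longrightarrow> ext0 f (fst p) = f (fst p)"
  using vert_sub[OF v0] by (intro ext0_simps) auto

lemma agrees_ext0: "agrees_at_vertices G (ext0 f) \<longleftrightarrow> agrees_at_vertices G f"
  unfolding agrees_at_vertices_def
proof (intro ball_cong refl)
  fix v p p' assume "v \<in> verts G" "p \<in> v" "p' \<in> v"
  then have "fst p \<in> edges G" "fst p' \<in> edges G" using vert_sub[of v] by auto
  then show "(ext0 f (fst p) (coord G p) = ext0 f (fst p') (coord G p')) = (f (fst p) (coord G p) = f (fst p') (coord G p'))" by simp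
qed

lemma ip_ext0: "ip H f (ext0 g) = ip G f g"
proof -
  have "ip G f (ext0 g) = ip G f g" by (rule ip_cong) simp
  then show ?thesis by (simp add: ip_H)
qed

lemma test_fun_ext0:
  assumes f: "test_fun G f g" and z: "\<And>p. p \<in> v0 \<Longrightarrow> f (fst p) (coord G p) = 0"
  shows "test_fun H (ext0 f) (ext0 g)"
proof -
  have "test_fun G (ext0 f) (ext0 g)" using f by (simp add: test_fun_def agrees_ext0)
  then show ?thesis unfolding test_fun_H_iff using z C2_on_pw_diff[OF C2_on_zero] by (simp add: ext0_v0)
qed

lemma esol_ext0: "esol H (\<lambda>_ _. 0) spectral_gap (ext0 \<phi>) (ext0 \<phi>')"
proof -
  have "kdom G (ext0 \<phi>) (ext0 \<phi>') (\<lambda>e x. (0 - spectral_gap) * ext0 \<phi> e x)"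
  proof -
    have n: "normal_deriv G (ext0 \<phi>') p = normal_deriv G \<phi>' p" if "w \<in> verts G" "p \<in> w" for w p
      using that vert_sub[of w] by (auto simp: normal_deriv_def)
    have s: "(\<Sum>p\<in>w. normal_deriv G (ext0 \<phi>') p) = 0" if "w \<in> verts G" for w
      using phi_kirchhoff[OF that] sum.cong[OF refl n[OF that], of w] by simp
    have "kdom G \<phi> \<phi>' (\<lambda>e x. (0 - spectral_gap) * \<phi> e x)" using \<phi> by (simp only: esol_def)
    then show ?thesis unfolding kdom_def by (simp add: agrees_ext0 s)
  qed
  then show ?thesis unfolding esol_def
    by (rule kdom_H) (use zero C2_on_zero in \<open>simp_all add: ext0_v0\<close>)
qed

lemma gap_H_le: "H.spectral_gap \<le> spectral_gap"
proof (rule H.spectral_gap_le[OF spectral_gap_pos])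
  have "ip H (ext0 \<phi>) (ext0 \<phi>) = ip G (ext0 \<phi>) \<phi>" by (rule ip_ext0)
  also have "\<dots> = ip G \<phi> \<phi>" by (rule ip_cong) simp
  finally show "is_eigenvalue H (\<lambda>_ _. 0) spectral_gap"
    using esol_ext0 pos unfolding H.Z.is_eigenvalue_iff by auto
qed

end

section \<open>The gap of the enlarged tree and the two cases\<close>

context attached
begin

lemma zero_not_minimizer_equal:
  assumes eq: "H.spectral_gap = spectral_gap" and M: "0 < M"
  shows "\<not> is_arg_min (fundamental_gap H) (\<lambda>q. q \<in> convex_potentials H M) (\<lambda>_ _. 0)"
proof (rule H.not_minimizer[of H.ramp, OF _ _ _ _ M])
  have rc: "edge_cont H H.ramp" unfolding edge_cont_H_iff edge_cont_def
    by (simp add: H.ramp_def[abs_def])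
  show "agrees_at_vertices H H.ramp"
  proof -
    have r: "H.ramp (fst p) x = 0" if "v \<in> verts G" "p \<in> v" for v p x using fst_ne[OF that] by (simp add: H.ramp_def)
    have "agrees_at_vertices G H.ramp" unfolding agrees_at_vertices_def
    proof (intro ballI)
      fix v p p' assume v: "v \<in> verts G" "p \<in> v" "p' \<in> v"
      show "H.ramp (fst p) (coord G p) = H.ramp (fst p') (coord G p')" unfolding r[OF v(1,2)] r[OF v(1,3)] ..
    qed
    moreover have "H.ramp er 0 = 0" by (simp add: H.ramp_def)
    ultimately show ?thesis using r[OF v0] by (simp only: agrees_H_iff ball_simps simp_thms) blast
  qed
  show "0 \<le> H.ramp e x \<and> H.ramp e x \<le> \<epsilon>" if "e \<in> edges H" "x \<in> {0..len H e}" for e x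
    using that \<epsilon> by (auto simp: H.ramp_def)
  show "convex_on {0..path_length H ps} (along H H.ramp ps)" if "Defs.simple_path H ps" for ps
    by (rule H.ramp_convex[OF that])
  have "ip H H.ramp (\<lambda>_ _. 1) = integral {0..\<epsilon>} (\<lambda>x. x) + ip G H.ramp (\<lambda>_ _. 1)"
    unfolding ip_H by (simp add: H.ramp_def)
  moreover have "integral {0..\<epsilon>} (\<lambda>x. x) = \<epsilon>\<^sup>2 / 2" using \<epsilon> ident_has_integral[of 0 \<epsilon>] by (simp add: integral_unique)
  moreover have "0 \<le> ip G H.ramp (\<lambda>_ _. 1)" by (rule ip_nonneg) (simp add: H.ramp_def)
  moreover have "0 < \<epsilon>\<^sup>2 / 2" using \<epsilon> by simp
  ultimately have p1: "0 < ip H H.ramp (\<lambda>_ _. 1)" by linarith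
  have "ip H (ext0 \<phi>) (ext0 \<phi>) = ip G (ext0 \<phi>) \<phi>" by (rule ip_ext0)
  also have "\<dots> = ip G \<phi> \<phi>" by (rule ip_cong) simp
  finally have p2: "0 < ip H (ext0 \<phi>) (ext0 \<phi>)" using pos by simp
  show "\<exists>t0>0. \<forall>t. 0 < t \<longrightarrow> t \<le> t0 \<longrightarrow> fundamental_gap H (\<lambda>e x. t * H.ramp e x) < fundamental_gap H (\<lambda>_ _. 0)"
  proof (rule H.gap_decreases_of_disjoint_support[OF _ p2 rc _ p1])
    show "esol H (\<lambda>_ _. 0) H.spectral_gap (ext0 \<phi>) (ext0 \<phi>')" unfolding eq by (rule esol_ext0)
    fix e x assume "e \<in> edges H" "x \<in> {0..len H e}"
    then show "0 \<le> H.ramp e x" "H.ramp e x * ext0 \<phi> e x = 0" by (auto simp: H.ramp_def)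
  qed
qed

text \<open>The trial function is - cos (pi x / \<epsilon>) on the new edge, continued by its value
  -1 at \<open>v0\<close>. It has the energy of the first nonconstant Neumann mode of the new edge
  but, after its mean is subtracted, strictly more mass. The bound keeps k \<epsilon> below
  pi.\<close>

lemma gap_H_less: "H.spectral_gap < (pi / \<epsilon>)\<^sup>2"
proof -
  define c where "c = pi / \<epsilon>"
  have c: "0 < c" "c * \<epsilon> = pi" using \<epsilon> by (simp_all add: c_def)
  let ?one = "\<lambda>(_::'e) (_::real). 1 :: real"
  define f where "f e x = (if e = er then - cos (c * x) else - 1)" for e :: 'e and x
  define f' where "f' e x = (if e = er then c * sin (c * x) else 0)" for e :: 'e and x
  define f'' where "f'' e x = (if e = er then c\<^sup>2 * cos (c * x) else 0)" for e :: 'e and x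
  have ne: "e \<noteq> er" if "e \<in> edges G" for e using that er by auto
  have kdG: "kdom G f f' f''"
  proof -
    have "kdom G (lc (- 1) ?one 0 ?one) (lc (- 1) (\<lambda>_ _. 0) 0 (\<lambda>_ _. 0)) (lc (- 1) (\<lambda>_ _. 0) 0 (\<lambda>_ _. 0))"
      by (rule kdom_lc[OF one_kdom one_kdom])
    then have m1: "kdom G (\<lambda>_ _. - 1) (\<lambda>_ _. 0) (\<lambda>_ _. 0)" by (simp add: lc_def)
    have n: "normal_deriv G f' p = 0" if "v \<in> verts G" "p \<in> v" for v p
      using fst_ne[OF that] by (simp add: normal_deriv_def f'_def)
    have e: "f e = (\<lambda>_. - 1)" "f' e = (\<lambda>_. 0)" "f'' e = (\<lambda>_. 0)" if "e \<in> edges G" for e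
      using ne[OF that] by (simp_all add: f_def f'_def f''_def fun_eq_iff)
    have "agrees_at_vertices G f" unfolding agrees_at_vertices_def using fst_ne by (simp add: f_def)
    then show ?thesis using m1 unfolding kdom_def by (simp add: e n sum.neutral)
  qed
  have kd: "kdom H f f' f''"
  proof (rule kdom_H[OF kdG])
    have 1: "((\<lambda>x. - cos (c * x)) has_real_derivative c * sin (c * x)) (at x within S)" for x S
      by (auto intro!: derivative_eq_intros)
    have 2: "((\<lambda>x. c * sin (c * x)) has_real_derivative c\<^sup>2 * cos (c * x)) (at x within S)" for x S
      by (auto intro!: derivative_eq_intros simp: power2_eq_square)
    show "C2_on \<epsilon> (f er) (f' er) (f'' er)"
      unfolding C2_on_def f_def f'_def f''_def using 1 2 by (auto intro!: continuous_intros)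
    show "f (fst p) (coord G p) = f er 0" if "p \<in> v0" for p using fst_ne[OF v0 that] by (simp add: f_def)
    show "f' er 0 = 0" "f' er \<epsilon> = 0" using c by (simp_all add: f'_def)
  qed
  have D: "((\<lambda>x. x / 2 + s * (sin (c * x) * cos (c * x)) / (2 * c)) has_real_derivative
     1 / 2 + s * ((cos (c * x))\<^sup>2 - (sin (c * x))\<^sup>2) / 2) (at x within S)" for s x S
    using c(1) by (auto intro!: derivative_eq_intros simp: power2_eq_square field_simps)
  have I: "((\<lambda>x. 1 / 2 + s * ((cos (c * x))\<^sup>2 - (sin (c * x))\<^sup>2) / 2) has_integral \<epsilon> / 2) {0..\<epsilon>}" for s
  proof -
    have "((\<lambda>x. 1 / 2 + s * ((cos (c * x))\<^sup>2 - (sin (c * x))\<^sup>2) / 2) has_integral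
      (\<epsilon> / 2 + s * (sin (c * \<epsilon>) * cos (c * \<epsilon>)) / (2 * c)) - (0 / 2 + s * (sin (c * 0) * cos (c * 0)) / (2 * c))) {0..\<epsilon>}"
      by (rule fundamental_theorem_of_calculus)
        (use \<epsilon> D in \<open>auto simp: has_real_derivative_iff_has_vector_derivative[symmetric]\<close>)
    then show ?thesis by (simp add: c(2))
  qed
  have cs: "integral {0..\<epsilon>} (\<lambda>x. (cos (c * x))\<^sup>2) = \<epsilon> / 2"
  proof -
    have "(\<lambda>x. (cos (c * x))\<^sup>2) = (\<lambda>x. 1 / 2 + 1 * ((cos (c * x))\<^sup>2 - (sin (c * x))\<^sup>2) / 2)"
      by (simp add: sin_squared_eq fun_eq_iff field_simps)
    then show ?thesis using integral_unique[OF I[of 1]] by simp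
  qed
  have sn: "integral {0..\<epsilon>} (\<lambda>x. (sin (c * x))\<^sup>2) = \<epsilon> / 2"
  proof -
    have "(\<lambda>x. (sin (c * x))\<^sup>2) = (\<lambda>x. 1 / 2 + (- 1) * ((cos (c * x))\<^sup>2 - (sin (c * x))\<^sup>2) / 2)"
      by (simp add: cos_squared_eq fun_eq_iff field_simps)
    then show ?thesis using integral_unique[OF I[of "- 1"]] by simp
  qed
  have c0: "integral {0..\<epsilon>} (\<lambda>x. - cos (c * x)) = 0"
  proof -
    have "((\<lambda>x. - cos (c * x)) has_integral (- sin (c * \<epsilon>) / c) - (- sin (c * 0) / c)) {0..\<epsilon>}"
      by (rule fundamental_theorem_of_calculus)
        (use \<epsilon> c in \<open>auto intro!: derivative_eq_intros simp: has_real_derivative_iff_has_vector_derivative[symmetric]\<close>)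
    then have "((\<lambda>x. - cos (c * x)) has_integral 0) {0..\<epsilon>}" by (simp add: c(2))
    then show ?thesis by (rule integral_unique)
  qed
  let ?L = "ip G ?one ?one"
  have L: "0 < ?L" by (rule length_pos)
  have LH: "ip H ?one ?one = \<epsilon> + ?L" unfolding ip_H using \<epsilon> by simp
  have G1: "ip G f g = - ip G ?one g" for g
  proof -
    have "ip G f g = ip G (lc (- 1) ?one 0 ?one) g" by (rule ip_cong) (use ne in \<open>simp add: f_def lc_def\<close>)
    then show ?thesis by (simp add: ip_scale)
  qed
  have f1: "ip H f ?one = - ?L" unfolding ip_H G1 using c0 by (simp add: f_def)
  have "ip G f f = ?L" using G1[of f] G1[of ?one] by (simp add: ip_commute[of G ?one f])
  then have ff: "ip H f f = \<epsilon> / 2 + ?L" unfolding ip_H using cs by (simp add: f_def power2_eq_square)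
  have "ip G f' f' = ip G (\<lambda>_ _. 0) (\<lambda>_ _. 0)" by (rule ip_cong) (use ne in \<open>simp add: f'_def\<close>)
  then have "ip G f' f' = 0" by (simp add: ip_def)
  moreover have "(\<lambda>x. f' er x * f' er x) = (\<lambda>x. c\<^sup>2 * (sin (c * x))\<^sup>2)" by (simp add: f'_def fun_eq_iff power2_eq_square)
  ultimately have f'f': "ip H f' f' = c\<^sup>2 * (\<epsilon> / 2)" unfolding ip_H using sn by simp
  define m where "m = ?L / (\<epsilon> + ?L)"
  have fc: "edge_cont H f" by (rule kdom_edge_cont(1)[OF kd])
  have oc: "edge_cont H ?one" by (rule edge_cont_const)
  have T: "test_fun H (lc 1 f m ?one) f'"
    using kdom_test_fun[OF kdom_lc[OF kd one_kdom, of 1 m]] by (simp add: lc_def)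
  have mL: "m * (\<epsilon> + ?L) = ?L" unfolding m_def using \<epsilon> L by simp
  have mz: "ip H (lc 1 f m ?one) ?one = 0" unfolding ip_lc_left[OF fc oc oc] f1 LH using mL by simp
  have "H.spectral_gap * ip H (lc 1 f m ?one) (lc 1 f m ?one) \<le> c\<^sup>2 * (\<epsilon> / 2)"
    using H.poincare[OF T mz] unfolding f'f' .
  moreover have "ip H (lc 1 f m ?one) (lc 1 f m ?one) = \<epsilon> / 2 + ?L - m * ?L"
  proof -
    have "m\<^sup>2 * (\<epsilon> + ?L) = m * (m * (\<epsilon> + ?L))" by (simp add: power2_eq_square)
    also have "\<dots> = m * ?L" unfolding mL ..
    finally show ?thesis unfolding ip_lc_square[OF fc oc] ff f1 LH by simp
  qed
  ultimately have le: "H.spectral_gap * (\<epsilon> / 2 + ?L - m * ?L) \<le> c\<^sup>2 * (\<epsilon> / 2)" by simp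
  have "m < 1" unfolding m_def using \<epsilon> L by simp
  then have "0 < ?L - m * ?L" using L by simp
  then have "H.spectral_gap * (\<epsilon> / 2) < H.spectral_gap * (\<epsilon> / 2 + ?L - m * ?L)"
    using H.spectral_gap_pos by simp
  then have "H.spectral_gap * (\<epsilon> / 2) < c\<^sup>2 * (\<epsilon> / 2)" using le by linarith
  then show ?thesis unfolding c_def using \<epsilon> by simp
qed

text \<open>If \<psi> vanished at \<open>v0\<close>, its restriction to \<open>G\<close> would have
  energy \<nu> times its mass, too little for \<open>dirichlet_poincare\<close>, and would be zero.
  Then \<psi> starts on the new edge with zero value and, by Kirchhoff's condition, zero slope, so
  it vanishes.\<close>

lemma vertex_value_ne:
  assumes less: "H.spectral_gap < spectral_gap"
    and \<psi>: "esol H (\<lambda>_ _. 0) H.spectral_gap \<psi> \<psi>'" and p: "0 < ip H \<psi> \<psi>"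
  shows "\<psi> er 0 \<noteq> 0"
proof
  assume z: "\<psi> er 0 = 0"
  let ?\<nu> = "H.spectral_gap"
  have kd: "kdom H \<psi> \<psi>' (\<lambda>e x. - ?\<nu> * \<psi> e x)" using \<psi> by (simp add: esol_def)
  have T: "test_fun H \<psi> \<psi>'" by (rule esol_cont(3)[OF \<psi>])
  then have TG: "test_fun G \<psi> \<psi>'" and v: "\<And>p. p \<in> v0 \<Longrightarrow> \<psi> (fst p) (coord G p) = 0" using z by (auto simp: test_fun_H_iff)
  have E: "?\<nu> * ip G \<psi> \<psi> = ip G \<psi>' \<psi>'"
    using H.Z.esol_weak[OF \<psi> test_fun_ext0[OF TG v]] unfolding ip_ext0 by (simp add: ip_def)
  have D: "spectral_gap * ip G \<psi> \<psi> \<le> ip G \<psi>' \<psi>'" by (rule dirichlet_H[OF T z])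
  have nn: "0 \<le> ip G \<psi> \<psi>" by (rule ip_square_nonneg)
  have "ip G \<psi> \<psi> = 0"
  proof (rule ccontr)
    assume "ip G \<psi> \<psi> \<noteq> 0"
    then have "?\<nu> * ip G \<psi> \<psi> < spectral_gap * ip G \<psi> \<psi>" using nn less by (intro mult_strict_right_mono) auto
    then show False using E D by simp
  qed
  then have zz: "ip G \<psi> \<psi> = 0" "ip G \<psi>' \<psi>' = 0" using E by simp_all
  have pc: "edge_cont G \<psi>'" using esol_cont(2)[OF \<psi>] by (simp add: edge_cont_H_iff)
  have d0: "normal_deriv H \<psi>' p = 0" if "p \<in> v0" for p
  proof -
    have e: "fst p \<in> edges G" using vert_sub[OF v0] that by auto
    have "coord G p \<in> {0..len G (fst p)}" using len_pos[OF e] by (simp add: coord_def)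
    then have "\<psi>' (fst p) (coord G p) = 0" by (rule ip_zeroD[OF pc zz(2) e])
    then show ?thesis using coord_H[OF fst_ne[OF v0 that]] by (simp add: normal_deriv_def)
  qed
  have "insert (er, False) v0 \<in> verts H" by simp
  then have "(\<Sum>p\<in>insert (er, False) v0. normal_deriv H \<psi>' p) = 0" using kd unfolding kdom_def by blast
  then have "\<psi>' er 0 = 0" using fin_vert[OF v0] ni[OF v0] d0 by (simp add: normal_deriv_def coord_def)
  moreover have "C2_on \<epsilon> (\<psi> er) (\<psi>' er) (\<lambda>x. - ?\<nu> * \<psi> er x)" using kd by (simp add: kdom_def)
  ultimately have "\<psi> er x = 0" if "x \<in> {0..\<epsilon>}" for x
    using linear_ivp_unique[of \<epsilon> "\<lambda>_. - ?\<nu>" "\<psi> er" "\<psi>' er" x] z that by simp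
  then have "integral {0..\<epsilon>} (\<lambda>x. \<psi> er x * \<psi> er x) = integral {0..\<epsilon>} (\<lambda>x. 0)" by (intro integral_cong) simp
  then have "ip H \<psi> \<psi> = 0" unfolding ip_H using zz by simp
  then show False using p by simp
qed

text \<open>The negative part of \<psi> on \<open>G\<close> vanishes at \<open>v0\<close>, so it may
  be used as a test function. Its energy is \<nu> times its mass, which by
  \<open>dirichlet_poincare\<close> leaves only zero.\<close>

lemma nonneg_off_edge:
  assumes less: "H.spectral_gap < spectral_gap"
    and \<psi>: "esol H (\<lambda>_ _. 0) H.spectral_gap \<psi> \<psi>'" and v: "0 < \<psi> er 0"
    and e: "e \<in> edges G" and x: "x \<in> {0..len G e}"
  shows "0 \<le> \<psi> e x"
proof -
  let ?\<nu> = "H.spectral_gap"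
  have kd: "kdom H \<psi> \<psi>' (\<lambda>e x. - ?\<nu> * \<psi> e x)" using \<psi> by (simp add: esol_def)
  define m where "m e x = min (\<psi> e x) 0" for e x
  define m' where "m' e x = (if \<psi> e x < 0 then \<psi>' e x else 0)" for e x
  have ag: "agrees_at_vertices G \<psi>" "\<And>p. p \<in> v0 \<Longrightarrow> \<psi> (fst p) (coord G p) = \<psi> er 0"
    using kd by (auto simp: kdom_def agrees_H_iff)
  have T: "test_fun G m m'"
    unfolding test_fun_def
  proof (intro conjI ballI)
    fix e assume e: "e \<in> edges G"
    have "C2_on (len G e) (\<psi> e) (\<psi>' e) (\<lambda>x. - ?\<nu> * \<psi> e x)"
    proof -
      have "e \<in> edges H" "len H e = len G e" using e er by auto
      then show ?thesis using kd unfolding kdom_def by metis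
    qed
    from pw_diff_neg_part[OF len_pos[OF e] this H.spectral_gap_pos] show "pw_diff (len G e) (m e) (m' e)"
      by (simp add: m_def[abs_def] m'_def[abs_def])
  next
    show "agrees_at_vertices G m" unfolding agrees_at_vertices_def
    proof (intro ballI)
      fix w p p' assume w: "w \<in> verts G" "p \<in> w" "p' \<in> w"
      have "\<psi> (fst p) (coord G p) = \<psi> (fst p') (coord G p')" using ag(1) w unfolding agrees_at_vertices_def by blast
      then show "m (fst p) (coord G p) = m (fst p') (coord G p')" by (simp add: m_def)
    qed
  qed
  have mv: "m (fst p) (coord G p) = 0" if "p \<in> v0" for p using ag(2)[OF that] v by (simp add: m_def)
  have "?\<nu> * ip G \<psi> m = ip G \<psi>' m'"
    using H.Z.esol_weak[OF \<psi> test_fun_ext0[OF T mv]] unfolding ip_ext0 by (simp add: ip_def)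
  moreover have "ip G \<psi> m = ip G m m" by (rule ip_cong) (auto simp: m_def min_def)
  moreover have "ip G \<psi>' m' = ip G m' m'" by (rule ip_cong) (auto simp: m'_def)
  ultimately have E: "?\<nu> * ip G m m = ip G m' m'" by simp
  have D: "spectral_gap * ip G m m \<le> ip G m' m'" by (rule dirichlet_poincare[OF T mv])
  have "ip G m m = 0"
  proof (rule ccontr)
    assume "ip G m m \<noteq> 0"
    then have "?\<nu> * ip G m m < spectral_gap * ip G m m"
      using ip_square_nonneg[of G m] less by (intro mult_strict_right_mono) auto
    then show False using E D by simp
  qed
  then have "m e x = 0" by (rule ip_zeroD[OF test_fun_edge_cont[OF T] _ e x])
  then show ?thesis by (simp add: m_def min_def split: if_splits)
qed

lemma positive_eigenfunction:
  assumes less: "H.spectral_gap < spectral_gap"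
  shows "\<exists>\<psi> \<psi>'. esol H (\<lambda>_ _. 0) H.spectral_gap \<psi> \<psi>' \<and> 0 < ip H \<psi> \<psi> \<and> 0 < \<psi> er 0"
proof -
  obtain \<psi> \<psi>' where \<psi>: "esol H (\<lambda>_ _. 0) H.spectral_gap \<psi> \<psi>'" "0 < ip H \<psi> \<psi>"
    using H.spectral_gap_eigenvalue unfolding H.Z.is_eigenvalue_iff by blast
  show ?thesis
  proof (cases "0 < \<psi> er 0")
    case True
    then show ?thesis using \<psi> by blast
  next
    case False
    then have neg: "\<psi> er 0 < 0" using vertex_value_ne[OF less \<psi>] by simp
    show ?thesis
    proof (intro exI conjI)
      show "esol H (\<lambda>_ _. 0) H.spectral_gap (lc (- 1) \<psi> 0 \<psi>) (lc (- 1) \<psi>' 0 \<psi>')" by (rule esol_scale[OF \<psi>(1)])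
      show "0 < ip H (lc (- 1) \<psi> 0 \<psi>) (lc (- 1) \<psi> 0 \<psi>)" using \<psi>(2) by (simp add: ip_scale ip_scale_right)
      show "0 < lc (- 1) \<psi> 0 \<psi> er 0" using neg by (simp add: lc_def)
    qed
  qed
qed

lemma zero_not_minimizer_less:
  assumes less: "H.spectral_gap < spectral_gap" and M: "0 < M"
  shows "\<not> is_arg_min (fundamental_gap H) (\<lambda>q. q \<in> convex_potentials H M) (\<lambda>_ _. 0)"
proof -
  obtain \<psi> \<psi>' where \<psi>: "esol H (\<lambda>_ _. 0) H.spectral_gap \<psi> \<psi>'" and \<psi>pos: "0 < ip H \<psi> \<psi>" and v: "0 < \<psi> er 0"
    using positive_eigenfunction[OF less] by blast
  obtain bt s where "rtree H er bt s" using H.rtree_exists by blast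
  then interpret R: rtree H er bt s .
  define k where "k = sqrt H.spectral_gap"
  have k: "0 < k" "k\<^sup>2 = H.spectral_gap" using H.spectral_gap_pos by (simp_all add: k_def)
  have er_in: "er \<in> edges H" by simp
  have len: "len H er = \<epsilon>" by simp
  have bt: "\<not> bt er" by (rule R.bt_er)
  interpret P: eigen_rtree H er bt s k \<psi> \<psi>'
  proof
    show "0 < k" by (rule k)
    show "esol H (\<lambda>_ _. 0) (k\<^sup>2) \<psi> \<psi>'" unfolding k by (rule \<psi>)
    show "0 \<le> \<psi> e x" if "e \<in> edges H" "e \<noteq> er" "x \<in> {0..len H e}" for e x
      using that by (intro nonneg_off_edge[OF less \<psi> v]) auto
  qed
  define B where "B = P.f er 0"
  have "{(er, True)} \<in> verts H" by simp
  then have "(\<Sum>p\<in>{(er, True)}. normal_deriv H \<psi>' p) = 0" using P.phi_kdom unfolding kdom_def by blast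
  then have p0: "P.p er 0 = 0" using bt by (simp add: P.outward_ends(1))
  \<comment> \<open>The leaf imposes zero slope, so uniqueness for the initial value problem forces
    a multiple of the cosine, with \<open>B\<close> the value at the leaf.\<close>
  have fp: "P.f er t = B * cos (k * t) \<and> P.p er t = - (k * B * sin (k * t))" if t: "t \<in> {0..\<epsilon>}" for t
  proof -
    have 1: "((\<lambda>x. P.f er x - B * cos (k * x)) has_real_derivative P.p er x + k * B * sin (k * x)) (at x within {0..\<epsilon>})"
      if "x \<in> {0..\<epsilon>}" for x
      using C2_onD(1)[OF P.outward_C2[OF er_in], unfolded len, OF that] by (auto intro!: derivative_eq_intros)
    have 2: "((\<lambda>x. P.p er x + k * B * sin (k * x)) has_real_derivative - k\<^sup>2 * (P.f er x - B * cos (k * x))) (at x within {0..\<epsilon>})"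
      if "x \<in> {0..\<epsilon>}" for x
      using C2_onD(2)[OF P.outward_C2[OF er_in], unfolded len, OF that]
      by (auto intro!: derivative_eq_intros simp: power2_eq_square algebra_simps)
    have "C2_on \<epsilon> (\<lambda>x. P.f er x - B * cos (k * x)) (\<lambda>x. P.p er x + k * B * sin (k * x)) (\<lambda>x. - k\<^sup>2 * (P.f er x - B * cos (k * x)))"
      unfolding C2_on_def using 1 2 C2_onD(3)[OF P.outward_C2[OF er_in], unfolded len] by (auto intro!: continuous_intros)
    from linear_ivp_unique[OF _ this _ _ t] show ?thesis using p0 by (simp add: B_def)
  qed
  have k\<epsilon>: "0 < k * \<epsilon>" "k * \<epsilon> < pi"
  proof -
    show "0 < k * \<epsilon>" using k \<epsilon> by simp
    have "k\<^sup>2 < (pi / \<epsilon>)\<^sup>2" unfolding k by (rule gap_H_less)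
    then have "k < pi / \<epsilon>" using \<epsilon> by (simp add: power_less_imp_less_base)
    then show "k * \<epsilon> < pi" using \<epsilon> by (simp add: pos_less_divide_eq)
  qed
  have sp: "0 < sin (k * \<epsilon>)" by (rule sin_gt_zero[OF k\<epsilon>])
  have f\<epsilon>: "P.f er \<epsilon> = \<psi> er 0" using bt by (simp add: P.f_def P.fw_def)
  have e\<epsilon>: "\<epsilon> \<in> {0..\<epsilon>}" using \<epsilon> by simp
  \<comment> \<open>The outward slope at \<open>v0\<close> is nonnegative while the value there is
    positive. The former makes \<open>B\<close> negative, the latter then makes cos (k \<epsilon>)
    negative, so that k \<epsilon> exceeds pi / 2.\<close>
  have "0 \<le> - (k * B * sin (k * \<epsilon>))" using P.p_bottom_nonneg[OF er_in] fp[OF e\<epsilon>] by simp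
  then have "B \<le> 0" using k(1) sp by (simp add: mult_le_0_iff not_less zero_less_mult_iff)
  moreover have Bc: "0 < B * cos (k * \<epsilon>)" using fp[OF e\<epsilon>] f\<epsilon> v by simp
  ultimately have B: "B < 0" by (cases "B = 0") auto
  have cneg: "cos (k * \<epsilon>) < 0" using Bc B by (simp add: zero_less_mult_iff)
  have half: "pi / 2 < k * \<epsilon>"
  proof (rule ccontr)
    assume "\<not> pi / 2 < k * \<epsilon>"
    then have "0 \<le> cos (k * \<epsilon>)" using k\<epsilon>(1) by (intro cos_ge_zero) auto
    then show False using cneg by simp
  qed
  \<comment> \<open>Scaling by \<open>c\<close> gives the value -1 at the leaf, the normalisation of
    \<open>outer_nodal\<close>.\<close>
  define c where "c = - 1 / B"
  have c: "0 < c" "c * B = - 1" using B by (simp_all add: c_def)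
  let ?\<psi> = "lc c \<psi> 0 \<psi>" and ?\<psi>' = "lc c \<psi>' 0 \<psi>'"
  have er_eq: "\<psi> er x = B * cos (k * (\<epsilon> - x)) \<and> \<psi>' er x = k * B * sin (k * (\<epsilon> - x))" if "x \<in> {0..\<epsilon>}" for x
    using fp[of "\<epsilon> - x"] that bt by (simp add: P.f_def P.p_def P.fw_def)
  interpret O: outer_nodal H er bt s k ?\<psi> ?\<psi>'
  proof
    show "0 < k" by (rule k)
    show "esol H (\<lambda>_ _. 0) (k\<^sup>2) ?\<psi> ?\<psi>'" unfolding k by (rule esol_scale[OF \<psi>])
    show "0 \<le> ?\<psi> e x" if "e \<in> edges H" "e \<noteq> er" "x \<in> {0..len H e}" for e x
      using P.nn[OF that] c by (simp add: lc_def)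
    show "pi / 2 < k * len H er" "k * len H er < pi" unfolding len by (rule half, rule k\<epsilon>)
    fix x assume x: "x \<in> {0..len H er}"
    have "c * (B * z) = - z" for z using c(2) by (simp add: mult.assoc[symmetric])
    then show "?\<psi> er x = - cos (k * (len H er - x))" "?\<psi>' er x = - k * sin (k * (len H er - x))"
      using er_eq[of x] x c(2) unfolding lc_def len by (simp_all add: mult.assoc[symmetric] mult.commute[of _ B])
  next
    have W: "insert (er, False) v0 \<in> verts H" by simp
    have bot: "R.botv er = insert (er, False) v0" using bt by (intro H.vertex_of_eq[OF W]) simp
    have kid: "fst p \<in> R.kids (R.botv er) \<and> p = (fst p, \<not> bt (fst p))" if p: "p \<in> v0" for p
    proof -
      have e: "fst p \<in> edges H" using vert_sub[OF v0] p by auto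
      have vp: "vertex_of H p = R.botv er" unfolding bot by (rule H.vertex_of_eq[OF W]) (use p in simp)
      have "p \<noteq> (fst p, bt (fst p))"
      proof
        assume "p = (fst p, bt (fst p))"
        then have "R.botv (fst p) = R.botv er" using vp by metis
        then have "fst p = er" by (rule R.bot_inj[OF e er_in])
        then show False using fst_ne[OF v0 p] by simp
      qed
      then have pp: "p = (fst p, \<not> bt (fst p))" using R.endpoint_cases[of p] by blast
      then have "R.topv (fst p) = R.botv er" using vp by metis
      then show ?thesis using pp e by (simp add: R.kids_def)
    qed
    obtain p p' where p: "p \<in> v0" "p' \<in> v0" "p \<noteq> p'" using two_endpoints by blast
    have "fst p \<noteq> fst p'"
    proof
      assume "fst p = fst p'"
      moreover have "p = (fst p, \<not> bt (fst p))" "p' = (fst p', \<not> bt (fst p'))" using kid p by blast+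
      ultimately have "p = p'" by metis
      then show False using p(3) by simp
    qed
    then show "\<exists>e1\<in>R.kids (R.botv er). \<exists>e2\<in>R.kids (R.botv er). e1 \<noteq> e2" using kid[OF p(1)] kid[OF p(2)] by blast
  qed
  obtain Bd where Bd: "\<forall>e\<in>edges H. \<forall>x\<in>{0..len H e}. R.rdist e x \<le> Bd" using R.rdist_bounded by blast
  show ?thesis
  proof (rule H.not_minimizer[of R.rdist Bd, OF R.rdist_agrees _ R.rdist_convex _ M])
    show "0 \<le> R.rdist e x \<and> R.rdist e x \<le> Bd" if "e \<in> edges H" "x \<in> {0..len H e}" for e x
      using R.rdist_nonneg[OF that] Bd that by blast
    show "\<exists>t0>0. \<forall>t. 0 < t \<longrightarrow> t \<le> t0 \<longrightarrow> fundamental_gap H (\<lambda>e x. t * R.rdist e x) < fundamental_gap H (\<lambda>_ _. 0)"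
    proof (rule H.gap_decreases_of_correlation[OF _ _ O.rdist_cont R.rdist_nonneg O.distance_correlation])
      show "esol H (\<lambda>_ _. 0) H.spectral_gap ?\<psi> ?\<psi>'" by (rule esol_scale[OF \<psi>])
      show "0 < ip H ?\<psi> ?\<psi>" using \<psi>pos c by (simp add: ip_scale ip_scale_right)
    qed
  qed
qed

theorem zero_not_minimizer:
  assumes "0 < M"
  shows "\<not> is_arg_min (fundamental_gap H) (\<lambda>q. q \<in> convex_potentials H M) (\<lambda>_ _. 0)"
  using zero_not_minimizer_equal[OF _ assms] zero_not_minimizer_less[OF _ assms] gap_H_le by (cases "H.spectral_gap = spectral_gap") auto

end

text \<open>The zero of \<phi> either is an end of \<open>e0\<close>, where an existing vertex
  receives the new edge, or is first made a vertex of degree two. Infinitely many edge names leave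
  room for the two new edges.\<close>

theorem attach_edge_zero_not_minimizer:
  fixes G :: "'e metric_graph"
  assumes inf: "infinite (UNIV :: 'e set)" and t: "metric_tree G" and \<epsilon>: "\<epsilon> > 0"
  shows "\<exists>G'. metric_tree G' \<and> attach_edge G \<epsilon> G' \<and>
    (\<forall>M>0. \<not> is_arg_min (fundamental_gap G') (\<lambda>q. q \<in> convex_potentials G' M) (\<lambda>_ _. 0))"
proof -
  interpret mtree G by (rule metric_tree_mtree[OF t])
  obtain \<phi> \<phi>' where \<phi>: "esol G (\<lambda>_ _. 0) spectral_gap \<phi> \<phi>'" and pos: "0 < ip G \<phi> \<phi>"
    using spectral_gap_eigenvalue unfolding Z.is_eigenvalue_iff by blast
  obtain e0 a where e0: "e0 \<in> edges G" and a: "a \<in> {0..len G e0}" and z: "\<phi> e0 a = 0" "\<phi>' e0 a \<noteq> 0"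
    using nodal_zero_exists[OF \<phi> pos] by blast
  obtain e1 where e1: "e1 \<notin> edges G" using ex_new_if_finite[OF inf fin_edges] by blast
  obtain er where er: "er \<notin> insert e1 (edges G)" using ex_new_if_finite[OF inf, of "insert e1 (edges G)"] by auto
  show ?thesis
  proof (cases "a = 0 \<or> a = len G e0")
    case True
    \<comment> \<open>The flag selects the endpoint of \<open>e0\<close> with coordinate
      \<open>a\<close>, which is 0 or the length of \<open>e0\<close>.\<close>
    define p where "p = (e0, a \<noteq> 0)"
    have cp: "coord G p = a" "fst p = e0" using True by (auto simp: p_def coord_def)
    have "p \<in> edges G \<times> UNIV" using e0 by (simp add: p_def)
    note v = vertex_of_in[OF this]
    have ag: "agrees_at_vertices G \<phi>" using \<phi> by (simp add: esol_def kdom_def)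
    interpret N: nodal_point G "vertex_of G p" \<phi> \<phi>'
    proof
      show "\<phi> (fst r) (coord G r) = 0" if "r \<in> vertex_of G p" for r
      proof -
        have "\<phi> (fst r) (coord G r) = \<phi> (fst p) (coord G p)" using ag v that unfolding agrees_at_vertices_def by blast
        then show ?thesis using cp z by simp
      qed
      have "normal_deriv G \<phi>' p \<noteq> 0" using cp z by (simp add: normal_deriv_def)
      then show "\<exists>p\<in>vertex_of G p. normal_deriv G \<phi>' p \<noteq> 0" using v(2) by blast
    qed (use v \<phi> pos in simp_all)
    interpret A: attached G "vertex_of G p" \<phi> \<phi>' er \<epsilon>
      by unfold_locales (use er \<epsilon> in simp_all)
    have "attach_edge G \<epsilon> A.H" unfolding attach_edge_def using v er by blast
    then show ?thesis using A.H_tree A.zero_not_minimizer by blast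
  next
    case False
    then have a: "0 < a" "a < len G e0" using a by auto
    interpret S: subdivision G e0 a e1 by unfold_locales (use e0 a e1 in simp_all)
    have N: "nodal_point S.H {(e0, True), (e1, False)} (S.sp \<phi>) (S.sp \<phi>')" by (rule S.nodal_point_subdivide[OF \<phi> pos z])
    interpret A: attached S.H "{(e0, True), (e1, False)}" "S.sp \<phi>" "S.sp \<phi>'" er \<epsilon>
      by (rule attached.intro[OF N], unfold_locales) (use er \<epsilon> in simp_all)
    have "attach_edge G \<epsilon> A.H" unfolding attach_edge_def using e0 a e1 er by blast
    then show ?thesis using A.H_tree A.zero_not_minimizer by blast
  qed
qed

theorem theorem5p5:
  fixes G :: "nat metric_graph" and \<epsilon> :: real
  assumes "metric_tree G"
    and "simple_eigenvalue G (\<lambda>_ _. 0) (eigval G (\<lambda>_ _. 0) 2)"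
    and "\<epsilon> > 0"
  shows "\<exists>G\<^sub>\<epsilon>. metric_tree G\<^sub>\<epsilon> \<and> attach_edge G \<epsilon> G\<^sub>\<epsilon> \<and>
    (\<forall>M>0. \<not> is_arg_min (fundamental_gap G\<^sub>\<epsilon>) (\<lambda>q. q \<in> convex_potentials G\<^sub>\<epsilon> M) (\<lambda>_ _. 0))"
  by (rule attach_edge_zero_not_minimizer[OF infinite_UNIV_nat assms(1,3)])

end
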